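(* Let $R$ be a standard graded Cohen-Macaulay ring of positive dimension with uncountable residue field $k=R_0$, and suppose $R$ is of graded countable Cohen-Macaulay type. Then the $h$-vector of $R$ is $(1)$, $(1,n)$, or $(1,n,1)$ for some integer $n$.
   Context: A standard graded ring is a Noetherian commutative graded ring $R=\bigoplus_{i\ge 0}R_i$ with $R_0=k$ a field and $R=R_0[R_1]$; its irrelevant maximal ideal is $\mathfrak m=\bigoplus_{i\ge1}R_i$, and $R/\mathfrak m=k$. Graded countable Cohen-Macaulay type: a standard graded Cohen-Macaulay ring $R$ has graded countable Cohen-Macaulay type if there are only countably many (finitely many allowed) indecomposable objects, up to isomorphism and shift in degree, in the category whose objects are the finitely generated graded maximal Cohen-Macaulay $R$-modules and whose morphisms are graded $R$-homomorphisms of degree zero. The shift is $M(n)_i=M_{i+n}$. $h$-vector: let $R$ be standard graded Cohen-Macaulay of dimension $d$ with $k$ infinite. Choose a minimal reduction of $\mathfrak m$, i.e. $d$ homogeneous elements $x_1,\dots,x_d$ of degree 1 with $\mathfrak m^{n+1}=(x_1,\dots,x_d)\mathfrak m^n$ for some $n$ (these exist and form a regular sequence). Put $\overline R=R/(x_1,\dots,x_d)$, an Artinian graded ring, and let $s$ be the largest integer with $\overline R_s\ne 0$. The $h$-vector of $R$ is $(\dim_k\overline R_0,\dim_k\overline R_1,\dots,\dim_k\overline R_s)$; it does not depend on the choice of minimal reduction. *)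

theory Defs
  imports
    "HOL-Algebra.Algebra"
    "HOL-Library.Extended_Nat"
    "HOL-Library.Countable_Set"
begin

text \<open>
  Rings and modules are the carrier-based structures of HOL-Algebra. A graded ring is a ring \<open>R\<close>
  with its family of homogeneous components \<open>G :: nat \<Rightarrow> 'a set\<close>; a graded module is a module \<open>M\<close>
  with its family of components \<open>H :: int \<Rightarrow> 'b set\<close> (generators may have negative degree). The
  multiplication and the unit that a \<open>module\<close> record carries are irrelevant throughout.
\<close>

section \<open>Graded rings\<close>

text \<open>\<open>M\<close> is the internal direct sum of the additive subgroups \<open>H i\<close>.\<close>

definition internal_direct_sum :: "('b, 'm) ring_scheme \<Rightarrow> ('i \<Rightarrow> 'b set) \<Rightarrow> bool" where
  "internal_direct_sum M H \<longleftrightarrow>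
     (\<forall>i. additive_subgroup (H i) M) \<and>
     (\<forall>x \<in> carrier M. \<exists>!f. (\<forall>i. f i \<in> H i) \<and> finite {i. f i \<noteq> \<zero>\<^bsub>M\<^esub>} \<and>
        x = (\<Oplus>\<^bsub>M\<^esub>i\<in>{i. f i \<noteq> \<zero>\<^bsub>M\<^esub>}. f i))"

locale standard_graded_ring = cring R + noetherian_ring R
  for R :: "('a, 'm) ring_scheme" (structure) +
  fixes G :: "nat \<Rightarrow> 'a set"
  assumes grading: "internal_direct_sum R G"
    and grading_mult: "\<lbrakk> a \<in> G i; b \<in> G j \<rbrakk> \<Longrightarrow> a \<otimes> b \<in> G (i + j)"
    and degree_0_field: "subfield (G 0) R"
    and generated_in_degree_1: "generate_ring R (G 0 \<union> G 1) = carrier R"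

definition irrelevant_ideal :: "('a, 'm) ring_scheme \<Rightarrow> (nat \<Rightarrow> 'a set) \<Rightarrow> 'a set" where
  "irrelevant_ideal R G = {(\<Oplus>\<^bsub>R\<^esub>i\<in>{1..n}. f i) | f n. \<forall>i. f i \<in> G i}"

definition krull_dim :: "('a, 'm) ring_scheme \<Rightarrow> enat" where
  "krull_dim R = Sup {enat n | n. \<exists>P :: nat \<Rightarrow> 'a set.
     (\<forall>i\<le>n. primeideal (P i) R) \<and> (\<forall>i<n. P i \<subset> P (Suc i))}"

section \<open>Depth and the Cohen-Macaulay property\<close>

text \<open>The submodule \<open>(x\<^sub>1, \<dots>, x\<^sub>r)M\<close> of \<open>M\<close> for \<open>xs = [x\<^sub>1, \<dots>, x\<^sub>r]\<close>.\<close>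

definition list_smult :: "'a list \<Rightarrow> ('a, 'b) module \<Rightarrow> 'b set" where
  "list_smult xs M = {(\<Oplus>\<^bsub>M\<^esub>i\<in>{..<length xs}. (xs ! i) \<odot>\<^bsub>M\<^esub> f i) | f. \<forall>i. f i \<in> carrier M}"

definition regular_sequence :: "('a, 'b) module \<Rightarrow> 'a list \<Rightarrow> bool" where
  "regular_sequence M xs \<longleftrightarrow>
     (\<forall>i<length xs. \<forall>m \<in> carrier M.
        (xs ! i) \<odot>\<^bsub>M\<^esub> m \<in> list_smult (take i xs) M \<longrightarrow> m \<in> list_smult (take i xs) M) \<and>
     list_smult xs M \<noteq> carrier M"

definition depth :: "'a set \<Rightarrow> ('a, 'b) module \<Rightarrow> enat" where
  "depth I M = Sup {enat (length xs) | xs. set xs \<subseteq> I \<and> regular_sequence M xs}"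

definition self_module :: "('a, 'm) ring_scheme \<Rightarrow> ('a, 'a) module" where
  "self_module R = \<lparr>carrier = carrier R, monoid.mult = (\<otimes>\<^bsub>R\<^esub>), monoid.one = \<one>\<^bsub>R\<^esub>,
     ring.zero = \<zero>\<^bsub>R\<^esub>, ring.add = (\<oplus>\<^bsub>R\<^esub>), smult = (\<otimes>\<^bsub>R\<^esub>)\<rparr>"

text \<open>
  As usual over a standard graded ring, where the irrelevant ideal plays the role of the maximal
  ideal of a local ring, the depth of a graded module is taken with respect to that ideal. The
  elements of a regular sequence are not required to be homogeneous.
\<close>

definition graded_cohen_macaulay :: "('a, 'm) ring_scheme \<Rightarrow> (nat \<Rightarrow> 'a set) \<Rightarrow> bool" where
  "graded_cohen_macaulay R G \<longleftrightarrow> depth (irrelevant_ideal R G) (self_module R) = krull_dim R"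

section \<open>Graded modules\<close>

definition finitely_generated_module :: "('a, 'm) ring_scheme \<Rightarrow> ('a, 'b) module \<Rightarrow> bool" where
  "finitely_generated_module R M \<longleftrightarrow>
     (\<exists>A \<subseteq> carrier M. finite A \<and>
        (\<forall>x \<in> carrier M. \<exists>c \<in> A \<rightarrow> carrier R. x = (\<Oplus>\<^bsub>M\<^esub>a\<in>A. c a \<odot>\<^bsub>M\<^esub> a)))"

definition graded_module ::
    "('a, 'm) ring_scheme \<Rightarrow> (nat \<Rightarrow> 'a set) \<Rightarrow> ('a, 'b) module \<Rightarrow> (int \<Rightarrow> 'b set) \<Rightarrow> bool" where
  "graded_module R G M H \<longleftrightarrow>
     module R M \<and> internal_direct_sum M H \<and>
     (\<forall>i j. \<forall>a \<in> G i. \<forall>m \<in> H j. a \<odot>\<^bsub>M\<^esub> m \<in> H (int i + j))"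

definition graded_mcm_module ::
    "('a, 'm) ring_scheme \<Rightarrow> (nat \<Rightarrow> 'a set) \<Rightarrow> ('a, 'b) module \<Rightarrow> (int \<Rightarrow> 'b set) \<Rightarrow> bool" where
  "graded_mcm_module R G M H \<longleftrightarrow>
     graded_module R G M H \<and> finitely_generated_module R M \<and>
     depth (irrelevant_ideal R G) M = krull_dim R"

text \<open>\<open>M\<close> is nonzero and not the direct sum of two nonzero objects of the category; a direct summand
  \<open>N\<close> carries the induced grading.\<close>

definition indecomposable_graded_mcm ::
    "('a, 'm) ring_scheme \<Rightarrow> (nat \<Rightarrow> 'a set) \<Rightarrow> ('a, 'b) module \<Rightarrow> (int \<Rightarrow> 'b set) \<Rightarrow> bool" where
  "indecomposable_graded_mcm R G M H \<longleftrightarrow>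
     graded_mcm_module R G M H \<and> carrier M \<noteq> {\<zero>\<^bsub>M\<^esub>} \<and>
     \<not> (\<exists>N N'. submodule N R M \<and> submodule N' R M \<and>
          N \<noteq> {\<zero>\<^bsub>M\<^esub>} \<and> N' \<noteq> {\<zero>\<^bsub>M\<^esub>} \<and>
          graded_mcm_module R G (M\<lparr>carrier := N\<rparr>) (\<lambda>i. N \<inter> H i) \<and>
          graded_mcm_module R G (M\<lparr>carrier := N'\<rparr>) (\<lambda>i. N' \<inter> H i) \<and>
          N \<inter> N' = {\<zero>\<^bsub>M\<^esub>} \<and> N <+>\<^bsub>M\<^esub> N' = carrier M)"

definition graded_isomorphic ::
    "('a, 'm) ring_scheme \<Rightarrow> ('a, 'b) module \<Rightarrow> (int \<Rightarrow> 'b set) \<Rightarrow>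
     ('a, 'c) module \<Rightarrow> (int \<Rightarrow> 'c set) \<Rightarrow> bool" where
  "graded_isomorphic R M H N K \<longleftrightarrow>
     (\<exists>f. bij_betw f (carrier M) (carrier N) \<and>
        (\<forall>x \<in> carrier M. \<forall>y \<in> carrier M. f (x \<oplus>\<^bsub>M\<^esub> y) = f x \<oplus>\<^bsub>N\<^esub> f y) \<and>
        (\<forall>a \<in> carrier R. \<forall>x \<in> carrier M. f (a \<odot>\<^bsub>M\<^esub> x) = a \<odot>\<^bsub>N\<^esub> f x) \<and>
        (\<forall>i. f ` H i = K i))"

definition shift :: "int \<Rightarrow> (int \<Rightarrow> 'b set) \<Rightarrow> (int \<Rightarrow> 'b set)" where
  "shift n H = (\<lambda>i. H (i + n))"

text \<open>
  HOL cannot quantify over all types of module elements, so the modules range over a type that is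
  large enough: a finitely generated \<open>R\<close>-module is isomorphic to a quotient \<open>R\<^sup>n/N\<close>, whose elements
  are cosets, that is, sets of functions \<open>nat \<Rightarrow> 'a\<close>.
\<close>

type_synonym 'a fg_elem = "(nat \<Rightarrow> 'a) set"

definition graded_countable_cm_type :: "('a, 'm) ring_scheme \<Rightarrow> (nat \<Rightarrow> 'a set) \<Rightarrow> bool" where
  "graded_countable_cm_type R G \<longleftrightarrow>
     (\<exists>S :: (('a, 'a fg_elem) module \<times> (int \<Rightarrow> 'a fg_elem set)) set.
        countable S \<and>
        (\<forall>(N, K) \<in> S. indecomposable_graded_mcm R G N K) \<and>
        (\<forall>(M :: ('a, 'a fg_elem) module) H. indecomposable_graded_mcm R G M H \<longrightarrow>
           (\<exists>(N, K) \<in> S. \<exists>n. graded_isomorphic R M H N (shift n K))))"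

section \<open>The h-vector\<close>

definition minimal_reduction :: "('a, 'm) ring_scheme \<Rightarrow> (nat \<Rightarrow> 'a set) \<Rightarrow> 'a list \<Rightarrow> bool" where
  "minimal_reduction R G xs \<longleftrightarrow>
     enat (length xs) = krull_dim R \<and> set xs \<subseteq> G 1 \<and>
     (\<exists>n::nat. irrelevant_ideal R G [^]\<^bsub>ideals_set R\<^esub> (n + 1) =
        (Idl\<^bsub>R\<^esub> (set xs)) \<cdot>\<^bsub>R\<^esub> (irrelevant_ideal R G [^]\<^bsub>ideals_set R\<^esub> n))"

definition quotient_component ::
    "('a, 'm) ring_scheme \<Rightarrow> (nat \<Rightarrow> 'a set) \<Rightarrow> 'a list \<Rightarrow> nat \<Rightarrow> 'a set set" where
  "quotient_component R G xs i = (\<lambda>a. (Idl\<^bsub>R\<^esub> (set xs)) +>\<^bsub>R\<^esub> a) ` G i"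

text \<open>The field \<open>k\<close> acts on the quotient ring through its image there, the component of degree 0.\<close>

definition h_vector_wrt :: "('a, 'm) ring_scheme \<Rightarrow> (nat \<Rightarrow> 'a set) \<Rightarrow> 'a list \<Rightarrow> nat list" where
  "h_vector_wrt R G xs =
     (let Q = R Quot (Idl\<^bsub>R\<^esub> (set xs));
          s = Max {i. quotient_component R G xs i \<noteq> {\<zero>\<^bsub>Q\<^esub>}}
      in map (\<lambda>i. ring.dim Q (quotient_component R G xs 0) (quotient_component R G xs i)) [0..<s + 1])"

definition h_vector :: "('a, 'm) ring_scheme \<Rightarrow> (nat \<Rightarrow> 'a set) \<Rightarrow> nat list" where
  "h_vector R G = h_vector_wrt R G (SOME xs. minimal_reduction R G xs)"

end

theory Submission
  imports Defs
begin

text \<open>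
  Let \<open>zs = ls @ [y]\<close> be a homogeneous system of parameters, with \<open>ls\<close> linear and \<open>y\<close> either the last
  linear parameter or its square. If \<open>R/(zs)\<close> has two linearly independent elements \<open>a, b\<close> of a degree
  larger than that of \<open>y\<close>, then every scalar \<open>\<alpha>\<close> gives an ideal \<open>I = (zs, a + \<alpha>b)\<close>. Starting from the
  ideal \<open>(y, a + \<alpha>b)\<close> of the one-dimensional ring \<open>R/(ls)\<close> and taking syzygies successively over the
  rings \<open>R/(z\<^sub>1, \<dots>, z\<^sub>j)\<close> for decreasing \<open>j\<close> produces a maximal Cohen-Macaulay \<open>R\<close>-module whose component
  of lowest degree is spanned by one element \<open>\<kappa>\<close>, and \<open>I\<close> is the annihilator of \<open>\<kappa>\<close> modulo \<open>zs\<close>. Both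
  properties pass to the indecomposable summand containing \<open>\<kappa>\<close>, so \<open>\<alpha>\<close> can be read off its isomorphism
  class, and uncountably many \<open>\<alpha>\<close> contradict countable type. With \<open>y\<close> linear this bounds the entry of
  the h-vector in degree 2 by 1; with \<open>y\<close> a square it excludes degree 3, where \<open>y\<^sup>2\<close> contributes the
  sum of the entries in degrees 2 and 3.
\<close>

section \<open>Weakly regular sequences on subquotients\<close>

text \<open>Countable type speaks of modules up to isomorphism and shift, so the parameter must be
  stored canonically. A one-dimensional graded component does this: a degree-preserving isomorphism
  can only rescale \<kappa>, so it respects the annihilator of \<kappa> modulo \<open>zs\<close>,
  and nothing else about the modules has to be compared. Every syzygy step must therefore avoid a
  second element in the degree of \<kappa>. This forces minimal generators, and it is why a and b
  must have larger degree than y: up to the degree of y, the ideal has then only the multiples of y.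
  For degree 3, one element a outside the ideal may be all there is modulo the linear parameters.
  Modulo y^2 in place of y, the product y b with a quadric b is a second one. The other obstacle is
  the definition of depth as a supremum over possibly inhomogeneous regular sequences, while a
  minimal reduction is linear and comes with no regularity. An exchange argument, based on avoiding
  ideals by vectors of a subspace over an infinite field, produces linear regular sequences and also
  bounds the depth of the constructed modules from above.\<close>

text \<open>
  The submodule \<open>A + xC\<close>. Quotients \<open>C/A\<close> are never formed: \<open>weakly_regular M xs C A\<close> says that \<open>xs\<close>
  is a weakly regular sequence on \<open>C/A\<close>, and \<open>add_mults M xs C A\<close> is \<open>A + xs C\<close>.
\<close>

definition add_mult :: "('a, 'b, 'n) module_scheme \<Rightarrow> 'a \<Rightarrow> 'b set \<Rightarrow> 'b set \<Rightarrow> 'b set" where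
  "add_mult M x C A = {a \<oplus>\<^bsub>M\<^esub> x \<odot>\<^bsub>M\<^esub> c | a c. a \<in> A \<and> c \<in> C}"

fun add_mults :: "('a, 'b, 'n) module_scheme \<Rightarrow> 'a list \<Rightarrow> 'b set \<Rightarrow> 'b set \<Rightarrow> 'b set" where
  "add_mults M [] C A = A"
| "add_mults M (x # xs) C A = add_mults M xs C (add_mult M x C A)"

definition regular_on :: "('a, 'b, 'n) module_scheme \<Rightarrow> 'a \<Rightarrow> 'b set \<Rightarrow> 'b set \<Rightarrow> bool" where
  "regular_on M x C A \<longleftrightarrow> (\<forall>m\<in>C. x \<odot>\<^bsub>M\<^esub> m \<in> A \<longrightarrow> m \<in> A)"

fun weakly_regular :: "('a, 'b, 'n) module_scheme \<Rightarrow> 'a list \<Rightarrow> 'b set \<Rightarrow> 'b set \<Rightarrow> bool" where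
  "weakly_regular M [] C A = True"
| "weakly_regular M (x # xs) C A \<longleftrightarrow>
     regular_on M x C A \<and> weakly_regular M xs C (add_mult M x C A)"

lemma add_mult_memI:
  "m = a \<oplus>\<^bsub>M\<^esub> x \<odot>\<^bsub>M\<^esub> c \<Longrightarrow> a \<in> A \<Longrightarrow> c \<in> C \<Longrightarrow> m \<in> add_mult M x C A"
  unfolding add_mult_def by blast

lemma add_mults_append: "add_mults M (xs @ ys) C A = add_mults M ys C (add_mults M xs C A)"
  by (induction xs arbitrary: A) auto

lemma weakly_regular_append:
  "weakly_regular M (xs @ ys) C A \<longleftrightarrow>
     weakly_regular M xs C A \<and> weakly_regular M ys C (add_mults M xs C A)"
  by (induction xs arbitrary: A) auto

lemma add_mult_carrier_update [simp]: "add_mult (M\<lparr>carrier := N\<rparr>) = add_mult M"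
  by (intro HOL.ext) (simp add: add_mult_def)

lemma add_mults_carrier_update [simp]: "add_mults (M\<lparr>carrier := N\<rparr>) xs C A = add_mults M xs C A"
  by (induction xs arbitrary: A) auto

lemma regular_on_carrier_update [simp]: "regular_on (M\<lparr>carrier := N\<rparr>) = regular_on M"
  by (intro HOL.ext) (simp add: regular_on_def)

lemma weakly_regular_carrier_update [simp]:
  "weakly_regular (M\<lparr>carrier := N\<rparr>) xs C A = weakly_regular M xs C A"
  by (induction xs arbitrary: A) auto

lemma add_mult_mono: "C \<subseteq> D \<Longrightarrow> A \<subseteq> B \<Longrightarrow> add_mult M x C A \<subseteq> add_mult M x D B"
  unfolding add_mult_def by blast

lemma add_mults_mono: "C \<subseteq> D \<Longrightarrow> A \<subseteq> B \<Longrightarrow> add_mults M xs C A \<subseteq> add_mults M xs D B"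
proof (induction xs arbitrary: A B)
  case (Cons x xs)
  then show ?case using Cons.IH[OF Cons.prems(1) add_mult_mono[OF Cons.prems]] by simp
qed simp

context module
begin

lemma submodule_carrier: "submodule A R M \<Longrightarrow> a \<in> A \<Longrightarrow> a \<in> carrier M"
  using submoduleE(1) by blast

lemma submodule_zero: "submodule A R M \<Longrightarrow> \<zero>\<^bsub>M\<^esub> \<in> A"
  using subgroup.one_closed[OF submodule.axioms(1)] by fastforce

lemma submodule_add: "submodule A R M \<Longrightarrow> a \<in> A \<Longrightarrow> b \<in> A \<Longrightarrow> a \<oplus>\<^bsub>M\<^esub> b \<in> A"
  using submoduleE(5) by blast

lemma submodule_smult: "submodule A R M \<Longrightarrow> r \<in> carrier R \<Longrightarrow> b \<in> A \<Longrightarrow> r \<odot>\<^bsub>M\<^esub> b \<in> A"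
  using submoduleE(4) by blast

lemma submodule_neg: "submodule A R M \<Longrightarrow> a \<in> A \<Longrightarrow> \<ominus>\<^bsub>M\<^esub> a \<in> A"
  using submoduleE(3) by blast

lemma submodule_minus: "submodule A R M \<Longrightarrow> a \<in> A \<Longrightarrow> b \<in> A \<Longrightarrow> a \<ominus>\<^bsub>M\<^esub> b \<in> A"
  by (simp add: a_minus_def submodule_add submodule_neg)

lemmas submodule_closed = submodule_zero submodule_add submodule_smult submodule_neg submodule_minus

lemma submodule_add_cancel:
  assumes "submodule A R M" "a \<in> A" "b \<in> carrier M"
  shows "a \<oplus>\<^bsub>M\<^esub> b \<in> A \<longleftrightarrow> b \<in> A" "b \<oplus>\<^bsub>M\<^esub> a \<in> A \<longleftrightarrow> b \<in> A"
proof -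
  have c: "a \<in> carrier M" using assms submodule_carrier by blast
  have "b \<in> A" if "a \<oplus>\<^bsub>M\<^esub> b \<in> A"
  proof -
    have "b = \<ominus>\<^bsub>M\<^esub> a \<oplus>\<^bsub>M\<^esub> (a \<oplus>\<^bsub>M\<^esub> b)" using c assms(3) by (simp add: M.r_neg1)
    then show ?thesis using that assms submodule_closed by metis
  qed
  then show "a \<oplus>\<^bsub>M\<^esub> b \<in> A \<longleftrightarrow> b \<in> A" using assms submodule_closed by metis
  then show "b \<oplus>\<^bsub>M\<^esub> a \<in> A \<longleftrightarrow> b \<in> A" using M.a_comm c assms(3) by simp
qed

lemma smult_comm:
  "r \<in> carrier R \<Longrightarrow> s \<in> carrier R \<Longrightarrow> m \<in> carrier M \<Longrightarrow>
     r \<odot>\<^bsub>M\<^esub> (s \<odot>\<^bsub>M\<^esub> m) = s \<odot>\<^bsub>M\<^esub> (r \<odot>\<^bsub>M\<^esub> m)"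
  by (metis R.m_comm smult_assoc1)

lemma smult_r_minus': "r \<in> carrier R \<Longrightarrow> x \<in> carrier M \<Longrightarrow> y \<in> carrier M \<Longrightarrow>
    r \<odot>\<^bsub>M\<^esub> (x \<ominus>\<^bsub>M\<^esub> y) = r \<odot>\<^bsub>M\<^esub> x \<ominus>\<^bsub>M\<^esub> r \<odot>\<^bsub>M\<^esub> y"
  by (simp add: a_minus_def smult_r_distr smult_r_minus)

lemma submodule_zero_set: "submodule {\<zero>\<^bsub>M\<^esub>} R M"
  by (rule submoduleI) auto

lemma submodule_add_mult:
  assumes "x \<in> carrier R" "submodule C R M" "submodule A R M"
  shows "submodule (add_mult M x C A) R M"
proof (rule submoduleI)
  note c = submodule_carrier[OF assms(2)] submodule_carrier[OF assms(3)]
  show "add_mult M x C A \<subseteq> carrier M" unfolding add_mult_def using c assms(1) by auto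
  show "\<zero>\<^bsub>M\<^esub> \<in> add_mult M x C A" 
    by (rule add_mult_memI[OF _ submodule_zero[OF assms(3)] submodule_zero[OF assms(2)]])
      (simp add: assms(1))
  fix u assume "u \<in> add_mult M x C A"
  then obtain a d where u: "a \<in> A" "d \<in> C" "u = a \<oplus>\<^bsub>M\<^esub> x \<odot>\<^bsub>M\<^esub> d" unfolding add_mult_def by auto
  have "\<ominus>\<^bsub>M\<^esub> u = \<ominus>\<^bsub>M\<^esub> a \<oplus>\<^bsub>M\<^esub> x \<odot>\<^bsub>M\<^esub> (\<ominus>\<^bsub>M\<^esub> d)"
    using u(3) c(2)[OF u(1)] c(1)[OF u(2)] assms(1) by (metis M.minus_add smult_r_minus smult_closed)
  then show "\<ominus>\<^bsub>M\<^esub> u \<in> add_mult M x C A"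
    by (rule add_mult_memI) (rule submodule_neg[OF assms(3) u(1)] submodule_neg[OF assms(2) u(2)])+
  { fix v assume "v \<in> add_mult M x C A"
    then obtain a' d' where v: "a' \<in> A" "d' \<in> C" "v = a' \<oplus>\<^bsub>M\<^esub> x \<odot>\<^bsub>M\<^esub> d'"
      unfolding add_mult_def by auto
    have "u \<oplus>\<^bsub>M\<^esub> v = (a \<oplus>\<^bsub>M\<^esub> a') \<oplus>\<^bsub>M\<^esub> x \<odot>\<^bsub>M\<^esub> (d \<oplus>\<^bsub>M\<^esub> d')"
      using u v c assms(1) by (simp add: M.a_ac smult_r_distr)
    then show "u \<oplus>\<^bsub>M\<^esub> v \<in> add_mult M x C A"
      by (rule add_mult_memI)
        (rule submodule_add[OF assms(3) u(1) v(1)] submodule_add[OF assms(2) u(2) v(2)])+ }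
  fix r assume r: "r \<in> carrier R"
  have "r \<odot>\<^bsub>M\<^esub> u = r \<odot>\<^bsub>M\<^esub> a \<oplus>\<^bsub>M\<^esub> x \<odot>\<^bsub>M\<^esub> (r \<odot>\<^bsub>M\<^esub> d)"
    using u c assms(1) r by (simp add: smult_r_distr smult_comm[of r x])
  then show "r \<odot>\<^bsub>M\<^esub> u \<in> add_mult M x C A"
    by (rule add_mult_memI)
      (rule submodule_smult[OF assms(3) r u(1)] submodule_smult[OF assms(2) r u(2)])+
qed

lemma submodule_add_mults:
  assumes "set xs \<subseteq> carrier R" "submodule C R M" "submodule A R M"
  shows "submodule (add_mults M xs C A) R M"
  using assms by (induction xs arbitrary: A) (auto simp: submodule_add_mult)

lemma add_mult_superset:
  assumes "x \<in> carrier R" "submodule C R M" "A \<subseteq> carrier M"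
  shows "A \<subseteq> add_mult M x C A"
proof
  fix a assume "a \<in> A"
  then have "a = a \<oplus>\<^bsub>M\<^esub> x \<odot>\<^bsub>M\<^esub> \<zero>\<^bsub>M\<^esub>" using assms by auto
  then show "a \<in> add_mult M x C A"
    unfolding add_mult_def using submodule_zero[OF assms(2)] \<open>a \<in> A\<close> by blast
qed

lemma add_mults_superset:
  assumes "set xs \<subseteq> carrier R" "submodule C R M" "submodule A R M"
  shows "A \<subseteq> add_mults M xs C A"
  using assms
proof (induction xs arbitrary: A)
  case (Cons x xs)
  have "A \<subseteq> add_mult M x C A"
    using Cons.prems add_mult_superset[of x C A] submoduleE(1)[of A] by auto
  also have "\<dots> \<subseteq> add_mults M xs C (add_mult M x C A)"
    using Cons submodule_add_mult by auto
  finally show ?case by simp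
qed simp

lemma smult_mem_add_mult:
  assumes "x \<in> carrier R" "submodule C R M" "submodule A R M" "c \<in> C"
  shows "x \<odot>\<^bsub>M\<^esub> c \<in> add_mult M x C A"
proof -
  have "x \<odot>\<^bsub>M\<^esub> c = \<zero>\<^bsub>M\<^esub> \<oplus>\<^bsub>M\<^esub> x \<odot>\<^bsub>M\<^esub> c"
    using assms submodule_carrier by auto
  then show ?thesis unfolding add_mult_def using assms submodule_zero by blast
qed

lemma add_mult_least:
  assumes "submodule B R M" "A \<subseteq> B" "\<And>c. c \<in> C \<Longrightarrow> x \<odot>\<^bsub>M\<^esub> c \<in> B"
  shows "add_mult M x C A \<subseteq> B"
  using assms unfolding add_mult_def by (auto intro: submodule_add)

lemma add_mults_least:
  assumes "submodule B R M" "A \<subseteq> B" "\<And>x c. x \<in> set xs \<Longrightarrow> c \<in> C \<Longrightarrow> x \<odot>\<^bsub>M\<^esub> c \<in> B"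
  shows "add_mults M xs C A \<subseteq> B"
  using assms
proof (induction xs arbitrary: A)
  case (Cons x xs)
  have "add_mult M x C A \<subseteq> B" using Cons.prems by (intro add_mult_least) auto
  then show ?case using Cons by auto
qed simp

lemma smult_mem_add_mults:
  assumes "set xs \<subseteq> carrier R" "submodule C R M" "submodule A R M" "c \<in> C" "x \<in> set xs"
  shows "x \<odot>\<^bsub>M\<^esub> c \<in> add_mults M xs C A"
  using assms
proof (induction xs arbitrary: A)
  case (Cons y xs)
  show ?case
  proof (cases "x = y")
    case True
    then have "x \<odot>\<^bsub>M\<^esub> c \<in> add_mult M y C A" using Cons.prems smult_mem_add_mult by auto
    then show ?thesis
      using add_mults_superset[of xs C "add_mult M y C A"] Cons.prems submodule_add_mult by auto
  next
    case False
    then show ?thesis using Cons submodule_add_mult by auto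
  qed
qed simp

lemma add_mult_commute:
  assumes "x \<in> carrier R" "y \<in> carrier R" "submodule C R M" "submodule A R M"
  shows "add_mult M x C (add_mult M y C A) = add_mult M y C (add_mult M x C A)"
proof -
  have "add_mult M x C (add_mult M y C A) \<subseteq> add_mult M y C (add_mult M x C A)"
    if xy: "x \<in> carrier R" "y \<in> carrier R" for x y
  proof (intro add_mult_least)
    note sx = submodule_add_mult[OF xy(1) assms(3,4)]
    show s: "submodule (add_mult M y C (add_mult M x C A)) R M"
      by (rule submodule_add_mult[OF xy(2) assms(3) sx])
    then show "submodule (add_mult M y C (add_mult M x C A)) R M" .
    have sup: "add_mult M x C A \<subseteq> add_mult M y C (add_mult M x C A)"
      by (rule add_mult_superset[OF xy(2) assms(3)]) (use sx submoduleE(1) in blast)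
    have "A \<subseteq> add_mult M x C A"
      by (rule add_mult_superset[OF xy(1) assms(3)]) (use assms submoduleE(1) in blast)
    then show "A \<subseteq> add_mult M y C (add_mult M x C A)" using sup by blast
    show "y \<odot>\<^bsub>M\<^esub> c \<in> add_mult M y C (add_mult M x C A)" if "c \<in> C" for c
      using smult_mem_add_mult[OF xy(2) assms(3) sx that] .
    show "x \<odot>\<^bsub>M\<^esub> c \<in> add_mult M y C (add_mult M x C A)" if "c \<in> C" for c
      using smult_mem_add_mult[OF xy(1) assms(3,4) that] sup by blast
  qed
  then show ?thesis using assms(1,2) by blast
qed

lemma add_mults_sup:
  assumes "set xs \<subseteq> carrier R" "submodule C R M" "submodule A R M" "submodule B R M" "A \<subseteq> B"
  shows "add_mults M xs C B = {b \<oplus>\<^bsub>M\<^esub> w | b w. b \<in> B \<and> w \<in> add_mults M xs C A}"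
  using assms(1)
proof (induction xs rule: rev_induct)
  case Nil
  show ?case
  proof (intro equalityI subsetI)
    fix b assume "b \<in> add_mults M [] C B"
    then have "b = b \<oplus>\<^bsub>M\<^esub> \<zero>\<^bsub>M\<^esub>" "b \<in> B" using assms(4) submodule_carrier by auto
    then show "b \<in> {b \<oplus>\<^bsub>M\<^esub> w | b w. b \<in> B \<and> w \<in> add_mults M [] C A}"
      using submodule_zero[OF assms(3)] by auto
  qed (use assms(4,5) submodule_add in auto)
next
  case (snoc x xs)
  then have x: "x \<in> carrier R" and xs: "set xs \<subseteq> carrier R" by auto
  note sA = submodule_add_mults[OF xs assms(2,3)]
  have BC: "\<And>b. b \<in> B \<Longrightarrow> b \<in> carrier M" "\<And>c. c \<in> C \<Longrightarrow> c \<in> carrier M"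
    "\<And>w. w \<in> add_mults M xs C A \<Longrightarrow> w \<in> carrier M"
    using assms(2,4) sA submodule_carrier by blast+
  have as: "(b \<oplus>\<^bsub>M\<^esub> w) \<oplus>\<^bsub>M\<^esub> x \<odot>\<^bsub>M\<^esub> c = b \<oplus>\<^bsub>M\<^esub> (w \<oplus>\<^bsub>M\<^esub> x \<odot>\<^bsub>M\<^esub> c)"
    if "b \<in> B" "w \<in> add_mults M xs C A" "c \<in> C" for b w c
    using BC that x by (simp add: M.a_assoc)
  have "add_mults M (xs @ [x]) C B =
     {(b \<oplus>\<^bsub>M\<^esub> w) \<oplus>\<^bsub>M\<^esub> x \<odot>\<^bsub>M\<^esub> c | b w c. b \<in> B \<and> w \<in> add_mults M xs C A \<and> c \<in> C}"
    using snoc.IH[OF xs] by (auto simp: add_mults_append add_mult_def)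
  also have "\<dots> = {b \<oplus>\<^bsub>M\<^esub> (w \<oplus>\<^bsub>M\<^esub> x \<odot>\<^bsub>M\<^esub> c) | b w c. b \<in> B \<and> w \<in> add_mults M xs C A \<and> c \<in> C}"
    using as by (intro Collect_cong ex_cong1) auto
  also have "\<dots> = {b \<oplus>\<^bsub>M\<^esub> w | b w. b \<in> B \<and> w \<in> add_mults M (xs @ [x]) C A}"
    by (auto simp: add_mults_append add_mult_def)
  finally show ?case .
qed

text \<open>This is the vanishing of the first Tor module of \<open>C/B\<close> and \<open>R/(xs)\<close>.\<close>

lemma add_mults_Int:
  assumes "set xs \<subseteq> carrier R" "submodule A R M" "submodule B R M" "submodule C R M"
    "A \<subseteq> B" "B \<subseteq> C" "weakly_regular M xs C B"
  shows "add_mults M xs C A \<inter> B = add_mults M xs B A"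
  using assms(1,7)
proof (induction xs rule: rev_induct)
  case Nil
  then show ?case using assms by auto
next
  case (snoc x xs)
  then have x: "x \<in> carrier R" and xs: "set xs \<subseteq> carrier R" by auto
  have wr: "weakly_regular M xs C B" "regular_on M x C (add_mults M xs C B)"
    using snoc.prems by (auto simp: weakly_regular_append)
  note IH = snoc.IH[OF xs wr(1)]
  note sA = submodule_add_mults[OF xs assms(4,2)]
  note sB = submodule_add_mults[OF xs assms(4,3)]
  show ?case
  proof (intro equalityI subsetI)
    fix m assume m: "m \<in> add_mults M (xs @ [x]) C A \<inter> B"
    then obtain w c where w: "w \<in> add_mults M xs C A" "c \<in> C" "m = w \<oplus>\<^bsub>M\<^esub> x \<odot>\<^bsub>M\<^esub> c"
      by (auto simp: add_mults_append add_mult_def)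
    have cc: "c \<in> carrier M" "w \<in> carrier M" "m \<in> carrier M"
      using w m assms(3,4) sA submodule_carrier by blast+
    have "w \<in> add_mults M xs C B" using w(1) add_mults_mono[OF order_refl assms(5)] by blast
    moreover have "m \<in> add_mults M xs C B"
      using add_mults_superset[OF xs assms(4,3)] m by blast
    \<comment> \<open>Regularity of \<open>x\<close> on C/B modulo \<open>xs\<close> moves c into
      \<open>B + xs C\<close>. After the splitting c = b + v, the term x v joins w, and m = (w + x
      v) + x b has its first summand in B as well, where the induction hypothesis applies.\<close>
    ultimately have "x \<odot>\<^bsub>M\<^esub> c \<in> add_mults M xs C B"
      using submodule_add_cancel(1)[OF sB, of w "x \<odot>\<^bsub>M\<^esub> c"] w(3) cc x by simp
    then have "c \<in> add_mults M xs C B" using wr(2) w(2) unfolding regular_on_def by blast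
    then obtain b v where b: "b \<in> B" "v \<in> add_mults M xs C A" "c = b \<oplus>\<^bsub>M\<^esub> v"
      using add_mults_sup[OF xs assms(4,2,3,5)] by auto
    have bc: "b \<in> carrier M" "v \<in> carrier M" using b assms(3) sA submodule_carrier by blast+
    have wv: "w \<oplus>\<^bsub>M\<^esub> x \<odot>\<^bsub>M\<^esub> v \<in> add_mults M xs C A"
      using w(1) b(2) sA x submodule_closed by blast
    have e: "m = (w \<oplus>\<^bsub>M\<^esub> x \<odot>\<^bsub>M\<^esub> v) \<oplus>\<^bsub>M\<^esub> x \<odot>\<^bsub>M\<^esub> b"
      using w(3) b(3) bc cc x by (simp add: M.a_ac smult_r_distr)
    have "x \<odot>\<^bsub>M\<^esub> b \<in> B" using b x assms(3) submodule_closed by blast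
    then have "w \<oplus>\<^bsub>M\<^esub> x \<odot>\<^bsub>M\<^esub> v \<in> B"
      using submodule_add_cancel(2)[OF assms(3), of "x \<odot>\<^bsub>M\<^esub> b" "w \<oplus>\<^bsub>M\<^esub> x \<odot>\<^bsub>M\<^esub> v"] e m bc cc x by simp
    then have "w \<oplus>\<^bsub>M\<^esub> x \<odot>\<^bsub>M\<^esub> v \<in> add_mults M xs B A" using wv IH by blast
    then show "m \<in> add_mults M (xs @ [x]) B A"
      using e b(1) by (auto simp: add_mults_append add_mult_def)
  next
    fix m assume m: "m \<in> add_mults M (xs @ [x]) B A"
    moreover have "add_mults M (xs @ [x]) B A \<subseteq> B"
      using snoc.prems(1) assms by (intro add_mults_least) (auto intro: submodule_closed)
    ultimately show "m \<in> add_mults M (xs @ [x]) C A \<inter> B"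
      using add_mults_mono[OF assms(6) order_refl] by blast
  qed
qed

text \<open>This is the left term of 0 -> B/A -> C/A -> C/B -> 0. By \<open>add_mults_Int\<close>
  the quotient of B/A by each initial segment of \<open>xs\<close> embeds into that of C/A, so
  nonzerodivisors are inherited.\<close>

lemma weakly_regular_sub:
  assumes "set xs \<subseteq> carrier R" "submodule A R M" "submodule B R M" "submodule C R M"
    "A \<subseteq> B" "B \<subseteq> C" "weakly_regular M xs C B" "weakly_regular M xs C A"
  shows "weakly_regular M xs B A"
  using assms(1,7,8)
proof (induction xs rule: rev_induct)
  case (snoc x xs)
  then have x: "x \<in> carrier R" and xs: "set xs \<subseteq> carrier R" by auto
  have wr: "weakly_regular M xs C B" "weakly_regular M xs C A"
    "regular_on M x C (add_mults M xs C A)"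
    using snoc.prems by (auto simp: weakly_regular_append)
  note I = add_mults_Int[OF xs assms(2-6) wr(1)]
  have "regular_on M x B (add_mults M xs B A)"
    unfolding regular_on_def
  proof (intro ballI impI)
    fix b assume b: "b \<in> B" "x \<odot>\<^bsub>M\<^esub> b \<in> add_mults M xs B A"
    then have "b \<in> add_mults M xs C A" using wr(3) I assms(6) unfolding regular_on_def by blast
    then show "b \<in> add_mults M xs B A" using I b(1) by blast
  qed
  then show ?case using snoc.IH[OF xs wr(1,2)] by (simp add: weakly_regular_append)
qed simp

text \<open>This is the middle term of 0 -> B/A -> C/A -> C/B -> 0. An element of C annihilated
  modulo the earlier elements vanishes in the reduction of C/B, so it is represented by some b in B,
  and \<open>add_mults_Int\<close> turns the relation for b into one inside B/A.\<close>

lemma weakly_regular_extension: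
  assumes "set xs \<subseteq> carrier R" "submodule A R M" "submodule B R M" "submodule C R M"
    "A \<subseteq> B" "B \<subseteq> C" "weakly_regular M xs C B" "weakly_regular M xs B A"
  shows "weakly_regular M xs C A"
  using assms(1,7,8)
proof (induction xs rule: rev_induct)
  case (snoc x xs)
  then have x: "x \<in> carrier R" and xs: "set xs \<subseteq> carrier R" by auto
  have wr: "weakly_regular M xs C B" "weakly_regular M xs B A"
    "regular_on M x C (add_mults M xs C B)" "regular_on M x B (add_mults M xs B A)"
    using snoc.prems by (auto simp: weakly_regular_append)
  note I = add_mults_Int[OF xs assms(2-6) wr(1)]
  note sA = submodule_add_mults[OF xs assms(4,2)]
  have "regular_on M x C (add_mults M xs C A)"
    unfolding regular_on_def
  proof (intro ballI impI)
    fix c assume c: "c \<in> C" "x \<odot>\<^bsub>M\<^esub> c \<in> add_mults M xs C A"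
    then have "c \<in> add_mults M xs C B"
      using wr(3) add_mults_mono[OF order_refl assms(5)] unfolding regular_on_def by blast
    then obtain b v where b: "b \<in> B" "v \<in> add_mults M xs C A" "c = b \<oplus>\<^bsub>M\<^esub> v"
      using add_mults_sup[OF xs assms(4,2,3,5)] by auto
    have bc: "b \<in> carrier M" "v \<in> carrier M" using b assms(3) sA submodule_carrier by blast+
    have "x \<odot>\<^bsub>M\<^esub> b \<oplus>\<^bsub>M\<^esub> x \<odot>\<^bsub>M\<^esub> v \<in> add_mults M xs C A" using c(2) b(3) bc x by (simp add: smult_r_distr)
    then have "x \<odot>\<^bsub>M\<^esub> b \<in> add_mults M xs C A"
      using submodule_add_cancel(2)[OF sA, of "x \<odot>\<^bsub>M\<^esub> v" "x \<odot>\<^bsub>M\<^esub> b"] b bc x sA submodule_closed by simp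
    moreover have "x \<odot>\<^bsub>M\<^esub> b \<in> B" using b x assms(3) submodule_closed by blast
    ultimately have "b \<in> add_mults M xs B A" using I wr(4) b(1) unfolding regular_on_def by blast
    then have "b \<in> add_mults M xs C A" using I by blast
    then show "c \<in> add_mults M xs C A" using b sA submodule_closed by blast
  qed
  then show ?case using snoc.IH[OF xs wr(1,2)] by (simp add: weakly_regular_append)
qed simp

end

section \<open>Isomorphisms between subquotients\<close>

definition module_hom_on :: "('a, 'm) ring_scheme \<Rightarrow> ('a, 'b, 'n) module_scheme \<Rightarrow> ('a, 'c, 'p) module_scheme \<Rightarrow>
    'b set \<Rightarrow> 'c set \<Rightarrow> ('b \<Rightarrow> 'c) \<Rightarrow> bool" where
  "module_hom_on R M N C D h \<longleftrightarrow> (\<forall>x\<in>C. h x \<in> D) \<and>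
     (\<forall>x\<in>C. \<forall>y\<in>C. h (x \<oplus>\<^bsub>M\<^esub> y) = h x \<oplus>\<^bsub>N\<^esub> h y) \<and>
     (\<forall>r\<in>carrier R. \<forall>x\<in>C. h (r \<odot>\<^bsub>M\<^esub> x) = r \<odot>\<^bsub>N\<^esub> h x)"

lemma module_hom_on_minus:
  assumes "module R M" "module R N" "submodule C R M" "submodule D R N"
    "module_hom_on R M N C D h" "a \<in> C" "b \<in> C"
  shows "h (a \<ominus>\<^bsub>M\<^esub> b) = h a \<ominus>\<^bsub>N\<^esub> h b" "h \<zero>\<^bsub>M\<^esub> = \<zero>\<^bsub>N\<^esub>"
proof -
  interpret M: module R M by fact
  interpret N: module R N by fact
  have C: "a \<in> carrier M" "b \<in> carrier M" using assms M.submodule_carrier by auto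
  have D: "h a \<in> carrier N" "h b \<in> carrier N"
    using assms N.submodule_carrier unfolding module_hom_on_def by blast+
  have mb: "\<ominus>\<^bsub>M\<^esub> b = (\<ominus>\<^bsub>R\<^esub> \<one>\<^bsub>R\<^esub>) \<odot>\<^bsub>M\<^esub> b" using C by (simp add: M.smult_l_minus)
  have nb: "\<ominus>\<^bsub>M\<^esub> b \<in> C" using assms M.submodule_closed by blast
  have "h (a \<ominus>\<^bsub>M\<^esub> b) = h a \<oplus>\<^bsub>N\<^esub> h (\<ominus>\<^bsub>M\<^esub> b)"
    using assms nb unfolding module_hom_on_def a_minus_def by blast
  also have "h (\<ominus>\<^bsub>M\<^esub> b) = (\<ominus>\<^bsub>R\<^esub> \<one>\<^bsub>R\<^esub>) \<odot>\<^bsub>N\<^esub> h b"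
    unfolding mb using assms unfolding module_hom_on_def by auto
  also have "\<dots> = \<ominus>\<^bsub>N\<^esub> h b" using D by (simp add: N.smult_l_minus)
  finally show "h (a \<ominus>\<^bsub>M\<^esub> b) = h a \<ominus>\<^bsub>N\<^esub> h b" by (simp add: a_minus_def)
  have "h \<zero>\<^bsub>M\<^esub> = h (\<zero>\<^bsub>R\<^esub> \<odot>\<^bsub>M\<^esub> a)" using C by simp
  also have "\<dots> = \<zero>\<^bsub>R\<^esub> \<odot>\<^bsub>N\<^esub> h a" using assms unfolding module_hom_on_def by auto
  finally show "h \<zero>\<^bsub>M\<^esub> = \<zero>\<^bsub>N\<^esub>" using D by simp
qed

text \<open>The last two assumptions say that \<open>h\<close> induces an isomorphism from C/A onto
  D/B, without any quotient being formed. The first conclusion then carries regularity across, the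
  second one vanishing modulo \<open>xs\<close> and hence annihilators.\<close>

lemma weakly_regular_transfer:
  assumes M: "module R M" and N: "module R N" and C: "submodule C R M" and D: "submodule D R N"
    and h: "module_hom_on R M N C D h" and xs: "set xs \<subseteq> carrier R"
    and "submodule A R M" "submodule B R N" "A \<subseteq> C" "B \<subseteq> D"
    and "\<And>c. c \<in> C \<Longrightarrow> c \<in> A \<longleftrightarrow> h c \<in> B"
    and "\<And>d. d \<in> D \<Longrightarrow> \<exists>c\<in>C. \<exists>b\<in>B. d = h c \<oplus>\<^bsub>N\<^esub> b"
  shows "weakly_regular N xs D B \<longleftrightarrow> weakly_regular M xs C A"
    "c \<in> C \<Longrightarrow> c \<in> add_mults M xs C A \<longleftrightarrow> h c \<in> add_mults N xs D B"
proof -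
  interpret M: module R M by fact
  interpret N: module R N by fact
  have CM: "\<And>c. c \<in> C \<Longrightarrow> c \<in> carrier M" using C M.submodule_carrier by blast
  have DN: "\<And>c. c \<in> D \<Longrightarrow> c \<in> carrier N" using D N.submodule_carrier by blast
  have hD: "\<And>c. c \<in> C \<Longrightarrow> h c \<in> D"
    and ha: "\<And>c c'. c \<in> C \<Longrightarrow> c' \<in> C \<Longrightarrow> h (c \<oplus>\<^bsub>M\<^esub> c') = h c \<oplus>\<^bsub>N\<^esub> h c'"
    and hm: "\<And>r c. r \<in> carrier R \<Longrightarrow> c \<in> C \<Longrightarrow> h (r \<odot>\<^bsub>M\<^esub> c) = r \<odot>\<^bsub>N\<^esub> h c"
    using h unfolding module_hom_on_def by auto
  have *: "(weakly_regular N xs D B \<longleftrightarrow> weakly_regular M xs C A) \<and>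
      (\<forall>c\<in>C. c \<in> add_mults M xs C A \<longleftrightarrow> h c \<in> add_mults N xs D B)"
    using assms(6-12)
  proof (induction xs arbitrary: A B)
    case (Cons x xs)
    then have x: "x \<in> carrier R" and xs: "set xs \<subseteq> carrier R" by auto
    note sA = Cons.prems(2) and sB = Cons.prems(3) and AC = Cons.prems(4) and BD = Cons.prems(5)
      and hAB = Cons.prems(6) and sur = Cons.prems(7)
    have xC: "\<And>c. c \<in> C \<Longrightarrow> x \<odot>\<^bsub>M\<^esub> c \<in> C" using C M.submodule_closed x by blast
    have xD: "\<And>c. c \<in> D \<Longrightarrow> x \<odot>\<^bsub>N\<^esub> c \<in> D" using D N.submodule_closed x by blast
    have 1: "regular_on N x D B \<longleftrightarrow> regular_on M x C A"
    proof
      assume r: "regular_on N x D B"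
      show "regular_on M x C A" unfolding regular_on_def
        using r hAB xC hm x hD unfolding regular_on_def by metis
    next
      assume r: "regular_on M x C A"
      show "regular_on N x D B" unfolding regular_on_def
      proof (intro ballI impI)
        fix d assume d: "d \<in> D" "x \<odot>\<^bsub>N\<^esub> d \<in> B"
        then obtain c b where c: "c \<in> C" "b \<in> B" "d = h c \<oplus>\<^bsub>N\<^esub> b" using sur by blast
        have bD: "b \<in> D" using c BD by blast
        have "x \<odot>\<^bsub>N\<^esub> h c \<oplus>\<^bsub>N\<^esub> x \<odot>\<^bsub>N\<^esub> b \<in> B"
          using d c(3) DN hD[OF c(1)] bD x by (simp add: N.smult_r_distr)
        then have "x \<odot>\<^bsub>N\<^esub> h c \<in> B"
          using N.submodule_add_cancel(2)[OF sB, of "x \<odot>\<^bsub>N\<^esub> b" "x \<odot>\<^bsub>N\<^esub> h c"] c(2) x sB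
            N.submodule_closed DN hD[OF c(1)] by auto
        then have "x \<odot>\<^bsub>M\<^esub> c \<in> A" using hAB[OF xC[OF c(1)]] hm[OF x c(1)] by simp
        then have "c \<in> A" using r c(1) unfolding regular_on_def by blast
        then show "d \<in> B" using hAB[OF c(1)] c sB N.submodule_closed by blast
      qed
    qed
    have sA': "submodule (add_mult M x C A) R M" using M.submodule_add_mult[OF x C sA] .
    have sB': "submodule (add_mult N x D B) R N" using N.submodule_add_mult[OF x D sB] .
    have AC': "add_mult M x C A \<subseteq> C" using M.add_mult_least[OF C AC] xC by blast
    have BD': "add_mult N x D B \<subseteq> D" using N.add_mult_least[OF D BD] xD by blast
    have B': "B \<subseteq> add_mult N x D B"
      using N.add_mult_superset[OF x D] BD DN by blast
    have hAB': "c \<in> add_mult M x C A \<longleftrightarrow> h c \<in> add_mult N x D B" if c: "c \<in> C" for c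
    proof
      assume "c \<in> add_mult M x C A"
      then obtain a c' where a: "a \<in> A" "c' \<in> C" "c = a \<oplus>\<^bsub>M\<^esub> x \<odot>\<^bsub>M\<^esub> c'"
        unfolding add_mult_def by auto
      then have "h c = h a \<oplus>\<^bsub>N\<^esub> x \<odot>\<^bsub>N\<^esub> h c'" "h a \<in> B"
        using ha hm xC AC x hAB by auto
      then show "h c \<in> add_mult N x D B" using hD a unfolding add_mult_def by blast
    next
      assume "h c \<in> add_mult N x D B"
      then obtain b d where b: "b \<in> B" "d \<in> D" "h c = b \<oplus>\<^bsub>N\<^esub> x \<odot>\<^bsub>N\<^esub> d"
        unfolding add_mult_def by auto
      obtain c' b' where c': "c' \<in> C" "b' \<in> B" "d = h c' \<oplus>\<^bsub>N\<^esub> b'" using sur b by blast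
      have mem: "b \<in> D" "b' \<in> D" "x \<odot>\<^bsub>N\<^esub> b' \<in> B" using b c' BD sB N.submodule_closed x by blast+
      have xc: "x \<odot>\<^bsub>M\<^esub> c' \<in> C" using xC c' by blast
      have "h (c \<ominus>\<^bsub>M\<^esub> x \<odot>\<^bsub>M\<^esub> c') = h c \<ominus>\<^bsub>N\<^esub> h (x \<odot>\<^bsub>M\<^esub> c')"
        using module_hom_on_minus(1)[OF M N C D h c xc] .
      also have "\<dots> = h c \<ominus>\<^bsub>N\<^esub> x \<odot>\<^bsub>N\<^esub> h c'" using hm[OF x c'(1)] by simp
      also have "\<dots> = b \<oplus>\<^bsub>N\<^esub> x \<odot>\<^bsub>N\<^esub> b'"
        using b(3) c'(3) mem DN hD[OF c'(1)] x
        by (simp add: N.smult_r_distr a_minus_def N.a_ac N.r_neg N.r_neg1 N.r_neg2)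
      finally have "h (c \<ominus>\<^bsub>M\<^esub> x \<odot>\<^bsub>M\<^esub> c') \<in> B" using N.submodule_add[OF sB b(1) mem(3)] by simp
      moreover have "c \<ominus>\<^bsub>M\<^esub> x \<odot>\<^bsub>M\<^esub> c' \<in> C" using M.submodule_minus[OF C c xc] .
      ultimately have "c \<ominus>\<^bsub>M\<^esub> x \<odot>\<^bsub>M\<^esub> c' \<in> A" using hAB by blast
      moreover have "c = (c \<ominus>\<^bsub>M\<^esub> x \<odot>\<^bsub>M\<^esub> c') \<oplus>\<^bsub>M\<^esub> x \<odot>\<^bsub>M\<^esub> c'"
        using CM[OF c] CM[OF xc] by (simp add: a_minus_def M.a_assoc M.l_neg)
      ultimately show "c \<in> add_mult M x C A" unfolding add_mult_def using c' by blast
    qed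
    have sur': "\<exists>c\<in>C. \<exists>b\<in>add_mult N x D B. d = h c \<oplus>\<^bsub>N\<^esub> b" if "d \<in> D" for d
      using sur[OF that] B' by blast
    from 1 Cons.IH[OF xs sA' sB' AC' BD' hAB' sur'] show ?case by simp
  qed auto
  show "weakly_regular N xs D B \<longleftrightarrow> weakly_regular M xs C A" using * by blast
  show "c \<in> C \<Longrightarrow> c \<in> add_mults M xs C A \<longleftrightarrow> h c \<in> add_mults N xs D B" using * by blast
qed

section \<open>Exchange of regular sequences\<close>

definition submodule_span :: "('a, 'm) ring_scheme \<Rightarrow> ('a, 'b, 'n) module_scheme \<Rightarrow> 'b set \<Rightarrow> 'b set" where
  "submodule_span R M S = \<Inter>{N. submodule N R M \<and> S \<subseteq> N}"

text \<open>The maximal condition is taken as the definition because every application chooses a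
  maximal member of a family of submodules.\<close>

definition noetherian_module :: "('a, 'm) ring_scheme \<Rightarrow> ('a, 'b, 'n) module_scheme \<Rightarrow> bool" where
  "noetherian_module R M \<longleftrightarrow> (\<forall>F. F \<noteq> {} \<and> (\<forall>N\<in>F. submodule N R M) \<longrightarrow>
     (\<exists>N\<in>F. \<forall>N'\<in>F. N \<subseteq> N' \<longrightarrow> N' = N))"

lemma noetherian_moduleD:
  assumes "noetherian_module R M" "F \<noteq> {}" "\<And>N. N \<in> F \<Longrightarrow> submodule N R M"
  obtains N where "N \<in> F" "\<And>N'. N' \<in> F \<Longrightarrow> N \<subseteq> N' \<Longrightarrow> N' = N"
  using assms unfolding noetherian_module_def by meson

text \<open>In a Noetherian ring a nonempty chain of ideals contains its union, and this is the
  upper bound that Zorn's lemma asks for.\<close>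

lemma (in noetherian_ring) ideal_family_maximal:
  assumes "F \<noteq> {}" "\<And>I. I \<in> F \<Longrightarrow> ideal I R"
  obtains I where "I \<in> F" "\<And>J. J \<in> F \<Longrightarrow> I \<subseteq> J \<Longrightarrow> J = I"
proof -
  have "\<exists>I\<in>F. \<forall>J\<in>F. I \<subseteq> J \<longrightarrow> J = I"
  proof (rule subset_Zorn)
    fix C assume C: "subset.chain F C"
    show "\<exists>U\<in>F. \<forall>I\<in>C. I \<subseteq> U"
    proof (cases "C = {}")
      case True
      then show ?thesis using assms by blast
    next
      case False
      have "subset.chain {I. ideal I R} C"
        using C assms(2) unfolding subset_chain_def by blast
      then have "\<Union>C \<in> C" by (rule ideal_chain_is_trivial[OF False])
      then have "\<Union>C \<in> F" using C unfolding subset_chain_def by auto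
      then show ?thesis by (rule rev_bexI) auto
    qed
  qed
  then obtain I where "I \<in> F" "\<forall>J\<in>F. I \<subseteq> J \<longrightarrow> J = I" by blast
  then show ?thesis by (intro that[of I]) auto
qed

context module
begin

lemma submodule_Inter:
  assumes "F \<noteq> {}" "\<And>N. N \<in> F \<Longrightarrow> submodule N R M"
  shows "submodule (\<Inter>F) R M"
proof (rule submoduleI)
  show "\<Inter>F \<subseteq> carrier M" using assms submoduleE(1) by blast
qed (use assms in \<open>auto intro: submodule_zero submodule_neg submodule_add submodule_smult\<close>)

lemma submodule_submodule_span: "S \<subseteq> carrier M \<Longrightarrow> submodule (submodule_span R M S) R M"
  unfolding submodule_span_def
  by (rule submodule_Inter) (use carrier_is_submodule in auto)

lemma submodule_span_superset: "S \<subseteq> submodule_span R M S"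
  unfolding submodule_span_def by blast

lemma submodule_span_least: "submodule N R M \<Longrightarrow> S \<subseteq> N \<Longrightarrow> submodule_span R M S \<subseteq> N"
  unfolding submodule_span_def by blast

lemma submodule_diffI:
  assumes "submodule A R M" "p \<oplus>\<^bsub>M\<^esub> u = q \<oplus>\<^bsub>M\<^esub> v" "p \<in> A" "q \<in> A" "u \<in> carrier M" "v \<in> carrier M"
  shows "u \<ominus>\<^bsub>M\<^esub> v \<in> A"
proof -
  have c: "p \<in> carrier M" "q \<in> carrier M" using assms submodule_carrier by auto
  have "u \<ominus>\<^bsub>M\<^esub> v = \<ominus>\<^bsub>M\<^esub> p \<oplus>\<^bsub>M\<^esub> (p \<oplus>\<^bsub>M\<^esub> u) \<ominus>\<^bsub>M\<^esub> v" using c assms(5,6) by (simp add: M.r_neg1)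
  also have "\<dots> = \<ominus>\<^bsub>M\<^esub> p \<oplus>\<^bsub>M\<^esub> (q \<oplus>\<^bsub>M\<^esub> v) \<ominus>\<^bsub>M\<^esub> v" by (simp only: assms(2))
  also have "\<dots> = \<ominus>\<^bsub>M\<^esub> p \<oplus>\<^bsub>M\<^esub> q" using c assms by (simp add: a_minus_def M.a_assoc M.r_neg)
  finally show ?thesis using submodule_add[OF assms(1) submodule_neg[OF assms(1,3)] assms(4)] by simp
qed

lemma submodule_diff_iff:
  assumes "submodule A R M" "v \<in> A" "u \<in> carrier M"
  shows "u \<ominus>\<^bsub>M\<^esub> v \<in> A \<longleftrightarrow> u \<in> A"
  unfolding a_minus_def using submodule_add_cancel(2)[OF assms(1) submodule_neg[OF assms(1,2)] assms(3)] .

lemma minus_add_cancel: "u \<in> carrier M \<Longrightarrow> v \<in> carrier M \<Longrightarrow> (u \<ominus>\<^bsub>M\<^esub> v) \<oplus>\<^bsub>M\<^esub> v = u"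
  by (simp add: a_minus_def M.a_assoc M.l_neg)

lemma colon_ideal:
  assumes "submodule A R M" "m \<in> carrier M"
  shows "ideal {r \<in> carrier R. r \<odot>\<^bsub>M\<^esub> m \<in> A} R"
proof (rule idealI)
  show "ring R" by (rule R.ring_axioms)
  show "subgroup {r \<in> carrier R. r \<odot>\<^bsub>M\<^esub> m \<in> A} (add_monoid R)"
  proof
    fix x assume x: "x \<in> {r \<in> carrier R. r \<odot>\<^bsub>M\<^esub> m \<in> A}"
    have "(\<ominus> x) \<odot>\<^bsub>M\<^esub> m \<in> A" using x assms by (simp add: smult_l_minus submodule_neg)
    then show "inv\<^bsub>add_monoid R\<^esub> x \<in> {r \<in> carrier R. r \<odot>\<^bsub>M\<^esub> m \<in> A}"
      using x by (simp add: a_inv_def[symmetric])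
  qed (use assms in \<open>auto simp: smult_l_distr submodule_add submodule_zero\<close>)
  fix a x assume a: "a \<in> {r \<in> carrier R. r \<odot>\<^bsub>M\<^esub> m \<in> A}" and x: "x \<in> carrier R"
  then show "x \<otimes> a \<in> {r \<in> carrier R. r \<odot>\<^bsub>M\<^esub> m \<in> A}"
    using assms by (simp add: smult_assoc1 submodule_smult)
  then show "a \<otimes> x \<in> {r \<in> carrier R. r \<odot>\<^bsub>M\<^esub> m \<in> A}" using a x by (simp add: R.m_comm)
qed

lemma smult_preimage_submodule:
  assumes "submodule A R M" "r \<in> carrier R"
  shows "submodule {m \<in> carrier M. r \<odot>\<^bsub>M\<^esub> m \<in> A} R M"
  by (rule submoduleI)
    (use assms in \<open>auto simp: smult_r_distr smult_r_minus smult_comm[of r] submodule_zero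
       intro: submodule_add submodule_neg submodule_smult\<close>)

text \<open>Distinct maximal colon ideals \<open>(A : m)\<close> give a direct sum of submodules in \<open>M/A\<close>, so a
  Noetherian module has only finitely many of them.\<close>

lemma finite_maximal_colon_ideals:
  assumes nR: "noetherian_ring R" and nM: "noetherian_module R M" and A: "submodule A R M"
  shows "\<exists>PP. finite PP \<and>
    (\<forall>P\<in>PP. primeideal P R \<and> (\<exists>m\<in>carrier M. m \<notin> A \<and> P = {r \<in> carrier R. r \<odot>\<^bsub>M\<^esub> m \<in> A})) \<and>
    (\<forall>w\<in>carrier R. (\<forall>P\<in>PP. w \<notin> P) \<longrightarrow> regular_on M w (carrier M) A)"
proof -
  interpret nR: noetherian_ring R by fact
  define co where "co m = {r \<in> carrier R. r \<odot>\<^bsub>M\<^esub> m \<in> A}" for m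
  define Co where "Co = {co m | m. m \<in> carrier M \<and> m \<notin> A}"
  define PP where "PP = {P \<in> Co. \<forall>Q\<in>Co. P \<subseteq> Q \<longrightarrow> Q = P}"
  have idl: "ideal I R" if "I \<in> Co" for I
    using that colon_ideal[OF A] unfolding Co_def co_def by blast
  have prime: "primeideal P R" if P: "P \<in> PP" for P
  proof -
    obtain m where m: "m \<in> carrier M" "m \<notin> A" "P = co m" using P unfolding PP_def Co_def by blast
    have iP: "ideal P R" using P idl unfolding PP_def by blast
    show ?thesis
    proof (rule primeidealI[OF iP R.is_cring])
      show "carrier R \<noteq> P"
      proof
        assume "carrier R = P"
        then have "\<one> \<in> co m" using m by auto
        then show False using m unfolding co_def by simp
      qed
      fix a b assume ab: "a \<in> carrier R" "b \<in> carrier R" "a \<otimes> b \<in> P"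
      show "a \<in> P \<or> b \<in> P"
      proof (rule disjCI)
        \<comment> \<open>Here b m is nonzero modulo A. Its colon ideal contains P, hence equals P
          by maximality, and it contains a because a b lies in P.\<close>
        assume nb: "b \<notin> P"
        then have bm: "b \<odot>\<^bsub>M\<^esub> m \<notin> A" using ab m unfolding co_def by simp
        have "co (b \<odot>\<^bsub>M\<^esub> m) \<in> Co" using bm ab m unfolding Co_def by blast
        moreover have "P \<subseteq> co (b \<odot>\<^bsub>M\<^esub> m)"
        proof
          fix r assume "r \<in> P"
          then have r: "r \<in> carrier R" "r \<odot>\<^bsub>M\<^esub> m \<in> A" unfolding m co_def by auto
          then show "r \<in> co (b \<odot>\<^bsub>M\<^esub> m)" unfolding co_def
            using submodule_smult[OF A ab(2) r(2)] smult_comm[of r b m] ab m by simp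
        qed
        ultimately have "co (b \<odot>\<^bsub>M\<^esub> m) = P" using P unfolding PP_def by blast
        moreover have "a \<in> co (b \<odot>\<^bsub>M\<^esub> m)"
          using ab m unfolding m co_def by (simp add: smult_assoc1)
        ultimately show "a \<in> P" by simp
      qed
    qed
  qed
  have above: "\<exists>P\<in>PP. I \<subseteq> P" if I: "I \<in> Co" for I
  proof -
    have "{J \<in> Co. I \<subseteq> J} \<noteq> {}" using I by blast
    then obtain J where J: "J \<in> {J \<in> Co. I \<subseteq> J}" "\<And>K. K \<in> {J \<in> Co. I \<subseteq> J} \<Longrightarrow> J \<subseteq> K \<Longrightarrow> K = J"
      by (rule nR.ideal_family_maximal) (use idl in auto)
    then have "J \<in> PP" unfolding PP_def by blast
    then show ?thesis using J by blast
  qed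
  have reg: "regular_on M w (carrier M) A" if w: "w \<in> carrier R" "\<And>P. P \<in> PP \<Longrightarrow> w \<notin> P" for w
    unfolding regular_on_def
  proof (intro ballI impI, rule ccontr)
    fix m assume m: "m \<in> carrier M" "w \<odot>\<^bsub>M\<^esub> m \<in> A" "m \<notin> A"
    then have "co m \<in> Co" unfolding Co_def by blast
    then obtain P where "P \<in> PP" "co m \<subseteq> P" using above by blast
    moreover have "w \<in> co m" using w m unfolding co_def by simp
    ultimately show False using w by blast
  qed
  have "\<forall>P\<in>PP. \<exists>m. m \<in> carrier M \<and> m \<notin> A \<and> P = co m" unfolding PP_def Co_def by blast
  then obtain g where g: "\<And>P. P \<in> PP \<Longrightarrow> g P \<in> carrier M \<and> g P \<notin> A \<and> P = co (g P)" by metis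
  have AM: "A \<subseteq> carrier M" using A submoduleE(1) by blast
  have "finite PP"
  proof (rule ccontr)
    assume inf: "infinite PP"
    \<comment> \<open>For a finite F with \<open>sp F\<close> maximal, adjoining the witness of a
      further Q adds nothing. The contradiction is a ring element that multiplies
      \<open>sp F\<close> into A but not the witness of Q.\<close>
    define sp where "sp F = submodule_span R M (A \<union> g ` F)" for F
    have sub: "submodule (sp F) R M" if "F \<subseteq> PP" for F
      unfolding sp_def by (rule submodule_submodule_span) (use that g AM in auto)
    obtain N where N: "N \<in> {sp F | F. F \<subseteq> PP \<and> finite F}"
      "\<And>N'. N' \<in> {sp F | F. F \<subseteq> PP \<and> finite F} \<Longrightarrow> N \<subseteq> N' \<Longrightarrow> N' = N"
      by (rule noetherian_moduleD[OF nM, of "{sp F | F. F \<subseteq> PP \<and> finite F}"]) (use sub in auto)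
    then obtain F where F: "F \<subseteq> PP" "finite F" "N = sp F" by blast
    obtain Q where Q: "Q \<in> PP" "Q \<notin> F" using inf F by (meson infinite_super subsetI)
    have "sp F \<subseteq> sp (insert Q F)"
      unfolding sp_def submodule_span_def by blast
    then have eq: "sp (insert Q F) = sp F" using N(2)[of "sp (insert Q F)"] F Q by blast
    \<comment> \<open>The element is a product of members s of P outside Q, one for each P in F.
      They exist since distinct maximal colon ideals are incomparable, and the product stays outside
      the prime Q.\<close>
    have "\<exists>r\<in>carrier R. r \<notin> Q \<and> (\<forall>P\<in>F. r \<in> P)" using F(2,1) Q(2)
    proof (induction F rule: finite_induct)
      case empty
      interpret Q: primeideal Q R using prime Q by blast
      have "\<one> \<notin> Q" using Q.I_notcarr Q.one_imp_carrier by blast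
      then show ?case by blast
    next
      case (insert P F)
      interpret Q: primeideal Q R using prime Q by blast
      interpret P: primeideal P R using prime insert by blast
      obtain r where r: "r \<in> carrier R" "r \<notin> Q" "\<forall>P\<in>F. r \<in> P" using insert by blast
      have "\<not> P \<subseteq> Q" using insert.prems Q(1) unfolding PP_def by blast
      then obtain s where s: "s \<in> P" "s \<notin> Q" by blast
      have sc: "s \<in> carrier R" using s P.Icarr by blast
      have "s \<otimes> r \<notin> Q" using Q.I_prime[OF sc r(1)] s r by blast
      moreover have "s \<otimes> r \<in> P" using P.I_r_closed[OF s(1) r(1)] .
      moreover have "s \<otimes> r \<in> P'" if "P' \<in> F" for P'
      proof -
        interpret P': primeideal P' R using prime insert.prems that by blast
        show ?thesis using P'.I_l_closed[of r s] r sc that by blast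
      qed
      ultimately show ?case using sc r by blast
    qed
    then obtain r where r: "r \<in> carrier R" "r \<notin> Q" "\<And>P. P \<in> F \<Longrightarrow> r \<in> P" by blast
    have "sp F \<subseteq> {m \<in> carrier M. r \<odot>\<^bsub>M\<^esub> m \<in> A}"
      unfolding sp_def
    proof (rule submodule_span_least[OF smult_preimage_submodule[OF A r(1)]])
      have "r \<odot>\<^bsub>M\<^esub> g P \<in> A" if "P \<in> F" for P
        using r(3)[OF that] g[of P] that F(1) unfolding co_def by blast
      then show "A \<union> g ` F \<subseteq> {m \<in> carrier M. r \<odot>\<^bsub>M\<^esub> m \<in> A}"
        using AM submodule_smult[OF A r(1)] g F(1) by auto
    qed
    moreover have "g Q \<in> sp (insert Q F)" unfolding sp_def submodule_span_def by blast
    ultimately have "r \<odot>\<^bsub>M\<^esub> g Q \<in> A" using eq by blast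
    then have "r \<in> co (g Q)" using r unfolding co_def by blast
    then show False using g[OF Q(1)] r(2) by blast
  qed
  show ?thesis
  proof (intro exI[of _ PP] conjI ballI impI)
    show "primeideal P R" if "P \<in> PP" for P using prime[OF that] .
    show "\<exists>m\<in>carrier M. m \<notin> A \<and> P = {r \<in> carrier R. r \<odot>\<^bsub>M\<^esub> m \<in> A}" if "P \<in> PP" for P
      using g[OF that] unfolding co_def by blast
  qed (use reg \<open>finite PP\<close> in auto)
qed

lemma regular_onD: "regular_on M x C A \<Longrightarrow> m \<in> C \<Longrightarrow> x \<odot>\<^bsub>M\<^esub> m \<in> A \<Longrightarrow> m \<in> A"
  unfolding regular_on_def by blast

text \<open>This is the half of the permutability of regular sequences that holds without Nakayama's
  lemma. A relation x m = w c modulo A gives c = x c' modulo A, and cancelling x leaves m = w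
  c'.\<close>

lemma regular_on_swap:
  assumes "x \<in> carrier R" "w \<in> carrier R" "submodule A R M"
    "regular_on M x (carrier M) A" "regular_on M w (carrier M) (add_mult M x (carrier M) A)"
  shows "regular_on M x (carrier M) (add_mult M w (carrier M) A)"
  unfolding regular_on_def
proof (intro ballI impI)
  note C = carrier_is_submodule
  note s = submodule_add_mult[OF assms(1) C assms(3)]
  fix m assume m: "m \<in> carrier M" "x \<odot>\<^bsub>M\<^esub> m \<in> add_mult M w (carrier M) A"
  then obtain a c where a: "a \<in> A" "c \<in> carrier M" "x \<odot>\<^bsub>M\<^esub> m = a \<oplus>\<^bsub>M\<^esub> w \<odot>\<^bsub>M\<^esub> c"
    unfolding add_mult_def by auto
  have aC: "a \<in> carrier M" using a assms submodule_carrier by blast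
  have "A \<subseteq> carrier M" using assms(3) submoduleE(1) by blast
  then have "a \<in> add_mult M x (carrier M) A" using add_mult_superset[OF assms(1) C] a by blast
  moreover have "a \<oplus>\<^bsub>M\<^esub> w \<odot>\<^bsub>M\<^esub> c \<in> add_mult M x (carrier M) A"
    using smult_mem_add_mult[OF assms(1) C assms(3) m(1)] a(3) by simp
  ultimately have "w \<odot>\<^bsub>M\<^esub> c \<in> add_mult M x (carrier M) A"
    using submodule_add_cancel(1)[OF s] a assms(2) by simp
  then have "c \<in> add_mult M x (carrier M) A" using assms(5) a unfolding regular_on_def by blast
  then obtain a' c' where a': "a' \<in> A" "c' \<in> carrier M" "c = a' \<oplus>\<^bsub>M\<^esub> x \<odot>\<^bsub>M\<^esub> c'"
    unfolding add_mult_def by auto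
  have a'C: "a' \<in> carrier M" using a' assms submodule_carrier by blast
  have e: "\<zero>\<^bsub>M\<^esub> \<oplus>\<^bsub>M\<^esub> x \<odot>\<^bsub>M\<^esub> m = (a \<oplus>\<^bsub>M\<^esub> w \<odot>\<^bsub>M\<^esub> a') \<oplus>\<^bsub>M\<^esub> x \<odot>\<^bsub>M\<^esub> (w \<odot>\<^bsub>M\<^esub> c')"
    using a(3) a' aC a'C m(1) assms(1,2) by (simp add: smult_r_distr smult_comm[of x w] M.a_assoc)
  have "x \<odot>\<^bsub>M\<^esub> m \<ominus>\<^bsub>M\<^esub> x \<odot>\<^bsub>M\<^esub> (w \<odot>\<^bsub>M\<^esub> c') \<in> A"
    by (rule submodule_diffI[OF assms(3) e submodule_zero[OF assms(3)]
          submodule_add[OF assms(3) a(1) submodule_smult[OF assms(3,2) a'(1)]]])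
      (use a'(2) m(1) assms(1,2) in simp_all)
  then have "x \<odot>\<^bsub>M\<^esub> (m \<ominus>\<^bsub>M\<^esub> w \<odot>\<^bsub>M\<^esub> c') \<in> A"
    using m a' assms by (simp add: smult_r_minus')
  then have "m \<ominus>\<^bsub>M\<^esub> w \<odot>\<^bsub>M\<^esub> c' \<in> A" by (rule regular_onD[OF assms(4), rotated]) (use m a' assms(1,2) in simp)
  moreover have "m = (m \<ominus>\<^bsub>M\<^esub> w \<odot>\<^bsub>M\<^esub> c') \<oplus>\<^bsub>M\<^esub> w \<odot>\<^bsub>M\<^esub> c'"
    using m a' assms by (simp add: minus_add_cancel)
  ultimately show "m \<in> add_mult M w (carrier M) A" using a'(2) by (intro add_mult_memI)
qed

text \<open>An elementary form of the fact that dividing by one regular element lowers the depth by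
  only one. From y m = x p and z m = x q, all modulo A, cancelling x gives z p = y q, so p = y r,
  and cancelling y gives m = x r.\<close>

lemma regular_pair_exchange:
  assumes "x \<in> carrier R" "y \<in> carrier R" "z \<in> carrier R" and A: "submodule A R M"
    and "regular_on M x (carrier M) A" "regular_on M y (carrier M) A"
    "regular_on M z (carrier M) (add_mult M y (carrier M) A)"
    and m: "m \<in> carrier M" "y \<odot>\<^bsub>M\<^esub> m \<in> add_mult M x (carrier M) A"
      "z \<odot>\<^bsub>M\<^esub> m \<in> add_mult M x (carrier M) A"
  shows "m \<in> add_mult M x (carrier M) A"
proof -
  obtain a p where a: "a \<in> A" "p \<in> carrier M" "y \<odot>\<^bsub>M\<^esub> m = a \<oplus>\<^bsub>M\<^esub> x \<odot>\<^bsub>M\<^esub> p"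
    using m unfolding add_mult_def by auto
  obtain b q where b: "b \<in> A" "q \<in> carrier M" "z \<odot>\<^bsub>M\<^esub> m = b \<oplus>\<^bsub>M\<^esub> x \<odot>\<^bsub>M\<^esub> q"
    using m unfolding add_mult_def by auto
  have AC: "a \<in> carrier M" "b \<in> carrier M" using a b A submodule_carrier by blast+
  have "z \<odot>\<^bsub>M\<^esub> (y \<odot>\<^bsub>M\<^esub> m) = y \<odot>\<^bsub>M\<^esub> (z \<odot>\<^bsub>M\<^esub> m)" using assms smult_comm by blast
  then have e: "z \<odot>\<^bsub>M\<^esub> a \<oplus>\<^bsub>M\<^esub> x \<odot>\<^bsub>M\<^esub> (z \<odot>\<^bsub>M\<^esub> p) = y \<odot>\<^bsub>M\<^esub> b \<oplus>\<^bsub>M\<^esub> x \<odot>\<^bsub>M\<^esub> (y \<odot>\<^bsub>M\<^esub> q)"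
    using a b AC assms(1-3) by (simp add: smult_r_distr smult_comm[of _ x])
  have "x \<odot>\<^bsub>M\<^esub> (z \<odot>\<^bsub>M\<^esub> p) \<ominus>\<^bsub>M\<^esub> x \<odot>\<^bsub>M\<^esub> (y \<odot>\<^bsub>M\<^esub> q) \<in> A"
    by (rule submodule_diffI[OF A e]) (use a b assms submodule_smult[OF A] in auto)
  then have "x \<odot>\<^bsub>M\<^esub> (z \<odot>\<^bsub>M\<^esub> p \<ominus>\<^bsub>M\<^esub> y \<odot>\<^bsub>M\<^esub> q) \<in> A" using a b assms by (simp add: smult_r_minus')
  then have zy: "z \<odot>\<^bsub>M\<^esub> p \<ominus>\<^bsub>M\<^esub> y \<odot>\<^bsub>M\<^esub> q \<in> A" by (rule regular_onD[OF assms(5), rotated]) (use a b assms(1-3) in simp)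
  have "z \<odot>\<^bsub>M\<^esub> p = (z \<odot>\<^bsub>M\<^esub> p \<ominus>\<^bsub>M\<^esub> y \<odot>\<^bsub>M\<^esub> q) \<oplus>\<^bsub>M\<^esub> y \<odot>\<^bsub>M\<^esub> q"
    using a b assms by (simp add: minus_add_cancel)
  then have "z \<odot>\<^bsub>M\<^esub> p \<in> add_mult M y (carrier M) A" using zy b(2) by (rule add_mult_memI)
  then have "p \<in> add_mult M y (carrier M) A" by (rule regular_onD[OF assms(7) a(2)])
  then obtain c r where c: "c \<in> A" "r \<in> carrier M" "p = c \<oplus>\<^bsub>M\<^esub> y \<odot>\<^bsub>M\<^esub> r"
    unfolding add_mult_def by auto
  have cC: "c \<in> carrier M" using c A submodule_carrier by blast
  have e: "\<zero>\<^bsub>M\<^esub> \<oplus>\<^bsub>M\<^esub> y \<odot>\<^bsub>M\<^esub> m = (a \<oplus>\<^bsub>M\<^esub> x \<odot>\<^bsub>M\<^esub> c) \<oplus>\<^bsub>M\<^esub> y \<odot>\<^bsub>M\<^esub> (x \<odot>\<^bsub>M\<^esub> r)"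
    using a c AC cC assms(1,2) m(1) by (simp add: smult_r_distr smult_comm[of y x] M.a_assoc)
  have "y \<odot>\<^bsub>M\<^esub> m \<ominus>\<^bsub>M\<^esub> y \<odot>\<^bsub>M\<^esub> (x \<odot>\<^bsub>M\<^esub> r) \<in> A"
    by (rule submodule_diffI[OF A e submodule_zero[OF A]
          submodule_add[OF A a(1) submodule_smult[OF A assms(1) c(1)]]])
      (use c(2) m(1) assms(1,2) in simp_all)
  then have "y \<odot>\<^bsub>M\<^esub> (m \<ominus>\<^bsub>M\<^esub> x \<odot>\<^bsub>M\<^esub> r) \<in> A" using m c assms by (simp add: smult_r_minus')
  then have "m \<ominus>\<^bsub>M\<^esub> x \<odot>\<^bsub>M\<^esub> r \<in> A" by (rule regular_onD[OF assms(6), rotated]) (use m c assms(1-3) in simp)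
  moreover have "m = (m \<ominus>\<^bsub>M\<^esub> x \<odot>\<^bsub>M\<^esub> r) \<oplus>\<^bsub>M\<^esub> x \<odot>\<^bsub>M\<^esub> r"
    using m c assms by (simp add: minus_add_cancel)
  ultimately show ?thesis using c(2) by (intro add_mult_memI)
qed

end

text \<open>Infinitely many scalars take over the role of primality in prime avoidance. If v avoids
  the earlier ideals but lies in P, and w lies outside P, then on the line w + t v every earlier
  ideal excludes at most one t, and P excludes none.\<close>

lemma (in cring) subspace_avoids_ideals:
  assumes K: "subfield K R" "infinite K"
    and W: "W \<subseteq> carrier R" "\<zero> \<in> W" "\<And>v w. v \<in> W \<Longrightarrow> w \<in> W \<Longrightarrow> v \<oplus> w \<in> W"
      "\<And>k w. k \<in> K \<Longrightarrow> w \<in> W \<Longrightarrow> k \<otimes> w \<in> W"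
    and PP: "finite PP" "\<And>P. P \<in> PP \<Longrightarrow> ideal P R" "\<And>P. P \<in> PP \<Longrightarrow> \<not> W \<subseteq> P"
  shows "\<exists>w\<in>W. \<forall>P\<in>PP. w \<notin> P"
  using PP
proof (induction PP rule: finite_induct)
  case (insert P PP)
  interpret P: ideal P R using insert by blast
  obtain v where v: "v \<in> W" "\<forall>Q\<in>PP. v \<notin> Q" using insert by blast
  have KR: "K \<subseteq> carrier R" using subfieldE(3)[OF K(1)] .
  show ?case
  proof (cases "v \<in> P")
    case True
    obtain w where w: "w \<in> W" "w \<notin> P" using insert.prems(2)[of P] by blast
    have c: "v \<in> carrier R" "w \<in> carrier R" using v w W by auto
    have one: "finite {t \<in> K. w \<oplus> t \<otimes> v \<in> Q}" if Q: "Q \<in> PP" for Q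
    proof -
      interpret Q: ideal Q R using insert Q by blast
      have "s = t" if st: "s \<in> K" "t \<in> K" "w \<oplus> s \<otimes> v \<in> Q" "w \<oplus> t \<otimes> v \<in> Q" for s t
      proof (rule ccontr)
        assume ne: "s \<noteq> t"
        have stc: "s \<in> carrier R" "t \<in> carrier R" using st KR by auto
        have "s \<ominus> t \<in> K" using subringE(5)[OF subfieldE(1)[OF K(1)]] st
            subringE(7)[OF subfieldE(1)[OF K(1)]] by (simp add: a_minus_def)
        moreover have "s \<ominus> t \<noteq> \<zero>" using ne stc by simp
        ultimately have d: "s \<ominus> t \<in> K - {\<zero>}" by simp
        have i: "inv (s \<ominus> t) \<in> K - {\<zero>}" "inv (s \<ominus> t) \<otimes> (s \<ominus> t) = \<one>"
          using subfield_m_inv[OF K(1) d] by auto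
        have "(w \<oplus> s \<otimes> v) \<ominus> (w \<oplus> t \<otimes> v) \<in> Q" using st Q.a_closed Q.a_inv_closed by (simp add: a_minus_def)
        moreover have "(w \<oplus> s \<otimes> v) \<ominus> (w \<oplus> t \<otimes> v) = (s \<ominus> t) \<otimes> v"
          using c stc by algebra
        ultimately have "(s \<ominus> t) \<otimes> v \<in> Q" by simp
        then have "inv (s \<ominus> t) \<otimes> ((s \<ominus> t) \<otimes> v) \<in> Q" using Q.I_l_closed i KR by blast
        moreover have "inv (s \<ominus> t) \<otimes> ((s \<ominus> t) \<otimes> v) = v"
          using i(1,2) c stc KR by (subst m_assoc[symmetric]) auto
        ultimately have "v \<in> Q" by simp
        then show False using v Q by blast
      qed
      then have "is_singleton {t \<in> K. w \<oplus> t \<otimes> v \<in> Q} \<or> {t \<in> K. w \<oplus> t \<otimes> v \<in> Q} = {}"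
        by (auto intro!: is_singletonI')
      then show ?thesis by (elim disjE is_singletonE) (simp_all only: finite.emptyI finite_insert)
    qed
    have "finite (\<Union>Q\<in>PP. {t \<in> K. w \<oplus> t \<otimes> v \<in> Q})" by (rule finite_UN_I[OF insert.hyps(1) one])
    then obtain t where t: "t \<in> K" "\<forall>Q\<in>PP. w \<oplus> t \<otimes> v \<notin> Q"
      using K(2) finite_subset[of K "\<Union>Q\<in>PP. {t \<in> K. w \<oplus> t \<otimes> v \<in> Q}"] by blast
    have tc: "t \<in> carrier R" using t KR by auto
    have tv: "t \<otimes> v \<in> P" using P.I_l_closed[OF True tc] .
    have "w \<oplus> t \<otimes> v \<notin> P"
    proof
      assume "w \<oplus> t \<otimes> v \<in> P"
      then have "(w \<oplus> t \<otimes> v) \<oplus> \<ominus> (t \<otimes> v) \<in> P" using P.a_closed P.a_inv_closed[OF tv] by blast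
      moreover have "(w \<oplus> t \<otimes> v) \<oplus> \<ominus> (t \<otimes> v) = w" using c tc by algebra
      ultimately show False using w by simp
    qed
    moreover have "w \<oplus> t \<otimes> v \<in> W" by (rule W(3)[OF w(1) W(4)[OF t(1) v(1)]])
    ultimately show ?thesis using t(2) by (intro bexI[of _ "w \<oplus> t \<otimes> v"]) simp_all
  qed (use v in blast)
qed (use W in blast)

text \<open>\<open>W\<close> is a space of candidates for regular elements: it need not generate
  \<open>I\<close>, but no prime contains \<open>W\<close> without containing \<open>I\<close>. The
  locale serves both for \<open>W = G 1\<close> and for the span of a minimal reduction, with
  \<open>I\<close> the irrelevant ideal.\<close>

locale depth_exchange = module R M + noetherian_ring R for R (structure) and M (structure) +
  fixes K W I
  assumes noetherian: "noetherian_module R M"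
    and K: "subfield K R" "infinite K"
    and W_zero: "\<zero>\<^bsub>R\<^esub> \<in> W" and W_add: "\<And>v w. v \<in> W \<Longrightarrow> w \<in> W \<Longrightarrow> v \<oplus>\<^bsub>R\<^esub> w \<in> W"
    and W_smult: "\<And>k w. k \<in> K \<Longrightarrow> w \<in> W \<Longrightarrow> k \<otimes>\<^bsub>R\<^esub> w \<in> W"
    and WI: "W \<subseteq> I" and I_carrier: "I \<subseteq> carrier R"
    and W_radical: "\<And>P. primeideal P R \<Longrightarrow> W \<subseteq> P \<Longrightarrow> I \<subseteq> P"
begin

text \<open>The last assumption says that \<open>I\<close> annihilates no nonzero element of M/A, so
  \<open>I\<close> lies in no maximal colon ideal of A. These ideals are prime and finite in number,
  so \<open>W\<close> lies in none of them, and a vector of \<open>W\<close> avoiding all of them is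
  regular on every M/A at once.\<close>

lemma common_regular_element:
  assumes "finite AA" "\<And>A. A \<in> AA \<Longrightarrow> submodule A R M"
    "\<And>A m. A \<in> AA \<Longrightarrow> m \<in> carrier M \<Longrightarrow> (\<And>y. y \<in> I \<Longrightarrow> y \<odot>\<^bsub>M\<^esub> m \<in> A) \<Longrightarrow> m \<in> A"
  obtains w where "w \<in> W" "\<And>A. A \<in> AA \<Longrightarrow> regular_on M w (carrier M) A"
proof -
  let ?Q = "\<lambda>A PP. finite PP \<and>
      (\<forall>P\<in>PP. primeideal P R \<and> (\<exists>m\<in>carrier M. m \<notin> A \<and> P = {r \<in> carrier R. r \<odot>\<^bsub>M\<^esub> m \<in> A})) \<and>
      (\<forall>w\<in>carrier R. (\<forall>P\<in>PP. w \<notin> P) \<longrightarrow> regular_on M w (carrier M) A)"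
  have "\<forall>A\<in>AA. \<exists>PP. ?Q A PP"
    using finite_maximal_colon_ideals[OF noetherian_ring_axioms noetherian assms(2)] by (rule ballI)
  then obtain pp where Q: "\<forall>A\<in>AA. ?Q A (pp A)" by (rule bchoice[THEN exE])
  have pp: "\<And>A. A \<in> AA \<Longrightarrow> finite (pp A)"
    "\<And>A P. A \<in> AA \<Longrightarrow> P \<in> pp A \<Longrightarrow>
      primeideal P R \<and> (\<exists>m\<in>carrier M. m \<notin> A \<and> P = {r \<in> carrier R. r \<odot>\<^bsub>M\<^esub> m \<in> A})"
    "\<And>A w. A \<in> AA \<Longrightarrow> w \<in> carrier R \<Longrightarrow> \<forall>P\<in>pp A. w \<notin> P \<Longrightarrow> regular_on M w (carrier M) A"
    using Q by (simp_all del: bex_simps)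
  have "\<exists>w\<in>W. \<forall>P\<in>(\<Union>A\<in>AA. pp A). w \<notin> P"
  proof (rule R.subspace_avoids_ideals[OF K _ W_zero W_add W_smult])
    show "W \<subseteq> carrier R" using WI I_carrier by blast
    show "finite (\<Union>A\<in>AA. pp A)" using assms(1) pp(1) by blast
    show "ideal P R" if "P \<in> (\<Union>A\<in>AA. pp A)" for P
      using that pp(2) primeideal.axioms(1) by blast
    show "\<not> W \<subseteq> P" if P: "P \<in> (\<Union>A\<in>AA. pp A)" for P
    proof
      assume WP: "W \<subseteq> P"
      obtain A where A: "A \<in> AA" "P \<in> pp A" using P by blast
      obtain m where m: "m \<in> carrier M" "m \<notin> A" "P = {r \<in> carrier R. r \<odot>\<^bsub>M\<^esub> m \<in> A}"
        using pp(2)[OF A] by blast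
      have "I \<subseteq> P" using W_radical WP pp(2)[OF A] by blast
      then show False using assms(3)[OF A(1) m(1)] m by blast
    qed
  qed
  then obtain w where w: "w \<in> W" "\<forall>A\<in>AA. \<forall>P\<in>pp A. w \<notin> P" by blast
  then show ?thesis using that[OF w(1)] pp(3) WI I_carrier by blast
qed

text \<open>The sequence loses only one element when M/A is divided by x, and the rest can be chosen
  in \<open>W\<close>. An element w of \<open>W\<close> mediates: it is regular modulo A, modulo x
  and modulo y, so the problem can be moved to M/(A + wM), where a shorter sequence is
  available.\<close>

lemma exchange:
  assumes "submodule A R M" "x \<in> I" "regular_on M x (carrier M) A"
    "set ys \<subseteq> I" "weakly_regular M ys (carrier M) A"
  shows "\<exists>zs. length zs = length ys - 1 \<and> set zs \<subseteq> W \<and>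
    weakly_regular M zs (carrier M) (add_mult M x (carrier M) A)"
  using assms
proof (induction "length ys" arbitrary: A x ys rule: less_induct)
  case less
  note C = carrier_is_submodule
  \<comment> \<open>Because subtraction on nat is truncated, the empty list settles sequences of
    length at most one.\<close>
  consider "ys = []" | y where "ys = [y]" | y z rs where "ys = y # z # rs"
    by (metis list.exhaust)
  then show ?case
  proof cases
    case (3 y z rs)
    let ?C = "carrier M"
    have c: "x \<in> carrier R" "y \<in> carrier R" "z \<in> carrier R" using less.prems 3 I_carrier by auto
    have yI: "y \<in> I" "z \<in> I" "set rs \<subseteq> I" using less.prems 3 by auto
    have yr: "regular_on M y ?C A" "regular_on M z ?C (add_mult M y ?C A)"
      "weakly_regular M (z # rs) ?C (add_mult M y ?C A)"
      using less.prems(5) 3 by auto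
    note A = less.prems(1)
    note Ax = submodule_add_mult[OF c(1) C A] and Ay = submodule_add_mult[OF c(2) C A]
    let ?AA = "{A, add_mult M x ?C A, add_mult M y ?C A}"
    \<comment> \<open>Modulo A and modulo y the elements y and z themselves witness that
      \<open>I\<close> annihilates nothing. Modulo x this is \<open>regular_pair_exchange\<close>
      for the pair y, z.\<close>
    obtain w where w: "w \<in> W" "\<And>B. B \<in> ?AA \<Longrightarrow> regular_on M w ?C B"
    proof (rule common_regular_element[of ?AA])
      show "submodule B R M" if "B \<in> ?AA" for B using that A Ax Ay by blast
      show "m \<in> B" if B: "B \<in> ?AA" "m \<in> ?C" "\<And>y. y \<in> I \<Longrightarrow> y \<odot>\<^bsub>M\<^esub> m \<in> B" for B m
        using B(1)
      proof (elim insertE emptyE)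
        assume "B = A" then show ?thesis using B yI yr unfolding regular_on_def by blast
      next
        assume "B = add_mult M y ?C A"
        then show ?thesis using B yI yr unfolding regular_on_def by blast
      next
        assume B': "B = add_mult M x ?C A"
        show ?thesis unfolding B'
          by (rule regular_pair_exchange[OF c A less.prems(3) yr(1,2) B(2)])
            (use B(3) yI B' in auto)
      qed
    qed auto
    have wI: "w \<in> I" and wc: "w \<in> carrier R" using w WI I_carrier by blast+
    note Aw = submodule_add_mult[OF wc C A]
    have l: "length (z # rs) < length ys" using 3 by simp
    obtain zs where zs: "length zs = length rs" "set zs \<subseteq> W"
      "weakly_regular M zs ?C (add_mult M w ?C (add_mult M y ?C A))"
      using less.hyps[OF l Ay wI _ _ yr(3)] w(2) yI by auto
    \<comment> \<open>Commuting w and y makes \<open>y # zs\<close> weakly regular modulo w. It is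
      shorter than \<open>ys\<close>, so a second use of the induction hypothesis exchanges x
      against it there.\<close>
    have e: "add_mult M w ?C (add_mult M y ?C A) = add_mult M y ?C (add_mult M w ?C A)"
      using add_mult_commute[OF wc c(2) C A] .
    have "regular_on M y ?C (add_mult M w ?C A)"
      using regular_on_swap[OF c(2) wc A yr(1)] w(2) by blast
    then have yz: "weakly_regular M (y # zs) ?C (add_mult M w ?C A)" using zs(3) e by simp
    have xw: "regular_on M x ?C (add_mult M w ?C A)"
      using regular_on_swap[OF c(1) wc A less.prems(3)] w(2) by blast
    have l': "length (y # zs) < length ys" using 3 zs by simp
    have yzI: "set (y # zs) \<subseteq> I" using yI zs WI by auto
    obtain vs where vs: "length vs = length zs" "set vs \<subseteq> W"
      "weakly_regular M vs ?C (add_mult M x ?C (add_mult M w ?C A))"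
      using less.hyps[OF l' Aw less.prems(2) xw yzI yz] by auto
    have "add_mult M x ?C (add_mult M w ?C A) = add_mult M w ?C (add_mult M x ?C A)"
      using add_mult_commute[OF c(1) wc C A] .
    then have "weakly_regular M (w # vs) ?C (add_mult M x ?C A)" using vs w(2) by simp
    then show ?thesis using vs zs w(1) 3 by (intro exI[of _ "w # vs"]) auto
  qed auto
qed

text \<open>A regular first element in \<open>I\<close> guarantees one in \<open>W\<close>, and
  \<open>exchange\<close> supplies the remaining ones modulo it.\<close>

lemma weakly_regular_in_subspace:
  assumes "submodule A R M" "set ys \<subseteq> I" "weakly_regular M ys (carrier M) A"
  shows "\<exists>zs. length zs = length ys \<and> set zs \<subseteq> W \<and> weakly_regular M zs (carrier M) A"
proof (cases ys)
  case (Cons y rs)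
  obtain w where w: "w \<in> W" "regular_on M w (carrier M) A"
  proof (rule common_regular_element[of "{A}"])
    show "m \<in> B" if "B \<in> {A}" "m \<in> carrier M" "\<And>y. y \<in> I \<Longrightarrow> y \<odot>\<^bsub>M\<^esub> m \<in> B" for B m
    proof -
      have "regular_on M y (carrier M) A" "y \<in> I" using assms Cons by auto
      then show ?thesis using regular_onD[of y "carrier M" A m] that by blast
    qed
  qed (use assms in auto)
  have wI: "w \<in> I" using w WI by blast
  obtain zs where "length zs = length ys - 1" "set zs \<subseteq> W"
    "weakly_regular M zs (carrier M) (add_mult M w (carrier M) A)"
    using exchange[OF assms(1) wI w(2) assms(2,3)] by blast
  then show ?thesis using w Cons by (intro exI[of _ "w # zs"]) auto
qed auto

text \<open>This is the comparison of two weakly regular sequences that makes all maximal ones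
  equally long: each element of \<open>xs\<close> uses up one element of \<open>ys\<close>.\<close>

lemma weakly_regular_remainder:
  assumes "submodule A R M" "set xs \<subseteq> I" "weakly_regular M xs (carrier M) A"
    "set ys \<subseteq> I" "weakly_regular M ys (carrier M) A"
  shows "\<exists>zs. length zs = length ys - length xs \<and> set zs \<subseteq> I \<and>
    weakly_regular M zs (carrier M) (add_mults M xs (carrier M) A)"
  using assms
proof (induction xs arbitrary: A ys)
  case (Cons x xs)
  then have x: "x \<in> I" "x \<in> carrier R" "regular_on M x (carrier M) A" using I_carrier by auto
  obtain zs where zs: "length zs = length ys - 1" "set zs \<subseteq> W"
    "weakly_regular M zs (carrier M) (add_mult M x (carrier M) A)"
    using exchange[OF Cons.prems(1) x(1,3) Cons.prems(4,5)] by blast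
  have zI: "set zs \<subseteq> I" using zs WI by blast
  have xs: "set xs \<subseteq> I" "weakly_regular M xs (carrier M) (add_mult M x (carrier M) A)"
    using Cons.prems(2,3) by auto
  have l: "length ys - length (x # xs) = length zs - length xs" using zs(1) by simp
  show ?case
    using Cons.IH[OF submodule_add_mult[OF x(2) carrier_is_submodule Cons.prems(1)] xs zI zs(3)]
    unfolding l by simp
qed auto

end

section \<open>Homogeneous components\<close>

definition decomposition :: "('b, 'm) ring_scheme \<Rightarrow> ('i \<Rightarrow> 'b set) \<Rightarrow> 'b \<Rightarrow> 'i \<Rightarrow> 'b" where
  "decomposition M H x = (THE f. (\<forall>i. f i \<in> H i) \<and> finite {i. f i \<noteq> \<zero>\<^bsub>M\<^esub>} \<and>
     x = (\<Oplus>\<^bsub>M\<^esub>i\<in>{i. f i \<noteq> \<zero>\<^bsub>M\<^esub>}. f i))"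

context abelian_group
begin

lemma internal_direct_sum_carrier: "internal_direct_sum G H \<Longrightarrow> x \<in> H i \<Longrightarrow> x \<in> carrier G"
  by (meson additive_subgroup.a_subset internal_direct_sum_def subsetD)

lemma internal_direct_sum_zero: "internal_direct_sum G H \<Longrightarrow> \<zero> \<in> H i"
  by (meson additive_subgroup.zero_closed internal_direct_sum_def)

lemma internal_direct_sum_add: "internal_direct_sum G H \<Longrightarrow> x \<in> H i \<Longrightarrow> y \<in> H i \<Longrightarrow> x \<oplus> y \<in> H i"
  by (meson additive_subgroup.a_closed internal_direct_sum_def)

lemma decomposition_props:
  assumes "internal_direct_sum G H" "x \<in> carrier G"
  shows "decomposition G H x i \<in> H i" "finite {i. decomposition G H x i \<noteq> \<zero>}"
    "x = (\<Oplus>i\<in>{i. decomposition G H x i \<noteq> \<zero>}. decomposition G H x i)"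
proof -
  have "\<exists>!f. (\<forall>i. f i \<in> H i) \<and> finite {i. f i \<noteq> \<zero>} \<and> x = (\<Oplus>i\<in>{i. f i \<noteq> \<zero>}. f i)"
    using assms unfolding internal_direct_sum_def by blast
  from theI'[OF this] show "decomposition G H x i \<in> H i" "finite {i. decomposition G H x i \<noteq> \<zero>}"
    "x = (\<Oplus>i\<in>{i. decomposition G H x i \<noteq> \<zero>}. decomposition G H x i)"
    unfolding decomposition_def by blast+
qed

lemma decomposition_eqI:
  assumes "internal_direct_sum G H" "\<And>i. f i \<in> H i" "finite S" "{i. f i \<noteq> \<zero>} \<subseteq> S"
    "x = (\<Oplus>i\<in>S. f i)"
  shows "decomposition G H x = f"
proof -
  have c: "f i \<in> carrier G" for i by (rule internal_direct_sum_carrier[OF assms(1,2)])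
  have xc: "x \<in> carrier G" using c assms(5) by (auto intro: finsum_closed)
  have "(\<Oplus>i\<in>{i. f i \<noteq> \<zero>}. f i) = (\<Oplus>i\<in>S. f i)"
    by (rule add.finprod_mono_neutral_cong_left) (use assms c in auto)
  then have "(\<forall>i. f i \<in> H i) \<and> finite {i. f i \<noteq> \<zero>} \<and> x = (\<Oplus>i\<in>{i. f i \<noteq> \<zero>}. f i)"
    using assms finite_subset by auto
  moreover have "\<exists>!f. (\<forall>i. f i \<in> H i) \<and> finite {i. f i \<noteq> \<zero>} \<and> x = (\<Oplus>i\<in>{i. f i \<noteq> \<zero>}. f i)"
    using assms(1) xc unfolding internal_direct_sum_def by blast
  ultimately show ?thesis unfolding decomposition_def by (rule the1_equality[rotated])
qed

lemma decomposition_sum: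
  assumes "internal_direct_sum G H" "x \<in> carrier G" "finite S"
    "{i. decomposition G H x i \<noteq> \<zero>} \<subseteq> S"
  shows "x = (\<Oplus>i\<in>S. decomposition G H x i)"
proof -
  have "(\<Oplus>i\<in>{i. decomposition G H x i \<noteq> \<zero>}. decomposition G H x i) =
      (\<Oplus>i\<in>S. decomposition G H x i)"
    by (rule add.finprod_mono_neutral_cong_left)
      (use assms(3,4) internal_direct_sum_carrier[OF assms(1) decomposition_props(1)[OF assms(1,2)]]
        in auto)
  then show ?thesis using decomposition_props(3)[OF assms(1,2)] by simp
qed

lemma decomposition_add:
  assumes "internal_direct_sum G H" "x \<in> carrier G" "y \<in> carrier G"
  shows "decomposition G H (x \<oplus> y) i = decomposition G H x i \<oplus> decomposition G H y i"
proof -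
  let ?d = "decomposition G H"
  let ?S = "{i. ?d x i \<noteq> \<zero>} \<union> {i. ?d y i \<noteq> \<zero>}"
  note p = decomposition_props[OF assms(1,2)] decomposition_props[OF assms(1,3)]
  have c: "?d x i \<in> carrier G" "?d y i \<in> carrier G" for i
    using internal_direct_sum_carrier[OF assms(1)] p(1,4) by blast+
  have fin: "finite ?S" using p(2,5) by simp
  have "?d (x \<oplus> y) = (\<lambda>i. ?d x i \<oplus> ?d y i)"
  proof (rule decomposition_eqI[OF assms(1) _ fin])
    show "?d x i \<oplus> ?d y i \<in> H i" for i using internal_direct_sum_add[OF assms(1) p(1,4)] .
    show "{i. ?d x i \<oplus> ?d y i \<noteq> \<zero>} \<subseteq> ?S" by auto
    have "x \<oplus> y = (\<Oplus>i\<in>?S. ?d x i) \<oplus> (\<Oplus>i\<in>?S. ?d y i)"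
      using decomposition_sum[OF assms(1,2) fin] decomposition_sum[OF assms(1,3) fin] by simp
    also have "\<dots> = (\<Oplus>i\<in>?S. ?d x i \<oplus> ?d y i)"
      using c by (intro finsum_addf[symmetric]) auto
    finally show "x \<oplus> y = (\<Oplus>i\<in>?S. ?d x i \<oplus> ?d y i)" .
  qed
  then show ?thesis by simp
qed

lemma decomposition_homogeneous:
  assumes "internal_direct_sum G H" "x \<in> H j"
  shows "decomposition G H x i = (if i = j then x else \<zero>)"
proof -
  have xc: "x \<in> carrier G" using internal_direct_sum_carrier[OF assms] .
  have "decomposition G H x = (\<lambda>i. if i = j then x else \<zero>)"
  proof (rule decomposition_eqI[OF assms(1), of _ "{j}"])
    show "(if i = j then x else \<zero>) \<in> H i" for i
      using assms(2) internal_direct_sum_zero[OF assms(1)] by simp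
    show "x = (\<Oplus>i\<in>{j}. if i = j then x else \<zero>)" using xc by simp
  qed (auto split: if_splits)
  then show ?thesis by simp
qed

end

text \<open>Degrees are integers here because they occur as differences \<open>t - e i\<close> with
  the degree of a basis vector. Negative ones give zero, which keeps the formula for products free
  of case distinctions.\<close>

definition component :: "('a, 'm) ring_scheme \<Rightarrow> (nat \<Rightarrow> 'a set) \<Rightarrow> int \<Rightarrow> 'a \<Rightarrow> 'a" where
  "component R G t x = (if t < 0 then \<zero>\<^bsub>R\<^esub> else decomposition R G x (nat t))"

definition int_grading :: "('a, 'm) ring_scheme \<Rightarrow> (nat \<Rightarrow> 'a set) \<Rightarrow> int \<Rightarrow> 'a set" where
  "int_grading R G t = (if t < 0 then {\<zero>\<^bsub>R\<^esub>} else G (nat t))"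

context standard_graded_ring
begin

lemma degree_carrier: "x \<in> G i \<Longrightarrow> x \<in> carrier R"
  by (rule internal_direct_sum_carrier[OF grading])

lemma degree_zero: "\<zero> \<in> G i"
  by (rule internal_direct_sum_zero[OF grading])

lemma degree_add: "x \<in> G i \<Longrightarrow> y \<in> G i \<Longrightarrow> x \<oplus> y \<in> G i"
  by (rule internal_direct_sum_add[OF grading])

lemma degree_minus: "x \<in> G i \<Longrightarrow> \<ominus> x \<in> G i"
proof -
  assume x: "x \<in> G i"
  have "additive_subgroup (G i) R" using grading unfolding internal_direct_sum_def by blast
  then show ?thesis using x additive_subgroup.a_inv_closed[of "G i" R] abelian_group_axioms by auto
qed

lemma degree_diff: "x \<in> G i \<Longrightarrow> y \<in> G i \<Longrightarrow> x \<ominus> y \<in> G i"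
  unfolding a_minus_def by (intro degree_add degree_minus)

lemma one_degree_0: "\<one> \<in> G 0"
  using subringE(3)[OF subfieldE(1)[OF degree_0_field]] .

lemma one_not_zero: "\<one> \<noteq> \<zero>"
  using subfieldE(6)[OF degree_0_field] by simp

lemma component_int_grading: "x \<in> carrier R \<Longrightarrow> component R G t x \<in> int_grading R G t"
  unfolding component_def int_grading_def using decomposition_props(1)[OF grading] by auto

lemma int_grading_carrier: "x \<in> int_grading R G t \<Longrightarrow> x \<in> carrier R"
  unfolding int_grading_def using degree_carrier by (auto split: if_splits)

lemma component_closed [simp]: "x \<in> carrier R \<Longrightarrow> component R G t x \<in> carrier R"
  by (rule int_grading_carrier[OF component_int_grading])

lemma int_grading_zero: "\<zero> \<in> int_grading R G t"
  unfolding int_grading_def using degree_zero by simp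

lemma int_grading_add:
  "x \<in> int_grading R G t \<Longrightarrow> y \<in> int_grading R G t \<Longrightarrow> x \<oplus> y \<in> int_grading R G t"
  unfolding int_grading_def using degree_add by (auto split: if_splits)

lemma int_grading_minus: "x \<in> int_grading R G t \<Longrightarrow> \<ominus> x \<in> int_grading R G t"
  unfolding int_grading_def using degree_minus by (auto split: if_splits)

lemma int_grading_mult:
  assumes "a \<in> G s" "b \<in> int_grading R G t"
  shows "a \<otimes> b \<in> int_grading R G (int s + t)"
proof (cases "t < 0")
  case True
  then have "b = \<zero>" using assms unfolding int_grading_def by simp
  then show ?thesis using degree_carrier[OF assms(1)] int_grading_zero by simp
next
  case False
  then have "a \<otimes> b \<in> G (s + nat t)" "nat (int s + t) = s + nat t"
    using assms grading_mult unfolding int_grading_def by auto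
  then show ?thesis using False unfolding int_grading_def by simp
qed

lemma int_grading_nat [simp]: "int_grading R G (int i) = G i"
  unfolding int_grading_def by simp

lemma component_neg [simp]: "t < 0 \<Longrightarrow> component R G t x = \<zero>"
  unfolding component_def by simp

lemma component_add:
  "x \<in> carrier R \<Longrightarrow> y \<in> carrier R \<Longrightarrow> component R G t (x \<oplus> y) = component R G t x \<oplus> component R G t y"
  unfolding component_def using decomposition_add[OF grading] by simp

lemma component_degree: "x \<in> G i \<Longrightarrow> component R G t x = (if t = int i then x else \<zero>)"
  unfolding component_def using decomposition_homogeneous[OF grading, of x i "nat t"] by auto

lemma component_int_degree:
  "x \<in> int_grading R G s \<Longrightarrow> component R G t x = (if t = s then x else \<zero>)"
  using component_degree[of x "nat s"] component_degree[OF degree_zero]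
  unfolding int_grading_def by (auto split: if_splits)

lemma component_zero [simp]: "component R G t \<zero> = \<zero>"
  using component_degree[OF degree_zero] by simp

lemma component_finsum:
  "finite S \<Longrightarrow> f \<in> S \<rightarrow> carrier R \<Longrightarrow> component R G t (\<Oplus>i\<in>S. f i) = (\<Oplus>i\<in>S. component R G t (f i))"
proof (induction S rule: finite_induct)
  case (insert x S)
  then have "f x \<in> carrier R" "f \<in> S \<rightarrow> carrier R" by auto
  moreover have "(\<lambda>i. component R G t (f i)) \<in> S \<rightarrow> carrier R" using insert.prems by (auto dest: funcset_mem)
  ultimately show ?case using insert by (simp add: component_add finsum_closed)
qed simp

lemma component_sum:
  assumes "x \<in> carrier R"
  shows "\<exists>S::nat set. finite S \<and> x = (\<Oplus>i\<in>S. component R G (int i) x) \<and>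
    (\<forall>i. i \<notin> S \<longrightarrow> component R G (int i) x = \<zero>)"
proof -
  note p = decomposition_props[OF grading assms]
  show ?thesis
    by (intro exI[of _ "{i. decomposition R G x i \<noteq> \<zero>}"]) (use p(2,3) in \<open>auto simp: component_def\<close>)
qed

lemma finsum_mem:
  assumes "finite S" "\<zero> \<in> N" "\<And>a b. a \<in> N \<Longrightarrow> b \<in> N \<Longrightarrow> a \<oplus> b \<in> N" "\<And>i. i \<in> S \<Longrightarrow> f i \<in> N"
    "N \<subseteq> carrier R"
  shows "(\<Oplus>i\<in>S. f i) \<in> N"
  using assms(1,4)
proof (induction S rule: finite_induct)
  case (insert x S)
  then have "f x \<in> carrier R" "f \<in> S \<rightarrow> carrier R" using assms(5) by auto
  then have "(\<Oplus>i\<in>insert x S. f i) = f x \<oplus> (\<Oplus>i\<in>S. f i)" using insert by simp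
  moreover have "f x \<in> N" "(\<Oplus>i\<in>S. f i) \<in> N" using insert by auto
  ultimately show ?case using assms(3)[of "f x" "\<Oplus>i\<in>S. f i"] by simp
qed (use assms in simp)

text \<open>Induction over homogeneous components. \<open>N\<close> has to be closed under addition
  only, so it can be the set of elements with any additive property.\<close>

lemma mem_of_components:
  assumes "x \<in> carrier R" "\<zero> \<in> N" "\<And>a b. a \<in> N \<Longrightarrow> b \<in> N \<Longrightarrow> a \<oplus> b \<in> N" "N \<subseteq> carrier R"
    "\<And>i::nat. component R G (int i) x \<in> N"
  shows "x \<in> N"
proof -
  obtain S :: "nat set" where S: "finite S" "x = (\<Oplus>i\<in>S. component R G (int i) x)"
    using component_sum[OF assms(1)] by auto
  have "(\<Oplus>i\<in>S. component R G (int i) x) \<in> N"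
    by (rule finsum_mem[OF S(1) assms(2,3) assms(5) assms(4)])
  then show ?thesis using S(2) by simp
qed

lemma component_mult:
  assumes "a \<in> G s" "b \<in> carrier R"
  shows "component R G t (a \<otimes> b) = a \<otimes> component R G (t - int s) b"
proof -
  have ac: "a \<in> carrier R" using degree_carrier assms(1) .
  obtain S :: "nat set" where S: "finite S" "b = (\<Oplus>i\<in>S. component R G (int i) b)"
    "\<And>i. i \<notin> S \<Longrightarrow> component R G (int i) b = \<zero>"
    using component_sum[OF assms(2)] by auto
  let ?f = "\<lambda>i. a \<otimes> component R G (int i) b"
  have deg: "?f i \<in> G (s + i)" for i
    using grading_mult[OF assms(1)] component_int_grading[OF assms(2), of "int i"] by simp
  have "component R G t (a \<otimes> b) = component R G t (a \<otimes> (\<Oplus>i\<in>S. component R G (int i) b))"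
    using S(2) by simp
  also have "a \<otimes> (\<Oplus>i\<in>S. component R G (int i) b) = (\<Oplus>i\<in>S. ?f i)"
    using assms(2) ac S(1) by (intro finsum_rdistr) auto
  also have "component R G t (\<Oplus>i\<in>S. ?f i) = (\<Oplus>i\<in>S. component R G t (?f i))"
    using assms(2) ac by (intro component_finsum[OF S(1)]) auto
  \<comment> \<open>The summand for i is homogeneous of degree s + i, so only i = t - s survives,
    and none does when t < s.\<close>
  also have "\<dots> = (\<Oplus>i\<in>S. if i = nat (t - int s) \<and> t \<ge> int s then ?f i else \<zero>)"
    by (intro finsum_cong') (use ac assms(2) component_degree[OF deg] in auto)
  also have "\<dots> = a \<otimes> component R G (t - int s) b"
  proof (cases "t \<ge> int s \<and> nat (t - int s) \<in> S")
    case True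
    let ?j = "nat (t - int s)"
    have "(\<Oplus>i\<in>S. if i = ?j \<and> t \<ge> int s then ?f i else \<zero>) = (\<Oplus>i\<in>S. if ?j = i then ?f i else \<zero>)"
      by (intro finsum_cong') (use True ac assms(2) in auto)
    also have "\<dots> = ?f ?j" using True ac assms(2) S(1) by (intro finsum_singleton) auto
    finally show ?thesis using True by simp
  next
    case False
    have "(\<Oplus>i\<in>S. if i = nat (t - int s) \<and> t \<ge> int s then ?f i else \<zero>) = (\<Oplus>i\<in>S. \<zero>)"
      by (intro finsum_cong') (use False in auto)
    also have "\<dots> = \<zero>" by simp
    finally have 1: "(\<Oplus>i\<in>S. if i = nat (t - int s) \<and> t \<ge> int s then ?f i else \<zero>) = \<zero>" .
    have "component R G (t - int s) b = \<zero>"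
    proof (cases "t \<ge> int s")
      case True
      then show ?thesis using S(3)[of "nat (t - int s)"] False by simp
    qed simp
    then show ?thesis using 1 ac by simp
  qed
  finally show ?thesis .
qed

lemma component_int_mult:
  assumes "a \<in> int_grading R G s" "b \<in> carrier R"
  shows "component R G t (a \<otimes> b) = a \<otimes> component R G (t - s) b"
    "component R G t (b \<otimes> a) = component R G (t - s) b \<otimes> a"
proof -
  have ac: "a \<in> carrier R" using int_grading_carrier assms(1) .
  show 1: "component R G t (a \<otimes> b) = a \<otimes> component R G (t - s) b"
  proof (cases "s < 0")
    case True
    then have "a = \<zero>" using assms unfolding int_grading_def by simp
    then show ?thesis using assms by simp
  next
    case False
    then show ?thesis using component_mult[of a "nat s" b t] assms unfolding int_grading_def by simp
  qed
  show "component R G t (b \<otimes> a) = component R G (t - s) b \<otimes> a"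
    using 1 ac assms(2) by (simp add: m_comm)
qed

end

section \<open>Free modules of finite rank\<close>

text \<open>Vectors are wrapped as singletons because \<open>graded_countable_cm_type\<close> ranges
  over modules with elements of type \<open>'a fg_elem\<close>, and the constructed modules have to
  live in that type. A singleton is the coset of its vector modulo 0. Coordinates from n on are
  padded by zero, which makes the coordinate function unique.\<close>

definition free_module :: "('a, 'm) ring_scheme \<Rightarrow> nat \<Rightarrow> ('a, 'a fg_elem) module" where
  "free_module R n =
     \<lparr>carrier = (\<lambda>v. {v}) ` {v. (\<forall>i<n. v i \<in> carrier R) \<and> (\<forall>i\<ge>n. v i = \<zero>\<^bsub>R\<^esub>)},
      monoid.mult = (\<lambda>v w. v), monoid.one = {\<lambda>i. \<zero>\<^bsub>R\<^esub>}, ring.zero = {\<lambda>i. \<zero>\<^bsub>R\<^esub>},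
      ring.add = (\<lambda>v w. {\<lambda>i. the_elem v i \<oplus>\<^bsub>R\<^esub> the_elem w i}),
      smult = (\<lambda>a v. {\<lambda>i. a \<otimes>\<^bsub>R\<^esub> the_elem v i})\<rparr>"

definition coord :: "'a fg_elem \<Rightarrow> nat \<Rightarrow> 'a" where "coord v = the_elem v"

definition vec :: "('a, 'm) ring_scheme \<Rightarrow> nat \<Rightarrow> (nat \<Rightarrow> 'a) \<Rightarrow> 'a fg_elem" where
  "vec R n f = {\<lambda>i. if i < n then f i else \<zero>\<^bsub>R\<^esub>}"

text \<open>For an ideal J this is the submodule J R^n.\<close>

definition cube :: "('a, 'm) ring_scheme \<Rightarrow> nat \<Rightarrow> 'a set \<Rightarrow> 'a fg_elem set" where
  "cube R n J = {v \<in> carrier (free_module R n). \<forall>i<n. coord v i \<in> J}"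

lemma coord_vec [simp]: "coord (vec R n f) i = (if i < n then f i else \<zero>\<^bsub>R\<^esub>)"
  unfolding coord_def vec_def by simp

lemma coord_add [simp]: "coord (v \<oplus>\<^bsub>free_module R n\<^esub> w) i = coord v i \<oplus>\<^bsub>R\<^esub> coord w i"
  unfolding coord_def free_module_def by simp

lemma coord_smult [simp]: "coord (a \<odot>\<^bsub>free_module R n\<^esub> v) i = a \<otimes>\<^bsub>R\<^esub> coord v i"
  unfolding coord_def free_module_def by simp

lemma coord_zero [simp]: "coord \<zero>\<^bsub>free_module R n\<^esub> i = \<zero>\<^bsub>R\<^esub>"
  unfolding coord_def free_module_def by simp

lemma coord_closed [simp]: "v \<in> carrier (free_module R n) \<Longrightarrow> i < n \<Longrightarrow> coord v i \<in> carrier R"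
  unfolding coord_def free_module_def by auto

lemma coord_outside: "v \<in> carrier (free_module R n) \<Longrightarrow> n \<le> i \<Longrightarrow> coord v i = \<zero>\<^bsub>R\<^esub>"
  unfolding coord_def free_module_def by auto

lemma vec_closed: "(\<And>i. i < n \<Longrightarrow> f i \<in> carrier R) \<Longrightarrow> vec R n f \<in> carrier (free_module R n)"
  unfolding vec_def free_module_def by auto

lemma coord_eqI:
  assumes "v \<in> carrier (free_module R n)" "w \<in> carrier (free_module R n)"
    "\<And>i. i < n \<Longrightarrow> coord v i = coord w i"
  shows "v = w"
proof -
  obtain f g where f: "v = {f}" "\<forall>i\<ge>n. f i = \<zero>\<^bsub>R\<^esub>" and g: "w = {g}" "\<forall>i\<ge>n. g i = \<zero>\<^bsub>R\<^esub>"
    using assms(1,2) unfolding free_module_def by auto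
  have "f i = g i" for i
    using f g assms(3)[of i] unfolding coord_def by (cases "i < n") auto
  then show ?thesis using f g by (metis ext)
qed

context cring
begin

lemma coord_closed' [simp]: "v \<in> carrier (free_module R n) \<Longrightarrow> coord v i \<in> carrier R"
  by (cases "i < n") (auto simp: coord_outside)

lemma free_module_add_closed:
  "v \<in> carrier (free_module R n) \<Longrightarrow> w \<in> carrier (free_module R n) \<Longrightarrow>
    v \<oplus>\<^bsub>free_module R n\<^esub> w \<in> carrier (free_module R n)"
  unfolding free_module_def by auto

lemma module_free_module: "module R (free_module R n)"
proof -
  let ?F = "free_module R n"
  have z: "\<zero>\<^bsub>?F\<^esub> \<in> carrier ?F" unfolding free_module_def by auto
  note ac = free_module_add_closed
  have sc: "a \<odot>\<^bsub>?F\<^esub> v \<in> carrier ?F" if "a \<in> carrier R" "v \<in> carrier ?F" for a v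
    using that unfolding free_module_def by auto
  have "abelian_group ?F"
  proof (rule abelian_groupI)
    fix x assume x: "x \<in> carrier ?F"
    let ?y = "vec R n (\<lambda>i. \<ominus> coord x i)"
    have y: "?y \<in> carrier ?F" by (rule vec_closed) (use x in simp)
    have "?y \<oplus>\<^bsub>?F\<^esub> x = \<zero>\<^bsub>?F\<^esub>"
      by (rule coord_eqI[OF ac[OF y x] z]) (use x in \<open>simp add: l_neg\<close>)
    then show "\<exists>y\<in>carrier ?F. y \<oplus>\<^bsub>?F\<^esub> x = \<zero>\<^bsub>?F\<^esub>" using y by blast
    show "\<zero>\<^bsub>?F\<^esub> \<oplus>\<^bsub>?F\<^esub> x = x"
      by (rule coord_eqI[OF ac[OF z x] x]) (use x in simp)
    fix y assume y: "y \<in> carrier ?F"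
    show "x \<oplus>\<^bsub>?F\<^esub> y \<in> carrier ?F" by (rule ac[OF x y])
    show "x \<oplus>\<^bsub>?F\<^esub> y = y \<oplus>\<^bsub>?F\<^esub> x"
      by (rule coord_eqI[OF ac[OF x y] ac[OF y x]]) (use x y in \<open>simp add: a_comm\<close>)
    fix w assume w: "w \<in> carrier ?F"
    show "x \<oplus>\<^bsub>?F\<^esub> y \<oplus>\<^bsub>?F\<^esub> w = x \<oplus>\<^bsub>?F\<^esub> (y \<oplus>\<^bsub>?F\<^esub> w)"
      by (rule coord_eqI[OF ac[OF ac[OF x y] w] ac[OF x ac[OF y w]]])
        (use x y w in \<open>simp add: a_assoc\<close>)
  qed (rule z)
  then show ?thesis
  proof (rule moduleI[OF is_cring])
    fix a v assume a: "a \<in> carrier R" and v: "v \<in> carrier ?F"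
    show "a \<odot>\<^bsub>?F\<^esub> v \<in> carrier ?F" by (rule sc[OF a v])
    { fix b assume b: "b \<in> carrier R"
      show "(a \<oplus> b) \<odot>\<^bsub>?F\<^esub> v = a \<odot>\<^bsub>?F\<^esub> v \<oplus>\<^bsub>?F\<^esub> b \<odot>\<^bsub>?F\<^esub> v"
        by (rule coord_eqI[OF sc[OF a_closed[OF a b] v] ac[OF sc[OF a v] sc[OF b v]]])
          (use a b v in \<open>simp add: l_distr\<close>)
      show "(a \<otimes> b) \<odot>\<^bsub>?F\<^esub> v = a \<odot>\<^bsub>?F\<^esub> (b \<odot>\<^bsub>?F\<^esub> v)"
        by (rule coord_eqI[OF sc[OF m_closed[OF a b] v] sc[OF a sc[OF b v]]])
          (use a b v in \<open>simp add: m_assoc\<close>) }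
    next
      fix v assume v: "v \<in> carrier ?F"
      show "\<one> \<odot>\<^bsub>?F\<^esub> v = v" by (rule coord_eqI[OF sc v]) (use v in simp_all)
    next
      fix a v assume a: "a \<in> carrier R" and v: "v \<in> carrier ?F"
    fix w assume w: "w \<in> carrier ?F"
    show "a \<odot>\<^bsub>?F\<^esub> (v \<oplus>\<^bsub>?F\<^esub> w) = a \<odot>\<^bsub>?F\<^esub> v \<oplus>\<^bsub>?F\<^esub> a \<odot>\<^bsub>?F\<^esub> w"
      by (rule coord_eqI[OF sc[OF a ac[OF v w]] ac[OF sc[OF a v] sc[OF a w]]])
        (use a v w in \<open>simp add: r_distr\<close>)
  qed
qed

lemma coord_neg [simp]:
  assumes "v \<in> carrier (free_module R n)"
  shows "coord (\<ominus>\<^bsub>free_module R n\<^esub> v) i = \<ominus> coord v i"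
proof -
  interpret F: module R "free_module R n" by (rule module_free_module)
  have "\<ominus>\<^bsub>free_module R n\<^esub> v = (\<ominus> \<one>) \<odot>\<^bsub>free_module R n\<^esub> v"
    using assms by (simp add: F.smult_l_minus)
  then show ?thesis using assms by (simp add: l_minus)
qed

lemma coord_minus [simp]:
  assumes "v \<in> carrier (free_module R n)" "w \<in> carrier (free_module R n)"
  shows "coord (v \<ominus>\<^bsub>free_module R n\<^esub> w) i = coord v i \<ominus> coord w i"
  using assms by (simp add: a_minus_def[of "free_module R n"] a_minus_def)

lemma coord_finsum:
  assumes "finite S" "f \<in> S \<rightarrow> carrier (free_module R n)"
  shows "coord (\<Oplus>\<^bsub>free_module R n\<^esub>k\<in>S. f k) i = (\<Oplus>k\<in>S. coord (f k) i)"
  using assms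
proof (induction S rule: finite_induct)
  case empty
  interpret F: module R "free_module R n" by (rule module_free_module)
  show ?case by simp
next
  case (insert x S)
  interpret F: module R "free_module R n" by (rule module_free_module)
  have f: "f x \<in> carrier (free_module R n)" "f \<in> S \<rightarrow> carrier (free_module R n)"
    using insert.prems by auto
  have "(\<lambda>k. coord (f k) i) \<in> S \<rightarrow> carrier R" using f(2) by (auto dest: funcset_mem)
  then show ?case using insert f by simp
qed

lemma module_self_module: "module R (self_module R)"
proof (rule moduleI[OF is_cring])
  show "abelian_group (self_module R)"
    by (rule abelian_groupI)
      (use l_neg a_inv_closed in \<open>auto simp: self_module_def a_ac\<close>)
qed (auto simp: self_module_def l_distr r_distr m_assoc)

lemma self_module_simps [simp]:
  "carrier (self_module R) = carrier R" "a \<oplus>\<^bsub>self_module R\<^esub> b = a \<oplus> b"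
  "a \<odot>\<^bsub>self_module R\<^esub> b = a \<otimes> b" "\<zero>\<^bsub>self_module R\<^esub> = \<zero>"
  by (simp_all add: self_module_def)

lemma self_module_neg [simp]: "\<ominus>\<^bsub>self_module R\<^esub> a = \<ominus> a"
  by (simp add: self_module_def a_inv_def m_inv_def)

text \<open>Ideals are handled as submodules of the ring, so everything proved about
  \<open>add_mult\<close> and \<open>weakly_regular\<close> applies to them.\<close>

lemma submodule_self_iff: "submodule J R (self_module R) \<longleftrightarrow> ideal J R"
proof
  interpret S: module R "self_module R" by (rule module_self_module)
  assume J: "submodule J R (self_module R)"
  show "ideal J R"
  proof (rule idealI)
    show "subgroup J (add_monoid R)"
      using submodule.axioms(1)[OF J] by (simp add: self_module_def subgroup_def m_inv_def)
    show "x \<otimes> a \<in> J" "a \<otimes> x \<in> J" if "a \<in> J" "x \<in> carrier R" for a x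
      using S.submodule_smult[OF J that(2,1)] S.submodule_carrier[OF J that(1)] that(2)
      by (simp_all add: m_comm)
  qed (rule ring_axioms)
next
  interpret S: module R "self_module R" by (rule module_self_module)
  assume J: "ideal J R"
  interpret J: ideal J R by fact
  show "submodule J R (self_module R)"
    by (rule S.submoduleI) (use J.a_subset J.zero_closed J.a_closed J.I_l_closed in auto)
qed

lemma submodule_cube:
  assumes "ideal J R"
  shows "submodule (cube R n J) R (free_module R n)"
proof -
  interpret F: module R "free_module R n" by (rule module_free_module)
  interpret J: ideal J R by fact
  show ?thesis
  proof (rule F.submoduleI)
    show "cube R n J \<subseteq> carrier (free_module R n)" unfolding cube_def by blast
  qed (auto simp: cube_def J.I_l_closed)
qed

lemma cube_mono: "I \<subseteq> J \<Longrightarrow> cube R n I \<subseteq> cube R n J"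
  unfolding cube_def by auto

lemma cube_carrier: "cube R n (carrier R) = carrier (free_module R n)"
  unfolding cube_def by auto

lemma cube_zero: "cube R n {\<zero>} = {\<zero>\<^bsub>free_module R n\<^esub>}"
proof -
  interpret F: module R "free_module R n" by (rule module_free_module)
  have "v = \<zero>\<^bsub>free_module R n\<^esub>" if "v \<in> cube R n {\<zero>}" for v
    by (rule coord_eqI[of _ R n]) (use that in \<open>auto simp: cube_def\<close>)
  moreover have "\<zero>\<^bsub>free_module R n\<^esub> \<in> cube R n {\<zero>}" unfolding cube_def by simp
  ultimately show ?thesis by blast
qed

text \<open>Coordinates can be treated independently, which reduces regularity on R^n modulo J R^n
  to regularity on R/J.\<close>

lemma add_mult_cube:
  assumes "x \<in> carrier R" "ideal J R" "ideal I R"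
  shows "add_mult (free_module R n) x (cube R n I) (cube R n J) =
    cube R n (add_mult (self_module R) x I J)"
proof (intro equalityI subsetI)
  interpret F: module R "free_module R n" by (rule module_free_module)
  note IR = additive_subgroup.a_subset[OF ideal.axioms(1)]
  { fix v assume "v \<in> add_mult (free_module R n) x (cube R n I) (cube R n J)"
    then obtain a c where a: "a \<in> cube R n J" "c \<in> cube R n I"
      "v = a \<oplus>\<^bsub>free_module R n\<^esub> x \<odot>\<^bsub>free_module R n\<^esub> c" unfolding add_mult_def by blast
    have "v \<in> carrier (free_module R n)" using a assms(1) unfolding cube_def by simp
    moreover have "coord v i \<in> add_mult (self_module R) x I J" if "i < n" for i
      using a that unfolding cube_def by (intro add_mult_memI[of _ _ "coord a i" _ "coord c i"]) auto
    ultimately show "v \<in> cube R n (add_mult (self_module R) x I J)" unfolding cube_def by blast }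
  fix v assume v: "v \<in> cube R n (add_mult (self_module R) x I J)"
  then have "\<forall>i<n. \<exists>p. fst p \<in> J \<and> snd p \<in> I \<and> coord v i = fst p \<oplus> x \<otimes> snd p"
    unfolding cube_def add_mult_def by auto
  then obtain p where p: "\<And>i. i < n \<Longrightarrow> fst (p i) \<in> J \<and> snd (p i) \<in> I \<and>
      coord v i = fst (p i) \<oplus> x \<otimes> snd (p i)" by metis
  let ?a = "vec R n (\<lambda>i. fst (p i))" and ?c = "vec R n (\<lambda>i. snd (p i))"
  have "?a \<in> carrier (free_module R n)" by (rule vec_closed) (use p IR[OF assms(2)] in blast)
  then have a: "?a \<in> cube R n J" unfolding cube_def using p by simp
  have cc: "?c \<in> carrier (free_module R n)" by (rule vec_closed) (use p IR[OF assms(3)] in blast)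
  then have c: "?c \<in> cube R n I" unfolding cube_def using p by simp
  have "v = ?a \<oplus>\<^bsub>free_module R n\<^esub> x \<odot>\<^bsub>free_module R n\<^esub> ?c"
    by (rule coord_eqI[of _ R n]) (use v p cc a assms(1) in \<open>auto simp: cube_def\<close>)
  then show "v \<in> add_mult (free_module R n) x (cube R n I) (cube R n J)"
    using a c by (rule add_mult_memI)
qed

lemma ideal_add_mult:
  assumes "x \<in> carrier R" "ideal J R" "ideal I R"
  shows "ideal (add_mult (self_module R) x I J) R"
  using module.submodule_add_mult[OF module_self_module assms(1)] assms(2,3)
  unfolding submodule_self_iff by blast

lemma ideal_add_mults:
  assumes "set xs \<subseteq> carrier R" "ideal J R" "ideal I R"
  shows "ideal (add_mults (self_module R) xs I J) R"
  using module.submodule_add_mults[OF module_self_module assms(1)] assms(2,3)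
  unfolding submodule_self_iff by blast

lemma regular_on_cube:
  assumes "x \<in> carrier R" "regular_on (self_module R) x I J"
  shows "regular_on (free_module R n) x (cube R n I) (cube R n J)"
  using assms unfolding regular_on_def cube_def by auto

lemma weakly_regular_cube:
  assumes "set xs \<subseteq> carrier R" "ideal J R" "ideal I R" "weakly_regular (self_module R) xs I J"
  shows "weakly_regular (free_module R n) xs (cube R n I) (cube R n J)"
  using assms
  by (induction xs arbitrary: J) (simp_all add: add_mult_cube ideal_add_mult regular_on_cube)

section \<open>Noetherian property of finite free modules\<close>

lemma coord_image_ideal:
  assumes "submodule U R (free_module R n)"
  shows "ideal ((\<lambda>v. coord v i) ` U) R"
proof -
  interpret F: module R "free_module R n" by (rule module_free_module)
  interpret S: module R "self_module R" by (rule module_self_module)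
  note UF = F.submodule_carrier[OF assms]
  have "submodule ((\<lambda>v. coord v i) ` U) R (self_module R)"
  proof (rule S.submoduleI)
    show "\<zero>\<^bsub>self_module R\<^esub> \<in> (\<lambda>v. coord v i) ` U"
      using F.submodule_zero[OF assms] by (intro image_eqI[of _ _ "\<zero>\<^bsub>free_module R n\<^esub>"]) auto
    show "\<ominus>\<^bsub>self_module R\<^esub> a \<in> (\<lambda>v. coord v i) ` U" if a: "a \<in> (\<lambda>v. coord v i) ` U" for a
    proof -
      obtain v where v: "v \<in> U" "a = coord v i" using a by blast
      then show ?thesis
        using F.submodule_neg[OF assms v(1)] UF[OF v(1)]
        by (intro image_eqI[of _ _ "\<ominus>\<^bsub>free_module R n\<^esub> v"]) auto
    qed
    show "a \<oplus>\<^bsub>self_module R\<^esub> b \<in> (\<lambda>v. coord v i) ` U"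
      if ab: "a \<in> (\<lambda>v. coord v i) ` U" "b \<in> (\<lambda>v. coord v i) ` U" for a b
    proof -
      obtain v w where v: "v \<in> U" "a = coord v i" "w \<in> U" "b = coord w i" using ab by blast
      then show ?thesis
        using F.submodule_add[OF assms v(1,3)]
        by (intro image_eqI[of _ _ "v \<oplus>\<^bsub>free_module R n\<^esub> w"]) auto
    qed
    show "r \<odot>\<^bsub>self_module R\<^esub> a \<in> (\<lambda>v. coord v i) ` U"
      if ra: "r \<in> carrier R" "a \<in> (\<lambda>v. coord v i) ` U" for r a
    proof -
      obtain v where v: "v \<in> U" "a = coord v i" using ra by blast
      then show ?thesis
        using F.submodule_smult[OF assms ra(1) v(1)]
        by (intro image_eqI[of _ _ "r \<odot>\<^bsub>free_module R n\<^esub> v"]) auto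
    qed
  qed (use coord_closed'[OF UF] in auto)
  then show ?thesis unfolding submodule_self_iff .
qed

text \<open>Padding by zeros makes R^n literally a subset of R^(n+1), the kernel of the last
  coordinate, so the induction on the rank needs no embedding.\<close>

lemma free_module_Suc:
  "v \<in> carrier (free_module R n) \<longleftrightarrow> v \<in> carrier (free_module R (Suc n)) \<and> coord v n = \<zero>"
  unfolding free_module_def coord_def using le_Suc_eq less_Suc_eq
  by (auto simp: image_iff) (metis Suc_leI le_neq_implies_less)

lemma free_module_ops:
  "(\<oplus>\<^bsub>free_module R n\<^esub>) = (\<oplus>\<^bsub>free_module R m\<^esub>)" "(\<odot>\<^bsub>free_module R n\<^esub>) = (\<odot>\<^bsub>free_module R m\<^esub>)"
  "\<zero>\<^bsub>free_module R n\<^esub> = \<zero>\<^bsub>free_module R m\<^esub>"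
  unfolding free_module_def by auto

lemma submodule_kernel_coord:
  assumes U: "submodule U R (free_module R (Suc n))"
  shows "submodule {v \<in> U. coord v n = \<zero>} R (free_module R n)"
proof -
  interpret F: module R "free_module R (Suc n)" by (rule module_free_module)
  interpret F': module R "free_module R n" by (rule module_free_module)
  note UF = F.submodule_carrier[OF U]
  show ?thesis
  proof (rule F'.submoduleI)
    show sub: "{v \<in> U. coord v n = \<zero>} \<subseteq> carrier (free_module R n)"
      using UF free_module_Suc by blast
    show "\<zero>\<^bsub>free_module R n\<^esub> \<in> {v \<in> U. coord v n = \<zero>}"
      using F.submodule_zero[OF U] free_module_ops(3)[of n "Suc n"] by auto
    show "a \<oplus>\<^bsub>free_module R n\<^esub> b \<in> {v \<in> U. coord v n = \<zero>}"
      if "a \<in> {v \<in> U. coord v n = \<zero>}" "b \<in> {v \<in> U. coord v n = \<zero>}" for a b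
      using F.submodule_add[OF U, of a b] that free_module_ops(1)[of n "Suc n"] by auto
    show *: "r \<odot>\<^bsub>free_module R n\<^esub> b \<in> {v \<in> U. coord v n = \<zero>}"
      if "r \<in> carrier R" "b \<in> {v \<in> U. coord v n = \<zero>}" for r b
      using F.submodule_smult[OF U, of r b] that free_module_ops(2)[of n "Suc n"] by auto
    show "\<ominus>\<^bsub>free_module R n\<^esub> b \<in> {v \<in> U. coord v n = \<zero>}" if b: "b \<in> {v \<in> U. coord v n = \<zero>}" for b
    proof -
      have "\<ominus>\<^bsub>free_module R n\<^esub> b = (\<ominus> \<one>) \<odot>\<^bsub>free_module R n\<^esub> b"
        using b sub by (subst F'.smult_l_minus) auto
      then show ?thesis using *[of "\<ominus> \<one>" b] b by simp
    qed
  qed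
qed

lemma submodule_eq_of_coord:
  assumes U: "submodule U R (free_module R (Suc n))" and V: "submodule V R (free_module R (Suc n))"
    and "U \<subseteq> V" "(\<lambda>v. coord v n) ` V = (\<lambda>v. coord v n) ` U"
    "{v \<in> V. coord v n = \<zero>} = {v \<in> U. coord v n = \<zero>}"
  shows "V = U"
proof -
  interpret F: module R "free_module R (Suc n)" by (rule module_free_module)
  have "v \<in> U" if v: "v \<in> V" for v
  proof -
    obtain u where u: "u \<in> U" "coord v n = coord u n" using assms(4) v by (metis imageE imageI)
    have c: "u \<in> carrier (free_module R (Suc n))" "v \<in> carrier (free_module R (Suc n))"
      using F.submodule_carrier[OF U u(1)] F.submodule_carrier[OF V v] by auto
    have "v \<ominus>\<^bsub>free_module R (Suc n)\<^esub> u \<in> V"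
      using F.submodule_minus[OF V v] u(1) assms(3) by blast
    moreover have "coord (v \<ominus>\<^bsub>free_module R (Suc n)\<^esub> u) n = \<zero>" using c u by simp
    ultimately have "v \<ominus>\<^bsub>free_module R (Suc n)\<^esub> u \<in> U" using assms(5) by blast
    then show ?thesis using F.submodule_diff_iff[OF U u(1) c(2)] by simp
  qed
  then show ?thesis using assms(3) by blast
qed

end

lemma (in noetherian_ring) noetherian_self_module:
  assumes "cring R"
  shows "noetherian_module R (self_module R)"
  unfolding noetherian_module_def cring.submodule_self_iff[OF assms]
proof (intro allI impI)
  fix F assume F: "F \<noteq> {} \<and> (\<forall>N\<in>F. ideal N R)"
  obtain N where "N \<in> F" "\<And>N'. N' \<in> F \<Longrightarrow> N \<subseteq> N' \<Longrightarrow> N' = N"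
    by (rule ideal_family_maximal[of F]) (use F in auto)
  then show "\<exists>N\<in>F. \<forall>N'\<in>F. N \<subseteq> N' \<longrightarrow> N' = N" by blast
qed

text \<open>A submodule of R^(n+1) is controlled by its ideal of last coordinates and its kernel in
  R^n. In a family one makes the ideal maximal, and among the members with that ideal the kernel; by
  \<open>submodule_eq_of_coord\<close> such a member is maximal.\<close>

lemma noetherian_free_module:
  assumes "cring R" "noetherian_ring R"
  shows "noetherian_module R (free_module R n)"
proof -
  interpret cring R by fact
  interpret N: noetherian_ring R by fact
  show ?thesis
  proof (induction n)
    case 0
    interpret F: module R "free_module R 0" by (rule module_free_module)
    have "v = \<zero>\<^bsub>free_module R 0\<^esub>" if "v \<in> carrier (free_module R 0)" for v
      by (rule coord_eqI[OF that F.zero_closed]) simp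
    then have "carrier (free_module R 0) = {\<zero>\<^bsub>free_module R 0\<^esub>}" using F.zero_closed by blast
    then have "N = {\<zero>\<^bsub>free_module R 0\<^esub>}" if "submodule N R (free_module R 0)" for N
      using F.submoduleE(1)[OF that] F.submodule_zero[OF that] by blast
    then show ?case unfolding noetherian_module_def by blast
  next
    case (Suc n)
    show ?case unfolding noetherian_module_def
    proof (intro allI impI)
      fix F assume F: "F \<noteq> {} \<and> (\<forall>N\<in>F. submodule N R (free_module R (Suc n)))"
      define J where "J U = (\<lambda>v. coord v n) ` U" for U :: "'a fg_elem set"
      define K where "K U = {v \<in> U. coord v n = \<zero>\<^bsub>R\<^esub>}" for U :: "'a fg_elem set"
      have "J ` F \<noteq> {}" using F by simp
      then obtain I where I: "I \<in> J ` F" "\<And>I'. I' \<in> J ` F \<Longrightarrow> I \<subseteq> I' \<Longrightarrow> I' = I"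
        by (rule N.ideal_family_maximal) (use F coord_image_ideal in \<open>auto simp: J_def\<close>)
      have "K ` {U \<in> F. J U = I} \<noteq> {}" using I(1) by blast
      then obtain L where L: "L \<in> K ` {U \<in> F. J U = I}"
        "\<And>L'. L' \<in> K ` {U \<in> F. J U = I} \<Longrightarrow> L \<subseteq> L' \<Longrightarrow> L' = L"
        by (rule noetherian_moduleD[OF Suc.IH])
          (use F submodule_kernel_coord in \<open>auto simp: K_def\<close>)
      obtain U where U: "U \<in> F" "J U = I" "L = K U" using L(1) by blast
      have "V = U" if V: "V \<in> F" "U \<subseteq> V" for V
      proof (rule submodule_eq_of_coord[OF _ _ V(2)])
        have JV: "J V = I" using I(2)[of "J V"] V U unfolding J_def by blast
        then show "(\<lambda>v. coord v n) ` V = (\<lambda>v. coord v n) ` U" using U unfolding J_def by simp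
        have "K V = L" using L(2)[of "K V"] V U JV unfolding K_def by blast
        then show "{v \<in> V. coord v n = \<zero>\<^bsub>R\<^esub>} = {v \<in> U. coord v n = \<zero>\<^bsub>R\<^esub>}" using U unfolding K_def by simp
      qed (use F U V in auto)
      then show "\<exists>N\<in>F. \<forall>N'\<in>F. N \<subseteq> N' \<longrightarrow> N' = N" using U by blast
    qed
  qed
qed

lemma noetherian_submodule:
  assumes "module R M" "noetherian_module R M" "submodule N R M"
  shows "noetherian_module R (M\<lparr>carrier := N\<rparr>)"
proof -
  interpret module R M by fact
  have "submodule L R M" if L: "submodule L R (M\<lparr>carrier := N\<rparr>)" for L
  proof -
    interpret N: module R "M\<lparr>carrier := N\<rparr>"
      by (rule submodule.submodule_is_module[OF assms(3,1)])
    have "module R (M\<lparr>carrier := N\<rparr>\<lparr>carrier := L\<rparr>)"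
      by (rule submodule.submodule_is_module[OF L N.module_axioms])
    then show ?thesis
      using module_incl_imp_submodule[of L] N.submoduleE(1)[OF L] submoduleE(1)[OF assms(3)] by auto
  qed
  then have "\<And>F. \<forall>L\<in>F. submodule L R (M\<lparr>carrier := N\<rparr>) \<Longrightarrow> \<forall>L\<in>F. submodule L R M" by simp
  then show ?thesis using assms(2) unfolding noetherian_module_def by meson
qed

section \<open>Graded submodules of the direct sum of the shifted modules R(-e i)\<close>

definition free_grading ::
    "('a, 'm) ring_scheme \<Rightarrow> (nat \<Rightarrow> 'a set) \<Rightarrow> nat \<Rightarrow> (nat \<Rightarrow> int) \<Rightarrow> int \<Rightarrow> 'a fg_elem set" where
  "free_grading R G n e t =
     {v \<in> carrier (free_module R n). \<forall>i<n. coord v i \<in> int_grading R G (t - e i)}"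

definition free_component ::
    "('a, 'm) ring_scheme \<Rightarrow> (nat \<Rightarrow> 'a set) \<Rightarrow> nat \<Rightarrow> (nat \<Rightarrow> int) \<Rightarrow> int \<Rightarrow> 'a fg_elem \<Rightarrow> 'a fg_elem" where
  "free_component R G n e t v = vec R n (\<lambda>i. component R G (t - e i) (coord v i))"

text \<open>Closure under components is the working form of gradedness. Its agreement with an
  internal direct sum of homogeneous parts is proved in
  \<open>internal_direct_sum_graded_submodule\<close> and
  \<open>graded_submodule_of_internal_direct_sum\<close>.\<close>

definition graded_submodule ::
    "('a, 'm) ring_scheme \<Rightarrow> (nat \<Rightarrow> 'a set) \<Rightarrow> nat \<Rightarrow> (nat \<Rightarrow> int) \<Rightarrow> 'a fg_elem set \<Rightarrow> bool" where
  "graded_submodule R G n e U \<longleftrightarrow> submodule U R (free_module R n) \<and>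
     (\<forall>v\<in>U. \<forall>t. free_component R G n e t v \<in> U)"

definition graded_ideal :: "('a, 'm) ring_scheme \<Rightarrow> (nat \<Rightarrow> 'a set) \<Rightarrow> 'a set \<Rightarrow> bool" where
  "graded_ideal R G J \<longleftrightarrow> ideal J R \<and> (\<forall>a\<in>J. \<forall>t. component R G t a \<in> J)"

lemma noetherian_module_maximal:
  assumes "noetherian_module R M" "F \<noteq> {}" "\<And>N. N \<in> F \<Longrightarrow> submodule N R M"
  shows "\<exists>N\<in>F. \<forall>N'\<in>F. N \<subseteq> N' \<longrightarrow> N' = N"
  using assms unfolding noetherian_module_def by simp

context module
begin

lemma submodule_finsum:
  assumes "submodule N R M" "finite S" "\<And>i. i \<in> S \<Longrightarrow> f i \<in> N"
  shows "(\<Oplus>\<^bsub>M\<^esub>i\<in>S. f i) \<in> N"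
  using assms(2,3)
proof (induction S rule: finite_induct)
  case (insert x S)
  then have f: "f \<in> S \<rightarrow> carrier M" "f x \<in> carrier M" using submodule_carrier[OF assms(1)] by auto
  have "(\<Oplus>\<^bsub>M\<^esub>i\<in>insert x S. f i) = f x \<oplus>\<^bsub>M\<^esub> (\<Oplus>\<^bsub>M\<^esub>i\<in>S. f i)" using insert.hyps f by simp
  then show ?case using submodule_add[OF assms(1), of "f x" "\<Oplus>\<^bsub>M\<^esub>i\<in>S. f i"] insert by simp
qed (use submodule_zero[OF assms(1)] in simp)

end

context standard_graded_ring
begin

lemma free_component_closed:
  "v \<in> carrier (free_module R n) \<Longrightarrow> free_component R G n e t v \<in> carrier (free_module R n)"
  unfolding free_component_def by (rule vec_closed) simp

lemma coord_free_component [simp]: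
  "coord (free_component R G n e t v) i = (if i < n then component R G (t - e i) (coord v i) else \<zero>)"
  unfolding free_component_def by simp

lemma free_grading_carrier: "v \<in> free_grading R G n e t \<Longrightarrow> v \<in> carrier (free_module R n)"
  unfolding free_grading_def by blast

lemma free_component_grading:
  "v \<in> carrier (free_module R n) \<Longrightarrow> free_component R G n e t v \<in> free_grading R G n e t"
  unfolding free_grading_def using free_component_closed by (auto intro: component_int_grading)

lemma free_component_add:
  assumes "v \<in> carrier (free_module R n)" "w \<in> carrier (free_module R n)"
  shows "free_component R G n e t (v \<oplus>\<^bsub>free_module R n\<^esub> w) =
    free_component R G n e t v \<oplus>\<^bsub>free_module R n\<^esub> free_component R G n e t w"
  by (rule coord_eqI[of _ R n])
    (use assms in \<open>auto simp: component_add intro!: free_component_closed free_module_add_closed\<close>)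

lemma free_component_of_grading:
  assumes "v \<in> free_grading R G n e s"
  shows "free_component R G n e t v = (if t = s then v else \<zero>\<^bsub>free_module R n\<^esub>)"
proof -
  interpret F: module R "free_module R n" by (rule module_free_module)
  have v: "v \<in> carrier (free_module R n)" by (rule free_grading_carrier[OF assms])
  show ?thesis
  proof (rule coord_eqI[OF free_component_closed[OF v]])
    show "(if t = s then v else \<zero>\<^bsub>free_module R n\<^esub>) \<in> carrier (free_module R n)" using v by simp
    show "coord (free_component R G n e t v) i = coord (if t = s then v else \<zero>\<^bsub>free_module R n\<^esub>) i"
      if "i < n" for i
      using component_int_degree[of "coord v i" "s - e i" "t - e i"] assms that
      unfolding free_grading_def by auto
  qed
qed

lemma free_component_smult_grading:
  assumes "r \<in> carrier R" "v \<in> free_grading R G n e s"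
  shows "free_component R G n e t (r \<odot>\<^bsub>free_module R n\<^esub> v) =
    component R G (t - s) r \<odot>\<^bsub>free_module R n\<^esub> v"
proof -
  interpret F: module R "free_module R n" by (rule module_free_module)
  have v: "v \<in> carrier (free_module R n)" by (rule free_grading_carrier[OF assms(2)])
  show ?thesis
  proof (rule coord_eqI[OF free_component_closed])
    show "coord (free_component R G n e t (r \<odot>\<^bsub>free_module R n\<^esub> v)) i =
        coord (component R G (t - s) r \<odot>\<^bsub>free_module R n\<^esub> v) i" if "i < n" for i
      using component_int_mult(2)[of "coord v i" "s - e i" r "t - e i"] assms that
      unfolding free_grading_def by auto
  qed (use assms v in auto)
qed

lemma free_component_smult:
  assumes "a \<in> G s" "v \<in> carrier (free_module R n)"
  shows "free_component R G n e t (a \<odot>\<^bsub>free_module R n\<^esub> v) =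
    a \<odot>\<^bsub>free_module R n\<^esub> free_component R G n e (t - int s) v"
proof -
  interpret F: module R "free_module R n" by (rule module_free_module)
  have a: "a \<in> carrier R" using degree_carrier assms(1) .
  show ?thesis
  proof (rule coord_eqI[OF free_component_closed])
    show "coord (free_component R G n e t (a \<odot>\<^bsub>free_module R n\<^esub> v)) i =
        coord (a \<odot>\<^bsub>free_module R n\<^esub> free_component R G n e (t - int s) v) i" if "i < n" for i
      using component_mult[OF assms(1), of "coord v i" "t - e i"] assms(2) that
      by (simp add: algebra_simps)
  qed (use assms a free_component_closed in auto)
qed

lemma free_component_zero [simp]:
  "free_component R G n e t \<zero>\<^bsub>free_module R n\<^esub> = \<zero>\<^bsub>free_module R n\<^esub>"
proof -
  interpret F: module R "free_module R n" by (rule module_free_module)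
  show ?thesis by (rule coord_eqI[OF free_component_closed]) auto
qed

lemma free_component_finsum:
  assumes "finite S" "\<And>k. k \<in> S \<Longrightarrow> f k \<in> carrier (free_module R n)"
  shows "free_component R G n e t (\<Oplus>\<^bsub>free_module R n\<^esub>k\<in>S. f k) =
    (\<Oplus>\<^bsub>free_module R n\<^esub>k\<in>S. free_component R G n e t (f k))"
  using assms
proof (induction S rule: finite_induct)
  case empty
  interpret F: module R "free_module R n" by (rule module_free_module)
  show ?case by simp
next
  case (insert x S)
  interpret F: module R "free_module R n" by (rule module_free_module)
  have f: "f x \<in> carrier (free_module R n)" "f \<in> S \<rightarrow> carrier (free_module R n)"
    "(\<lambda>k. free_component R G n e t (f k)) \<in> S \<rightarrow> carrier (free_module R n)"
    using insert.prems free_component_closed by auto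
  then show ?case
    using insert free_component_closed[OF f(1)] by (simp add: free_component_add F.finsum_closed)
qed

lemma free_component_sum:
  assumes v: "v \<in> carrier (free_module R n)"
  shows "\<exists>T. finite T \<and> v = (\<Oplus>\<^bsub>free_module R n\<^esub>t\<in>T. free_component R G n e t v)"
proof -
  interpret F: module R "free_module R n" by (rule module_free_module)
  have "\<forall>i. \<exists>S::nat set. finite S \<and> coord v i = (\<Oplus>j\<in>S. component R G (int j) (coord v i)) \<and>
      (\<forall>j. j \<notin> S \<longrightarrow> component R G (int j) (coord v i) = \<zero>)"
    using component_sum v by simp
  then obtain S :: "nat \<Rightarrow> nat set" where S: "\<And>i. finite (S i)"
    "\<And>i. coord v i = (\<Oplus>j\<in>S i. component R G (int j) (coord v i))"
    "\<And>i j. j \<notin> S i \<Longrightarrow> component R G (int j) (coord v i) = \<zero>" by metis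
  \<comment> \<open>A component of degree j in coordinate i belongs to degree \<open>j + e i\<close>
    of the free module; T collects these degrees over all coordinates.\<close>
  define T where "T = (\<Union>i<n. (\<lambda>j. int j + e i) ` S i)"
  have T: "finite T" unfolding T_def using S(1) by blast
  have c: "(\<lambda>t. free_component R G n e t v) \<in> T \<rightarrow> carrier (free_module R n)"
    using free_component_closed[OF v] by blast
  have "v = (\<Oplus>\<^bsub>free_module R n\<^esub>t\<in>T. free_component R G n e t v)"
  proof (rule coord_eqI[OF v F.finsum_closed[OF c]])
    fix i assume i: "i < n"
    have cv: "coord v i \<in> carrier R" using v by simp
    have "coord (\<Oplus>\<^bsub>free_module R n\<^esub>t\<in>T. free_component R G n e t v) i =
        (\<Oplus>t\<in>T. coord (free_component R G n e t v) i)"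
      by (rule coord_finsum[OF T c])
    also have "\<dots> = (\<Oplus>t\<in>T. component R G (t - e i) (coord v i))"
      using i cv by (intro finsum_cong') auto
    also have "\<dots> = (\<Oplus>t\<in>(\<lambda>j. int j + e i) ` S i. component R G (t - e i) (coord v i))"
    proof (rule add.finprod_mono_neutral_cong_right[OF T])
      show "(\<lambda>j. int j + e i) ` S i \<subseteq> T" unfolding T_def using i by blast
      show "component R G (t - e i) (coord v i) = \<zero>" if "t \<in> T - (\<lambda>j. int j + e i) ` S i" for t
      proof (cases "t - e i < 0")
        case False
        have "nat (t - e i) \<notin> S i"
        proof
          assume "nat (t - e i) \<in> S i"
          then have "int (nat (t - e i)) + e i \<in> (\<lambda>j. int j + e i) ` S i" by (rule imageI)
          then show False using that False by simp
        qed
        then show ?thesis using S(3)[of "nat (t - e i)" i] False by simp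
      qed simp
    qed (use cv in auto)
    also have "\<dots> = (\<Oplus>j\<in>S i. component R G (int j) (coord v i))"
    proof -
      have "(\<Oplus>t\<in>(\<lambda>j. int j + e i) ` S i. component R G (t - e i) (coord v i)) =
          (\<Oplus>j\<in>S i. component R G ((int j + e i) - e i) (coord v i))"
        by (rule finsum_reindex) (use cv in \<open>auto simp: inj_on_def\<close>)
      then show ?thesis by simp
    qed
    finally show "coord v i = coord (\<Oplus>\<^bsub>free_module R n\<^esub>t\<in>T. free_component R G n e t v) i"
      using S(2)[of i] by simp
  qed
  then show ?thesis using T by blast
qed

lemma mem_of_free_components:
  assumes "submodule N R (free_module R n)" "v \<in> carrier (free_module R n)"
    "\<And>t. free_component R G n e t v \<in> N"
  shows "v \<in> N"
proof -
  interpret F: module R "free_module R n" by (rule module_free_module)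
  obtain T where T: "finite T" "v = (\<Oplus>\<^bsub>free_module R n\<^esub>t\<in>T. free_component R G n e t v)"
    using free_component_sum[OF assms(2)] by blast
  have "(\<Oplus>\<^bsub>free_module R n\<^esub>t\<in>T. free_component R G n e t v) \<in> N"
    by (rule F.submodule_finsum[OF assms(1) T(1) assms(3)])
  then show ?thesis using T(2) by simp
qed

text \<open>Among the spans of finite sets of homogeneous elements of U a maximal one contains every
  homogeneous element of U, since adjoining it cannot enlarge the span; so it contains U.\<close>

lemma homogeneous_generators:
  assumes "graded_submodule R G n e U"
  shows "\<exists>S. finite S \<and> S \<subseteq> (\<Union>t. U \<inter> free_grading R G n e t) \<and>
    U \<subseteq> submodule_span R (free_module R n) S"
proof -
  let ?F = "free_module R n"
  interpret F: module R ?F by (rule module_free_module)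
  have U: "submodule U R ?F" and Uc: "\<And>v t. v \<in> U \<Longrightarrow> free_component R G n e t v \<in> U"
    using assms unfolding graded_submodule_def by auto
  let ?H = "\<Union>t. U \<inter> free_grading R G n e t"
  have HF: "?H \<subseteq> carrier ?F" using F.submodule_carrier[OF U] by blast
  let ?Fam = "{submodule_span R ?F S | S. finite S \<and> S \<subseteq> ?H}"
  have sub: "submodule N R ?F" if N: "N \<in> ?Fam" for N
  proof -
    obtain S where S: "S \<subseteq> ?H" "N = submodule_span R ?F S" using N by auto
    show ?thesis unfolding S(2) by (rule F.submodule_submodule_span[OF order_trans[OF S(1) HF]])
  qed
  have "\<exists>N\<in>?Fam. \<forall>N'\<in>?Fam. N \<subseteq> N' \<longrightarrow> N' = N"
    by (rule noetherian_module_maximal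
        [OF noetherian_free_module[OF is_cring noetherian_ring_axioms] _ sub]) auto
  then obtain N where N: "N \<in> ?Fam" "\<forall>N'\<in>?Fam. N \<subseteq> N' \<longrightarrow> N' = N" by (rule bexE)
  obtain S where S: "finite S" "S \<subseteq> ?H" "N = submodule_span R ?F S" using N(1) by blast
  have hom: "h \<in> N" if h: "h \<in> ?H" for h
  proof -
    have "submodule_span R ?F (insert h S) = N"
    proof (rule mp[OF bspec[OF N(2)]])
      show "submodule_span R ?F (insert h S) \<in> ?Fam" using S(1,2) h by blast
      show "N \<subseteq> submodule_span R ?F (insert h S)"
        unfolding S(3) submodule_span_def by blast
    qed
    then show ?thesis using F.submodule_span_superset[of "insert h S"] by blast
  qed
  have sN: "submodule N R ?F" unfolding S(3) by (rule F.submodule_submodule_span) (use S HF in blast)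
  have "U \<subseteq> N"
  proof
    fix v assume v: "v \<in> U"
    have vF: "v \<in> carrier ?F" using F.submodule_carrier[OF U v] .
    show "v \<in> N"
      by (rule mem_of_free_components[OF sN vF])
        (use hom Uc[OF v] free_component_grading[OF vF] in blast)
  qed
  then show ?thesis using S by blast
qed

lemma graded_submodule_cube:
  assumes "graded_ideal R G J"
  shows "graded_submodule R G n e (cube R n J)"
  using assms submodule_cube free_component_closed
  unfolding graded_submodule_def graded_ideal_def cube_def by auto

lemma graded_ideal_add_mult:
  assumes "graded_ideal R G J" "graded_ideal R G I" "x \<in> G s"
  shows "graded_ideal R G (add_mult (self_module R) x I J)"
proof -
  have JI: "ideal J R" "ideal I R" using assms unfolding graded_ideal_def by auto
  note c = ideal.Icarr[OF JI(1)] ideal.Icarr[OF JI(2)]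
  have xc: "x \<in> carrier R" using degree_carrier assms(3) .
  have "component R G t m \<in> add_mult (self_module R) x I J"
    if m: "m \<in> add_mult (self_module R) x I J" for m t
  proof -
    obtain a b where a: "a \<in> J" "b \<in> I" "m = a \<oplus> x \<otimes> b" using m unfolding add_mult_def by auto
    have "component R G t m = component R G t a \<oplus> x \<otimes> component R G (t - int s) b"
      using a c xc component_mult[OF assms(3), of b t] by (simp add: component_add)
    moreover have "component R G t a \<in> J" "component R G (t - int s) b \<in> I"
      using a assms unfolding graded_ideal_def by auto
    ultimately show ?thesis by (intro add_mult_memI) auto
  qed
  then show ?thesis using ideal_add_mult[OF xc JI] unfolding graded_ideal_def by blast
qed

lemma graded_ideal_zero: "graded_ideal R G {\<zero>}"
  unfolding graded_ideal_def using zeroideal by simp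

lemma graded_ideal_carrier: "graded_ideal R G (carrier R)"
  unfolding graded_ideal_def using oneideal by simp

lemma graded_ideal_add_mults:
  assumes "set xs \<subseteq> G s" "graded_ideal R G J" "graded_ideal R G I"
  shows "graded_ideal R G (add_mults (self_module R) xs I J)"
  using assms by (induction xs arbitrary: J) (auto intro: graded_ideal_add_mult)

end

section \<open>Iterated syzygies\<close>

text \<open>
  The modules are built by taking syzygies over the successive quotients \<open>R/L\<close>. A stage is the
  \<open>R/L\<close>-module \<open>U/LR\<^sup>n\<close>, for a graded submodule \<open>U\<close> of the graded free module \<open>R\<^sup>n\<close> whose basis has
  degrees \<open>e\<close>, with a distinguished element \<open>\<kappa>\<close> spanning its component of lowest degree \<open>\<delta>\<close>. The
  ideal \<open>I\<close> is recovered from \<open>\<kappa>\<close> as the annihilator of its class modulo \<open>ys\<close>.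
\<close>

definition syzygy_stage ::
    "('a, 'm) ring_scheme \<Rightarrow> (nat \<Rightarrow> 'a set) \<Rightarrow> 'a set \<Rightarrow> 'a set \<Rightarrow> 'a list \<Rightarrow>
     nat \<Rightarrow> (nat \<Rightarrow> int) \<Rightarrow> 'a fg_elem set \<Rightarrow> 'a fg_elem \<Rightarrow> int \<Rightarrow> bool" where
  "syzygy_stage R G I L ys n e U \<kappa> \<delta> \<longleftrightarrow>
     graded_submodule R G n e U \<and> cube R n L \<subseteq> U \<and>
     weakly_regular (free_module R n) ys U (cube R n L) \<and>
     \<kappa> \<in> U \<and> \<kappa> \<in> free_grading R G n e \<delta> \<and>
     (\<forall>r\<in>carrier R. r \<odot>\<^bsub>free_module R n\<^esub> \<kappa> \<in> add_mults (free_module R n) ys U (cube R n L) \<longleftrightarrow> r \<in> I) \<and>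
     (\<forall>r\<in>carrier R. r \<odot>\<^bsub>free_module R n\<^esub> \<kappa> \<in> cube R n L \<longrightarrow> r \<in> L) \<and>
     (\<forall>v\<in>U. v \<in> free_grading R G n e \<delta> \<longrightarrow>
        (\<exists>a\<in>G 0. \<exists>w\<in>cube R n L. v = a \<odot>\<^bsub>free_module R n\<^esub> \<kappa> \<oplus>\<^bsub>free_module R n\<^esub> w)) \<and>
     (\<forall>v\<in>U. \<forall>t<\<delta>. v \<in> free_grading R G n e t \<longrightarrow> v \<in> cube R n L)"

lemma regular_on_mono: "regular_on M x C A \<Longrightarrow> D \<subseteq> C \<Longrightarrow> regular_on M x D A"
  unfolding regular_on_def by blast

context standard_graded_ring
begin

text \<open>Since \<open>c\<close> has degree above r, the ideal I agrees in degrees below r with L,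
  and in degree r with L plus the scalar multiples of y. Multiplication by y, which is regular
  modulo L, embeds R/I into I/(L + yI); this is why the class of y has annihilator I modulo
  y.\<close>

lemma syzygy_stage_base:
  assumes L: "graded_ideal R G L" and y: "y \<in> G r" "r \<ge> 1" and c: "c \<in> G i" "i > r"
    and reg: "regular_on (self_module R) y (carrier R) L"
    and I: "I = add_mult (self_module R) c (carrier R) (add_mult (self_module R) y (carrier R) L)"
  shows "syzygy_stage R G I L [y] 1 (\<lambda>_. 0) (cube R 1 I) (vec R 1 (\<lambda>_. y)) (int r)"
proof -
  let ?F = "free_module R 1" and ?S = "self_module R" and ?\<kappa> = "vec R 1 (\<lambda>_. y)"
  let ?Ly = "add_mult ?S y (carrier R) L"
  interpret F: module R ?F by (rule module_free_module)
  interpret S: module R ?S by (rule module_self_module)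
  have yc: "y \<in> carrier R" and cc: "c \<in> carrier R" using degree_carrier y c by auto
  have Li: "ideal L R" using L unfolding graded_ideal_def by blast
  note Lc = ideal.Icarr[OF Li]
  have LyG: "graded_ideal R G ?Ly"
    by (rule graded_ideal_add_mult[OF L graded_ideal_carrier y(1)])
  have IG: "graded_ideal R G I"
    unfolding I by (rule graded_ideal_add_mult[OF LyG graded_ideal_carrier c(1)])
  have Ii: "ideal I R" using IG unfolding graded_ideal_def by blast
  have Lyi: "ideal ?Ly R" using LyG unfolding graded_ideal_def by blast
  have sL: "submodule L R ?S" and sLy: "submodule ?Ly R ?S" and sI: "submodule I R ?S"
    using Li Lyi Ii by (simp_all add: submodule_self_iff)
  have sC: "submodule (carrier R) R ?S" using S.carrier_is_submodule by simp
  have LLy: "L \<subseteq> ?Ly" using S.add_mult_superset[OF yc sC] Lc by (auto simp: subset_iff)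
  have LyI: "?Ly \<subseteq> I" unfolding I
    using S.add_mult_superset[OF cc sC] ideal.Icarr[OF Lyi] by (auto simp: subset_iff)
  have "y \<otimes> \<one> \<in> ?Ly" using S.smult_mem_add_mult[OF yc sC sL one_closed] by simp
  then have yI: "y \<in> I" using LyI yc by auto
  have \<kappa>F: "?\<kappa> \<in> carrier ?F" by (rule vec_closed) (rule yc)
  have \<kappa>I: "?\<kappa> \<in> cube R 1 I" unfolding cube_def using \<kappa>F yI by simp
  have reg': "r \<in> I" if rr: "r \<in> carrier R" "r \<otimes> y \<in> add_mult ?S y I L" for r
  proof -
    obtain l a where a: "l \<in> L" "a \<in> I" "r \<otimes> y = l \<oplus> y \<otimes> a"
      using rr(2) unfolding add_mult_def by auto
    have ac: "a \<in> carrier R" "l \<in> carrier R" using a ideal.Icarr[OF Ii] Lc by auto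
    have "y \<otimes> (r \<ominus> a) = (r \<otimes> y) \<ominus> y \<otimes> a" using rr(1) ac yc by algebra
    also have "\<dots> = l" using ac yc unfolding a(3) by algebra
    finally have "r \<ominus> a \<in> L"
      using regular_on_def[of ?S y "carrier R" L] reg a(1) rr(1) ac by simp
    then have "r \<ominus> a \<in> I" using LLy LyI by blast
    moreover have "r = (r \<ominus> a) \<oplus> a" using rr(1) ac by algebra
    ultimately show ?thesis using S.submodule_add[OF sI _ a(2)] by (metis self_module_simps(2))
  qed
  \<comment> \<open>In degree t the multiple of \<open>c\<close> would need a coefficient of
    negative degree, and the multiple of y has a coefficient of degree t - r, which is a scalar for
    t = r and zero below.\<close>
  have deg: "v0 \<in> L \<or> (\<exists>a\<in>G 0. \<exists>l\<in>L. t = int r \<and> v0 = a \<otimes> y \<oplus> l)"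
    if v0: "v0 \<in> I" "v0 \<in> int_grading R G t" "t \<le> int r" for v0 t
  proof -
    obtain l a b where a: "l \<in> L" "a \<in> carrier R" "b \<in> carrier R" "v0 = (l \<oplus> y \<otimes> a) \<oplus> c \<otimes> b"
      using v0(1) unfolding I add_mult_def by auto
    note lc = Lc[OF a(1)]
    have "v0 = component R G t v0" using component_int_degree[OF v0(2), of t] by simp
    also have "\<dots> = component R G t l \<oplus> y \<otimes> component R G (t - int r) a"
      unfolding a(4) using lc a yc cc component_mult[OF y(1) a(2), of t]
        component_mult[OF c(1) a(3), of t] c(2) v0(3) by (simp add: component_add)
    finally have v: "v0 = component R G t l \<oplus> y \<otimes> component R G (t - int r) a" .
    have lL: "component R G t l \<in> L" using L a(1) unfolding graded_ideal_def by blast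
    show ?thesis
    proof (cases "t = int r")
      case True
      have "component R G 0 a \<in> G 0" using component_int_grading[OF a(2), of "int 0"] by (simp add: int_grading_def)
      moreover have "v0 = component R G 0 a \<otimes> y \<oplus> component R G t l"
        using v True lc a(2) yc by (simp add: m_comm a_comm)
      ultimately show ?thesis using lL True by blast
    next
      case False
      then have "v0 = component R G t l" using v v0(3) lc yc by simp
      then show ?thesis using lL by simp
    qed
  qed
  show ?thesis unfolding syzygy_stage_def
  proof (intro conjI ballI allI impI)
    show "graded_submodule R G 1 (\<lambda>_. 0) (cube R 1 I)" by (rule graded_submodule_cube[OF IG])
    show "cube R 1 L \<subseteq> cube R 1 I" using cube_mono LLy LyI by blast
    have "regular_on ?F y (cube R 1 (carrier R)) (cube R 1 L)" by (rule regular_on_cube[OF yc reg])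
    then show "weakly_regular ?F [y] (cube R 1 I) (cube R 1 L)"
      using regular_on_mono[of ?F y "cube R 1 (carrier R)" "cube R 1 L" "cube R 1 I"]
      by (simp add: cube_mono ideal.Icarr[OF Ii] subset_iff) (simp add: cube_def ideal.Icarr[OF Ii])
    show "?\<kappa> \<in> cube R 1 I" by (rule \<kappa>I)
    show "?\<kappa> \<in> free_grading R G 1 (\<lambda>_. 0) (int r)"
      unfolding free_grading_def using \<kappa>F y(1) by simp
  next
    fix r assume rc: "r \<in> carrier R"
    have r\<kappa>: "r \<odot>\<^bsub>?F\<^esub> ?\<kappa> \<in> carrier ?F" by (rule F.smult_closed[OF rc \<kappa>F])
    have "add_mults ?F [y] (cube R 1 I) (cube R 1 L) = cube R 1 (add_mult ?S y I L)"
      by (simp add: add_mult_cube[OF yc Li Ii])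
    then have "r \<odot>\<^bsub>?F\<^esub> ?\<kappa> \<in> add_mults ?F [y] (cube R 1 I) (cube R 1 L) \<longleftrightarrow>
        r \<otimes> y \<in> add_mult ?S y I L"
      using r\<kappa> unfolding cube_def by simp
    also have "\<dots> \<longleftrightarrow> r \<in> I"
      using reg'[OF rc] S.smult_mem_add_mult[OF yc sI sL, of r] rc yc by (auto simp: m_comm)
    finally show "r \<odot>\<^bsub>?F\<^esub> ?\<kappa> \<in> add_mults ?F [y] (cube R 1 I) (cube R 1 L) \<longleftrightarrow> r \<in> I" .
    assume "r \<odot>\<^bsub>?F\<^esub> ?\<kappa> \<in> cube R 1 L"
    then have "y \<otimes> r \<in> L" unfolding cube_def using rc yc by (simp add: m_comm)
    then show "r \<in> L" using regular_on_def[of ?S y "carrier R" L] reg rc by simp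
  next
    fix v assume v: "v \<in> cube R 1 I" "v \<in> free_grading R G 1 (\<lambda>_. 0) (int r)"
    have vF: "v \<in> carrier ?F" using v unfolding cube_def by blast
    have "coord v 0 \<in> I" "coord v 0 \<in> int_grading R G (int r)"
      using v unfolding cube_def free_grading_def by auto
    then consider "coord v 0 \<in> L" | a l where "a \<in> G 0" "l \<in> L" "coord v 0 = a \<otimes> y \<oplus> l"
      using deg[of "coord v 0" "int r"] by auto
    then obtain a l where al: "a \<in> G 0" "l \<in> L" "coord v 0 = a \<otimes> y \<oplus> l"
    proof cases
      case 1
      then show ?thesis using that[OF degree_zero 1] yc Lc by simp
    qed
    have ac: "a \<in> carrier R" using degree_carrier al(1) .
    let ?w = "vec R 1 (\<lambda>_. l)"
    have wF: "?w \<in> carrier ?F" by (rule vec_closed) (use Lc al in blast)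
    have "v = a \<odot>\<^bsub>?F\<^esub> ?\<kappa> \<oplus>\<^bsub>?F\<^esub> ?w"
      by (rule coord_eqI[OF vF F.a_closed[OF F.smult_closed[OF ac \<kappa>F] wF]]) (use al in auto)
    moreover have "?w \<in> cube R 1 L" unfolding cube_def using wF al by simp
    ultimately show "\<exists>a\<in>G 0. \<exists>w\<in>cube R 1 L. v = a \<odot>\<^bsub>?F\<^esub> ?\<kappa> \<oplus>\<^bsub>?F\<^esub> w" using al(1) by blast
  next
    fix v t assume v: "v \<in> cube R 1 I" "t < int r" "v \<in> free_grading R G 1 (\<lambda>_. 0) t"
    have "coord v 0 \<in> I" "coord v 0 \<in> int_grading R G t" "v \<in> carrier ?F"
      using v unfolding cube_def free_grading_def by auto
    then show "v \<in> cube R 1 L" using deg[of "coord v 0" t] v(2) unfolding cube_def by auto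
  qed
qed

definition linear_combination :: "nat \<Rightarrow> nat \<Rightarrow> (nat \<Rightarrow> 'a fg_elem) \<Rightarrow> 'a fg_elem \<Rightarrow> 'a fg_elem" where
  "linear_combination n m u v = (\<Oplus>\<^bsub>free_module R n\<^esub>k\<in>{..<m}. coord v k \<odot>\<^bsub>free_module R n\<^esub> u k)"

lemma
  assumes "\<And>k. k < m \<Longrightarrow> u k \<in> carrier (free_module R n)"
  shows module_hom_linear_combination:
    "submodule U R (free_module R n) \<Longrightarrow> (\<And>k. k < m \<Longrightarrow> u k \<in> U) \<Longrightarrow>
      module_hom_on R (free_module R m) (free_module R n) (carrier (free_module R m)) U
        (linear_combination n m u)"
    and linear_combination_single: "k < m \<Longrightarrow> r \<in> carrier R \<Longrightarrow>
      linear_combination n m u (vec R m (\<lambda>i. if i = k then r else \<zero>)) = r \<odot>\<^bsub>free_module R n\<^esub> u k"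
    and linear_combination_component: "v \<in> carrier (free_module R m) \<Longrightarrow>
      (\<And>k. k < m \<Longrightarrow> u k \<in> free_grading R G n e (e' k)) \<Longrightarrow>
      linear_combination n m u (free_component R G m e' t v) =
      free_component R G n e t (linear_combination n m u v)"
    and linear_combination_split: "v \<in> carrier (free_module R m) \<Longrightarrow> k < m \<Longrightarrow>
      linear_combination n m u v = coord v k \<odot>\<^bsub>free_module R n\<^esub> u k \<oplus>\<^bsub>free_module R n\<^esub>
        (\<Oplus>\<^bsub>free_module R n\<^esub>j\<in>{..<m} - {k}. coord v j \<odot>\<^bsub>free_module R n\<^esub> u j)"
proof -
  let ?F = "free_module R n" and ?F' = "free_module R m"
  interpret F: module R ?F by (rule module_free_module)
  interpret F': module R ?F' by (rule module_free_module)
  have t: "(\<lambda>k. coord v k \<odot>\<^bsub>?F\<^esub> u k) \<in> {..<m} \<rightarrow> carrier ?F" if "v \<in> carrier ?F'" for v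
    using assms that by auto
  { assume U: "submodule U R ?F" and uU: "\<And>k. k < m \<Longrightarrow> u k \<in> U"
    show "module_hom_on R ?F' ?F (carrier ?F') U (linear_combination n m u)"
      unfolding module_hom_on_def
    proof (intro conjI ballI)
      fix v assume v: "v \<in> carrier ?F'"
      show "linear_combination n m u v \<in> U"
        unfolding linear_combination_def
        by (rule F.submodule_finsum[OF U]) (use F.submodule_smult[OF U] uU v in auto)
      { fix w assume w: "w \<in> carrier ?F'"
        have "linear_combination n m u (v \<oplus>\<^bsub>?F'\<^esub> w) =
            (\<Oplus>\<^bsub>?F\<^esub>k\<in>{..<m}. coord v k \<odot>\<^bsub>?F\<^esub> u k \<oplus>\<^bsub>?F\<^esub> coord w k \<odot>\<^bsub>?F\<^esub> u k)"
          unfolding linear_combination_def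
          by (rule F.finsum_cong') (use v w assms in \<open>auto simp: F.smult_l_distr\<close>)
        also have "\<dots> = linear_combination n m u v \<oplus>\<^bsub>?F\<^esub> linear_combination n m u w"
          unfolding linear_combination_def by (rule F.finsum_addf[OF t[OF v] t[OF w]])
        finally show "linear_combination n m u (v \<oplus>\<^bsub>?F'\<^esub> w) =
            linear_combination n m u v \<oplus>\<^bsub>?F\<^esub> linear_combination n m u w" . }
    next
      fix r v assume r: "r \<in> carrier R" and v: "v \<in> carrier ?F'"
      have "linear_combination n m u (r \<odot>\<^bsub>?F'\<^esub> v) = (\<Oplus>\<^bsub>?F\<^esub>k\<in>{..<m}. r \<odot>\<^bsub>?F\<^esub> (coord v k \<odot>\<^bsub>?F\<^esub> u k))"
        unfolding linear_combination_def
        by (rule F.finsum_cong') (use v r assms in \<open>auto simp: F.smult_assoc1\<close>)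
      also have "\<dots> = r \<odot>\<^bsub>?F\<^esub> linear_combination n m u v"
        unfolding linear_combination_def
        by (rule F.finsum_smult_ldistr[symmetric, OF _ r t[OF v]]) simp
      finally show "linear_combination n m u (r \<odot>\<^bsub>?F'\<^esub> v) = r \<odot>\<^bsub>?F\<^esub> linear_combination n m u v" .
    qed }
  { assume k: "k < m" and r: "r \<in> carrier R"
    have "linear_combination n m u (vec R m (\<lambda>i. if i = k then r else \<zero>)) =
        (\<Oplus>\<^bsub>?F\<^esub>j\<in>{..<m}. if k = j then r \<odot>\<^bsub>?F\<^esub> u j else \<zero>\<^bsub>?F\<^esub>)"
      unfolding linear_combination_def
      by (rule F.finsum_cong') (use assms r in auto)
    also have "\<dots> = r \<odot>\<^bsub>?F\<^esub> u k"
      by (rule F.finsum_singleton) (use k assms r in auto)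
    finally show "linear_combination n m u (vec R m (\<lambda>i. if i = k then r else \<zero>)) = r \<odot>\<^bsub>?F\<^esub> u k" . }
  { assume v: "v \<in> carrier ?F'" and ue: "\<And>k. k < m \<Longrightarrow> u k \<in> free_grading R G n e (e' k)"
    have "free_component R G n e t (linear_combination n m u v) =
        (\<Oplus>\<^bsub>?F\<^esub>k\<in>{..<m}. free_component R G n e t (coord v k \<odot>\<^bsub>?F\<^esub> u k))"
      unfolding linear_combination_def by (rule free_component_finsum) (use t[OF v] in auto)
    also have "\<dots> = (\<Oplus>\<^bsub>?F\<^esub>k\<in>{..<m}. coord (free_component R G m e' t v) k \<odot>\<^bsub>?F\<^esub> u k)"
      by (rule F.finsum_cong')
        (use v assms free_component_smult_grading[OF _ ue] in \<open>auto\<close>)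
    finally show "linear_combination n m u (free_component R G m e' t v) =
        free_component R G n e t (linear_combination n m u v)"
      unfolding linear_combination_def by simp }
  { assume v: "v \<in> carrier ?F'" and k: "k < m"
    have "(\<Oplus>\<^bsub>?F\<^esub>j\<in>insert k ({..<m} - {k}). coord v j \<odot>\<^bsub>?F\<^esub> u j) =
        coord v k \<odot>\<^bsub>?F\<^esub> u k \<oplus>\<^bsub>?F\<^esub> (\<Oplus>\<^bsub>?F\<^esub>j\<in>{..<m} - {k}. coord v j \<odot>\<^bsub>?F\<^esub> u j)"
      by (rule F.finsum_insert) (use t[OF v] k in auto)
    moreover have "insert k ({..<m} - {k}) = {..<m}" using k by auto
    ultimately show "linear_combination n m u v = coord v k \<odot>\<^bsub>?F\<^esub> u k \<oplus>\<^bsub>?F\<^esub>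
        (\<Oplus>\<^bsub>?F\<^esub>j\<in>{..<m} - {k}. coord v j \<odot>\<^bsub>?F\<^esub> u j)"
      unfolding linear_combination_def by simp }
qed

text \<open>Minimality is relative: \<kappa> and B are kept, and the number of further generators is
  made as small as possible. This way \<kappa> can become the image of a basis vector, and no other
  generator is redundant.\<close>

lemma minimal_homogeneous_generators:
  assumes U: "graded_submodule R G n e U" and "\<kappa> \<in> U" "B \<subseteq> U"
  shows "\<exists>S. finite S \<and> \<kappa> \<notin> S \<and> S \<subseteq> (\<Union>t. U \<inter> free_grading R G n e t) \<and>
    U \<subseteq> submodule_span R (free_module R n) (insert \<kappa> S \<union> B) \<and>
    (\<forall>s\<in>S. s \<notin> submodule_span R (free_module R n) (insert \<kappa> (S - {s}) \<union> B))"
proof -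
  let ?F = "free_module R n"
  interpret F: module R ?F by (rule module_free_module)
  have sU: "submodule U R ?F" using U unfolding graded_submodule_def by blast
  note UF = F.submodule_carrier[OF sU]
  let ?H = "\<Union>t. U \<inter> free_grading R G n e t"
  define P where "P S \<longleftrightarrow> finite S \<and> S \<subseteq> ?H \<and> U \<subseteq> submodule_span R ?F (insert \<kappa> S \<union> B)" for S
  have "\<exists>S. P S"
  proof -
    obtain S where S: "finite S" "S \<subseteq> ?H" "U \<subseteq> submodule_span R ?F S"
      using homogeneous_generators[OF U] by auto
    have "submodule_span R ?F S \<subseteq> submodule_span R ?F (insert \<kappa> S \<union> B)"
      unfolding submodule_span_def by auto
    then show ?thesis using S unfolding P_def by (intro exI[of _ S]) auto
  qed
  then obtain S where S: "P S" and min: "\<And>T. P T \<Longrightarrow> card S \<le> card T"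
    using ex_has_least_nat[of P _ card] by metis
  have fin: "finite S" and SH: "S \<subseteq> ?H" and span: "U \<subseteq> submodule_span R ?F (insert \<kappa> S \<union> B)"
    using S unfolding P_def by auto
  have smaller: "\<not> U \<subseteq> submodule_span R ?F (insert \<kappa> (S - {s}) \<union> B)" if s: "s \<in> S" for s
  proof
    assume "U \<subseteq> submodule_span R ?F (insert \<kappa> (S - {s}) \<union> B)"
    then have "P (S - {s})" using fin SH unfolding P_def by auto
    then have "card S \<le> card (S - {s})" by (rule min)
    then show False using card_Diff1_less[OF fin s] by simp
  qed
  have \<kappa>S: "\<kappa> \<notin> S"
  proof
    assume "\<kappa> \<in> S"
    moreover then have "insert \<kappa> (S - {\<kappa>}) = insert \<kappa> S" by blast
    ultimately show False using smaller[of \<kappa>] span by simp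
  qed
  have "s \<notin> submodule_span R ?F (insert \<kappa> (S - {s}) \<union> B)" if s: "s \<in> S" for s
  proof
    let ?T = "submodule_span R ?F (insert \<kappa> (S - {s}) \<union> B)"
    assume sT: "s \<in> ?T"
    have "insert \<kappa> (S - {s}) \<union> B \<subseteq> carrier ?F" using SH assms(2,3) UF by auto
    then have T: "submodule ?T R ?F" by (rule F.submodule_submodule_span)
    have "insert \<kappa> S \<union> B \<subseteq> ?T"
      using sT F.submodule_span_superset[of "insert \<kappa> (S - {s}) \<union> B"] by auto
    then have "submodule_span R ?F (insert \<kappa> S \<union> B) \<subseteq> ?T" by (rule F.submodule_span_least[OF T])
    then show False using smaller[OF s] span by blast
  qed
  then show ?thesis using fin \<kappa>S SH span by blast
qed

end

lemma (in module) module_hom_preimage_submodule: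
  assumes N: "module R N" and U: "submodule U R N" and B: "submodule B R N"
    and h: "module_hom_on R M N (carrier M) U h"
  shows "submodule {v \<in> carrier M. h v \<in> B} R M"
proof -
  interpret N: module R N by fact
  note C = carrier_is_submodule
  have ha: "\<And>x y. x \<in> carrier M \<Longrightarrow> y \<in> carrier M \<Longrightarrow> h (x \<oplus>\<^bsub>M\<^esub> y) = h x \<oplus>\<^bsub>N\<^esub> h y"
    and hs: "\<And>r x. r \<in> carrier R \<Longrightarrow> x \<in> carrier M \<Longrightarrow> h (r \<odot>\<^bsub>M\<^esub> x) = r \<odot>\<^bsub>N\<^esub> h x"
    using h unfolding module_hom_on_def by auto
  have h0: "h \<zero>\<^bsub>M\<^esub> = \<zero>\<^bsub>N\<^esub>"
    by (rule module_hom_on_minus(2)[OF module_axioms N C U h, of "\<zero>\<^bsub>M\<^esub>" "\<zero>\<^bsub>M\<^esub>"]) simp_all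
  show ?thesis
  proof (rule submoduleI)
    show *: "r \<odot>\<^bsub>M\<^esub> a \<in> {v \<in> carrier M. h v \<in> B}"
      if "r \<in> carrier R" "a \<in> {v \<in> carrier M. h v \<in> B}" for r a
      using that N.submodule_smult[OF B that(1), of "h a"] hs by simp
    show "\<ominus>\<^bsub>M\<^esub> a \<in> {v \<in> carrier M. h v \<in> B}" if a: "a \<in> {v \<in> carrier M. h v \<in> B}" for a
    proof -
      have "\<ominus>\<^bsub>M\<^esub> a = (\<ominus>\<^bsub>R\<^esub> \<one>\<^bsub>R\<^esub>) \<odot>\<^bsub>M\<^esub> a" using a by (simp add: smult_l_minus)
      then show ?thesis using *[of "\<ominus>\<^bsub>R\<^esub> \<one>\<^bsub>R\<^esub>" a] a by simp
    qed
    show "a \<oplus>\<^bsub>M\<^esub> b \<in> {v \<in> carrier M. h v \<in> B}"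
      if "a \<in> {v \<in> carrier M. h v \<in> B}" "b \<in> {v \<in> carrier M. h v \<in> B}" for a b
      using that N.submodule_add[OF B, of "h a" "h b"] ha by simp
  qed (use h0 N.submodule_zero[OF B] in auto)
qed

lemma (in module) module_hom_image_submodule:
  assumes N: "module R N" and U: "submodule U R N" and B: "submodule B R N"
    and h: "module_hom_on R M N (carrier M) U h"
  shows "submodule {h v \<oplus>\<^bsub>N\<^esub> b | v b. v \<in> carrier M \<and> b \<in> B} R N"
proof -
  interpret N: module R N by fact
  note C = carrier_is_submodule
  have ha: "\<And>x y. x \<in> carrier M \<Longrightarrow> y \<in> carrier M \<Longrightarrow> h (x \<oplus>\<^bsub>M\<^esub> y) = h x \<oplus>\<^bsub>N\<^esub> h y"
    and hs: "\<And>r x. r \<in> carrier R \<Longrightarrow> x \<in> carrier M \<Longrightarrow> h (r \<odot>\<^bsub>M\<^esub> x) = r \<odot>\<^bsub>N\<^esub> h x"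
    and hU: "\<And>x. x \<in> carrier M \<Longrightarrow> h x \<in> U"
    using h unfolding module_hom_on_def by auto
  have hN: "\<And>x. x \<in> carrier M \<Longrightarrow> h x \<in> carrier N" using N.submodule_carrier[OF U hU] .
  have BN: "\<And>b. b \<in> B \<Longrightarrow> b \<in> carrier N" using N.submodule_carrier[OF B] .
  have h0: "h \<zero>\<^bsub>M\<^esub> = \<zero>\<^bsub>N\<^esub>"
    by (rule module_hom_on_minus(2)[OF module_axioms N C U h, of "\<zero>\<^bsub>M\<^esub>" "\<zero>\<^bsub>M\<^esub>"]) simp_all
  let ?S = "{h v \<oplus>\<^bsub>N\<^esub> b | v b. v \<in> carrier M \<and> b \<in> B}"
  have mem: "x \<in> ?S" if "x = h v \<oplus>\<^bsub>N\<^esub> b" "v \<in> carrier M" "b \<in> B" for x v b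
    using that by (intro CollectI exI conjI)
  show ?thesis
  proof (rule N.submoduleI)
    show sub: "?S \<subseteq> carrier N" using hN BN by auto
    show "\<zero>\<^bsub>N\<^esub> \<in> ?S" by (rule mem[of _ "\<zero>\<^bsub>M\<^esub>" "\<zero>\<^bsub>N\<^esub>"]) (use h0 N.submodule_zero[OF B] in auto)
    show *: "r \<odot>\<^bsub>N\<^esub> a \<in> ?S" if r: "r \<in> carrier R" and a: "a \<in> ?S" for r a
    proof -
      obtain v b where v: "v \<in> carrier M" "b \<in> B" "a = h v \<oplus>\<^bsub>N\<^esub> b" using a by blast
      show ?thesis
        by (rule mem[of _ "r \<odot>\<^bsub>M\<^esub> v" "r \<odot>\<^bsub>N\<^esub> b"])
          (use v r hN BN hs N.submodule_smult[OF B r v(2)] in \<open>auto simp: N.smult_r_distr\<close>)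
    qed
    show "\<ominus>\<^bsub>N\<^esub> a \<in> ?S" if a: "a \<in> ?S" for a
    proof -
      have "\<ominus>\<^bsub>N\<^esub> a = (\<ominus>\<^bsub>R\<^esub> \<one>\<^bsub>R\<^esub>) \<odot>\<^bsub>N\<^esub> a" using subsetD[OF sub a] by (simp add: N.smult_l_minus)
      then show ?thesis using *[OF _ a, of "\<ominus>\<^bsub>R\<^esub> \<one>\<^bsub>R\<^esub>"] by simp
    qed
    show "a \<oplus>\<^bsub>N\<^esub> a' \<in> ?S" if a: "a \<in> ?S" and a': "a' \<in> ?S" for a a'
    proof -
      obtain v b where v: "v \<in> carrier M" "b \<in> B" "a = h v \<oplus>\<^bsub>N\<^esub> b" using a by blast
      obtain v' b' where v': "v' \<in> carrier M" "b' \<in> B" "a' = h v' \<oplus>\<^bsub>N\<^esub> b'" using a' by blast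
      show ?thesis
        by (rule mem[of _ "v \<oplus>\<^bsub>M\<^esub> v'" "b \<oplus>\<^bsub>N\<^esub> b'"])
          (use v v' hN[OF v(1)] hN[OF v'(1)] BN[OF v(2)] BN[OF v'(2)] ha
            N.submodule_add[OF B v(2) v'(2)] in \<open>auto simp: N.a_ac\<close>)
    qed
  qed
qed

context standard_graded_ring
begin

text \<open>Let F = R^m map onto U/LR^n by \<pi>, with basis vector 0 going to \<kappa>. U' is the
  kernel, a syzygy module over R/L', and the new distinguished element is y times basis vector 0.
  The argument follows A0 = L'F + yU' \<subseteq> LF = L'F + yF \<subseteq> U' \<subseteq> F. Here
  F/U' is isomorphic to U/LR^n through \<pi>, LF/A0 to F/U' through multiplication by y, and U'/LF
  inherits the regularity of \<open>ys\<close> from F/LF and F/U'. Hence \<open>ys\<close> is weakly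
  regular on U'/A0, and the new element has the same annihilator modulo \<open>y # ys\<close> as
  \<kappa> has modulo \<open>ys\<close>.\<close>

lemma syzygy_stage_step:
  assumes st: "syzygy_stage R G I L ys n e U \<kappa> \<delta>"
    and L': "graded_ideal R G L'" "L' \<inter> G 0 \<subseteq> {\<zero>}" and y: "y \<in> G 1"
    and reg: "regular_on (self_module R) y (carrier R) L'"
    and L: "L = add_mult (self_module R) y (carrier R) L'"
    and ys: "set ys \<subseteq> carrier R" "weakly_regular (self_module R) ys (carrier R) L"
  shows "\<exists>m e' U' \<kappa>' \<delta>'. syzygy_stage R G I L' (y # ys) m e' U' \<kappa>' \<delta>'"
proof -
  let ?F = "free_module R n" and ?S = "self_module R"
  interpret F: module R ?F by (rule module_free_module)
  interpret S: module R ?S by (rule module_self_module)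
  let ?LF = "cube R n L"
  have U: "graded_submodule R G n e U" and LFU: "?LF \<subseteq> U"
    and wrU: "weakly_regular ?F ys U ?LF"
    and \<kappa>: "\<kappa> \<in> U" "\<kappa> \<in> free_grading R G n e \<delta>"
    and inv: "\<And>r. r \<in> carrier R \<Longrightarrow> r \<odot>\<^bsub>?F\<^esub> \<kappa> \<in> add_mults ?F ys U ?LF \<longleftrightarrow> r \<in> I"
    and ann: "\<And>r. r \<in> carrier R \<Longrightarrow> r \<odot>\<^bsub>?F\<^esub> \<kappa> \<in> ?LF \<Longrightarrow> r \<in> L"
    and low: "\<And>v. v \<in> U \<Longrightarrow> v \<in> free_grading R G n e \<delta> \<Longrightarrow>
      \<exists>a\<in>G 0. \<exists>w\<in>?LF. v = a \<odot>\<^bsub>?F\<^esub> \<kappa> \<oplus>\<^bsub>?F\<^esub> w"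
    and lower: "\<And>v t. v \<in> U \<Longrightarrow> t < \<delta> \<Longrightarrow> v \<in> free_grading R G n e t \<Longrightarrow> v \<in> ?LF"
    using st unfolding syzygy_stage_def by simp_all
  have sU: "submodule U R ?F" using U unfolding graded_submodule_def by blast
  note UF = F.submodule_carrier[OF sU]
  have yc: "y \<in> carrier R" using degree_carrier y .
  have L'i: "ideal L' R" using L' unfolding graded_ideal_def by blast
  have LG: "graded_ideal R G L"
    unfolding L by (rule graded_ideal_add_mult[OF L'(1) graded_ideal_carrier y])
  have Li: "ideal L R" using LG unfolding graded_ideal_def by blast
  have sC: "submodule (carrier R) R ?S" using S.carrier_is_submodule by simp
  have sL': "submodule L' R ?S" and sL: "submodule L R ?S"
    using L'i Li by (simp_all add: submodule_self_iff)
  have L'L: "L' \<subseteq> L" unfolding L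
    by (rule S.add_mult_superset[OF yc sC]) (use ideal.Icarr[OF L'i] in auto)
  have yL: "y \<in> L" using S.smult_mem_add_mult[OF yc sC sL' one_closed] yc unfolding L by simp
  have Lrep: "\<exists>l\<in>L'. \<exists>a\<in>carrier R. r = l \<oplus> y \<otimes> a" if "r \<in> L" for r
    using that unfolding L add_mult_def by auto
  \<comment> \<open>Because y has degree 1, L has no nonzero constants and its degree 1 part is that
    of L' plus the scalar multiples of y. These two facts identify the lowest component of the next
    stage.\<close>
  have L0: "r = \<zero>" if r: "r \<in> L" "r \<in> G 0" for r
  proof -
    obtain l a where l: "l \<in> L'" "a \<in> carrier R" "r = l \<oplus> y \<otimes> a" using Lrep[OF r(1)] by blast
    have lc: "l \<in> carrier R" using ideal.Icarr[OF L'i l(1)] .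
    have "r = component R G 0 r" using component_degree[OF r(2), of 0] by simp
    also have "\<dots> = component R G 0 l"
      unfolding l(3) using lc l(2) yc component_mult[OF y l(2), of 0] by (simp add: component_add)
    finally have "r \<in> L'" using l(1) L'(1) unfolding graded_ideal_def by metis
    then show ?thesis using r L'(2) by blast
  qed
  have L1: "\<exists>l\<in>L'. \<exists>a\<in>G 0. r = l \<oplus> y \<otimes> a" if r: "r \<in> L" "r \<in> G 1" for r
  proof -
    obtain l a where l: "l \<in> L'" "a \<in> carrier R" "r = l \<oplus> y \<otimes> a" using Lrep[OF r(1)] by blast
    have lc: "l \<in> carrier R" using ideal.Icarr[OF L'i l(1)] .
    have "r = component R G 1 r" using component_degree[OF r(2), of 1] by simp
    also have "\<dots> = component R G 1 l \<oplus> y \<otimes> component R G 0 a"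
      unfolding l(3) using lc l(2) yc component_mult[OF y l(2), of 1] by (simp add: component_add)
    finally have "r = component R G 1 l \<oplus> y \<otimes> component R G 0 a" .
    moreover have "component R G 1 l \<in> L'" using l(1) L'(1) unfolding graded_ideal_def by blast
    moreover have "component R G 0 a \<in> G 0"
      using component_int_grading[OF l(2), of 0] by (simp add: int_grading_def)
    ultimately show ?thesis by blast
  qed
  obtain S where S: "finite S" "\<kappa> \<notin> S" "S \<subseteq> (\<Union>t. U \<inter> free_grading R G n e t)"
    "U \<subseteq> submodule_span R ?F (insert \<kappa> S \<union> ?LF)"
    "\<forall>s\<in>S. s \<notin> submodule_span R ?F (insert \<kappa> (S - {s}) \<union> ?LF)"
    using minimal_homogeneous_generators[OF U \<kappa>(1) LFU] by auto
  obtain ss where ss: "set ss = S" "distinct ss" using finite_distinct_list[OF S(1)] by blast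
  define us where "us = \<kappa> # ss"
  define m where "m = length us"
  define u where "u = (!) us"
  \<comment> \<open>The degree at index 0 is prescribed, since it fixes the degree of the new
    distinguished element; for the other generators any degree in which they are homogeneous will
    do.\<close>
  define e' where "e' k = (if k = 0 then \<delta> else SOME t. u k \<in> free_grading R G n e t)" for k
  have m0: "0 < m" unfolding m_def us_def by simp
  have u0: "u 0 = \<kappa>" unfolding u_def us_def by simp
  have uS: "u k \<in> S" if "k < m" "k \<noteq> 0" for k
    using that ss unfolding u_def us_def m_def by (cases k) auto
  have u_inj: "u j \<noteq> u k" if "j < m" "k < m" "j \<noteq> k" for j k
  proof -
    have "distinct us" using ss S(2) unfolding us_def by simp
    then show ?thesis using that nth_eq_iff_index_eq unfolding u_def m_def by blast
  qed
  have uU: "u k \<in> U" if "k < m" for k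
    using uS[OF that] u0 \<kappa>(1) S(3) by (cases "k = 0") auto
  have ue: "u k \<in> free_grading R G n e (e' k)" if k: "k < m" for k
  proof (cases "k = 0")
    case True
    then show ?thesis using u0 \<kappa>(2) unfolding e'_def by simp
  next
    case False
    then have "\<exists>t. u k \<in> free_grading R G n e t" using uS[OF k] S(3) by auto
    then show ?thesis using False someI_ex[of "\<lambda>t. u k \<in> free_grading R G n e t"]
      unfolding e'_def by simp
  qed
  have uF: "u k \<in> carrier ?F" if "k < m" for k using UF[OF uU[OF that]] .
  let ?F' = "free_module R m"
  interpret F': module R ?F' by (rule module_free_module)
  let ?C = "carrier ?F'" and ?L'F = "cube R m L'" and ?LF' = "cube R m L"
  define \<pi> where "\<pi> = linear_combination n m u"
  have hom: "module_hom_on R ?F' ?F ?C U \<pi>"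
    unfolding \<pi>_def by (rule module_hom_linear_combination[OF uF sU uU])
  define E where "E r = vec R m (\<lambda>i. if i = 0 then r else \<zero>)" for r
  have Ec: "E r \<in> ?C" if "r \<in> carrier R" for r
    unfolding E_def by (rule vec_closed) (use that in simp)
  have \<pi>E: "\<pi> (E r) = r \<odot>\<^bsub>?F\<^esub> \<kappa>" if "r \<in> carrier R" for r
    unfolding \<pi>_def E_def using linear_combination_single[OF uF m0 that] u0 by simp
  have \<pi>U: "\<pi> v \<in> U" if "v \<in> ?C" for v using hom that unfolding module_hom_on_def by blast
  have sLF: "submodule ?LF R ?F" by (rule submodule_cube[OF Li])
  have sLF': "submodule ?LF' R ?F'" by (rule submodule_cube[OF Li])
  have sL'F: "submodule ?L'F R ?F'" by (rule submodule_cube[OF L'i])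
  define U' where "U' = {v \<in> ?C. \<pi> v \<in> ?LF}"
  have sU': "submodule U' R ?F'"
    unfolding U'_def by (rule F'.module_hom_preimage_submodule[OF F.module_axioms sU sLF hom])
  have U'C: "U' \<subseteq> ?C" unfolding U'_def by blast
  have LF'U': "?LF' \<subseteq> U'"
  proof
    fix v assume v: "v \<in> ?LF'"
    have "\<pi> v \<in> ?LF" unfolding \<pi>_def linear_combination_def
    proof (rule F.submodule_finsum[OF sLF])
      fix k assume k: "k \<in> {..<m}"
      have cL: "coord v k \<in> L" using v k unfolding cube_def by simp
      have "coord v k \<otimes> coord (u k) i \<in> L" if "i < n" for i
        using ideal.I_r_closed[OF Li cL coord_closed'[OF uF[of k], of i]] k by simp
      then show "coord v k \<odot>\<^bsub>?F\<^esub> u k \<in> ?LF"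
        using F.smult_closed[OF ideal.Icarr[OF Li cL] uF[of k]] k unfolding cube_def by simp
    qed simp
    then show "v \<in> U'" using v unfolding U'_def cube_def by blast
  qed
  have L'F_LF': "?L'F \<subseteq> ?LF'" by (rule cube_mono[OF L'L])
  have L'FU': "?L'F \<subseteq> U'" using L'F_LF' LF'U' by blast
  \<comment> \<open>The elements reached by \<pi> modulo LR^n form a submodule, so it is enough that
    it contains the generators.\<close>
  have surj: "\<exists>c\<in>?C. \<exists>b\<in>?LF. d = \<pi> c \<oplus>\<^bsub>?F\<^esub> b" if d: "d \<in> U" for d
  proof -
    let ?N = "{\<pi> v \<oplus>\<^bsub>?F\<^esub> b | v b. v \<in> ?C \<and> b \<in> ?LF}"
    have sN: "submodule ?N R ?F"
      by (rule F'.module_hom_image_submodule[OF F.module_axioms sU sLF hom])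
    have memN: "x \<in> ?N" if "x = \<pi> v \<oplus>\<^bsub>?F\<^esub> b" "v \<in> ?C" "b \<in> ?LF" for x v b
      using that by (intro CollectI exI conjI)
    have uN: "u k \<in> ?N" if k: "k < m" for k
    proof -
      let ?v = "vec R m (\<lambda>i. if i = k then \<one> else \<zero>)"
      have "\<pi> ?v = u k"
        unfolding \<pi>_def using linear_combination_single[OF uF k one_closed] uF[OF k] by simp
      moreover have "?v \<in> ?C" by (rule vec_closed) simp
      moreover have "u k = u k \<oplus>\<^bsub>?F\<^esub> \<zero>\<^bsub>?F\<^esub>" using uF[OF k] by simp
      ultimately show ?thesis by (intro memN[OF _ _ F.submodule_zero[OF sLF], of _ ?v]) simp_all
    qed
    have "s \<in> ?N" if s: "s \<in> insert \<kappa> S" for s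
    proof -
      have "s \<in> set us" using s ss unfolding us_def by simp
      then obtain k where "k < m" "s = u k" unfolding u_def m_def by (auto simp: in_set_conv_nth)
      then show ?thesis using uN by simp
    qed
    moreover have "b \<in> ?N" if b: "b \<in> ?LF" for b
    proof -
      have "\<pi> \<zero>\<^bsub>?F'\<^esub> = \<zero>\<^bsub>?F\<^esub>"
        by (rule module_hom_on_minus(2)[OF F'.module_axioms F.module_axioms
              F'.carrier_is_submodule sU hom F'.zero_closed F'.zero_closed])
      then have "b = \<pi> \<zero>\<^bsub>?F'\<^esub> \<oplus>\<^bsub>?F\<^esub> b" using F.submodule_carrier[OF sLF b] by simp
      then show ?thesis by (rule memN[OF _ F'.zero_closed b])
    qed
    ultimately have "insert \<kappa> S \<union> ?LF \<subseteq> ?N" by blast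
    then have "submodule_span R ?F (insert \<kappa> S \<union> ?LF) \<subseteq> ?N" by (rule F.submodule_span_least[OF sN])
    then have "d \<in> ?N" using d S(4) by blast
    then show ?thesis by blast
  qed
  have U'iff: "c \<in> U' \<longleftrightarrow> \<pi> c \<in> ?LF" if "c \<in> ?C" for c using that unfolding U'_def by simp
  note transfer1 = weakly_regular_transfer[OF F'.module_axioms F.module_axioms
      F'.carrier_is_submodule sU hom ys(1) sU' sLF U'C LFU U'iff surj]
  have wrC: "weakly_regular ?F' ys ?C U'" using transfer1(1) wrU by blast
  have wrCL: "weakly_regular ?F' ys ?C ?LF'"
    using weakly_regular_cube[OF ys(1) Li oneideal ys(2), of m] by (simp add: cube_carrier)
  have wrUL: "weakly_regular ?F' ys U' ?LF'"
    by (rule F'.weakly_regular_sub[OF ys(1) sLF' sU' F'.carrier_is_submodule LF'U' U'C wrC wrCL])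
  let ?A0 = "add_mult ?F' y U' ?L'F"
  have sA0: "submodule ?A0 R ?F'" by (rule F'.submodule_add_mult[OF yc sU' sL'F])
  have yLF: "y \<odot>\<^bsub>?F'\<^esub> c \<in> ?LF'" if c: "c \<in> ?C" for c
  proof -
    have "y \<otimes> coord c i \<in> L" for i using ideal.I_r_closed[OF Li yL] c by simp
    then show ?thesis using F'.smult_closed[OF yc c] unfolding cube_def by simp
  qed
  have A0LF: "?A0 \<subseteq> ?LF'"
    by (rule F'.add_mult_least[OF sLF' L'F_LF']) (rule yLF[OF subsetD[OF U'C]])
  have regF: "regular_on ?F' y ?C ?L'F"
    using regular_on_cube[OF yc reg, of m] by (simp add: cube_carrier)
  have hom2: "module_hom_on R ?F' ?F' ?C ?LF' (\<lambda>c. y \<odot>\<^bsub>?F'\<^esub> c)"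
    unfolding module_hom_on_def
    using yLF yc by (auto simp: F'.smult_r_distr F'.smult_comm[of y])
  have A0iff: "c \<in> U' \<longleftrightarrow> y \<odot>\<^bsub>?F'\<^esub> c \<in> ?A0" if c: "c \<in> ?C" for c
  proof
    assume "c \<in> U'"
    then show "y \<odot>\<^bsub>?F'\<^esub> c \<in> ?A0" by (rule F'.smult_mem_add_mult[OF yc sU' sL'F])
  next
    assume "y \<odot>\<^bsub>?F'\<^esub> c \<in> ?A0"
    then obtain l w where l: "l \<in> ?L'F" "w \<in> U'" "y \<odot>\<^bsub>?F'\<^esub> c = l \<oplus>\<^bsub>?F'\<^esub> y \<odot>\<^bsub>?F'\<^esub> w"
      unfolding add_mult_def by auto
    have wC: "w \<in> ?C" using l(2) U'C by blast
    have "\<zero>\<^bsub>?F'\<^esub> \<oplus>\<^bsub>?F'\<^esub> y \<odot>\<^bsub>?F'\<^esub> c = l \<oplus>\<^bsub>?F'\<^esub> y \<odot>\<^bsub>?F'\<^esub> w" by (simp only: l(3)[symmetric] F'.l_zero[OF F'.smult_closed[OF yc c]])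
    then have "y \<odot>\<^bsub>?F'\<^esub> c \<ominus>\<^bsub>?F'\<^esub> y \<odot>\<^bsub>?F'\<^esub> w \<in> ?L'F"
      by (rule F'.submodule_diffI[OF sL'F _ F'.submodule_zero[OF sL'F] l(1)]) (use c wC yc in auto)
    then have "y \<odot>\<^bsub>?F'\<^esub> (c \<ominus>\<^bsub>?F'\<^esub> w) \<in> ?L'F" using c wC yc by (simp add: F'.smult_r_minus')
    then have "c \<ominus>\<^bsub>?F'\<^esub> w \<in> ?L'F" using regF c wC unfolding regular_on_def by simp
    then have "c \<ominus>\<^bsub>?F'\<^esub> w \<in> U'" using L'FU' by blast
    then show "c \<in> U'" using F'.submodule_diff_iff[OF sU' l(2) c] by simp
  qed
  have LFadd: "?LF' = add_mult ?F' y ?C ?L'F"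
    using add_mult_cube[OF yc L'i oneideal, of m] unfolding L by (simp add: cube_carrier)
  have surj2: "\<exists>c\<in>?C. \<exists>b\<in>?A0. d = y \<odot>\<^bsub>?F'\<^esub> c \<oplus>\<^bsub>?F'\<^esub> b" if d: "d \<in> ?LF'" for d
  proof -
    obtain l c where l: "l \<in> ?L'F" "c \<in> ?C" "d = l \<oplus>\<^bsub>?F'\<^esub> y \<odot>\<^bsub>?F'\<^esub> c"
      using d unfolding LFadd add_mult_def by auto
    have "l \<in> ?A0"
      using F'.add_mult_superset[OF yc sU' F'.submoduleE(1)[OF sL'F]] l(1) by blast
    moreover have "d = y \<odot>\<^bsub>?F'\<^esub> c \<oplus>\<^bsub>?F'\<^esub> l"
      using l F'.submodule_carrier[OF sL'F l(1)] yc by (simp add: F'.a_comm)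
    ultimately show ?thesis using l(2) by blast
  qed
  note transfer2 = weakly_regular_transfer[OF F'.module_axioms F'.module_axioms
      F'.carrier_is_submodule sLF' hom2 ys(1) sU' sA0 U'C A0LF A0iff surj2]
  have wrLA: "weakly_regular ?F' ys ?LF' ?A0" using transfer2(1) wrC by blast
  have wrUA: "weakly_regular ?F' ys U' ?A0"
    by (rule F'.weakly_regular_extension[OF ys(1) sA0 sLF' sU' A0LF LF'U' wrUL wrLA])
  \<comment> \<open>Multiples of the new distinguished element lie in LF, where multiplication by y
    gives control, but the annihilator concerns U'. The intersection formula says that reducing by
    \<open>ys\<close> in LF and in U' gives the same answer.\<close>
  have A0Int: "add_mults ?F' ys U' ?A0 \<inter> ?LF' = add_mults ?F' ys ?LF' ?A0"
    by (rule F'.add_mults_Int[OF ys(1) sA0 sLF' sU' A0LF LF'U' wrUL])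
  have "syzygy_stage R G I L' (y # ys) m e' U' (E y) (\<delta> + 1)"
    unfolding syzygy_stage_def
  proof (intro conjI ballI allI impI)
    show "graded_submodule R G m e' U'"
      unfolding graded_submodule_def
    proof (intro conjI ballI allI)
      fix v t assume v: "v \<in> U'"
      have vC: "v \<in> ?C" using v U'C by blast
      have "\<pi> (free_component R G m e' t v) = free_component R G n e t (\<pi> v)"
        unfolding \<pi>_def by (rule linear_combination_component[OF uF vC ue])
      moreover have "\<pi> v \<in> ?LF" using v unfolding U'_def by blast
      ultimately have "\<pi> (free_component R G m e' t v) \<in> ?LF"
        using graded_submodule_cube[OF LG, of n e] unfolding graded_submodule_def by simp
      then show "free_component R G m e' t v \<in> U'"
        unfolding U'_def using free_component_closed[OF vC] by simp
    qed (rule sU')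
    show "?L'F \<subseteq> U'" by (rule L'FU')
    have "regular_on ?F' y U' ?L'F" by (rule regular_on_mono[OF regF U'C])
    then show "weakly_regular ?F' (y # ys) U' ?L'F" using wrUA by simp
    show "E y \<in> U'"
    proof -
      have "\<pi> (E y) \<in> ?LF"
        unfolding \<pi>E[OF yc] cube_def
        using F.smult_closed[OF yc UF[OF \<kappa>(1)]] ideal.I_r_closed[OF Li yL] UF[OF \<kappa>(1)] by simp
      then show ?thesis unfolding U'_def using Ec[OF yc] by simp
    qed
    show "E y \<in> free_grading R G m e' (\<delta> + 1)"
      unfolding free_grading_def
    proof (intro CollectI conjI allI impI)
      fix i assume i: "i < m"
      show "coord (E y) i \<in> int_grading R G (\<delta> + 1 - e' i)"
        unfolding E_def using i y by (auto simp: e'_def int_grading_def degree_zero)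
    qed (rule Ec[OF yc])
  next
    fix r assume r: "r \<in> carrier R"
    have e: "r \<odot>\<^bsub>?F'\<^esub> E y = y \<odot>\<^bsub>?F'\<^esub> E r"
      by (rule coord_eqI[OF F'.smult_closed[OF r Ec[OF yc]] F'.smult_closed[OF yc Ec[OF r]]])
        (use r yc in \<open>auto simp: E_def m_comm\<close>)
    have "r \<odot>\<^bsub>?F'\<^esub> E y \<in> add_mults ?F' (y # ys) U' ?L'F \<longleftrightarrow>
        y \<odot>\<^bsub>?F'\<^esub> E r \<in> add_mults ?F' ys ?LF' ?A0"
      using A0Int yLF[OF Ec[OF r]] unfolding e by auto
    also have "\<dots> \<longleftrightarrow> E r \<in> add_mults ?F' ys ?C U'" by (rule transfer2(2)[symmetric]) (use Ec[OF r] in simp_all)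
    also have "\<dots> \<longleftrightarrow> \<pi> (E r) \<in> add_mults ?F ys U ?LF" by (rule transfer1(2)) (use Ec[OF r] in simp_all)
    also have "\<dots> \<longleftrightarrow> r \<in> I" unfolding \<pi>E[OF r] by (rule inv[OF r])
    finally show "r \<odot>\<^bsub>?F'\<^esub> E y \<in> add_mults ?F' (y # ys) U' ?L'F \<longleftrightarrow> r \<in> I" .
    assume "r \<odot>\<^bsub>?F'\<^esub> E y \<in> ?L'F"
    then have "coord (r \<odot>\<^bsub>?F'\<^esub> E y) 0 \<in> L'" using m0 unfolding cube_def by blast
    then have "y \<otimes> r \<in> L'" using m0 r yc unfolding E_def by (simp add: m_comm)
    then show "r \<in> L'" using regular_on_def[of ?S y "carrier R" L'] reg r by simp
  next
    \<comment> \<open>Up to degree \<delta> + 1 a syzygy involves only basis vector 0. The other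
      generators have degree at least \<delta> + 1, because in degree \<delta> and below everything
      in U comes from \<kappa> and LR^n. A nonzero coefficient at such a generator would thus be a
      scalar, and dividing by it would make the generator redundant.\<close>
    have single: "v = E (coord v 0) \<and> coord v 0 \<in> L"
      if v: "v \<in> U'" "v \<in> free_grading R G m e' t" "t \<le> \<delta> + 1" for v t
    proof -
      have vC: "v \<in> ?C" using v U'C by blast
      have zero: "coord v k = \<zero>" if k: "k < m" "k \<noteq> 0" for k
      proof (rule ccontr)
        assume nz: "coord v k \<noteq> \<zero>"
        let ?T = "submodule_span R ?F (insert \<kappa> (S - {u k}) \<union> ?LF)"
        have "insert \<kappa> (S - {u k}) \<union> ?LF \<subseteq> carrier ?F"
          using S(3) \<kappa>(1) UF F.submoduleE(1)[OF sLF] by auto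
        then have sT: "submodule ?T R ?F" by (rule F.submodule_submodule_span)
        have Tsup: "insert \<kappa> (S - {u k}) \<union> ?LF \<subseteq> ?T" by (rule F.submodule_span_superset)
        have uT: "u k \<notin> ?T" using S(5) uS[OF k] by blast
        have "\<not> e' k < \<delta>"
        proof
          assume "e' k < \<delta>"
          then have "u k \<in> ?LF" by (rule lower[OF uU[OF k(1)] _ ue[OF k(1)]])
          then show False using uT Tsup by blast
        qed
        moreover have "e' k \<noteq> \<delta>"
        proof
          assume "e' k = \<delta>"
          then obtain a w where a: "a \<in> G 0" "w \<in> ?LF" "u k = a \<odot>\<^bsub>?F\<^esub> \<kappa> \<oplus>\<^bsub>?F\<^esub> w"
            using low[OF uU[OF k(1)]] ue[OF k(1)] by auto
          have "a \<odot>\<^bsub>?F\<^esub> \<kappa> \<in> ?T" using F.submodule_smult[OF sT degree_carrier[OF a(1)]] Tsup by blast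
          moreover have "w \<in> ?T" using a(2) Tsup by blast
          ultimately have "a \<odot>\<^bsub>?F\<^esub> \<kappa> \<oplus>\<^bsub>?F\<^esub> w \<in> ?T" by (rule F.submodule_add[OF sT])
          then have "u k \<in> ?T" by (simp only: a(3)[symmetric])
          then show False using uT by blast
        qed
        ultimately have gt: "\<delta> + 1 \<le> e' k" by simp
        have vk: "coord v k \<in> int_grading R G (t - e' k)"
          using v(2) k unfolding free_grading_def by simp
        then have "t - e' k = 0"
          using nz gt v(3) unfolding int_grading_def by (cases "t - e' k < 0") auto
        then have "coord v k \<in> G 0 - {\<zero>}" using vk nz by (simp add: int_grading_def)
        from subfield_m_inv[OF degree_0_field this]
        have i: "inv (coord v k) \<in> carrier R" "inv (coord v k) \<otimes> coord v k = \<one>"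
          using degree_carrier by auto
        let ?rest = "\<Oplus>\<^bsub>?F\<^esub>j\<in>{..<m} - {k}. coord v j \<odot>\<^bsub>?F\<^esub> u j"
        have rest: "?rest \<in> ?T"
        proof (rule F.submodule_finsum[OF sT])
          fix j assume j: "j \<in> {..<m} - {k}"
          have "u j \<in> insert \<kappa> (S - {u k})"
            using j uS[of j] u0 u_inj[of j k] k by (cases "j = 0") auto
          then show "coord v j \<odot>\<^bsub>?F\<^esub> u j \<in> ?T"
            using F.submodule_smult[OF sT, of "coord v j" "u j"] Tsup vC by auto
        qed simp
        have "\<pi> v = coord v k \<odot>\<^bsub>?F\<^esub> u k \<oplus>\<^bsub>?F\<^esub> ?rest"
          unfolding \<pi>_def by (rule linear_combination_split[OF uF vC k(1)])
        moreover have "\<pi> v \<in> ?T" using v(1) Tsup unfolding U'_def by blast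
        ultimately have "coord v k \<odot>\<^bsub>?F\<^esub> u k \<in> ?T"
          using F.submodule_add_cancel(2)[OF sT rest, of "coord v k \<odot>\<^bsub>?F\<^esub> u k"] vC uF[OF k(1)] by simp
        then have "inv (coord v k) \<odot>\<^bsub>?F\<^esub> (coord v k \<odot>\<^bsub>?F\<^esub> u k) \<in> ?T"
          by (rule F.submodule_smult[OF sT i(1)])
        moreover have "inv (coord v k) \<odot>\<^bsub>?F\<^esub> (coord v k \<odot>\<^bsub>?F\<^esub> u k) = u k"
          using i vC uF[OF k(1)] by (simp add: F.smult_assoc1[symmetric])
        ultimately show False using uT by simp
      qed
      have v0: "coord v 0 \<in> carrier R" using vC by simp
      have "v = E (coord v 0)"
        by (rule coord_eqI[OF vC Ec[OF v0]]) (use zero in \<open>auto simp: E_def\<close>)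
      moreover have "coord v 0 \<in> L"
      proof (rule ann[OF v0])
        show "coord v 0 \<odot>\<^bsub>?F\<^esub> \<kappa> \<in> ?LF"
          using \<pi>E[OF v0] calculation v(1) unfolding U'_def by simp
      qed
      ultimately show ?thesis by blast
    qed
    { fix v assume v: "v \<in> U'" "v \<in> free_grading R G m e' (\<delta> + 1)"
      have s: "v = E (coord v 0)" "coord v 0 \<in> L" using single[OF v] by auto
      have "coord v 0 \<in> int_grading R G (\<delta> + 1 - e' 0)"
        using v(2) m0 unfolding free_grading_def by blast
      then have "coord v 0 \<in> G 1" unfolding e'_def int_grading_def by simp
      then obtain l a where l: "l \<in> L'" "a \<in> G 0" "coord v 0 = l \<oplus> y \<otimes> a" using L1[OF s(2)] by blast
      have c: "l \<in> carrier R" "a \<in> carrier R" using ideal.Icarr[OF L'i l(1)] degree_carrier[OF l(2)] .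
      have "v = a \<odot>\<^bsub>?F'\<^esub> E y \<oplus>\<^bsub>?F'\<^esub> E l"
      proof (rule coord_eqI[OF _ F'.a_closed[OF F'.smult_closed[OF c(2) Ec[OF yc]] Ec[OF c(1)]]])
        show "v \<in> ?C" using v U'C by blast
        show "coord v i = coord (a \<odot>\<^bsub>?F'\<^esub> E y \<oplus>\<^bsub>?F'\<^esub> E l) i" if "i < m" for i
          using that c yc l(3) by (subst s(1)) (simp add: E_def m_comm a_comm)
      qed
      moreover have "E l \<in> ?L'F"
        unfolding cube_def using Ec[OF c(1)] l(1) ideal.axioms(1)[OF L'i]
        by (auto simp: E_def additive_subgroup.zero_closed)
      ultimately show "\<exists>a\<in>G 0. \<exists>w\<in>?L'F. v = a \<odot>\<^bsub>?F'\<^esub> E y \<oplus>\<^bsub>?F'\<^esub> w" using l(2) by blast }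
    fix v t assume v: "v \<in> U'" and t: "t < \<delta> + 1" and vt: "v \<in> free_grading R G m e' t"
    have s: "v = E (coord v 0)" "coord v 0 \<in> L" using single[OF v vt] t by auto
    have v0: "coord v 0 \<in> int_grading R G (t - e' 0)"
      using vt m0 unfolding free_grading_def by blast
    \<comment> \<open>The coefficient has degree t - \<delta>. For t = \<delta> it is a constant in
      L and vanishes by L0; for smaller t its degree is negative.\<close>
    have "coord v 0 = \<zero>"
    proof (cases "t = \<delta>")
      case True
      then show ?thesis using L0[OF s(2)] v0 unfolding e'_def int_grading_def by simp
    next
      case False
      then show ?thesis using v0 t unfolding e'_def int_grading_def by simp
    qed
    moreover have "\<zero> \<in> L'" using ideal.axioms(1)[OF L'i] by (rule additive_subgroup.zero_closed)
    ultimately have "coord (E (coord v 0)) i \<in> L'" if "i < m" for i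
      using that by (simp add: E_def)
    then show "v \<in> ?L'F" using s(1) v U'C unfolding cube_def by auto
  qed
  then show ?thesis by blast
qed

section \<open>The irrelevant ideal\<close>

text \<open>The additive group generated by the products of R_1 and R_j, written as an intersection
  so that it is used through its closure properties. That it exhausts R_(j+1) is the graded meaning
  of R = R_0[R_1].\<close>

definition degree_products :: "nat \<Rightarrow> 'a set" where
  "degree_products j = \<Inter>{A. A \<subseteq> carrier R \<and> \<zero> \<in> A \<and> (\<forall>x\<in>A. \<forall>y\<in>A. x \<oplus> y \<in> A) \<and>
     (\<forall>a\<in>G 1. \<forall>b\<in>G j. a \<otimes> b \<in> A)}"

lemma degree_products_carrier: "degree_products j \<subseteq> carrier R"
  unfolding degree_products_def
  by (rule Inter_lower) (auto intro: degree_carrier)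

lemma degree_products_zero: "\<zero> \<in> degree_products j"
  unfolding degree_products_def by blast

lemma degree_products_add:
  "x \<in> degree_products j \<Longrightarrow> y \<in> degree_products j \<Longrightarrow> x \<oplus> y \<in> degree_products j"
  unfolding degree_products_def by auto

lemma degree_products_base: "a \<in> G 1 \<Longrightarrow> b \<in> G j \<Longrightarrow> a \<otimes> b \<in> degree_products j"
  unfolding degree_products_def by blast

lemma degree_products_least:
  assumes "A \<subseteq> carrier R" "\<zero> \<in> A" "\<And>x y. x \<in> A \<Longrightarrow> y \<in> A \<Longrightarrow> x \<oplus> y \<in> A"
    "\<And>a b. a \<in> G 1 \<Longrightarrow> b \<in> G j \<Longrightarrow> a \<otimes> b \<in> A"
  shows "degree_products j \<subseteq> A"
  unfolding degree_products_def by (rule Inter_lower) (use assms in simp)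

lemma degree_products_mult:
  assumes "x \<in> degree_products j" "y \<in> G t"
  shows "x \<otimes> y \<in> degree_products (j + t)"
proof -
  have yc: "y \<in> carrier R" by (rule degree_carrier[OF assms(2)])
  have "degree_products j \<subseteq> {x \<in> carrier R. x \<otimes> y \<in> degree_products (j + t)}"
  proof (rule degree_products_least)
    fix a b assume a: "a \<in> G 1" and b: "b \<in> G j"
    have "a \<otimes> (b \<otimes> y) \<in> degree_products (j + t)"
      by (rule degree_products_base[OF a grading_mult[OF b assms(2)]])
    then show "a \<otimes> b \<in> {x \<in> carrier R. x \<otimes> y \<in> degree_products (j + t)}"
      using degree_carrier[OF a] degree_carrier[OF b] yc by (simp add: m_assoc)
  qed (use yc degree_products_zero in \<open>auto simp: l_distr intro: degree_products_add\<close>)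
  then show ?thesis using assms(1) by blast
qed

text \<open>The generation of x from R_0 and R_1 is followed. In a product h k, a part of h of
  positive degree already is a sum of products with a linear factor, and for the constant part of h
  this holds for the component of k.\<close>

lemma component_Suc_degree_products:
  assumes "x \<in> carrier R"
  shows "component R G (int (Suc i)) x \<in> degree_products i"
proof -
  have "x \<in> generate_ring R (G 0 \<union> G 1)" using assms generated_in_degree_1 by simp
  then show ?thesis
  proof (induction arbitrary: i)
    case one
    then show ?case using component_degree[OF one_degree_0] degree_products_zero by simp
  next
    case (incl h)
    then consider "h \<in> G 0" | "h \<in> G 1" by blast
    then show ?case
    proof cases
      case 1
      then show ?thesis using component_degree[OF 1] degree_products_zero by simp
    next
      case 2
      have "h \<otimes> \<one> \<in> degree_products 0" by (rule degree_products_base[OF 2 one_degree_0])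
      then show ?thesis using component_degree[OF 2] degree_products_zero degree_carrier[OF 2] by simp
    qed
  next
    case (a_inv h)
    have h: "h \<in> carrier R" using a_inv(1) generated_in_degree_1 by simp
    have "component R G (int (Suc i)) (\<ominus> h) = component R G (int (Suc i)) ((\<ominus> \<one>) \<otimes> h)"
      using h by (simp add: l_minus)
    also have "\<dots> = component R G (int (Suc i)) h \<otimes> (\<ominus> \<one>)"
      using component_mult[OF degree_minus[OF one_degree_0] h, of "int (Suc i)"] h
      by (simp add: m_comm)
    finally show ?case
      using degree_products_mult[OF a_inv(2)[of i] degree_minus[OF one_degree_0]] by simp
  next
    case (eng_add h k)
    have hk: "h \<in> carrier R" "k \<in> carrier R" using eng_add generated_in_degree_1 by auto
    show ?case using degree_products_add[OF eng_add(3,4)] hk by (simp add: component_add)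
  next
    case (eng_mult h k)
    have hk: "h \<in> carrier R" "k \<in> carrier R" using eng_mult generated_in_degree_1 by auto
    obtain S :: "nat set" where S: "finite S" "h = (\<Oplus>s\<in>S. component R G (int s) h)"
      using component_sum[OF hk(1)] by blast
    let ?c = "\<lambda>s. component R G (int s) h"
    have cd: "?c s \<in> G s" for s using component_int_grading[OF hk(1), of "int s"] by simp
    have "h \<otimes> k = (\<Oplus>s\<in>S. ?c s \<otimes> k)"
    proof -
      have "h \<otimes> k = (\<Oplus>s\<in>S. ?c s) \<otimes> k" using S(2) by simp
      also have "\<dots> = (\<Oplus>s\<in>S. ?c s \<otimes> k)" using hk S(1) by (intro finsum_ldistr) auto
      finally show ?thesis .
    qed
    then have "component R G (int (Suc i)) (h \<otimes> k) =
        (\<Oplus>s\<in>S. component R G (int (Suc i)) (?c s \<otimes> k))"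
      using component_finsum[OF S(1), of "\<lambda>s. ?c s \<otimes> k"] hk by simp
    also have "\<dots> \<in> degree_products i"
    proof (rule finsum_mem[OF S(1) degree_products_zero degree_products_add _ degree_products_carrier])
      fix s
      have e: "component R G (int (Suc i)) (?c s \<otimes> k) = ?c s \<otimes> component R G (int (Suc i) - int s) k"
        by (rule component_mult[OF cd hk(2)])
      show "component R G (int (Suc i)) (?c s \<otimes> k) \<in> degree_products i"
      proof (cases s)
        case 0
        have "component R G (int (Suc i)) k \<otimes> ?c 0 \<in> degree_products (i + 0)"
          by (rule degree_products_mult[OF eng_mult(4) cd])
        then show ?thesis unfolding e using 0 hk by (simp add: m_comm)
      next
        case (Suc s')
        show ?thesis
        proof (cases "s' \<le> i")
          case True
          have "component R G (int (i - s')) k \<in> G (i - s')"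
            using component_int_grading[OF hk(2), of "int (i - s')"] by simp
          then have "?c (Suc s') \<otimes> component R G (int (i - s')) k \<in> degree_products (s' + (i - s'))"
            by (rule degree_products_mult[OF eng_mult(3)])
          then show ?thesis unfolding e using Suc True by (simp add: of_nat_diff)
        next
          case False
          then show ?thesis unfolding e using Suc hk degree_products_zero by simp
        qed
      qed
    qed
    finally show ?case .
  qed
qed

text \<open>The equality of R_(j+1) and R_1 R_j in the form of an induction principle: A can be any
  additively closed set.\<close>

lemma degree_Suc_subset:
  assumes "A \<subseteq> carrier R" "\<zero> \<in> A" "\<And>x y. x \<in> A \<Longrightarrow> y \<in> A \<Longrightarrow> x \<oplus> y \<in> A"
    "\<And>a b. a \<in> G 1 \<Longrightarrow> b \<in> G j \<Longrightarrow> a \<otimes> b \<in> A"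
  shows "G (Suc j) \<subseteq> A"
proof
  fix x assume x: "x \<in> G (Suc j)"
  then have "x \<in> degree_products j"
    using component_Suc_degree_products[OF degree_carrier[OF x], of j] component_degree[OF x] by simp
  then show "x \<in> A" using degree_products_least[OF assms] by blast
qed

lemma degree_add_subset:
  assumes "A \<subseteq> carrier R" "\<zero> \<in> A" "\<And>x y. x \<in> A \<Longrightarrow> y \<in> A \<Longrightarrow> x \<oplus> y \<in> A"
    "\<And>a b. a \<in> G i \<Longrightarrow> b \<in> G j \<Longrightarrow> a \<otimes> b \<in> A"
  shows "G (i + j) \<subseteq> A"
  using assms
proof (induction i arbitrary: A)
  case 0
  have "\<one> \<otimes> b \<in> A" if "b \<in> G j" for b using 0(4)[OF one_degree_0 that] .
  then show ?case using degree_carrier by force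
next
  case (Suc i)
  have "G (Suc (i + j)) \<subseteq> A"
  proof (rule degree_Suc_subset[OF Suc.prems(1-3)])
    fix a b assume a: "a \<in> G 1" and b: "b \<in> G (i + j)"
    have ac: "a \<in> carrier R" by (rule degree_carrier[OF a])
    have "G (i + j) \<subseteq> {b \<in> carrier R. a \<otimes> b \<in> A}"
    proof (rule Suc.IH)
      fix p q assume p: "p \<in> G i" and q: "q \<in> G j"
      have "a \<otimes> p \<in> G (Suc i)" using grading_mult[OF a p] by simp
      then have "(a \<otimes> p) \<otimes> q \<in> A" using Suc.prems(4) q by blast
      then show "p \<otimes> q \<in> {b \<in> carrier R. a \<otimes> b \<in> A}"
        using ac degree_carrier[OF p] degree_carrier[OF q] by (simp add: m_assoc)
    qed (use ac Suc.prems(2,3) in \<open>auto simp: r_distr\<close>)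
    then show "a \<otimes> b \<in> A" using b by blast
  qed simp_all
  then show ?case by simp
qed

lemma degree_mono_ideal:
  assumes "ideal J R" "G i \<subseteq> J" "i \<le> j"
  shows "G j \<subseteq> J"
proof -
  interpret J: ideal J R by fact
  have "G (i + (j - i)) \<subseteq> J"
    by (rule degree_add_subset[OF J.a_subset J.zero_closed J.a_closed])
      (use assms(2) J.I_r_closed degree_carrier in auto)
  then show ?thesis using assms(3) by simp
qed

lemma irrelevant_ideal_iff:
  "x \<in> irrelevant_ideal R G \<longleftrightarrow> x \<in> carrier R \<and> component R G 0 x = \<zero>"
proof
  assume "x \<in> irrelevant_ideal R G"
  then obtain f and n::nat where f: "x = (\<Oplus>i\<in>{1..n}. f i)" "\<And>i. f i \<in> G i"
    unfolding irrelevant_ideal_def by blast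
  have fc: "f \<in> {1..n} \<rightarrow> carrier R" using f(2) degree_carrier by blast
  have "component R G 0 x = (\<Oplus>i\<in>{1..n}. component R G 0 (f i))"
    unfolding f(1) by (rule component_finsum[OF _ fc]) simp
  also have "\<dots> = (\<Oplus>i\<in>{1..n}. \<zero>)"
    by (rule finsum_cong') (use component_degree[OF f(2)] in auto)
  also have "\<dots> = \<zero>" by simp
  finally show "x \<in> carrier R \<and> component R G 0 x = \<zero>" using f(1) fc by simp
next
  assume x: "x \<in> carrier R \<and> component R G 0 x = \<zero>"
  then obtain S :: "nat set" where S: "finite S" "x = (\<Oplus>i\<in>S. component R G (int i) x)"
    "\<And>i. i \<notin> S \<Longrightarrow> component R G (int i) x = \<zero>"
    using component_sum[of x] by auto
  obtain n where n: "S \<subseteq> {..n}" using S(1) by (meson finite_nat_iff_bounded_le)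
  have "x = (\<Oplus>i\<in>{1..n}. component R G (int i) x)"
  proof -
    have "(\<Oplus>i\<in>S. component R G (int i) x) = (\<Oplus>i\<in>S \<union> {1..n}. component R G (int i) x)"
      by (rule add.finprod_mono_neutral_cong_left) (use S x in auto)
    also have "\<dots> = (\<Oplus>i\<in>{1..n}. component R G (int i) x)"
    proof (rule add.finprod_mono_neutral_cong_right)
      show "component R G (int i) x = \<zero>" if "i \<in> S \<union> {1..n} - {1..n}" for i
      proof -
        have "i = 0" using that n by (cases i) auto
        then show ?thesis using x by simp
      qed
    qed (use S x in auto)
    finally show ?thesis using S(2) by simp
  qed
  moreover have "\<forall>i::nat. component R G (int i) x \<in> G i"
    using component_int_grading[of x "int i" for i] x by (metis int_grading_nat)
  ultimately show "x \<in> irrelevant_ideal R G" unfolding irrelevant_ideal_def by blast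
qed

text \<open>Taking constant terms is thus a ring homomorphism onto the field R_0, and the irrelevant
  ideal is its kernel; this gives that the latter is an ideal and prime.\<close>

lemma component_0_mult:
  assumes "a \<in> carrier R" "b \<in> carrier R"
  shows "component R G 0 (a \<otimes> b) = component R G 0 a \<otimes> component R G 0 b"
proof -
  let ?N = "{a \<in> carrier R. component R G 0 (a \<otimes> b) = component R G 0 a \<otimes> component R G 0 b}"
  have "a \<in> ?N"
  proof (rule mem_of_components[OF assms(1)])
    fix i :: nat
    let ?c = "component R G (int i) a"
    have cd: "?c \<in> G i" using component_int_grading[OF assms(1), of "int i"] by simp
    have "component R G 0 (?c \<otimes> b) = ?c \<otimes> component R G (0 - int i) b"
      by (rule component_mult[OF cd assms(2)])
    then show "?c \<in> ?N"
      using component_degree[OF cd, of 0] degree_carrier[OF cd] assms(2) by (cases "i = 0") auto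
  qed (use assms(2) in \<open>auto simp: l_distr component_add\<close>)
  then show ?thesis by simp
qed

lemma ideal_irrelevant: "ideal (irrelevant_ideal R G) R"
proof -
  interpret S: module R "self_module R" by (rule module_self_module)
  have "submodule (irrelevant_ideal R G) R (self_module R)"
  proof (rule S.submoduleI)
    fix a assume "a \<in> irrelevant_ideal R G"
    then have a: "a \<in> carrier R" "component R G 0 a = \<zero>" by (auto simp: irrelevant_ideal_iff)
    have "component R G 0 (\<ominus> a) \<oplus> component R G 0 a = \<zero>"
      using component_add[of "\<ominus> a" a 0] a(1) by (simp add: l_neg)
    then show "\<ominus>\<^bsub>self_module R\<^esub> a \<in> irrelevant_ideal R G"
      using a by (simp add: irrelevant_ideal_iff)
  qed (auto simp: irrelevant_ideal_iff component_add component_0_mult)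
  then show ?thesis by (simp add: submodule_self_iff)
qed

lemma degree_irrelevant: "x \<in> G i \<Longrightarrow> 0 < i \<Longrightarrow> x \<in> irrelevant_ideal R G"
  by (simp add: irrelevant_ideal_iff degree_carrier component_degree)

lemma irrelevant_subset_ideal:
  assumes "ideal P R" "G 1 \<subseteq> P"
  shows "irrelevant_ideal R G \<subseteq> P"
proof
  interpret P: ideal P R by fact
  fix x assume x: "x \<in> irrelevant_ideal R G"
  show "x \<in> P"
  proof (rule mem_of_components[OF _ P.zero_closed P.a_closed P.a_subset])
    fix i :: nat
    have c: "component R G (int i) x \<in> G i"
      using component_int_grading[of x "int i"] x by (simp add: irrelevant_ideal_iff)
    show "component R G (int i) x \<in> P"
    proof (cases "i = 0")
      case False
      then show ?thesis using c degree_mono_ideal[OF assms, of i] by auto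
    qed (use x in \<open>simp add: irrelevant_ideal_iff\<close>)
  qed (use x in \<open>auto simp: irrelevant_ideal_iff\<close>)
qed

lemma component_0_add_mults:
  assumes "\<And>x. x \<in> set xs \<Longrightarrow> x \<in> irrelevant_ideal R G" "r \<in> add_mults (self_module R) xs (carrier R) {\<zero>}"
  shows "r \<in> irrelevant_ideal R G"
proof -
  interpret S: module R "self_module R" by (rule module_self_module)
  have "add_mults (self_module R) xs (carrier R) {\<zero>} \<subseteq> irrelevant_ideal R G"
    by (rule S.add_mults_least)
      (use assms(1) ideal_irrelevant in \<open>auto simp: submodule_self_iff irrelevant_ideal_iff
          ideal.I_r_closed component_0_mult\<close>)
  then show ?thesis using assms(2) by blast
qed

text \<open>The induction moves the elements of \<open>ls\<close> from the ideal into the sequence,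
  last one first: the base stage is over R/(ls), the final one over R itself. The ideals on the way
  are generated in degree 1, so they contain no constants, as \<open>syzygy_stage_step\<close>
  requires.\<close>

lemma syzygy_stage_exists:
  assumes ls: "set ls \<subseteq> G 1" and y: "y \<in> G r" "r \<ge> 1" and c: "c \<in> G i" "i > r"
    and reg: "weakly_regular (self_module R) (ls @ [y]) (carrier R) {\<zero>}"
    and I: "I = add_mult (self_module R) c (carrier R)
      (add_mults (self_module R) (ls @ [y]) (carrier R) {\<zero>})"
  shows "\<exists>n e U \<kappa> \<delta>. syzygy_stage R G I {\<zero>} (ls @ [y]) n e U \<kappa> \<delta>"
proof -
  let ?S = "self_module R"
  let ?L = "\<lambda>ls. add_mults ?S ls (carrier R) {\<zero>}"
  have yc: "y \<in> carrier R" using degree_carrier y(1) .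
  have "\<exists>n e U \<kappa> \<delta>. syzygy_stage R G I (?L ls1) (ls2 @ [y]) n e U \<kappa> \<delta>" if "ls = ls1 @ ls2" for ls1 ls2
    using that
  proof (induction ls2 arbitrary: ls1)
    case Nil
    have LG: "graded_ideal R G (?L ls)"
      by (rule graded_ideal_add_mults[OF ls graded_ideal_zero graded_ideal_carrier])
    have "regular_on ?S y (carrier R) (?L ls)" using reg by (simp add: weakly_regular_append)
    moreover have "I = add_mult ?S c (carrier R) (add_mult ?S y (carrier R) (?L ls))"
      using I by (simp add: add_mults_append)
    ultimately have "syzygy_stage R G I (?L ls) [y] 1 (\<lambda>_. 0) (cube R 1 I) (vec R 1 (\<lambda>_. y)) (int r)"
      by (rule syzygy_stage_base[OF LG y c])
    moreover have "ls1 = ls" "[y] = [] @ [y]" using Nil by simp_all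
    ultimately show ?case by (intro exI) simp
  next
    case (Cons z ls2)
    have z: "z \<in> G 1" and ls1: "set ls1 \<subseteq> G 1" and ls2: "set ls2 \<subseteq> G 1" using ls Cons.prems by auto
    obtain n e U \<kappa> \<delta> where st: "syzygy_stage R G I (?L (ls1 @ [z])) (ls2 @ [y]) n e U \<kappa> \<delta>"
      using Cons.IH[of "ls1 @ [z]"] Cons.prems by auto
    have reg': "weakly_regular ?S (ls1 @ z # ls2 @ [y]) (carrier R) {\<zero>}" using reg Cons.prems by simp
    have LG: "graded_ideal R G (?L ls1)"
      by (rule graded_ideal_add_mults[OF ls1 graded_ideal_zero graded_ideal_carrier])
    have L0: "?L ls1 \<inter> G 0 \<subseteq> {\<zero>}"
    proof
      fix x assume x: "x \<in> ?L ls1 \<inter> G 0"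
      have "x \<in> irrelevant_ideal R G"
        by (rule component_0_add_mults[of ls1]) (use x ls1 degree_irrelevant[of _ 1] in auto)
      then show "x \<in> {\<zero>}" using x component_degree[of x 0 0] by (simp add: irrelevant_ideal_iff)
    qed
    have rz: "regular_on ?S z (carrier R) (?L ls1)" using reg' by (simp add: weakly_regular_append)
    have e: "?L (ls1 @ [z]) = add_mult ?S z (carrier R) (?L ls1)" by (simp add: add_mults_append)
    have wr: "weakly_regular ?S (ls2 @ [y]) (carrier R) (?L (ls1 @ [z]))"
      using reg' unfolding e by (simp add: weakly_regular_append)
    have sy: "set (ls2 @ [y]) \<subseteq> carrier R" using ls2 yc degree_carrier by auto
    show ?case using syzygy_stage_step[OF st LG L0 z rz e sy wr] by simp
  qed
  from this[of "[]" ls] show ?thesis by simp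
qed

end

section \<open>Depth of graded submodules of free modules\<close>

lemma weakly_regular_iff_nth:
  "weakly_regular M xs C A \<longleftrightarrow>
    (\<forall>i<length xs. regular_on M (xs ! i) C (add_mults M (take i xs) C A))"
  by (induction xs arbitrary: A) (auto simp: less_Suc_eq_0_disj)

text \<open>This links the sums over indices in the definition of depth to the recursion of
  \<open>add_mults\<close>. The induction is at the end of the list, where the recursion adds one
  summand.\<close>

lemma list_smult_eq_add_mults:
  fixes M :: "('a, 'b) module"
  assumes M: "module R M" and "set xs \<subseteq> carrier R"
  shows "list_smult xs M = add_mults M xs (carrier M) {\<zero>\<^bsub>M\<^esub>}"
proof -
  interpret module R M by fact
  define T where "T xs = {(\<Oplus>\<^bsub>M\<^esub>i\<in>{..<length xs}. (xs ! i) \<odot>\<^bsub>M\<^esub> f i) | f. \<forall>i. f i \<in> carrier M}"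
    for xs :: "'a list"
  have "T xs = add_mults M xs (carrier M) {\<zero>\<^bsub>M\<^esub>}"
    using assms(2)
  proof (induction xs rule: rev_induct)
    case Nil
    have "\<exists>f::nat \<Rightarrow> 'b. \<forall>i. f i \<in> carrier M" by (rule exI[of _ "\<lambda>_. \<zero>\<^bsub>M\<^esub>"]) simp
    then show ?case unfolding T_def by simp
  next
    case (snoc x xs)
    then have x: "x \<in> carrier R" and xs: "set xs \<subseteq> carrier R" by auto
    let ?n = "length xs"
    have xi: "xs ! i \<in> carrier R" if "i < ?n" for i using xs that nth_mem by blast
    have e: "(\<Oplus>\<^bsub>M\<^esub>i\<in>{..<length (xs @ [x])}. ((xs @ [x]) ! i) \<odot>\<^bsub>M\<^esub> f i) =
        (\<Oplus>\<^bsub>M\<^esub>i\<in>{..<?n}. (xs ! i) \<odot>\<^bsub>M\<^esub> f i) \<oplus>\<^bsub>M\<^esub> x \<odot>\<^bsub>M\<^esub> f ?n" if f: "\<forall>i. f i \<in> carrier M" for f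
    proof -
      have "{..<length (xs @ [x])} = insert ?n {..<?n}" by auto
      moreover have "(\<Oplus>\<^bsub>M\<^esub>i\<in>insert ?n {..<?n}. ((xs @ [x]) ! i) \<odot>\<^bsub>M\<^esub> f i) =
          ((xs @ [x]) ! ?n) \<odot>\<^bsub>M\<^esub> f ?n \<oplus>\<^bsub>M\<^esub> (\<Oplus>\<^bsub>M\<^esub>i\<in>{..<?n}. ((xs @ [x]) ! i) \<odot>\<^bsub>M\<^esub> f i)"
        by (rule M.finsum_insert) (use f x xi in \<open>auto simp: nth_append\<close>)
      moreover have "(\<Oplus>\<^bsub>M\<^esub>i\<in>{..<?n}. ((xs @ [x]) ! i) \<odot>\<^bsub>M\<^esub> f i) = (\<Oplus>\<^bsub>M\<^esub>i\<in>{..<?n}. (xs ! i) \<odot>\<^bsub>M\<^esub> f i)"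
        by (rule M.finsum_cong') (use f xi in \<open>auto simp: nth_append\<close>)
      moreover have "(\<Oplus>\<^bsub>M\<^esub>i\<in>{..<?n}. (xs ! i) \<odot>\<^bsub>M\<^esub> f i) \<in> carrier M"
        by (rule M.finsum_closed) (use f xi in auto)
      ultimately show ?thesis using f x by (simp add: M.a_comm)
    qed
    have "T (xs @ [x]) = add_mult M x (carrier M) (T xs)"
    proof (intro equalityI subsetI)
      fix m assume "m \<in> T (xs @ [x])"
      then obtain f where f: "\<forall>i. f i \<in> carrier M"
        "m = (\<Oplus>\<^bsub>M\<^esub>i\<in>{..<length (xs @ [x])}. ((xs @ [x]) ! i) \<odot>\<^bsub>M\<^esub> f i)"
        unfolding T_def by blast
      have "m = (\<Oplus>\<^bsub>M\<^esub>i\<in>{..<?n}. (xs ! i) \<odot>\<^bsub>M\<^esub> f i) \<oplus>\<^bsub>M\<^esub> x \<odot>\<^bsub>M\<^esub> f ?n"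
        unfolding f(2) by (rule e[OF f(1)])
      moreover have "(\<Oplus>\<^bsub>M\<^esub>i\<in>{..<?n}. (xs ! i) \<odot>\<^bsub>M\<^esub> f i) \<in> T xs" unfolding T_def using f(1) by blast
      ultimately show "m \<in> add_mult M x (carrier M) (T xs)" using f(1) by (intro add_mult_memI) auto
    next
      fix m assume "m \<in> add_mult M x (carrier M) (T xs)"
      then obtain f c where f: "\<forall>i. f i \<in> carrier M" "c \<in> carrier M"
        "m = (\<Oplus>\<^bsub>M\<^esub>i\<in>{..<?n}. (xs ! i) \<odot>\<^bsub>M\<^esub> f i) \<oplus>\<^bsub>M\<^esub> x \<odot>\<^bsub>M\<^esub> c"
        unfolding add_mult_def T_def by auto
      let ?g = "f(?n := c)"
      have g: "\<forall>i. ?g i \<in> carrier M" using f by simp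
      have "(\<Oplus>\<^bsub>M\<^esub>i\<in>{..<?n}. (xs ! i) \<odot>\<^bsub>M\<^esub> ?g i) = (\<Oplus>\<^bsub>M\<^esub>i\<in>{..<?n}. (xs ! i) \<odot>\<^bsub>M\<^esub> f i)"
        by (rule M.finsum_cong') (use f xi in auto)
      then have "m = (\<Oplus>\<^bsub>M\<^esub>i\<in>{..<length (xs @ [x])}. ((xs @ [x]) ! i) \<odot>\<^bsub>M\<^esub> ?g i)"
        using e[OF g] f(3) by simp
      then show "m \<in> T (xs @ [x])" unfolding T_def using g by blast
    qed
    then show ?case using snoc.IH[OF xs] by (simp add: add_mults_append)
  qed
  then show ?thesis unfolding T_def list_smult_def .
qed

lemma regular_sequence_iff:
  fixes M :: "('a, 'b) module"
  assumes M: "module R M" and "set xs \<subseteq> carrier R"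
  shows "regular_sequence M xs \<longleftrightarrow> weakly_regular M xs (carrier M) {\<zero>\<^bsub>M\<^esub>} \<and>
    add_mults M xs (carrier M) {\<zero>\<^bsub>M\<^esub>} \<noteq> carrier M"
proof -
  have "list_smult (take i xs) M = add_mults M (take i xs) (carrier M) {\<zero>\<^bsub>M\<^esub>}" for i
    by (rule list_smult_eq_add_mults[OF M]) (use assms(2) set_take_subset in fast)
  then show ?thesis
    unfolding regular_sequence_def weakly_regular_iff_nth regular_on_def
    using list_smult_eq_add_mults[OF assms] by simp
qed

context module
begin

lemma add_mults_ideal_smult:
  assumes "set xs \<subseteq> carrier R" "m \<in> carrier M"
    "r \<in> add_mults (self_module R) xs (carrier R) {\<zero>\<^bsub>R\<^esub>}"
  shows "r \<odot>\<^bsub>M\<^esub> m \<in> add_mults M xs (carrier M) {\<zero>\<^bsub>M\<^esub>}"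
proof -
  let ?A = "add_mults M xs (carrier M) {\<zero>\<^bsub>M\<^esub>}"
  interpret S: module R "self_module R" by (rule R.module_self_module)
  have sA: "submodule ?A R M"
    by (rule submodule_add_mults[OF assms(1) carrier_is_submodule submodule_zero_set])
  have "add_mults (self_module R) xs (carrier R) {\<zero>\<^bsub>R\<^esub>} \<subseteq> {r \<in> carrier R. r \<odot>\<^bsub>M\<^esub> m \<in> ?A}"
  proof (rule S.add_mults_least)
    show "submodule {r \<in> carrier R. r \<odot>\<^bsub>M\<^esub> m \<in> ?A} R (self_module R)"
      using colon_ideal[OF sA assms(2)] by (simp add: R.submodule_self_iff)
    show "{\<zero>\<^bsub>R\<^esub>} \<subseteq> {r \<in> carrier R. r \<odot>\<^bsub>M\<^esub> m \<in> ?A}" using assms(2) submodule_zero[OF sA] by simp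
    fix x c assume x: "x \<in> set xs" and c: "c \<in> carrier R"
    have "x \<odot>\<^bsub>M\<^esub> (c \<odot>\<^bsub>M\<^esub> m) \<in> ?A"
      by (rule smult_mem_add_mults[OF assms(1) carrier_is_submodule submodule_zero_set _ x])
        (use c assms(2) in simp)
    then show "x \<odot>\<^bsub>self_module R\<^esub> c \<in> {r \<in> carrier R. r \<odot>\<^bsub>M\<^esub> m \<in> ?A}"
      using x c assms(1,2) by (auto simp: smult_assoc1)
  qed
  then show ?thesis using assms(3) by blast
qed

lemma finsum_submodule:
  assumes "submodule N R M" "finite S" "\<And>i. i \<in> S \<Longrightarrow> f i \<in> N"
  shows "finsum (M\<lparr>carrier := N\<rparr>) f S = finsum M f S"
  using assms(2,3)
proof (induction S rule: finite_induct)
  case empty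
  interpret N: module R "M\<lparr>carrier := N\<rparr>"
    by (rule submodule.submodule_is_module[OF assms(1) module_axioms])
  show ?case by simp
next
  case (insert x S)
  interpret N: module R "M\<lparr>carrier := N\<rparr>"
    by (rule submodule.submodule_is_module[OF assms(1) module_axioms])
  have "finsum (M\<lparr>carrier := N\<rparr>) f (insert x S) = f x \<oplus>\<^bsub>M\<^esub> finsum (M\<lparr>carrier := N\<rparr>) f S"
    using N.finsum_insert[OF insert.hyps] insert.prems by simp
  moreover have "finsum M f (insert x S) = f x \<oplus>\<^bsub>M\<^esub> finsum M f S"
    by (rule M.finsum_insert[OF insert.hyps]) (use insert.prems submodule_carrier[OF assms(1)] in auto)
  ultimately show ?case using insert by simp
qed

lemma submodule_trans:
  assumes "submodule N R M" "submodule L R (M\<lparr>carrier := N\<rparr>)"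
  shows "submodule L R M" "L \<subseteq> N"
proof -
  interpret N: module R "M\<lparr>carrier := N\<rparr>"
    by (rule submodule.submodule_is_module[OF assms(1) module_axioms])
  show LN: "L \<subseteq> N" using N.submoduleE(1)[OF assms(2)] by simp
  have "module R (M\<lparr>carrier := N\<rparr>\<lparr>carrier := L\<rparr>)"
    by (rule submodule.submodule_is_module[OF assms(2) N.module_axioms])
  then show "submodule L R M"
    using module_incl_imp_submodule[of L] LN submoduleE(1)[OF assms(1)] by auto
qed

end

context depth_exchange
begin

text \<open>A longer \<open>ys\<close> would leave an element z of \<open>I\<close> that is regular
  on M/(xs)M. Some power of z lies in (xs) and kills this module, so M = (xs)M, against properness.
  This is the upper bound for the depth.\<close>

lemma weakly_regular_length_le:
  assumes xs: "set xs \<subseteq> I" "weakly_regular M xs (carrier M) {\<zero>\<^bsub>M\<^esub>}"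
    "add_mults M xs (carrier M) {\<zero>\<^bsub>M\<^esub>} \<noteq> carrier M"
    and rad: "\<And>y. y \<in> I \<Longrightarrow> \<exists>k::nat. y [^]\<^bsub>R\<^esub> k \<in> add_mults (self_module R) xs (carrier R) {\<zero>\<^bsub>R\<^esub>}"
    and ys: "set ys \<subseteq> I" "weakly_regular M ys (carrier M) {\<zero>\<^bsub>M\<^esub>}"
  shows "length ys \<le> length xs"
proof (rule ccontr)
  assume l: "\<not> length ys \<le> length xs"
  let ?A = "add_mults M xs (carrier M) {\<zero>\<^bsub>M\<^esub>}"
  have xsR: "set xs \<subseteq> carrier R" using xs(1) I_carrier by blast
  obtain zs where zs: "length zs = length ys - length xs" "set zs \<subseteq> I"
    "weakly_regular M zs (carrier M) ?A"
    using weakly_regular_remainder[OF submodule_zero_set xs(1,2) ys] by blast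
  obtain z zs' where z: "zs = z # zs'" using zs(1) l by (cases zs) auto
  have zI: "z \<in> I" "regular_on M z (carrier M) ?A" using zs z by auto
  have zR: "z \<in> carrier R" using zI I_carrier by blast
  obtain k :: nat where k: "z [^]\<^bsub>R\<^esub> k \<in> add_mults (self_module R) xs (carrier R) {\<zero>\<^bsub>R\<^esub>}"
    using rad[OF zI(1)] by blast
  have "m \<in> ?A" if m: "m \<in> carrier M" for m
  proof -
    have "z [^]\<^bsub>R\<^esub> k \<odot>\<^bsub>M\<^esub> m \<in> ?A" by (rule add_mults_ideal_smult[OF xsR m k])
    then show ?thesis
    proof (induction k)
      case 0
      then show ?case using m by simp
    next
      case (Suc k)
      have "z \<odot>\<^bsub>M\<^esub> (z [^]\<^bsub>R\<^esub> k \<odot>\<^bsub>M\<^esub> m) = z [^]\<^bsub>R\<^esub> Suc k \<odot>\<^bsub>M\<^esub> m"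
        using zR m by (simp add: smult_assoc1[symmetric] R.m_comm)
      then have "z [^]\<^bsub>R\<^esub> k \<odot>\<^bsub>M\<^esub> m \<in> ?A"
        using regular_onD[OF zI(2), of "z [^]\<^bsub>R\<^esub> k \<odot>\<^bsub>M\<^esub> m"] Suc.prems zR m by simp
      then show ?case by (rule Suc.IH)
    qed
  qed
  moreover have "?A \<subseteq> carrier M"
    using submoduleE(1)[OF submodule_add_mults[OF xsR carrier_is_submodule submodule_zero_set]] .
  ultimately show False using xs(3) by blast
qed

end

context standard_graded_ring
begin

lemma depth_exchange_irrelevant:
  assumes "module R M" "noetherian_module R M" "infinite (G 0)"
  shows "depth_exchange R M (G 0) (G 1) (irrelevant_ideal R G)"
proof -
  interpret module R M by fact
  show ?thesis
  proof (intro depth_exchange.intro depth_exchange_axioms.intro)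
    show "irrelevant_ideal R G \<subseteq> P" if "primeideal P R" "G 1 \<subseteq> P" for P
      using irrelevant_subset_ideal primeideal.axioms(1) that by blast
    show "irrelevant_ideal R G \<subseteq> carrier R" by (auto simp: irrelevant_ideal_iff)
    show "G 1 \<subseteq> irrelevant_ideal R G" using degree_irrelevant by auto
    show "k \<otimes> w \<in> G 1" if "k \<in> G 0" "w \<in> G 1" for k w using grading_mult[OF that] by simp
  qed (use assms module_axioms noetherian_ring_axioms degree_0_field degree_zero degree_add in auto)
qed

text \<open>Degrees in N are bounded below by the least \<open>e i\<close>, and the elements of
  \<open>zs\<close> have positive degree, so the degree t component of \<open>zs N\<close> uses only
  components of N below t. If \<open>zs N = N\<close>, these vanish one degree after the
  other.\<close>

lemma graded_nakayama:
  assumes N: "graded_submodule R G n e N" and zs: "\<And>z. z \<in> set zs \<Longrightarrow> \<exists>s\<ge>1. z \<in> G s"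
    and eq: "add_mults (free_module R n) zs N {\<zero>\<^bsub>free_module R n\<^esub>} = N"
  shows "N = {\<zero>\<^bsub>free_module R n\<^esub>}"
proof -
  let ?F = "free_module R n"
  interpret F: module R ?F by (rule module_free_module)
  have sN: "submodule N R ?F" and gN: "\<And>v t. v \<in> N \<Longrightarrow> free_component R G n e t v \<in> N"
    using N unfolding graded_submodule_def by auto
  note NF = F.submodule_carrier[OF sN]
  \<comment> \<open>For n = 0 there is no least basis degree, and any value serves as the lower
    bound.\<close>
  define t0 where "t0 = (if n = 0 then 0 else Min (e ` {..<n}))"
  have t0: "t0 \<le> e i" if "i < n" for i
    unfolding t0_def using that by (auto intro!: Min_le)
  have comp: "free_component R G n e t w = \<zero>\<^bsub>?F\<^esub>"
    if wA: "w \<in> add_mults ?F zs N A" "\<And>a. a \<in> A \<Longrightarrow> a \<in> carrier ?F \<and> free_component R G n e t a = \<zero>\<^bsub>?F\<^esub>"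
      and z0: "\<And>s v. s < t \<Longrightarrow> v \<in> N \<Longrightarrow> v \<in> free_grading R G n e s \<Longrightarrow> v = \<zero>\<^bsub>?F\<^esub>" for t w A
    using wA zs
  proof (induction zs arbitrary: A)
    case (Cons z zs)
    obtain s where s: "s \<ge> 1" "z \<in> G s" using Cons.prems(3)[of z] by auto
    have zc: "z \<in> carrier R" by (rule degree_carrier[OF s(2)])
    have "a \<in> carrier ?F \<and> free_component R G n e t a = \<zero>\<^bsub>?F\<^esub>" if a: "a \<in> add_mult ?F z N A" for a
    proof -
      obtain b c where b: "b \<in> A" "c \<in> N" "a = b \<oplus>\<^bsub>?F\<^esub> z \<odot>\<^bsub>?F\<^esub> c"
        using a unfolding add_mult_def by auto
      have "free_component R G n e (t - int s) c = \<zero>\<^bsub>?F\<^esub>"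
        by (rule z0[OF _ gN[OF b(2)] free_component_grading[OF NF[OF b(2)]]]) (use s in simp)
      then have "free_component R G n e t (z \<odot>\<^bsub>?F\<^esub> c) = \<zero>\<^bsub>?F\<^esub>"
        using free_component_smult[OF s(2) NF[OF b(2)], of e t] zc by simp
      then show ?thesis
        unfolding b(3) using Cons.prems(2)[OF b(1)] NF[OF b(2)] zc by (simp add: free_component_add)
    qed
    then show ?case using Cons.IH[of "add_mult ?F z N A"] Cons.prems(1,3) by simp
  qed simp
  have zero: "v = \<zero>\<^bsub>?F\<^esub>" if "t < t0 + int k" "v \<in> N" "v \<in> free_grading R G n e t" for t k v
    using that
  proof (induction k arbitrary: t v)
    case 0
    show ?case
    proof (rule coord_eqI[OF NF[OF 0(2)] F.zero_closed])
      fix i assume i: "i < n"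
      have "t - e i < 0" using t0[OF i] 0(1) by simp
      then show "coord v i = coord \<zero>\<^bsub>?F\<^esub> i"
        using 0(3) i unfolding free_grading_def int_grading_def by force
    qed
  next
    case (Suc k)
    have "free_component R G n e t v = \<zero>\<^bsub>?F\<^esub>"
    proof (rule comp[of v "{\<zero>\<^bsub>?F\<^esub>}"])
      show "v \<in> add_mults ?F zs N {\<zero>\<^bsub>?F\<^esub>}" using eq Suc.prems(2) by simp
      show "u = \<zero>\<^bsub>?F\<^esub>" if "s < t" "u \<in> N" "u \<in> free_grading R G n e s" for s u
        using Suc.IH[of s u] that Suc.prems(1) by simp
    qed simp
    then show ?case using free_component_of_grading[OF Suc.prems(3), of t] by simp
  qed
  have "v = \<zero>\<^bsub>?F\<^esub>" if v: "v \<in> N" for v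
  proof -
    have "v \<in> {\<zero>\<^bsub>?F\<^esub>}"
    proof (rule mem_of_free_components[OF F.submodule_zero_set NF[OF v]])
      fix t
      have "t < t0 + int (nat (t - t0 + 1))" by simp
      then show "free_component R G n e t v \<in> {\<zero>\<^bsub>?F\<^esub>}"
        using zero[OF _ gN[OF v] free_component_grading[OF NF[OF v]]] by blast
    qed
    then show ?thesis by simp
  qed
  then show ?thesis using F.submodule_zero[OF sN] by blast
qed

lemma free_grading_add:
  "v \<in> free_grading R G n e t \<Longrightarrow> w \<in> free_grading R G n e t \<Longrightarrow>
    v \<oplus>\<^bsub>free_module R n\<^esub> w \<in> free_grading R G n e t"
  unfolding free_grading_def using free_module_add_closed by (auto intro: int_grading_add)

lemma free_grading_zero: "\<zero>\<^bsub>free_module R n\<^esub> \<in> free_grading R G n e t"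
proof -
  interpret F: module R "free_module R n" by (rule module_free_module)
  show ?thesis unfolding free_grading_def by (auto intro: int_grading_zero)
qed

lemma free_grading_neg:
  assumes "v \<in> free_grading R G n e t"
  shows "\<ominus>\<^bsub>free_module R n\<^esub> v \<in> free_grading R G n e t"
proof -
  interpret F: module R "free_module R n" by (rule module_free_module)
  show ?thesis
    using assms free_grading_carrier[OF assms]
    unfolding free_grading_def by (auto intro: int_grading_minus)
qed

lemma free_grading_smult:
  assumes "a \<in> G i" "v \<in> free_grading R G n e t"
  shows "a \<odot>\<^bsub>free_module R n\<^esub> v \<in> free_grading R G n e (int i + t)"
proof -
  interpret F: module R "free_module R n" by (rule module_free_module)
  have v: "v \<in> carrier (free_module R n)" by (rule free_grading_carrier[OF assms(2)])
  have "a \<otimes> coord v j \<in> int_grading R G (int i + t - e j)" if "j < n" for j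
    using int_grading_mult[OF assms(1), of "coord v j" "t - e j"] assms(2) that
    unfolding free_grading_def by (simp add: algebra_simps)
  then show ?thesis
    using F.smult_closed[OF degree_carrier[OF assms(1)] v] unfolding free_grading_def by simp
qed

lemma internal_direct_sum_graded_submodule:
  assumes N: "graded_submodule R G n e N"
  shows "internal_direct_sum (free_module R n\<lparr>carrier := N\<rparr>) (\<lambda>t. N \<inter> free_grading R G n e t)"
proof -
  let ?F = "free_module R n" and ?N = "free_module R n\<lparr>carrier := N\<rparr>"
  let ?fc = "free_component R G n e"
  interpret F: module R ?F by (rule module_free_module)
  have sN: "submodule N R ?F" and gN: "\<And>v t. v \<in> N \<Longrightarrow> ?fc t v \<in> N"
    using N unfolding graded_submodule_def by auto
  interpret N: module R ?N by (rule submodule.submodule_is_module[OF sN F.module_axioms])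
  note NF = F.submodule_carrier[OF sN]
  have neg: "\<ominus>\<^bsub>?N\<^esub> a = \<ominus>\<^bsub>?F\<^esub> a" if a: "a \<in> N" for a
  proof (rule N.minus_equality)
    show "\<ominus>\<^bsub>?F\<^esub> a \<oplus>\<^bsub>?N\<^esub> a = \<zero>\<^bsub>?N\<^esub>" using NF[OF a] by (simp add: F.l_neg)
  qed (use a F.submodule_neg[OF sN a] in auto)
  have sub: "additive_subgroup (N \<inter> free_grading R G n e t) ?N" for t
    unfolding additive_subgroup_def
  proof (rule group.subgroupI)
    show "group (add_monoid ?N)" using N.a_group .
    show "N \<inter> free_grading R G n e t \<subseteq> carrier (add_monoid ?N)" by simp
    show "N \<inter> free_grading R G n e t \<noteq> {}"
      using free_grading_zero F.submodule_zero[OF sN] by blast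
    show "inv\<^bsub>add_monoid ?N\<^esub> a \<in> N \<inter> free_grading R G n e t"
      if a: "a \<in> N \<inter> free_grading R G n e t" for a
    proof -
      have "inv\<^bsub>add_monoid ?N\<^esub> a = \<ominus>\<^bsub>?F\<^esub> a" using neg[of a] a by (simp add: a_inv_def)
      then show ?thesis using a F.submodule_neg[OF sN, of a] free_grading_neg[of a n e t] by simp
    qed
    show "a \<otimes>\<^bsub>add_monoid ?N\<^esub> b \<in> N \<inter> free_grading R G n e t"
      if "a \<in> N \<inter> free_grading R G n e t" "b \<in> N \<inter> free_grading R G n e t" for a b
      using that F.submodule_add[OF sN, of a b] free_grading_add[of a n e t b] by simp
  qed
  have "\<exists>!f. (\<forall>i. f i \<in> N \<inter> free_grading R G n e i) \<and> finite {i. f i \<noteq> \<zero>\<^bsub>?F\<^esub>} \<and>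
      x = (\<Oplus>\<^bsub>?N\<^esub>i\<in>{i. f i \<noteq> \<zero>\<^bsub>?F\<^esub>}. f i)" if x: "x \<in> N" for x
  proof (rule ex1I[of _ "\<lambda>t. ?fc t x"])
    obtain T where T: "finite T" "x = (\<Oplus>\<^bsub>?F\<^esub>t\<in>T. ?fc t x)"
      using free_component_sum[OF NF[OF x]] by blast
    have fcF: "?fc t x \<in> carrier ?F" for t by (rule free_component_closed[OF NF[OF x]])
    \<comment> \<open>\<open>free_component_sum\<close> yields some finite T. Applying the
      projection to a degree outside T annihilates the sum, so T contains all nonzero
      components.\<close>
    have supp: "{t. ?fc t x \<noteq> \<zero>\<^bsub>?F\<^esub>} \<subseteq> T"
    proof (rule subsetI, rule ccontr)
      fix s assume s: "s \<in> {t. ?fc t x \<noteq> \<zero>\<^bsub>?F\<^esub>}" "s \<notin> T"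
      have "?fc s x = ?fc s (\<Oplus>\<^bsub>?F\<^esub>t\<in>T. ?fc t x)" using T(2) by simp
      also have "\<dots> = (\<Oplus>\<^bsub>?F\<^esub>t\<in>T. ?fc s (?fc t x))" by (rule free_component_finsum[OF T(1) fcF])
      also have "\<dots> = (\<Oplus>\<^bsub>?F\<^esub>t\<in>T. \<zero>\<^bsub>?F\<^esub>)"
        by (rule F.finsum_cong')
          (use s(2) free_component_of_grading[OF free_component_grading[OF NF[OF x]]] in auto)
      also have "\<dots> = \<zero>\<^bsub>?F\<^esub>" by simp
      finally show False using s(1) by simp
    qed
    have "x = (\<Oplus>\<^bsub>?F\<^esub>t\<in>{t. ?fc t x \<noteq> \<zero>\<^bsub>?F\<^esub>}. ?fc t x)"
    proof -
      have "(\<Oplus>\<^bsub>?F\<^esub>t\<in>{t. ?fc t x \<noteq> \<zero>\<^bsub>?F\<^esub>}. ?fc t x) = (\<Oplus>\<^bsub>?F\<^esub>t\<in>T. ?fc t x)"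
        by (rule F.add.finprod_mono_neutral_cong_left) (use T(1) supp fcF in auto)
      then show ?thesis using T(2) by simp
    qed
    moreover have "finite {t. ?fc t x \<noteq> \<zero>\<^bsub>?F\<^esub>}" by (rule finite_subset[OF supp T(1)])
    ultimately show "(\<forall>i. ?fc i x \<in> N \<inter> free_grading R G n e i) \<and> finite {i. ?fc i x \<noteq> \<zero>\<^bsub>?F\<^esub>} \<and>
        x = (\<Oplus>\<^bsub>?N\<^esub>i\<in>{i. ?fc i x \<noteq> \<zero>\<^bsub>?F\<^esub>}. ?fc i x)"
      using F.finsum_submodule[OF sN, of "{t. ?fc t x \<noteq> \<zero>\<^bsub>?F\<^esub>}" "\<lambda>t. ?fc t x"]
        gN[OF x] free_component_grading[OF NF[OF x]] by simp
    fix f assume f: "(\<forall>i. f i \<in> N \<inter> free_grading R G n e i) \<and> finite {i. f i \<noteq> \<zero>\<^bsub>?F\<^esub>} \<and>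
      x = (\<Oplus>\<^bsub>?N\<^esub>i\<in>{i. f i \<noteq> \<zero>\<^bsub>?F\<^esub>}. f i)"
    let ?S = "{i. f i \<noteq> \<zero>\<^bsub>?F\<^esub>}"
    have fN: "f i \<in> N" "f i \<in> free_grading R G n e i" for i using f by auto
    have xF: "x = (\<Oplus>\<^bsub>?F\<^esub>i\<in>?S. f i)" using f F.finsum_submodule[OF sN, of ?S f] by simp
    show "f = (\<lambda>t. ?fc t x)"
    proof
      fix s
      have "?fc s x = (\<Oplus>\<^bsub>?F\<^esub>i\<in>?S. ?fc s (f i))"
        unfolding xF by (rule free_component_finsum) (use f NF in auto)
      also have "\<dots> = (\<Oplus>\<^bsub>?F\<^esub>i\<in>?S. if s = i then f i else \<zero>\<^bsub>?F\<^esub>)"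
        by (rule F.finsum_cong') (use free_component_of_grading[OF fN(2)] NF[OF fN(1)] in auto)
      also have "\<dots> = f s"
      proof (cases "s \<in> ?S")
        case True
        show ?thesis by (rule F.finsum_singleton) (use True f NF[OF fN(1)] in auto)
      next
        case False
        have "(\<Oplus>\<^bsub>?F\<^esub>i\<in>?S. if s = i then f i else \<zero>\<^bsub>?F\<^esub>) = (\<Oplus>\<^bsub>?F\<^esub>i\<in>?S. \<zero>\<^bsub>?F\<^esub>)"
          by (rule F.finsum_cong') (use False in auto)
        then show ?thesis using False by simp
      qed
      finally show "f s = ?fc s x" by simp
    qed
  qed
  then show ?thesis unfolding internal_direct_sum_def using sub by simp
qed

text \<open>The definition of indecomposability offers summands graded as internal direct sums; this
  turns them into graded submodules.\<close>

lemma graded_submodule_of_internal_direct_sum: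
  assumes A: "submodule A R (free_module R n)"
    and ds: "internal_direct_sum (free_module R n\<lparr>carrier := A\<rparr>) H"
    and H: "\<And>t. H t \<subseteq> A \<inter> free_grading R G n e t"
  shows "graded_submodule R G n e A"
proof -
  let ?F = "free_module R n" and ?A = "free_module R n\<lparr>carrier := A\<rparr>"
  let ?fc = "free_component R G n e"
  interpret F: module R ?F by (rule module_free_module)
  interpret A: module R ?A by (rule submodule.submodule_is_module[OF A F.module_axioms])
  have "?fc s a \<in> A" if a: "a \<in> A" for a s
  proof -
    have "\<exists>f. (\<forall>i. f i \<in> H i) \<and> finite {i. f i \<noteq> \<zero>\<^bsub>?A\<^esub>} \<and> a = (\<Oplus>\<^bsub>?A\<^esub>i\<in>{i. f i \<noteq> \<zero>\<^bsub>?A\<^esub>}. f i)"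
      using ds a unfolding internal_direct_sum_def by (simp add: ex1_implies_ex)
    then obtain f where f: "\<forall>i. f i \<in> H i" "finite {i. f i \<noteq> \<zero>\<^bsub>?F\<^esub>}"
      "a = (\<Oplus>\<^bsub>?A\<^esub>i\<in>{i. f i \<noteq> \<zero>\<^bsub>?F\<^esub>}. f i)" by auto
    have fA: "f i \<in> A" "f i \<in> free_grading R G n e i" for i using f(1) H by auto
    have aF: "a = (\<Oplus>\<^bsub>?F\<^esub>i\<in>{i. f i \<noteq> \<zero>\<^bsub>?F\<^esub>}. f i)"
      using f(3) F.finsum_submodule[OF A f(2), of f] fA(1) by simp
    have "?fc s a = (\<Oplus>\<^bsub>?F\<^esub>i\<in>{i. f i \<noteq> \<zero>\<^bsub>?F\<^esub>}. ?fc s (f i))"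
      unfolding aF by (rule free_component_finsum[OF f(2)]) (rule free_grading_carrier[OF fA(2)])
    also have "\<dots> \<in> A"
      by (rule F.submodule_finsum[OF A f(2)])
        (use free_component_of_grading[OF fA(2)] fA(1) F.submodule_zero[OF A] in simp)
    finally show ?thesis .
  qed
  then show ?thesis using A unfolding graded_submodule_def by blast
qed

lemma finitely_generated_graded_submodule:
  assumes N: "graded_submodule R G n e N"
  shows "finitely_generated_module R (free_module R n\<lparr>carrier := N\<rparr>)"
proof -
  let ?F = "free_module R n" and ?N = "free_module R n\<lparr>carrier := N\<rparr>"
  interpret F: module R ?F by (rule module_free_module)
  have sN: "submodule N R ?F" using N unfolding graded_submodule_def by auto
  note NF = F.submodule_carrier[OF sN]
  obtain S where S: "finite S" "S \<subseteq> N" "N \<subseteq> submodule_span R ?F S"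
    using homogeneous_generators[OF N] by auto
  \<comment> \<open>Finite generation is stated by sums over a set of generators, linear
    combinations here by sums over indices. Distinctness makes the reindexing a bijection.\<close>
  obtain ss where ss: "set ss = S" "distinct ss" using finite_distinct_list[OF S(1)] by blast
  define m where "m = length ss"
  let ?u = "(!) ss"
  have uS: "?u k \<in> S" if "k < m" for k using that ss unfolding m_def by auto
  have uN: "?u k \<in> N" if "k < m" for k using uS[OF that] S(2) by blast
  have uF: "?u k \<in> carrier ?F" if "k < m" for k using NF[OF uN[OF that]] .
  interpret F': module R "free_module R m" by (rule module_free_module)
  let ?\<pi> = "linear_combination n m ?u"
  have hom: "module_hom_on R (free_module R m) ?F (carrier (free_module R m)) N ?\<pi>"
    by (rule module_hom_linear_combination[OF uF sN uN])
  let ?I = "{?\<pi> v \<oplus>\<^bsub>?F\<^esub> b | v b. v \<in> carrier (free_module R m) \<and> b \<in> {\<zero>\<^bsub>?F\<^esub>}}"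
  have sI: "submodule ?I R ?F"
    by (rule F'.module_hom_image_submodule[OF F.module_axioms sN F.submodule_zero_set hom])
  have "S \<subseteq> ?I"
  proof
    fix s assume "s \<in> S"
    then obtain k where k: "k < m" "s = ?u k" using ss unfolding m_def by (auto simp: in_set_conv_nth)
    let ?v = "vec R m (\<lambda>i. if i = k then \<one> else \<zero>)"
    have "?\<pi> ?v = s" using linear_combination_single[OF uF k(1) one_closed] uF[OF k(1)] k(2) by simp
    then have "s = ?\<pi> ?v \<oplus>\<^bsub>?F\<^esub> \<zero>\<^bsub>?F\<^esub>" using uF[OF k(1)] k(2) by simp
    moreover have "?v \<in> carrier (free_module R m)" by (rule vec_closed) simp
    ultimately show "s \<in> ?I" by blast
  qed
  then have NI: "N \<subseteq> ?I" using F.submodule_span_least[OF sI] S(3) by blast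
  have "\<exists>c \<in> S \<rightarrow> carrier R. x = (\<Oplus>\<^bsub>?N\<^esub>a\<in>S. c a \<odot>\<^bsub>?N\<^esub> a)" if x: "x \<in> N" for x
  proof -
    obtain v where v: "v \<in> carrier (free_module R m)" "x = ?\<pi> v \<oplus>\<^bsub>?F\<^esub> \<zero>\<^bsub>?F\<^esub>" using NI x by blast
    have "?\<pi> v \<in> N" using hom v(1) unfolding module_hom_on_def by blast
    then have xv: "x = ?\<pi> v" using v(2) NF by simp
    have bij: "inj_on ?u {..<m}" "?u ` {..<m} = S"
      using ss unfolding m_def by (auto simp: inj_on_nth in_set_conv_nth image_iff)
    define c where "c a = coord v (the_inv_into {..<m} ?u a)" for a
    have cu: "c (?u k) = coord v k" if "k < m" for k
      unfolding c_def using the_inv_into_f_f[OF bij(1)] that by simp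
    have cR: "c a \<in> carrier R" for a unfolding c_def using v(1) by simp
    have "(\<Oplus>\<^bsub>?N\<^esub>a\<in>S. c a \<odot>\<^bsub>?F\<^esub> a) = (\<Oplus>\<^bsub>?F\<^esub>a\<in>S. c a \<odot>\<^bsub>?F\<^esub> a)"
      by (rule F.finsum_submodule[OF sN S(1)]) (use F.submodule_smult[OF sN cR] S(2) in blast)
    also have "\<dots> = (\<Oplus>\<^bsub>?F\<^esub>a\<in>?u ` {..<m}. c a \<odot>\<^bsub>?F\<^esub> a)" unfolding bij(2) ..
    also have "\<dots> = (\<Oplus>\<^bsub>?F\<^esub>k\<in>{..<m}. c (?u k) \<odot>\<^bsub>?F\<^esub> ?u k)"
      by (rule F.finsum_reindex[OF _ bij(1)]) (use cR uF in auto)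
    also have "\<dots> = x"
      unfolding xv linear_combination_def by (rule F.finsum_cong') (use cu v(1) uF in auto)
    finally show ?thesis using cR by (intro bexI[of _ c]) auto
  qed
  then show ?thesis unfolding finitely_generated_module_def
    using S(1,2) by (intro exI[of _ S]) simp
qed

text \<open>\<open>zs\<close> itself gives the lower bound for the depth, properness coming from
  Nakayama's lemma. The upper bound must cover inhomogeneous sequences as well; it is
  \<open>weakly_regular_length_le\<close>, since (zs) and the irrelevant ideal have the same
  radical.\<close>

lemma graded_mcm_of_weakly_regular:
  assumes N: "graded_submodule R G n e N" "N \<noteq> {\<zero>\<^bsub>free_module R n\<^esub>}"
    and zs: "\<And>z. z \<in> set zs \<Longrightarrow> \<exists>s\<ge>1. z \<in> G s"
    and reg: "weakly_regular (free_module R n) zs N {\<zero>\<^bsub>free_module R n\<^esub>}"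
    and dim: "krull_dim R = enat (length zs)"
    and rad: "\<And>y. y \<in> irrelevant_ideal R G \<Longrightarrow>
      \<exists>k::nat. y [^] k \<in> add_mults (self_module R) zs (carrier R) {\<zero>}"
    and inf: "infinite (G 0)"
  shows "graded_mcm_module R G (free_module R n\<lparr>carrier := N\<rparr>) (\<lambda>t. N \<inter> free_grading R G n e t)"
proof -
  let ?F = "free_module R n" and ?N = "free_module R n\<lparr>carrier := N\<rparr>"
  interpret F: module R ?F by (rule module_free_module)
  have sN: "submodule N R ?F" using N(1) unfolding graded_submodule_def by auto
  interpret N: module R ?N by (rule submodule.submodule_is_module[OF sN F.module_axioms])
  have nN: "noetherian_module R ?N"
    by (rule noetherian_submodule[OF F.module_axioms
          noetherian_free_module[OF is_cring noetherian_ring_axioms] sN])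
  interpret E: depth_exchange R ?N "G 0" "G 1" "irrelevant_ideal R G"
    by (rule depth_exchange_irrelevant[OF N.module_axioms nN inf])
  have zsI: "set zs \<subseteq> irrelevant_ideal R G" using zs degree_irrelevant by force
  have zsR: "set zs \<subseteq> carrier R" using zsI E.I_carrier by blast
  have ne: "add_mults ?F zs N {\<zero>\<^bsub>?F\<^esub>} \<noteq> N" using graded_nakayama[OF N(1) zs] N(2) by blast
  have rs: "regular_sequence ?N zs"
    using regular_sequence_iff[OF N.module_axioms zsR] reg ne by simp
  have le: "length ys \<le> length zs"
    if ys: "set ys \<subseteq> irrelevant_ideal R G" "regular_sequence ?N ys" for ys
  proof (rule E.weakly_regular_length_le[OF zsI _ _ rad ys(1)])
    have "set ys \<subseteq> carrier R" using ys(1) E.I_carrier by blast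
    then show "weakly_regular ?N ys (carrier ?N) {\<zero>\<^bsub>?N\<^esub>}"
      using regular_sequence_iff[OF N.module_axioms] ys(2) by blast
  qed (use reg ne in simp_all)
  have "depth (irrelevant_ideal R G) ?N = enat (length zs)"
    unfolding depth_def
  proof (rule antisym)
    show "Sup {enat (length xs) | xs. set xs \<subseteq> irrelevant_ideal R G \<and> regular_sequence ?N xs}
        \<le> enat (length zs)"
      by (rule Sup_least) (use le in auto)
    show "enat (length zs) \<le>
        Sup {enat (length xs) | xs. set xs \<subseteq> irrelevant_ideal R G \<and> regular_sequence ?N xs}"
      by (rule Sup_upper) (use zsI rs in blast)
  qed
  moreover have "graded_module R G ?N (\<lambda>t. N \<inter> free_grading R G n e t)"
    unfolding graded_module_def
  proof (intro conjI allI ballI)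
    fix i j a m assume a: "a \<in> G i" and m: "m \<in> N \<inter> free_grading R G n e j"
    show "a \<odot>\<^bsub>?N\<^esub> m \<in> N \<inter> free_grading R G n e (int i + j)"
      using F.submodule_smult[OF sN degree_carrier[OF a], of m] free_grading_smult[OF a, of m] m by simp
  qed (rule N.module_axioms internal_direct_sum_graded_submodule[OF N(1)])+
  ultimately show ?thesis
    unfolding graded_mcm_module_def using finitely_generated_graded_submodule[OF N(1)] dim by simp
qed

section \<open>An uncountable family of indecomposable modules\<close>

definition graded_summands ::
    "nat \<Rightarrow> (nat \<Rightarrow> int) \<Rightarrow> 'a fg_elem set \<Rightarrow> 'a fg_elem set \<Rightarrow> 'a fg_elem set \<Rightarrow> bool" where
  "graded_summands n e U N N' \<longleftrightarrow> graded_submodule R G n e N \<and> graded_submodule R G n e N' \<and>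
     N \<subseteq> U \<and> N' \<subseteq> U \<and> N \<inter> N' = {\<zero>\<^bsub>free_module R n\<^esub>} \<and>
     (\<forall>u\<in>U. \<exists>a\<in>N. \<exists>b\<in>N'. u = a \<oplus>\<^bsub>free_module R n\<^esub> b)"

lemma graded_submodule_sum:
  assumes A: "graded_submodule R G n e A" and B: "graded_submodule R G n e B"
  shows "graded_submodule R G n e {a \<oplus>\<^bsub>free_module R n\<^esub> b | a b. a \<in> A \<and> b \<in> B}"
proof -
  let ?F = "free_module R n"
  interpret F: module R ?F by (rule module_free_module)
  have sA: "submodule A R ?F" and gA: "\<And>v t. v \<in> A \<Longrightarrow> free_component R G n e t v \<in> A"
    using A unfolding graded_submodule_def by auto
  have sB: "submodule B R ?F" and gB: "\<And>v t. v \<in> B \<Longrightarrow> free_component R G n e t v \<in> B"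
    using B unfolding graded_submodule_def by auto
  \<comment> \<open>The sum of two submodules is \<open>add_mult\<close> with multiplier 1.\<close>
  have "{a \<oplus>\<^bsub>?F\<^esub> b | a b. a \<in> A \<and> b \<in> B} = add_mult ?F \<one> B A"
    unfolding add_mult_def using F.smult_one[OF F.submodule_carrier[OF sB]]
    by (intro Collect_cong ex_cong1) auto
  then have "submodule {a \<oplus>\<^bsub>?F\<^esub> b | a b. a \<in> A \<and> b \<in> B} R ?F"
    using F.submodule_add_mult[OF one_closed sB sA] by simp
  moreover have "free_component R G n e t v \<in> {a \<oplus>\<^bsub>?F\<^esub> b | a b. a \<in> A \<and> b \<in> B}"
    if v: "v \<in> {a \<oplus>\<^bsub>?F\<^esub> b | a b. a \<in> A \<and> b \<in> B}" for v t
  proof -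
    obtain a b where ab: "a \<in> A" "b \<in> B" "v = a \<oplus>\<^bsub>?F\<^esub> b" using v by blast
    have "free_component R G n e t v = free_component R G n e t a \<oplus>\<^bsub>?F\<^esub> free_component R G n e t b"
      unfolding ab(3)
      by (rule free_component_add[OF F.submodule_carrier[OF sA ab(1)] F.submodule_carrier[OF sB ab(2)]])
    then show ?thesis using gA[OF ab(1)] gB[OF ab(2)] by blast
  qed
  ultimately show ?thesis unfolding graded_submodule_def by blast
qed

text \<open>From U = N + N' one gets \<open>zs U\<close> inside \<open>zs N + N'\<close>, and an
  element of N there has trivial N' part. So reduction modulo \<open>zs\<close> sees no difference
  between U and its summand.\<close>

lemma graded_summands_add_mults:
  assumes s: "graded_summands n e U N N'" and zs: "set zs \<subseteq> carrier R"
    and v: "v \<in> N" "v \<in> add_mults (free_module R n) zs U {\<zero>\<^bsub>free_module R n\<^esub>}"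
  shows "v \<in> add_mults (free_module R n) zs N {\<zero>\<^bsub>free_module R n\<^esub>}"
proof -
  let ?F = "free_module R n"
  interpret F: module R ?F by (rule module_free_module)
  have sN: "submodule N R ?F" and sN': "submodule N' R ?F"
    and int: "N \<inter> N' = {\<zero>\<^bsub>?F\<^esub>}" and dec: "\<And>u. u \<in> U \<Longrightarrow> \<exists>a\<in>N. \<exists>b\<in>N'. u = a \<oplus>\<^bsub>?F\<^esub> b"
    using s unfolding graded_summands_def graded_submodule_def by auto
  note c = F.submodule_carrier[OF sN] F.submodule_carrier[OF sN']
  let ?A = "add_mults ?F zs N {\<zero>\<^bsub>?F\<^esub>}"
  have sA: "submodule ?A R ?F" by (rule F.submodule_add_mults[OF zs sN F.submodule_zero_set])
  have AN: "?A \<subseteq> N"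
    by (rule F.add_mults_least[OF sN]) (use F.submodule_zero[OF sN] F.submodule_smult[OF sN] zs in auto)
  let ?B = "add_mult ?F \<one> N' ?A"
  have sB: "submodule ?B R ?F" by (rule F.submodule_add_mult[OF one_closed sN' sA])
  have "add_mults ?F zs U {\<zero>\<^bsub>?F\<^esub>} \<subseteq> ?B"
  proof (rule F.add_mults_least[OF sB])
    show "{\<zero>\<^bsub>?F\<^esub>} \<subseteq> ?B" using F.submodule_zero[OF sB] by simp
    fix x u assume x: "x \<in> set zs" and u: "u \<in> U"
    obtain a b where ab: "a \<in> N" "b \<in> N'" "u = a \<oplus>\<^bsub>?F\<^esub> b" using dec[OF u] by blast
    have xR: "x \<in> carrier R" using x zs by blast
    have xb: "x \<odot>\<^bsub>?F\<^esub> b \<in> N'" by (rule F.submodule_smult[OF sN' xR ab(2)])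
    have xa: "x \<odot>\<^bsub>?F\<^esub> a \<in> ?A" by (rule F.smult_mem_add_mults[OF zs sN F.submodule_zero_set ab(1) x])
    have "x \<odot>\<^bsub>?F\<^esub> u = x \<odot>\<^bsub>?F\<^esub> a \<oplus>\<^bsub>?F\<^esub> \<one> \<odot>\<^bsub>?F\<^esub> (x \<odot>\<^bsub>?F\<^esub> b)"
      using ab(3) c(1)[OF ab(1)] c(2)[OF ab(2)] xR by (simp add: F.smult_r_distr)
    then show "x \<odot>\<^bsub>?F\<^esub> u \<in> ?B" using xa xb by (rule add_mult_memI)
  qed
  then obtain p q where p: "p \<in> ?A" "q \<in> N'" "v = p \<oplus>\<^bsub>?F\<^esub> \<one> \<odot>\<^bsub>?F\<^esub> q"
    using v(2) unfolding add_mult_def by blast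
  have q1: "\<one> \<odot>\<^bsub>?F\<^esub> q = q" using c(2)[OF p(2)] by simp
  have "q \<in> N"
    using F.submodule_add_cancel(1)[OF sN, of p q] p AN c(2)[OF p(2)] v(1) q1 by auto
  then have "q = \<zero>\<^bsub>?F\<^esub>" using int p(2) by blast
  then have "v = p" using p(1,3) q1 c(1) AN by auto
  then show ?thesis using p(1) by simp
qed

lemma graded_summands_weakly_regular:
  assumes s: "graded_summands n e U N N'" and zs: "set zs \<subseteq> carrier R"
    and wr: "weakly_regular (free_module R n) zs U {\<zero>\<^bsub>free_module R n\<^esub>}"
  shows "weakly_regular (free_module R n) zs N {\<zero>\<^bsub>free_module R n\<^esub>}"
  unfolding weakly_regular_iff_nth regular_on_def
proof (intro allI impI ballI)
  let ?F = "free_module R n"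
  have NU: "N \<subseteq> U" using s unfolding graded_summands_def by blast
  fix i m assume i: "i < length zs" and m: "m \<in> N"
    and zm: "(zs ! i) \<odot>\<^bsub>?F\<^esub> m \<in> add_mults ?F (take i zs) N {\<zero>\<^bsub>?F\<^esub>}"
  have "regular_on ?F (zs ! i) U (add_mults ?F (take i zs) U {\<zero>\<^bsub>?F\<^esub>})"
    using wr i unfolding weakly_regular_iff_nth by blast
  moreover have "(zs ! i) \<odot>\<^bsub>?F\<^esub> m \<in> add_mults ?F (take i zs) U {\<zero>\<^bsub>?F\<^esub>}"
    using zm add_mults_mono[OF NU order_refl] by blast
  ultimately have "m \<in> add_mults ?F (take i zs) U {\<zero>\<^bsub>?F\<^esub>}"
    using m NU unfolding regular_on_def by blast
  moreover have "set (take i zs) \<subseteq> carrier R" using set_take_subset[of i zs] zs by blast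
  ultimately show "m \<in> add_mults ?F (take i zs) N {\<zero>\<^bsub>?F\<^esub>}"
    using graded_summands_add_mults[OF s _ m] by blast
qed

text \<open>The summand containing \<open>\<kappa>\<close> with maximal complement is indecomposable, because in any further
  decomposition \<open>\<kappa>\<close>, spanning its degree, would lie in one of the two parts.\<close>

lemma indecomposable_summand_exists:
  assumes U: "graded_submodule R G n e U"
    and wr: "weakly_regular (free_module R n) zs U {\<zero>\<^bsub>free_module R n\<^esub>}"
    and \<kappa>: "\<kappa> \<in> U" "\<kappa> \<in> free_grading R G n e \<delta>" "\<kappa> \<noteq> \<zero>\<^bsub>free_module R n\<^esub>"
    and low: "\<And>v. v \<in> U \<Longrightarrow> v \<in> free_grading R G n e \<delta> \<Longrightarrow> \<exists>a\<in>G 0. v = a \<odot>\<^bsub>free_module R n\<^esub> \<kappa>"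
    and zs: "\<And>z. z \<in> set zs \<Longrightarrow> \<exists>s\<ge>1. z \<in> G s"
    and dim: "krull_dim R = enat (length zs)"
    and rad: "\<And>y. y \<in> irrelevant_ideal R G \<Longrightarrow>
      \<exists>k::nat. y [^] k \<in> add_mults (self_module R) zs (carrier R) {\<zero>}"
    and inf: "infinite (G 0)"
  shows "\<exists>N N'. graded_summands n e U N N' \<and> \<kappa> \<in> N \<and>
    indecomposable_graded_mcm R G (free_module R n\<lparr>carrier := N\<rparr>) (\<lambda>t. N \<inter> free_grading R G n e t)"
proof -
  let ?F = "free_module R n"
  interpret F: module R ?F by (rule module_free_module)
  have sU: "submodule U R ?F" using U unfolding graded_submodule_def by blast
  have zsR: "set zs \<subseteq> carrier R" using zs degree_carrier by blast
  let ?Fam = "{N'. \<exists>N. graded_summands n e U N N' \<and> \<kappa> \<in> N}"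
  have g0: "graded_submodule R G n e {\<zero>\<^bsub>?F\<^esub>}"
    unfolding graded_submodule_def using F.submodule_zero_set by simp
  have "u = u \<oplus>\<^bsub>?F\<^esub> \<zero>\<^bsub>?F\<^esub>" if "u \<in> U" for u using F.submodule_carrier[OF sU that] by simp
  then have "graded_summands n e U U {\<zero>\<^bsub>?F\<^esub>}"
    unfolding graded_summands_def using U g0 F.submodule_zero[OF sU] by auto
  then have ne: "?Fam \<noteq> {}" using \<kappa>(1) by blast
  have "\<exists>N'\<in>?Fam. \<forall>L\<in>?Fam. N' \<subseteq> L \<longrightarrow> L = N'"
    by (rule noetherian_module_maximal[OF noetherian_free_module[OF is_cring noetherian_ring_axioms] ne])
      (auto simp: graded_summands_def graded_submodule_def)
  then obtain N' where N': "N' \<in> ?Fam" "\<forall>L\<in>?Fam. N' \<subseteq> L \<longrightarrow> L = N'" by (rule bexE)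
  obtain N where N: "graded_summands n e U N N'" "\<kappa> \<in> N" using N'(1) by blast
  have gN: "graded_submodule R G n e N" and gN': "graded_submodule R G n e N'"
    and NU: "N \<subseteq> U" "N' \<subseteq> U" and NN: "N \<inter> N' = {\<zero>\<^bsub>?F\<^esub>}"
    and dec: "\<And>u. u \<in> U \<Longrightarrow> \<exists>a\<in>N. \<exists>b\<in>N'. u = a \<oplus>\<^bsub>?F\<^esub> b"
    using N(1) unfolding graded_summands_def by auto
  have sN: "submodule N R ?F" and sN': "submodule N' R ?F"
    using gN gN' unfolding graded_submodule_def by auto
  note NF = F.submodule_carrier[OF sN] and N'F = F.submodule_carrier[OF sN']
  have mcm: "graded_mcm_module R G (?F\<lparr>carrier := N\<rparr>) (\<lambda>t. N \<inter> free_grading R G n e t)"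
    by (rule graded_mcm_of_weakly_regular[OF gN _ zs
          graded_summands_weakly_regular[OF N(1) zsR wr] dim rad inf])
      (use N(2) \<kappa>(3) in auto)
  \<comment> \<open>If \<kappa> were in A, then U = A + (B + N') would be a decomposition with
    \<kappa> in the first part and a strictly larger complement.\<close>
  have no: "\<kappa> \<notin> A"
    if A: "graded_submodule R G n e A" "A \<subseteq> N" and B: "graded_submodule R G n e B" "B \<subseteq> N"
      "B \<noteq> {\<zero>\<^bsub>?F\<^esub>}" and AB: "A \<inter> B = {\<zero>\<^bsub>?F\<^esub>}" "\<And>u. u \<in> N \<Longrightarrow> \<exists>a\<in>A. \<exists>b\<in>B. u = a \<oplus>\<^bsub>?F\<^esub> b" for A B
  proof
    assume \<kappa>A: "\<kappa> \<in> A"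
    have sA: "submodule A R ?F" and sB: "submodule B R ?F"
      using A(1) B(1) unfolding graded_submodule_def by auto
    note AF = F.submodule_carrier[OF sA] and BF = F.submodule_carrier[OF sB]
    let ?L = "{b \<oplus>\<^bsub>?F\<^esub> c | b c. b \<in> B \<and> c \<in> N'}"
    have gL: "graded_submodule R G n e ?L" by (rule graded_submodule_sum[OF B(1) gN'])
    have sL: "submodule ?L R ?F" using gL unfolding graded_submodule_def by blast
    have "graded_summands n e U A ?L"
      unfolding graded_summands_def
    proof (intro conjI ballI)
      show "A \<subseteq> U" using A(2) NU by blast
      show "?L \<subseteq> U" using F.submodule_add[OF sU] B(2) NU by blast
      show "A \<inter> ?L = {\<zero>\<^bsub>?F\<^esub>}"
      proof (intro equalityI subsetI)
        fix x assume x: "x \<in> A \<inter> ?L"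
        then obtain b c where b: "b \<in> B" "c \<in> N'" "x = b \<oplus>\<^bsub>?F\<^esub> c" by blast
        have "x \<in> N" using x A(2) by blast
        then have "b \<oplus>\<^bsub>?F\<^esub> c \<in> N" by (simp only: b(3))
        then have "c \<in> N"
          using F.submodule_add_cancel(1)[OF sN, of b c] b B(2) N'F[OF b(2)] by blast
        then have "c = \<zero>\<^bsub>?F\<^esub>" using NN b(2) by blast
        then have "x = b" using b BF by simp
        then show "x \<in> {\<zero>\<^bsub>?F\<^esub>}" using x b(1) AB(1) by blast
      next
        fix x assume "x \<in> {\<zero>\<^bsub>?F\<^esub>}"
        then show "x \<in> A \<inter> ?L" using F.submodule_zero[OF sA] F.submodule_zero[OF sL] by simp
      qed
      fix u assume "u \<in> U"
      then obtain x c where x: "x \<in> N" "c \<in> N'" "u = x \<oplus>\<^bsub>?F\<^esub> c" using dec by blast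
      obtain a b where a: "a \<in> A" "b \<in> B" "x = a \<oplus>\<^bsub>?F\<^esub> b" using AB(2)[OF x(1)] by blast
      have "u = a \<oplus>\<^bsub>?F\<^esub> (b \<oplus>\<^bsub>?F\<^esub> c)"
        using x(3) a(3) AF[OF a(1)] BF[OF a(2)] N'F[OF x(2)] by (simp add: F.a_assoc)
      then show "\<exists>a\<in>A. \<exists>b\<in>?L. u = a \<oplus>\<^bsub>?F\<^esub> b" using a x(2) by blast
    qed (rule A(1) gL)+
    then have "?L \<in> ?Fam" using \<kappa>A by blast
    moreover have "N' \<subseteq> ?L"
    proof
      fix c assume c: "c \<in> N'"
      then have "c = \<zero>\<^bsub>?F\<^esub> \<oplus>\<^bsub>?F\<^esub> c" using N'F by simp
      then show "c \<in> ?L" using F.submodule_zero[OF sB] c by blast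
    qed
    ultimately have eq: "?L = N'" using N'(2) by blast
    have "B \<subseteq> ?L"
    proof
      fix b assume b: "b \<in> B"
      then have "b = b \<oplus>\<^bsub>?F\<^esub> \<zero>\<^bsub>?F\<^esub>" using BF by simp
      then show "b \<in> ?L" using F.submodule_zero[OF sN'] b by blast
    qed
    then have "B \<subseteq> {\<zero>\<^bsub>?F\<^esub>}" using eq B(2) NN by blast
    then show False using B(3) F.submodule_zero[OF sB] by blast
  qed
  have "indecomposable_graded_mcm R G (?F\<lparr>carrier := N\<rparr>) (\<lambda>t. N \<inter> free_grading R G n e t)"
    unfolding indecomposable_graded_mcm_def
  proof (intro conjI notI)
    show "graded_mcm_module R G (?F\<lparr>carrier := N\<rparr>) (\<lambda>t. N \<inter> free_grading R G n e t)" by (rule mcm)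
    show "carrier (?F\<lparr>carrier := N\<rparr>) = {\<zero>\<^bsub>?F\<lparr>carrier := N\<rparr>\<^esub>} \<Longrightarrow> False" using N(2) \<kappa>(3) by auto
    assume "\<exists>A B. submodule A R (?F\<lparr>carrier := N\<rparr>) \<and> submodule B R (?F\<lparr>carrier := N\<rparr>) \<and>
      A \<noteq> {\<zero>\<^bsub>?F\<lparr>carrier := N\<rparr>\<^esub>} \<and> B \<noteq> {\<zero>\<^bsub>?F\<lparr>carrier := N\<rparr>\<^esub>} \<and>
      graded_mcm_module R G (?F\<lparr>carrier := N\<rparr>\<lparr>carrier := A\<rparr>) (\<lambda>i. A \<inter> (N \<inter> free_grading R G n e i)) \<and>
      graded_mcm_module R G (?F\<lparr>carrier := N\<rparr>\<lparr>carrier := B\<rparr>) (\<lambda>i. B \<inter> (N \<inter> free_grading R G n e i)) \<and>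
      A \<inter> B = {\<zero>\<^bsub>?F\<lparr>carrier := N\<rparr>\<^esub>} \<and> A <+>\<^bsub>?F\<lparr>carrier := N\<rparr>\<^esub> B = carrier (?F\<lparr>carrier := N\<rparr>)"
    then obtain A B where A: "submodule A R (?F\<lparr>carrier := N\<rparr>)" and B: "submodule B R (?F\<lparr>carrier := N\<rparr>)"
      and ne: "A \<noteq> {\<zero>\<^bsub>?F\<^esub>}" "B \<noteq> {\<zero>\<^bsub>?F\<^esub>}"
      and mA: "graded_mcm_module R G (?F\<lparr>carrier := A\<rparr>) (\<lambda>i. A \<inter> (N \<inter> free_grading R G n e i))"
      and mB: "graded_mcm_module R G (?F\<lparr>carrier := B\<rparr>) (\<lambda>i. B \<inter> (N \<inter> free_grading R G n e i))"
      and AB: "A \<inter> B = {\<zero>\<^bsub>?F\<^esub>}" "A <+>\<^bsub>?F\<lparr>carrier := N\<rparr>\<^esub> B = N" by auto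
    note tA = F.submodule_trans[OF sN A] and tB = F.submodule_trans[OF sN B]
    have gA: "graded_submodule R G n e A"
      by (rule graded_submodule_of_internal_direct_sum[OF tA(1)])
        (use mA in \<open>auto simp: graded_mcm_module_def graded_module_def\<close>)
    have gB: "graded_submodule R G n e B"
      by (rule graded_submodule_of_internal_direct_sum[OF tB(1)])
        (use mB in \<open>auto simp: graded_mcm_module_def graded_module_def\<close>)
    have decN: "\<exists>a\<in>A. \<exists>b\<in>B. u = a \<oplus>\<^bsub>?F\<^esub> b" if u: "u \<in> N" for u
    proof -
      have "u \<in> A <+>\<^bsub>?F\<lparr>carrier := N\<rparr>\<^esub> B" using AB(2) u by simp
      then show ?thesis unfolding set_add_def' by auto
    qed
    have decN': "\<exists>b\<in>B. \<exists>a\<in>A. u = b \<oplus>\<^bsub>?F\<^esub> a" if u: "u \<in> N" for u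
    proof -
      obtain a b where ab: "a \<in> A" "b \<in> B" "u = a \<oplus>\<^bsub>?F\<^esub> b" using decN[OF u] by blast
      have "u = b \<oplus>\<^bsub>?F\<^esub> a"
        using ab F.submodule_carrier[OF tA(1)] F.submodule_carrier[OF tB(1)] by (simp add: F.a_comm)
      then show ?thesis using ab by blast
    qed
    have \<kappa>A: "\<kappa> \<notin> A" by (rule no[OF gA tA(2) gB tB(2) ne(2) AB(1) decN])
    have \<kappa>B: "\<kappa> \<notin> B" by (rule no[OF gB tB(2) gA tA(2) ne(1) _ decN']) (use AB(1) in blast)+
    obtain a b where ab: "a \<in> A" "b \<in> B" "\<kappa> = a \<oplus>\<^bsub>?F\<^esub> b" using decN[OF N(2)] by blast
    have abF: "a \<in> carrier ?F" "b \<in> carrier ?F"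
      using ab F.submodule_carrier[OF tA(1)] F.submodule_carrier[OF tB(1)] by auto
    \<comment> \<open>Passing to degree \<delta> makes the A-part of \<kappa> a scalar multiple x of
      \<kappa>. If x is nonzero, \<kappa> lies in A; if x is zero, \<kappa> equals its
      B-part.\<close>
    let ?a = "free_component R G n e \<delta> a" and ?b = "free_component R G n e \<delta> b"
    have \<kappa>ab: "\<kappa> = ?a \<oplus>\<^bsub>?F\<^esub> ?b"
      using free_component_of_grading[OF \<kappa>(2), of \<delta>] free_component_add[OF abF, of e \<delta>] ab(3) by simp
    have aA: "?a \<in> A" "?b \<in> B" using gA gB ab unfolding graded_submodule_def by auto
    obtain x where x: "x \<in> G 0" "?a = x \<odot>\<^bsub>?F\<^esub> \<kappa>"
      using low[of ?a] aA(1) tA(2) NU(1) free_component_grading[OF abF(1)] by blast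
    have \<kappa>F: "\<kappa> \<in> carrier ?F" by (rule NF[OF N(2)])
    show False
    proof (cases "x = \<zero>")
      case True
      then have "\<kappa> = ?b" using \<kappa>ab x(2) \<kappa>F free_component_closed[OF abF(2)] by simp
      then show False using aA(2) \<kappa>B by simp
    next
      case False
      then have "x \<in> G 0 - {\<zero>}" using x(1) by blast
      from subfield_m_inv[OF degree_0_field this]
      have i: "inv x \<in> carrier R" "inv x \<otimes> x = \<one>" using degree_carrier by auto
      have "inv x \<odot>\<^bsub>?F\<^esub> ?a \<in> A" by (rule F.submodule_smult[OF tA(1) i(1) aA(1)])
      moreover have "inv x \<odot>\<^bsub>?F\<^esub> ?a = \<kappa>"
        unfolding x(2) using i degree_carrier[OF x(1)] \<kappa>F by (simp add: F.smult_assoc1[symmetric])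
      ultimately show False using \<kappa>A by simp
    qed
  qed
  then show ?thesis using N by blast
qed

lemma graded_isomorphic_add_mults:
  assumes M: "module R M" and N: "module R N" and xs: "set xs \<subseteq> carrier R"
    and f: "bij_betw f (carrier M) (carrier N)"
      "\<And>x y. x \<in> carrier M \<Longrightarrow> y \<in> carrier M \<Longrightarrow> f (x \<oplus>\<^bsub>M\<^esub> y) = f x \<oplus>\<^bsub>N\<^esub> f y"
      "\<And>a x. a \<in> carrier R \<Longrightarrow> x \<in> carrier M \<Longrightarrow> f (a \<odot>\<^bsub>M\<^esub> x) = a \<odot>\<^bsub>N\<^esub> f x"
    and m: "m \<in> carrier M"
  shows "m \<in> add_mults M xs (carrier M) {\<zero>\<^bsub>M\<^esub>} \<longleftrightarrow> f m \<in> add_mults N xs (carrier N) {\<zero>\<^bsub>N\<^esub>}"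
    "f \<zero>\<^bsub>M\<^esub> = \<zero>\<^bsub>N\<^esub>"
proof -
  interpret M: module R M by fact
  interpret N: module R N by fact
  have hom: "module_hom_on R M N (carrier M) (carrier N) f"
    unfolding module_hom_on_def using f bij_betwE[OF f(1)] by blast
  show f0: "f \<zero>\<^bsub>M\<^esub> = \<zero>\<^bsub>N\<^esub>"
    by (rule module_hom_on_minus(2)[OF M N M.carrier_is_submodule N.carrier_is_submodule hom m m])
  show "m \<in> add_mults M xs (carrier M) {\<zero>\<^bsub>M\<^esub>} \<longleftrightarrow> f m \<in> add_mults N xs (carrier N) {\<zero>\<^bsub>N\<^esub>}"
  proof (rule weakly_regular_transfer(2)[OF M N M.carrier_is_submodule N.carrier_is_submodule hom xs
        M.submodule_zero_set N.submodule_zero_set _ _ _ _ m])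
    show "c \<in> {\<zero>\<^bsub>M\<^esub>} \<longleftrightarrow> f c \<in> {\<zero>\<^bsub>N\<^esub>}" if "c \<in> carrier M" for c
      using inj_onD[OF bij_betw_imp_inj_on[OF f(1)], of c "\<zero>\<^bsub>M\<^esub>"] that f0 by auto
    show "\<exists>c\<in>carrier M. \<exists>b\<in>{\<zero>\<^bsub>N\<^esub>}. d = f c \<oplus>\<^bsub>N\<^esub> b" if d: "d \<in> carrier N" for d
    proof -
      obtain c where "c \<in> carrier M" "d = f c" using bij_betw_imp_surj_on[OF f(1)] d by blast
      then show ?thesis using d by (intro bexI[of _ c]) auto
    qed
  qed auto
qed

lemma indecomposable_mcm_with_colon_ideal:
  assumes ls: "set ls \<subseteq> G 1" and y: "y \<in> G r" "r \<ge> 1" and c: "c \<in> G i" "i > r"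
    and reg: "weakly_regular (self_module R) (ls @ [y]) (carrier R) {\<zero>}"
    and dim: "krull_dim R = enat (length (ls @ [y]))"
    and rad: "\<And>x. x \<in> irrelevant_ideal R G \<Longrightarrow>
      \<exists>k::nat. x [^] k \<in> add_mults (self_module R) (ls @ [y]) (carrier R) {\<zero>}"
    and inf: "infinite (G 0)"
  shows "\<exists>(M :: ('a, 'a fg_elem) module) H \<kappa> \<delta>.
    indecomposable_graded_mcm R G M H \<and> \<kappa> \<in> H \<delta> \<and> \<kappa> \<in> carrier M \<and> \<kappa> \<noteq> \<zero>\<^bsub>M\<^esub> \<and>
    H \<delta> \<subseteq> carrier M \<and> (\<forall>v\<in>H \<delta>. \<exists>a\<in>G 0. v = a \<odot>\<^bsub>M\<^esub> \<kappa>) \<and>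
    (\<forall>s\<in>carrier R. s \<odot>\<^bsub>M\<^esub> \<kappa> \<in> add_mults M (ls @ [y]) (carrier M) {\<zero>\<^bsub>M\<^esub>} \<longleftrightarrow>
       s \<in> add_mult (self_module R) c (carrier R)
         (add_mults (self_module R) (ls @ [y]) (carrier R) {\<zero>}))"
proof -
  let ?zs = "ls @ [y]"
  let ?I = "add_mult (self_module R) c (carrier R) (add_mults (self_module R) ?zs (carrier R) {\<zero>})"
  obtain n e U \<kappa> \<delta> where st: "syzygy_stage R G ?I {\<zero>} ?zs n e U \<kappa> \<delta>"
    using syzygy_stage_exists[OF ls y c reg refl] by auto
  let ?F = "free_module R n"
  interpret F: module R ?F by (rule module_free_module)
  have U: "graded_submodule R G n e U" and wr: "weakly_regular ?F ?zs U {\<zero>\<^bsub>?F\<^esub>}"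
    and \<kappa>: "\<kappa> \<in> U" "\<kappa> \<in> free_grading R G n e \<delta>"
    and inv: "\<And>s. s \<in> carrier R \<Longrightarrow> s \<odot>\<^bsub>?F\<^esub> \<kappa> \<in> add_mults ?F ?zs U {\<zero>\<^bsub>?F\<^esub>} \<longleftrightarrow> s \<in> ?I"
    and ann: "\<And>s. s \<in> carrier R \<Longrightarrow> s \<odot>\<^bsub>?F\<^esub> \<kappa> = \<zero>\<^bsub>?F\<^esub> \<Longrightarrow> s = \<zero>"
    and low: "\<And>v. v \<in> U \<Longrightarrow> v \<in> free_grading R G n e \<delta> \<Longrightarrow> \<exists>a\<in>G 0. v = a \<odot>\<^bsub>?F\<^esub> \<kappa> \<oplus>\<^bsub>?F\<^esub> \<zero>\<^bsub>?F\<^esub>"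
    using st unfolding syzygy_stage_def cube_zero by simp_all
  have \<kappa>F: "\<kappa> \<in> carrier ?F" by (rule free_grading_carrier[OF \<kappa>(2)])
  have \<kappa>0: "\<kappa> \<noteq> \<zero>\<^bsub>?F\<^esub>" using ann[OF one_closed] one_not_zero \<kappa>F by auto
  have low': "\<exists>a\<in>G 0. v = a \<odot>\<^bsub>?F\<^esub> \<kappa>" if v: "v \<in> U" "v \<in> free_grading R G n e \<delta>" for v
  proof -
    obtain a where a: "a \<in> G 0" "v = a \<odot>\<^bsub>?F\<^esub> \<kappa> \<oplus>\<^bsub>?F\<^esub> \<zero>\<^bsub>?F\<^esub>" using low[OF v] by blast
    then have "v = a \<odot>\<^bsub>?F\<^esub> \<kappa>" using \<kappa>F degree_carrier[OF a(1)] by simp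
    then show ?thesis using a(1) by blast
  qed
  have zs: "\<exists>s\<ge>1. z \<in> G s" if "z \<in> set ?zs" for z using that ls y by auto
  have zsR: "set ?zs \<subseteq> carrier R" using zs degree_carrier by blast
  obtain N N' where N: "graded_summands n e U N N'" "\<kappa> \<in> N"
    "indecomposable_graded_mcm R G (?F\<lparr>carrier := N\<rparr>) (\<lambda>t. N \<inter> free_grading R G n e t)"
    using indecomposable_summand_exists[OF U wr \<kappa> \<kappa>0 low' zs dim rad inf] by blast
  have NU: "N \<subseteq> U" and sN: "submodule N R ?F"
    using N(1) unfolding graded_summands_def graded_submodule_def by auto
  let ?M = "?F\<lparr>carrier := N\<rparr>"
  show ?thesis
  proof (intro exI conjI ballI)
    show "indecomposable_graded_mcm R G ?M (\<lambda>t. N \<inter> free_grading R G n e t)" by (rule N(3))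
    show "\<kappa> \<in> N \<inter> free_grading R G n e \<delta>" "\<kappa> \<in> carrier ?M" "\<kappa> \<noteq> \<zero>\<^bsub>?M\<^esub>" using N(2) \<kappa> \<kappa>0 by auto
    show "N \<inter> free_grading R G n e \<delta> \<subseteq> carrier ?M" by simp
    show "\<exists>a\<in>G 0. v = a \<odot>\<^bsub>?M\<^esub> \<kappa>" if "v \<in> N \<inter> free_grading R G n e \<delta>" for v
      using low'[of v] that NU by auto
    fix s assume s: "s \<in> carrier R"
    have s\<kappa>: "s \<odot>\<^bsub>?F\<^esub> \<kappa> \<in> N" by (rule F.submodule_smult[OF sN s N(2)])
    \<comment> \<open>The annihilator passes from U to the summand because \<open>zs U\<close> meets
      N in \<open>zs N\<close>.\<close>
    have "s \<odot>\<^bsub>?F\<^esub> \<kappa> \<in> add_mults ?F ?zs N {\<zero>\<^bsub>?F\<^esub>} \<longleftrightarrow> s \<odot>\<^bsub>?F\<^esub> \<kappa> \<in> add_mults ?F ?zs U {\<zero>\<^bsub>?F\<^esub>}"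
      using graded_summands_add_mults[OF N(1) zsR s\<kappa>]
        subsetD[OF add_mults_mono[OF NU order_refl, of ?F ?zs "{\<zero>\<^bsub>?F\<^esub>}"]] by blast
    then show "s \<odot>\<^bsub>?M\<^esub> \<kappa> \<in> add_mults ?M ?zs (carrier ?M) {\<zero>\<^bsub>?M\<^esub>} \<longleftrightarrow> s \<in> ?I" using inv[OF s] by simp
  qed
qed

text \<open>With countably many classes, two distinct parameters \<alpha>, \<beta> share a
  representative. The two isomorphisms together send \<kappa> of \<alpha> to x times \<kappa> of
  \<beta> for a nonzero scalar x. Since a + \<alpha> b annihilates the former modulo
  \<open>zs\<close>, x (a + \<alpha> b) lies in the ideal of \<beta>, and the independence of a and
  b allows coefficients to be compared.\<close>

lemma uncountably_many_indecomposables: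
  assumes ls: "set ls \<subseteq> G 1" and y: "y \<in> G r" "r \<ge> 1"
    and reg: "weakly_regular (self_module R) (ls @ [y]) (carrier R) {\<zero>}"
    and dim: "krull_dim R = enat (length (ls @ [y]))"
    and rad: "\<And>x. x \<in> irrelevant_ideal R G \<Longrightarrow>
      \<exists>k::nat. x [^] k \<in> add_mults (self_module R) (ls @ [y]) (carrier R) {\<zero>}"
    and unc: "uncountable (G 0)"
    and ab: "a \<in> G i" "b \<in> G i" "i > r"
    and indep: "\<And>s t. s \<in> G 0 \<Longrightarrow> t \<in> G 0 \<Longrightarrow>
      s \<otimes> a \<oplus> t \<otimes> b \<in> add_mults (self_module R) (ls @ [y]) (carrier R) {\<zero>} \<Longrightarrow> s = \<zero> \<and> t = \<zero>"
  shows "\<not> graded_countable_cm_type R G"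
proof
  assume "graded_countable_cm_type R G"
  then obtain S :: "(('a, 'a fg_elem) module \<times> (int \<Rightarrow> 'a fg_elem set)) set" where
    S: "countable S" "\<forall>(N, K)\<in>S. indecomposable_graded_mcm R G N K"
    "\<forall>(M :: ('a, 'a fg_elem) module) H. indecomposable_graded_mcm R G M H \<longrightarrow>
      (\<exists>(N, K)\<in>S. \<exists>n. graded_isomorphic R M H N (shift n K))"
    unfolding graded_countable_cm_type_def by blast
  let ?zs = "ls @ [y]" and ?S = "self_module R"
  let ?J = "add_mults ?S ?zs (carrier R) {\<zero>}"
  define c where "c \<alpha> = a \<oplus> \<alpha> \<otimes> b" for \<alpha>
  let ?I = "\<lambda>\<alpha>. add_mult ?S (c \<alpha>) (carrier R) ?J"
  have inf: "infinite (G 0)" using unc countable_finite by blast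
  have abc: "a \<in> carrier R" "b \<in> carrier R" using ab degree_carrier by auto
  have yc: "y \<in> carrier R" using degree_carrier y(1) .
  have zsR: "set ?zs \<subseteq> carrier R" using ls yc degree_carrier by auto
  have cG: "c \<alpha> \<in> G i" if "\<alpha> \<in> G 0" for \<alpha>
    unfolding c_def using degree_add[OF ab(1)] grading_mult[OF that ab(2)] by simp
  have JG: "graded_ideal R G ?J"
    unfolding add_mults_append
    using graded_ideal_add_mult[OF graded_ideal_add_mults[OF ls graded_ideal_zero
          graded_ideal_carrier] graded_ideal_carrier y(1)] by simp
  have Ji: "ideal ?J R" using JG unfolding graded_ideal_def by blast
  interpret J: ideal ?J R by (rule Ji)
  define P where "P \<alpha> M H \<kappa> \<delta> \<longleftrightarrow> indecomposable_graded_mcm R G M H \<and> \<kappa> \<in> H \<delta> \<and> \<kappa> \<in> carrier M \<and>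
      \<kappa> \<noteq> \<zero>\<^bsub>M\<^esub> \<and> H \<delta> \<subseteq> carrier M \<and> (\<forall>v\<in>H \<delta>. \<exists>a\<in>G 0. v = a \<odot>\<^bsub>M\<^esub> \<kappa>) \<and>
      (\<forall>s\<in>carrier R. s \<odot>\<^bsub>M\<^esub> \<kappa> \<in> add_mults M ?zs (carrier M) {\<zero>\<^bsub>M\<^esub>} \<longleftrightarrow> s \<in> ?I \<alpha>)"
    for \<alpha> and M :: "('a, 'a fg_elem) module" and H and \<kappa> and \<delta> :: int
  have "\<exists>M H \<kappa> \<delta>. P \<alpha> M H \<kappa> \<delta>" if "\<alpha> \<in> G 0" for \<alpha>
    unfolding P_def
    by (rule indecomposable_mcm_with_colon_ideal[OF ls y cG[OF that] ab(3) reg dim rad inf])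
  then have "\<forall>\<alpha>\<in>G 0. \<exists>p. P \<alpha> (fst p) (fst (snd p)) (fst (snd (snd p))) (snd (snd (snd p)))"
    by simp
  then obtain p where p: "\<forall>\<alpha>\<in>G 0. P \<alpha> (fst (p \<alpha>)) (fst (snd (p \<alpha>))) (fst (snd (snd (p \<alpha>))))
      (snd (snd (snd (p \<alpha>))))" by (rule bchoice[THEN exE])
  define M where "M \<alpha> = fst (p \<alpha>)" for \<alpha>
  define H where "H \<alpha> = fst (snd (p \<alpha>))" for \<alpha>
  define \<kappa> where "\<kappa> \<alpha> = fst (snd (snd (p \<alpha>)))" for \<alpha>
  define \<delta> where "\<delta> \<alpha> = snd (snd (snd (p \<alpha>)))" for \<alpha>
  have P: "P \<alpha> (M \<alpha>) (H \<alpha>) (\<kappa> \<alpha>) (\<delta> \<alpha>)" if "\<alpha> \<in> G 0" for \<alpha>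
    using p that unfolding M_def H_def \<kappa>_def \<delta>_def by (rule bspec)
  let ?Q = "\<lambda>\<alpha> s. fst s \<in> S \<and> graded_isomorphic R (M \<alpha>) (H \<alpha>) (fst (fst s)) (shift (snd s) (snd (fst s)))"
  have ex: "\<exists>s. ?Q \<alpha> s" if \<alpha>: "\<alpha> \<in> G 0" for \<alpha>
  proof -
    have "\<exists>(N, K)\<in>S. \<exists>n. graded_isomorphic R (M \<alpha>) (H \<alpha>) N (shift n K)"
    proof (rule S(3)[rule_format])
      show "indecomposable_graded_mcm R G (M \<alpha>) (H \<alpha>)" using P[OF \<alpha>] unfolding P_def by (rule conjunct1)
    qed
    then obtain N K n where "(N, K) \<in> S" "graded_isomorphic R (M \<alpha>) (H \<alpha>) N (shift n K)"
      by (elim bexE) (simp split: prod.splits, elim exE)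
    then show ?thesis by (intro exI[of _ "((N, K), n)"]) simp
  qed
  then have "\<forall>\<alpha>\<in>G 0. \<exists>s. ?Q \<alpha> s" by (intro ballI)
  then obtain s where s0: "\<forall>\<alpha>\<in>G 0. ?Q \<alpha> (s \<alpha>)" by (rule bchoice[THEN exE])
  have s: "fst (s \<alpha>) \<in> S"
    "graded_isomorphic R (M \<alpha>) (H \<alpha>) (fst (fst (s \<alpha>))) (shift (snd (s \<alpha>)) (snd (fst (s \<alpha>))))"
    if "\<alpha> \<in> G 0" for \<alpha>
    using bspec[OF s0 that] by simp_all
  \<comment> \<open>Besides representative and shift, the degree of \<kappa> is recorded, which
    costs only a factor of integers. When all three agree, both isomorphisms carry the components of
    their \<kappa> onto the same component of N.\<close>
  let ?g = "\<lambda>\<alpha>. (s \<alpha>, \<delta> \<alpha>)"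
  have "?g ` G 0 \<subseteq> (S \<times> UNIV) \<times> UNIV" by (rule image_subsetI) (simp add: mem_Times_iff s(1))
  moreover have "countable ((S \<times> (UNIV :: int set)) \<times> (UNIV :: int set))" using S(1) by simp
  ultimately have "countable (?g ` G 0)" by (rule countable_subset)
  then have "\<not> inj_on ?g (G 0)" using unc countable_image_inj_on by blast
  then obtain \<alpha> \<beta> where \<alpha>\<beta>: "\<alpha> \<in> G 0" "\<beta> \<in> G 0" "\<alpha> \<noteq> \<beta>" "s \<alpha> = s \<beta>" "\<delta> \<alpha> = \<delta> \<beta>"
    unfolding inj_on_def by auto
  obtain N K n where NK: "s \<beta> = ((N, K), n)" by (metis prod.exhaust)
  have iso\<alpha>: "graded_isomorphic R (M \<alpha>) (H \<alpha>) N (shift n K)"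
    and iso\<beta>: "graded_isomorphic R (M \<beta>) (H \<beta>) N (shift n K)"
    using s(2)[OF \<alpha>\<beta>(1)] s(2)[OF \<alpha>\<beta>(2)] \<alpha>\<beta>(4) NK by auto
  have "indecomposable_graded_mcm R G N K" using s(1)[OF \<alpha>\<beta>(2)] NK S(2) by auto
  then have mN: "module R N"
    unfolding indecomposable_graded_mcm_def graded_mcm_module_def graded_module_def by blast
  have mM: "module R (M \<alpha>)" if "\<alpha> \<in> G 0" for \<alpha>
    using P[OF that]
    unfolding P_def indecomposable_graded_mcm_def graded_mcm_module_def graded_module_def by blast
  interpret M\<alpha>: module R "M \<alpha>" by (rule mM[OF \<alpha>\<beta>(1)])
  interpret M\<beta>: module R "M \<beta>" by (rule mM[OF \<alpha>\<beta>(2)])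
  obtain f where f0: "bij_betw f (carrier (M \<alpha>)) (carrier N) \<and>
      (\<forall>x\<in>carrier (M \<alpha>). \<forall>y\<in>carrier (M \<alpha>). f (x \<oplus>\<^bsub>M \<alpha>\<^esub> y) = f x \<oplus>\<^bsub>N\<^esub> f y) \<and>
      (\<forall>a\<in>carrier R. \<forall>x\<in>carrier (M \<alpha>). f (a \<odot>\<^bsub>M \<alpha>\<^esub> x) = a \<odot>\<^bsub>N\<^esub> f x) \<and>
      (\<forall>i. f ` H \<alpha> i = shift n K i)"
    using iso\<alpha> unfolding graded_isomorphic_def by (rule exE)
  have f: "bij_betw f (carrier (M \<alpha>)) (carrier N)"
    "\<And>x y. x \<in> carrier (M \<alpha>) \<Longrightarrow> y \<in> carrier (M \<alpha>) \<Longrightarrow> f (x \<oplus>\<^bsub>M \<alpha>\<^esub> y) = f x \<oplus>\<^bsub>N\<^esub> f y"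
    "\<And>a x. a \<in> carrier R \<Longrightarrow> x \<in> carrier (M \<alpha>) \<Longrightarrow> f (a \<odot>\<^bsub>M \<alpha>\<^esub> x) = a \<odot>\<^bsub>N\<^esub> f x"
    "\<And>i. f ` H \<alpha> i = shift n K i"
    using f0 by simp_all
  obtain g where g0: "bij_betw g (carrier (M \<beta>)) (carrier N) \<and>
      (\<forall>x\<in>carrier (M \<beta>). \<forall>y\<in>carrier (M \<beta>). g (x \<oplus>\<^bsub>M \<beta>\<^esub> y) = g x \<oplus>\<^bsub>N\<^esub> g y) \<and>
      (\<forall>a\<in>carrier R. \<forall>x\<in>carrier (M \<beta>). g (a \<odot>\<^bsub>M \<beta>\<^esub> x) = a \<odot>\<^bsub>N\<^esub> g x) \<and>
      (\<forall>i. g ` H \<beta> i = shift n K i)"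
    using iso\<beta> unfolding graded_isomorphic_def by (rule exE)
  have g: "bij_betw g (carrier (M \<beta>)) (carrier N)"
    "\<And>x y. x \<in> carrier (M \<beta>) \<Longrightarrow> y \<in> carrier (M \<beta>) \<Longrightarrow> g (x \<oplus>\<^bsub>M \<beta>\<^esub> y) = g x \<oplus>\<^bsub>N\<^esub> g y"
    "\<And>a x. a \<in> carrier R \<Longrightarrow> x \<in> carrier (M \<beta>) \<Longrightarrow> g (a \<odot>\<^bsub>M \<beta>\<^esub> x) = a \<odot>\<^bsub>N\<^esub> g x"
    "\<And>i. g ` H \<beta> i = shift n K i"
    using g0 by simp_all
  have \<kappa>\<alpha>: "\<kappa> \<alpha> \<in> H \<alpha> (\<delta> \<alpha>)" "\<kappa> \<alpha> \<in> carrier (M \<alpha>)" "\<kappa> \<alpha> \<noteq> \<zero>\<^bsub>M \<alpha>\<^esub>"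
    and inv\<alpha>: "\<And>s. s \<in> carrier R \<Longrightarrow>
      s \<odot>\<^bsub>M \<alpha>\<^esub> \<kappa> \<alpha> \<in> add_mults (M \<alpha>) ?zs (carrier (M \<alpha>)) {\<zero>\<^bsub>M \<alpha>\<^esub>} \<longleftrightarrow> s \<in> ?I \<alpha>"
    using P[OF \<alpha>\<beta>(1)] unfolding P_def by simp_all
  have \<kappa>\<beta>: "\<kappa> \<beta> \<in> carrier (M \<beta>)" "H \<beta> (\<delta> \<beta>) \<subseteq> carrier (M \<beta>)"
    and low\<beta>: "\<And>v. v \<in> H \<beta> (\<delta> \<beta>) \<Longrightarrow> \<exists>a\<in>G 0. v = a \<odot>\<^bsub>M \<beta>\<^esub> \<kappa> \<beta>"
    and inv\<beta>: "\<And>s. s \<in> carrier R \<Longrightarrow>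
      s \<odot>\<^bsub>M \<beta>\<^esub> \<kappa> \<beta> \<in> add_mults (M \<beta>) ?zs (carrier (M \<beta>)) {\<zero>\<^bsub>M \<beta>\<^esub>} \<longleftrightarrow> s \<in> ?I \<beta>"
    using P[OF \<alpha>\<beta>(2)] unfolding P_def by simp_all
  have "f (\<kappa> \<alpha>) \<in> g ` H \<beta> (\<delta> \<beta>)"
    using \<kappa>\<alpha>(1) f(4)[of "\<delta> \<alpha>"] g(4)[of "\<delta> \<beta>"] \<alpha>\<beta>(5) by (metis imageI)
  then obtain \<xi> where \<xi>: "\<xi> \<in> H \<beta> (\<delta> \<beta>)" "g \<xi> = f (\<kappa> \<alpha>)" by (metis imageE)
  obtain x where x: "x \<in> G 0" "\<xi> = x \<odot>\<^bsub>M \<beta>\<^esub> \<kappa> \<beta>" using low\<beta>[OF \<xi>(1)] by blast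
  have xc: "x \<in> carrier R" by (rule degree_carrier[OF x(1)])
  have c\<alpha>: "c \<alpha> \<in> carrier R" and c\<beta>: "c \<beta> \<in> carrier R" using cG \<alpha>\<beta>(1,2) degree_carrier by auto
  note isof = graded_isomorphic_add_mults[OF mM[OF \<alpha>\<beta>(1)] mN zsR f(1-3)]
  note isog = graded_isomorphic_add_mults[OF mM[OF \<alpha>\<beta>(2)] mN zsR g(1-3)]
  have f0': "f \<zero>\<^bsub>M \<alpha>\<^esub> = \<zero>\<^bsub>N\<^esub>" by (rule isof(2)) (use \<kappa>\<alpha>(2) in auto)
  have g0': "g \<zero>\<^bsub>M \<beta>\<^esub> = \<zero>\<^bsub>N\<^esub>" by (rule isog(2)) (use \<kappa>\<beta>(1) in auto)
  have sC: "submodule (carrier R) R ?S"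
    using module.carrier_is_submodule[OF module_self_module] by simp
  \<comment> \<open>Only the generator c \<alpha> of the ideal of \<alpha> is transported; the
    reverse inclusion of ideals does not have to be followed.\<close>
  have "c \<alpha> \<otimes> \<one> \<in> ?I \<alpha>"
    using module.smult_mem_add_mult[OF module_self_module c\<alpha> sC _ one_closed, of ?J] Ji
    by (simp add: submodule_self_iff)
  then have "c \<alpha> \<odot>\<^bsub>M \<alpha>\<^esub> \<kappa> \<alpha> \<in> add_mults (M \<alpha>) ?zs (carrier (M \<alpha>)) {\<zero>\<^bsub>M \<alpha>\<^esub>}"
    using inv\<alpha>[OF c\<alpha>] c\<alpha> by simp
  then have "f (c \<alpha> \<odot>\<^bsub>M \<alpha>\<^esub> \<kappa> \<alpha>) \<in> add_mults N ?zs (carrier N) {\<zero>\<^bsub>N\<^esub>}"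
    by (subst isof(1)[symmetric]) (use c\<alpha> \<kappa>\<alpha>(2) in auto)
  moreover have "f (c \<alpha> \<odot>\<^bsub>M \<alpha>\<^esub> \<kappa> \<alpha>) = g ((c \<alpha> \<otimes> x) \<odot>\<^bsub>M \<beta>\<^esub> \<kappa> \<beta>)"
    using f(3)[OF c\<alpha> \<kappa>\<alpha>(2)] g(3)[OF c\<alpha>, of \<xi>] \<xi> \<kappa>\<beta> x(2) c\<alpha> xc by (auto simp: M\<beta>.smult_assoc1)
  ultimately have "g ((c \<alpha> \<otimes> x) \<odot>\<^bsub>M \<beta>\<^esub> \<kappa> \<beta>) \<in> add_mults N ?zs (carrier N) {\<zero>\<^bsub>N\<^esub>}" by simp
  then have "(c \<alpha> \<otimes> x) \<odot>\<^bsub>M \<beta>\<^esub> \<kappa> \<beta> \<in> add_mults (M \<beta>) ?zs (carrier (M \<beta>)) {\<zero>\<^bsub>M \<beta>\<^esub>}"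
    by (subst isog(1)) (use c\<alpha> xc \<kappa>\<beta>(1) in auto)
  then have "c \<alpha> \<otimes> x \<in> ?I \<beta>" using inv\<beta>[of "c \<alpha> \<otimes> x"] c\<alpha> xc by simp
  then obtain j q where j: "j \<in> ?J" "q \<in> carrier R" "c \<alpha> \<otimes> x = j \<oplus> c \<beta> \<otimes> q"
    unfolding add_mult_def by auto
  \<comment> \<open>In degree i the coefficient of c \<beta> is replaced by its constant term, which
    leaves a linear combination of a and b in (zs).\<close>
  let ?q = "component R G 0 q" and ?j = "component R G (int i) j"
  have q: "?q \<in> G 0" using component_int_grading[OF j(2), of 0] by (simp add: int_grading_def)
  have jJ: "?j \<in> ?J" using JG j(1) unfolding graded_ideal_def by blast
  have qc: "?q \<in> carrier R" and jc: "?j \<in> carrier R" "j \<in> carrier R"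
    using degree_carrier[OF q] J.Icarr[OF jJ] J.Icarr[OF j(1)] by auto
  have \<alpha>c: "\<alpha> \<in> carrier R" "\<beta> \<in> carrier R" using \<alpha>\<beta>(1,2) degree_carrier by auto
  have "c \<alpha> \<otimes> x \<in> G i" using grading_mult[OF cG[OF \<alpha>\<beta>(1)] x(1)] by simp
  then have "c \<alpha> \<otimes> x = component R G (int i) (c \<alpha> \<otimes> x)" using component_degree by simp
  also have "\<dots> = ?j \<oplus> c \<beta> \<otimes> ?q"
    unfolding j(3) using component_mult[OF cG[OF \<alpha>\<beta>(2)] j(2), of "int i"] jc j(2) c\<beta>
    by (simp add: component_add)
  finally have e: "c \<alpha> \<otimes> x = ?j \<oplus> c \<beta> \<otimes> ?q" .
  have "(x \<ominus> ?q) \<otimes> a \<oplus> (\<alpha> \<otimes> x \<ominus> \<beta> \<otimes> ?q) \<otimes> b = c \<alpha> \<otimes> x \<ominus> c \<beta> \<otimes> ?q"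
    unfolding c_def using abc \<alpha>c xc qc by algebra
  also have "\<dots> = ?j" unfolding e using c\<beta> qc jc by algebra
  finally have "(x \<ominus> ?q) \<otimes> a \<oplus> (\<alpha> \<otimes> x \<ominus> \<beta> \<otimes> ?q) \<otimes> b \<in> ?J" using jJ by simp
  moreover have "x \<ominus> ?q \<in> G 0" "\<alpha> \<otimes> x \<ominus> \<beta> \<otimes> ?q \<in> G 0"
    using degree_diff x(1) q grading_mult[OF \<alpha>\<beta>(1) x(1)] grading_mult[OF \<alpha>\<beta>(2) q] by simp_all
  ultimately have z: "x \<ominus> ?q = \<zero>" "\<alpha> \<otimes> x \<ominus> \<beta> \<otimes> ?q = \<zero>" using indep by auto
  then have "x = ?q" "\<alpha> \<otimes> x = \<beta> \<otimes> x" using xc qc \<alpha>c by auto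
  have "x \<noteq> \<zero>"
  proof
    assume "x = \<zero>"
    then have "\<xi> = \<zero>\<^bsub>M \<beta>\<^esub>" using x(2) \<kappa>\<beta>(1) by simp
    then have "f (\<kappa> \<alpha>) = f \<zero>\<^bsub>M \<alpha>\<^esub>" using \<xi>(2) f0' g0' by simp
    then show False using inj_onD[OF bij_betw_imp_inj_on[OF f(1)]] \<kappa>\<alpha>(2,3) by auto
  qed
  then have "x \<in> G 0 - {\<zero>}" using x(1) by blast
  from subfield_m_inv[OF degree_0_field this]
  have i: "inv x \<in> carrier R" "x \<otimes> inv x = \<one>" using degree_carrier by auto
  have "\<alpha> = (\<alpha> \<otimes> x) \<otimes> inv x" using \<alpha>c xc i by (simp add: m_assoc)
  also have "\<dots> = (\<beta> \<otimes> x) \<otimes> inv x" using \<open>\<alpha> \<otimes> x = \<beta> \<otimes> x\<close> by simp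
  also have "\<dots> = \<beta>" using \<alpha>c xc i by (simp add: m_assoc)
  finally show False using \<alpha>\<beta>(3) by simp
qed

end

section \<open>Minimal reductions\<close>

lemma weakly_regular_take:
  "weakly_regular M xs C A \<Longrightarrow> weakly_regular M (take n xs) C A"
  unfolding weakly_regular_iff_nth by (simp add: min_def)

context standard_graded_ring
begin

text \<open>In an ideal P maximal among those over J missing S, adjoining a or b outside P meets S.
  The product of the two elements of S so obtained lies in P + (ab), so ab is not in P.\<close>

lemma prime_ideal_avoiding:
  assumes J: "ideal J R" and S: "S \<subseteq> carrier R" "\<one> \<in> S" "\<And>s t. s \<in> S \<Longrightarrow> t \<in> S \<Longrightarrow> s \<otimes> t \<in> S"
    and JS: "J \<inter> S = {}"
  shows "\<exists>P. primeideal P R \<and> J \<subseteq> P \<and> P \<inter> S = {}"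
proof -
  interpret M: module R "self_module R" by (rule module_self_module)
  let ?Fam = "{I. ideal I R \<and> J \<subseteq> I \<and> I \<inter> S = {}}"
  have ne: "?Fam \<noteq> {}" using J JS by blast
  have "\<exists>P\<in>?Fam. \<forall>I\<in>?Fam. P \<subseteq> I \<longrightarrow> I = P"
    by (rule noetherian_module_maximal[OF noetherian_self_module[OF is_cring] ne])
      (simp add: submodule_self_iff)
  then obtain P where P: "P \<in> ?Fam" "\<forall>I\<in>?Fam. P \<subseteq> I \<longrightarrow> I = P" by (rule bexE)
  have Pi: "ideal P R" and JP: "J \<subseteq> P" and PS: "P \<inter> S = {}" using P(1) by auto
  note Pc = ideal.Icarr[OF Pi]
  have meet: "\<exists>s\<in>S. \<exists>p\<in>P. \<exists>r\<in>carrier R. s = p \<oplus> a \<otimes> r" if a: "a \<in> carrier R" "a \<notin> P" for a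
  proof (rule ccontr)
    assume no: "\<not> ?thesis"
    let ?A = "add_mult (self_module R) a (carrier R) P"
    have sP: "submodule P R (self_module R)" using Pi by (simp add: submodule_self_iff)
    have sC: "submodule (carrier R) R (self_module R)" using M.carrier_is_submodule by simp
    have A: "ideal ?A R" by (rule ideal_add_mult[OF a(1) Pi oneideal])
    have PA: "P \<subseteq> ?A" by (rule M.add_mult_superset[OF a(1) sC]) (use Pc in auto)
    have "?A \<inter> S = {}" using no unfolding add_mult_def by auto
    then have "?A \<in> ?Fam" using A PA JP by auto
    then have "?A = P" using P(2) PA by blast
    moreover have "a \<otimes> \<one> \<in> ?A" using M.smult_mem_add_mult[OF a(1) sC sP one_closed] by simp
    ultimately show False using a by simp
  qed
  have "primeideal P R"
  proof (rule primeidealI[OF Pi is_cring])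
    show "carrier R \<noteq> P" using S(1,2) PS by blast
    fix a b assume a: "a \<in> carrier R" and b: "b \<in> carrier R" and ab: "a \<otimes> b \<in> P"
    show "a \<in> P \<or> b \<in> P"
    proof (rule ccontr)
      assume "\<not> (a \<in> P \<or> b \<in> P)"
      then obtain s p r t q u where s: "s \<in> S" "p \<in> P" "r \<in> carrier R" "s = p \<oplus> a \<otimes> r"
        and t: "t \<in> S" "q \<in> P" "u \<in> carrier R" "t = q \<oplus> b \<otimes> u"
        using meet[OF a] meet[OF b] by blast
      interpret P: ideal P R by (rule Pi)
      have "s \<otimes> t = p \<otimes> t \<oplus> ((a \<otimes> r) \<otimes> q \<oplus> (a \<otimes> b) \<otimes> (r \<otimes> u))"
        unfolding s(4) t(4) using a b s(3) t(3) Pc[OF s(2)] Pc[OF t(2)] by algebra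
      moreover have "p \<otimes> t \<oplus> ((a \<otimes> r) \<otimes> q \<oplus> (a \<otimes> b) \<otimes> (r \<otimes> u)) \<in> P"
        using P.I_r_closed[OF s(2), of t] P.I_l_closed[OF t(2), of "a \<otimes> r"]
          P.I_r_closed[OF ab, of "r \<otimes> u"] a s(3) t(1,3) S(1) by (auto intro: P.a_closed)
      ultimately show False using S(3)[OF s(1) t(1)] PS by auto
    qed
  qed
  then show ?thesis using JP PS by blast
qed

text \<open>The last element x is regular modulo the ideal J of the others, so no product x^k t with
  t outside P lies in J. A prime over J avoiding all these products sits inside P, strictly since it
  misses x, and continues the chain downwards. This bounds the height from below without
  localisation.\<close>

lemma prime_chain_of_weakly_regular:
  assumes "set xs \<subseteq> carrier R" "weakly_regular (self_module R) xs (carrier R) {\<zero>}"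
    "primeideal P R" "set xs \<subseteq> P"
  shows "\<exists>Q. (\<forall>i\<le>length xs. primeideal (Q i) R) \<and> (\<forall>i<length xs. Q i \<subset> Q (Suc i)) \<and>
    Q (length xs) = P"
  using assms
proof (induction xs arbitrary: P rule: rev_induct)
  case Nil
  then show ?case by (intro exI[of _ "\<lambda>_. P"]) simp
next
  case (snoc x xs)
  interpret M: module R "self_module R" by (rule module_self_module)
  interpret P: primeideal P R by fact
  let ?J = "add_mults (self_module R) xs (carrier R) {\<zero>}"
  have x: "x \<in> carrier R" "x \<in> P" and xs: "set xs \<subseteq> carrier R" "set xs \<subseteq> P" using snoc.prems by auto
  have wr: "weakly_regular (self_module R) xs (carrier R) {\<zero>}"
    "regular_on (self_module R) x (carrier R) ?J"
    using snoc.prems(2) by (auto simp: weakly_regular_append)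
  have J: "ideal ?J R" by (rule ideal_add_mults[OF xs(1) zeroideal oneideal])
  have sJ: "submodule ?J R (self_module R)" using J by (simp add: submodule_self_iff)
  have sC: "submodule (carrier R) R (self_module R)" using M.carrier_is_submodule by simp
  have JP: "?J \<subseteq> P"
    by (rule M.add_mults_least)
      (use P.is_ideal P.zero_closed P.I_r_closed subsetD[OF xs(2)] in \<open>simp_all add: submodule_self_iff\<close>)
  \<comment> \<open>Avoiding the elements t outside P (the case k = 0) gives containment in P, and
    avoiding x (the case k = 1, t = 1) makes it strict.\<close>
  let ?S = "{x [^] k \<otimes> t | (k::nat) t. t \<in> carrier R \<and> t \<notin> P}"
  have one: "\<one> \<notin> P" using P.I_notcarr P.one_imp_carrier by blast
  have Smem: "x [^] k \<otimes> t \<in> ?S" if "t \<in> carrier R" "t \<notin> P" for k :: nat and t using that by blast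
  have JS: "?J \<inter> ?S = {}"
  proof (rule ccontr)
    assume "?J \<inter> ?S \<noteq> {}"
    then obtain k :: nat and t where t: "x [^] k \<otimes> t \<in> ?J" "t \<in> carrier R" "t \<notin> P" by blast
    have "t \<in> ?J" using t(1)
    proof (induction k)
      case (Suc k)
      have "x \<otimes> (x [^] k \<otimes> t) = x [^] Suc k \<otimes> t"
        using x t(2) by (simp add: m_assoc[symmetric] m_comm)
      then have "x [^] k \<otimes> t \<in> ?J"
        using M.regular_onD[OF wr(2), of "x [^] k \<otimes> t"] Suc.prems x(1) t(2) by simp
      then show ?case by (rule Suc.IH)
    qed (use t(2) in simp)
    then show False using JP t(3) by blast
  qed
  have "\<exists>Q. primeideal Q R \<and> ?J \<subseteq> Q \<and> Q \<inter> ?S = {}"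
  proof (rule prime_ideal_avoiding[OF J _ _ _ JS])
    show "?S \<subseteq> carrier R" using x by auto
    show "\<one> \<in> ?S" using Smem[OF one_closed one, of 0] by simp
    fix s t assume "s \<in> ?S" "t \<in> ?S"
    then obtain k l :: nat and p q where p: "s = x [^] k \<otimes> p" "p \<in> carrier R" "p \<notin> P"
      and q: "t = x [^] l \<otimes> q" "q \<in> carrier R" "q \<notin> P" by blast
    have "s \<otimes> t = (x [^] k \<otimes> x [^] l) \<otimes> (p \<otimes> q)"
      unfolding p(1) q(1) using x p(2) q(2) by (simp add: m_ac)
    also have "\<dots> = x [^] (k + l) \<otimes> (p \<otimes> q)" using x by (simp add: nat_pow_mult)
    finally show "s \<otimes> t \<in> ?S"
      using Smem[of "p \<otimes> q" "k + l"] P.I_prime[OF p(2) q(2)] p(2,3) q(2,3) by auto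
  qed
  then obtain Q where Q: "primeideal Q R" "?J \<subseteq> Q" "Q \<inter> ?S = {}" by blast
  interpret Q: primeideal Q R by (rule Q(1))
  have QP: "Q \<subseteq> P"
  proof
    fix t assume t: "t \<in> Q"
    show "t \<in> P"
    proof (rule ccontr)
      assume "t \<notin> P"
      then have "t \<in> ?S" using Smem[of t 0] Q.Icarr[OF t] by simp
      then show False using Q(3) t by blast
    qed
  qed
  have "x \<in> ?S" using Smem[OF one_closed one, of 1] x by simp
  then have "Q \<subset> P" using QP x(2) Q(3) by blast
  have "set xs \<subseteq> Q"
  proof
    fix z assume z: "z \<in> set xs"
    have "z \<otimes> \<one> \<in> ?J"
      using M.smult_mem_add_mults[OF xs(1) sC M.submodule_zero_set one_closed z] by simp
    moreover have "z \<otimes> \<one> = z" by (rule r_one) (use z xs(1) in blast)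
    ultimately have "z \<in> ?J" by simp
    then show "z \<in> Q" using Q(2) by blast
  qed
  then obtain C where C: "\<forall>i\<le>length xs. primeideal (C i) R" "\<forall>i<length xs. C i \<subset> C (Suc i)"
    "C (length xs) = Q" using snoc.IH[OF xs(1) wr(1) Q(1)] by blast
  show ?case
    by (intro exI[of _ "C(Suc (length xs) := P)"])
      (use C \<open>Q \<subset> P\<close> snoc.prems(3) in \<open>auto simp: less_Suc_eq le_Suc_eq\<close>)
qed

lemma primeideal_irrelevant: "primeideal (irrelevant_ideal R G) R"
proof (rule primeidealI[OF ideal_irrelevant is_cring])
  have "\<one> \<notin> irrelevant_ideal R G"
    using component_degree[OF one_degree_0, of 0] one_not_zero by (simp add: irrelevant_ideal_iff)
  then show "carrier R \<noteq> irrelevant_ideal R G" using one_closed by blast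
  fix a b assume a: "a \<in> carrier R" and b: "b \<in> carrier R" and ab: "a \<otimes> b \<in> irrelevant_ideal R G"
  have z: "component R G 0 a \<otimes> component R G 0 b = \<zero>"
    using ab component_0_mult[OF a b] by (simp add: irrelevant_ideal_iff)
  have "component R G 0 a \<in> G 0" "component R G 0 b \<in> G 0"
    using component_int_grading[OF a, of 0] component_int_grading[OF b, of 0]
    by (simp_all add: int_grading_def)
  then have "component R G 0 a = \<zero> \<or> component R G 0 b = \<zero>"
    using subfieldE(5)[OF degree_0_field] z by blast
  then show "a \<in> irrelevant_ideal R G \<or> b \<in> irrelevant_ideal R G"
    using a b by (simp add: irrelevant_ideal_iff)
qed

text \<open>A smaller prime P over \<open>zs\<close> already tops a chain with
  \<open>length zs\<close> strict inclusions, and the irrelevant ideal above it would make the chain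
  longer than the dimension allows.\<close>

lemma prime_over_weakly_regular:
  assumes zs: "set zs \<subseteq> carrier R" "weakly_regular (self_module R) zs (carrier R) {\<zero>}"
    and dim: "krull_dim R = enat (length zs)"
    and P: "primeideal P R" "set zs \<subseteq> P" "P \<subseteq> irrelevant_ideal R G"
  shows "P = irrelevant_ideal R G"
proof (rule ccontr)
  assume "P \<noteq> irrelevant_ideal R G"
  then have lt: "P \<subset> irrelevant_ideal R G" using P(3) by blast
  obtain Q where Q: "\<forall>i\<le>length zs. primeideal (Q i) R" "\<forall>i<length zs. Q i \<subset> Q (Suc i)"
    "Q (length zs) = P" using prime_chain_of_weakly_regular[OF zs P(1,2)] by blast
  let ?Q = "Q(Suc (length zs) := irrelevant_ideal R G)"
  have "(\<forall>i\<le>Suc (length zs). primeideal (?Q i) R) \<and> (\<forall>i<Suc (length zs). ?Q i \<subset> ?Q (Suc i))"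
    using Q lt primeideal_irrelevant by (auto simp: less_Suc_eq le_Suc_eq)
  then have "enat (Suc (length zs)) \<le> krull_dim R"
    unfolding krull_dim_def by (intro Sup_upper) blast
  then show False using dim by simp
qed

text \<open>A homogeneous ideal maximal among those containing no \<open>G t\<close> is prime on homogeneous
  elements; localising at a homogeneous element then gives a prime below the irrelevant ideal.\<close>

lemma degree_subset_of_weakly_regular:
  assumes zs: "set zs \<subseteq> G 1" "weakly_regular (self_module R) zs (carrier R) {\<zero>}"
    and dim: "krull_dim R = enat (length zs)"
  shows "\<exists>t. G t \<subseteq> add_mults (self_module R) zs (carrier R) {\<zero>}"
proof (rule ccontr)
  let ?S = "self_module R" and ?J = "add_mults (self_module R) zs (carrier R) {\<zero>}"
  interpret M: module R ?S by (rule module_self_module)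
  assume no: "\<not> ?thesis"
  have zsR: "set zs \<subseteq> carrier R" using zs(1) degree_carrier by blast
  have JG: "graded_ideal R G ?J"
    by (rule graded_ideal_add_mults[OF zs(1) graded_ideal_zero graded_ideal_carrier])
  have sC: "submodule (carrier R) R ?S" using M.carrier_is_submodule by simp
  let ?Fam = "{I. graded_ideal R G I \<and> ?J \<subseteq> I \<and> (\<forall>t. \<not> G t \<subseteq> I)}"
  have ne: "?Fam \<noteq> {}" using JG no by blast
  have "\<exists>J\<in>?Fam. \<forall>I\<in>?Fam. J \<subseteq> I \<longrightarrow> I = J"
    by (rule noetherian_module_maximal[OF noetherian_self_module[OF is_cring] ne])
      (simp add: submodule_self_iff graded_ideal_def)
  then obtain J where J: "J \<in> ?Fam" "\<forall>I\<in>?Fam. J \<subseteq> I \<longrightarrow> I = J" by (rule bexE)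
  have gJ: "graded_ideal R G J" and Ji: "ideal J R" and JJ: "?J \<subseteq> J" and noG: "\<And>t. \<not> G t \<subseteq> J"
    using J(1) unfolding graded_ideal_def by auto
  interpret J: ideal J R by (rule Ji)
  have sJ: "submodule J R ?S" using Ji by (simp add: submodule_self_iff)
  have big: "\<exists>t. G t \<subseteq> add_mult ?S f (carrier R) J" if f: "f \<in> G s" "f \<notin> J" for f s
  proof (rule ccontr)
    assume no: "\<not> ?thesis"
    have fc: "f \<in> carrier R" by (rule degree_carrier[OF f(1)])
    have "graded_ideal R G (add_mult ?S f (carrier R) J)"
      by (rule graded_ideal_add_mult[OF gJ graded_ideal_carrier f(1)])
    have sup: "J \<subseteq> add_mult ?S f (carrier R) J"
      by (rule M.add_mult_superset[OF fc sC]) (use J.a_subset in auto)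
    have "add_mult ?S f (carrier R) J \<in> ?Fam"
      using \<open>graded_ideal R G (add_mult ?S f (carrier R) J)\<close> no sup JJ by auto
    then have "add_mult ?S f (carrier R) J = J" using J(2) sup by blast
    moreover have "f \<otimes> \<one> \<in> add_mult ?S f (carrier R) J"
      using M.smult_mem_add_mult[OF fc sC sJ one_closed] by simp
    ultimately show False using f(2) fc by simp
  qed
  have prime: "f \<in> J \<or> g \<in> J" if fg: "f \<in> G s" "g \<in> G t" "f \<otimes> g \<in> J" for f g s t
  proof (rule ccontr)
    assume n: "\<not> ?thesis"
    obtain p where p: "G p \<subseteq> add_mult ?S f (carrier R) J" using big[OF fg(1)] n by blast
    obtain q where q: "G q \<subseteq> add_mult ?S g (carrier R) J" using big[OF fg(2)] n by blast
    have fgc: "f \<in> carrier R" "g \<in> carrier R" using fg degree_carrier by auto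
    \<comment> \<open>R_(p+q) is R_p R_q, and a product of an element of J + (f) with one of J + (g)
      lies in J because f g does.\<close>
    have "G (p + q) \<subseteq> J"
    proof (rule degree_add_subset[OF J.a_subset J.zero_closed J.a_closed])
      fix u v assume u: "u \<in> G p" and v: "v \<in> G q"
      obtain j r where j: "j \<in> J" "r \<in> carrier R" "u = j \<oplus> f \<otimes> r"
        using subsetD[OF p u] unfolding add_mult_def by auto
      obtain k w where k: "k \<in> J" "w \<in> carrier R" "v = k \<oplus> g \<otimes> w"
        using subsetD[OF q v] unfolding add_mult_def by auto
      have vc: "v \<in> carrier R" using v degree_carrier by blast
      have "u \<otimes> v = j \<otimes> v \<oplus> ((f \<otimes> r) \<otimes> k \<oplus> (f \<otimes> g) \<otimes> (r \<otimes> w))"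
        unfolding j(3) k(3) using fgc j(2) k(2) J.Icarr[OF j(1)] J.Icarr[OF k(1)] by algebra
      moreover have "j \<otimes> v \<oplus> ((f \<otimes> r) \<otimes> k \<oplus> (f \<otimes> g) \<otimes> (r \<otimes> w)) \<in> J"
        using J.I_r_closed[OF j(1) vc] J.I_l_closed[OF k(1), of "f \<otimes> r"]
          J.I_r_closed[OF fg(3), of "r \<otimes> w"] fgc j(2) k(2) by (auto intro: J.a_closed)
      ultimately show "u \<otimes> v \<in> J" by simp
    qed
    then show False using noG by blast
  qed
  obtain u where u: "u \<in> G 1" "u \<notin> J" using noG[of 1] by blast
  have uc: "u \<in> carrier R" using degree_carrier u(1) .
  have uk: "u [^] k \<in> G k" for k :: nat
  proof (induction k)
    case 0
    then show ?case using one_degree_0 by simp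
  next
    case (Suc k)
    then show ?case using grading_mult[OF Suc u(1)] by simp
  qed
  have one: "\<one> \<notin> J" using noG[of 0] J.one_imp_carrier degree_carrier by blast
  have ukJ: "u [^] k \<notin> J" for k :: nat
  proof (induction k)
    case 0
    then show ?case using one by simp
  next
    case (Suc k)
    then show ?case using prime[OF uk[of k] u(1)] u(2) by auto
  qed
  interpret I: primeideal "irrelevant_ideal R G" R by (rule primeideal_irrelevant)
  \<comment> \<open>A prime over J avoiding this set is contained in the irrelevant ideal but misses
    u, so it is a second prime over \<open>zs\<close> below the top. Powers of u stay outside J
    because J is prime on homogeneous elements.\<close>
  let ?T = "{u [^] k \<otimes> t | (k::nat) t. t \<in> carrier R \<and> t \<notin> irrelevant_ideal R G}"
  have Tmem: "u [^] k \<otimes> t \<in> ?T" if "t \<in> carrier R" "t \<notin> irrelevant_ideal R G" for k :: nat and t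
    using that by blast
  have oneI: "\<one> \<notin> irrelevant_ideal R G" using I.I_notcarr I.one_imp_carrier by blast
  have JT: "J \<inter> ?T = {}"
  proof (rule ccontr)
    assume "J \<inter> ?T \<noteq> {}"
    then obtain k :: nat and t where t: "u [^] k \<otimes> t \<in> J" "t \<in> carrier R" "t \<notin> irrelevant_ideal R G"
      by blast
    \<comment> \<open>Comparing components of degree k replaces t by its constant term, which is a
      nonzero scalar and can be cancelled.\<close>
    let ?t = "component R G 0 t"
    have "component R G (int k) (u [^] k \<otimes> t) \<in> J" using gJ t(1) unfolding graded_ideal_def by blast
    then have m: "u [^] k \<otimes> ?t \<in> J" using component_mult[OF uk t(2), of "int k" k] by simp
    have "?t \<in> G 0" using component_int_grading[OF t(2), of 0] by (simp add: int_grading_def)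
    then have "?t \<in> G 0 - {\<zero>}" using t(2,3) by (simp add: irrelevant_ideal_iff)
    from subfield_m_inv[OF degree_0_field this]
    have i: "inv ?t \<in> carrier R" "?t \<otimes> inv ?t = \<one>" using degree_carrier by auto
    have "(u [^] k \<otimes> ?t) \<otimes> inv ?t \<in> J" by (rule J.I_r_closed[OF m i(1)])
    moreover have "(u [^] k \<otimes> ?t) \<otimes> inv ?t = u [^] k" using i uc t(2) by (simp add: m_assoc)
    ultimately show False using ukJ by simp
  qed
  have "\<exists>P. primeideal P R \<and> J \<subseteq> P \<and> P \<inter> ?T = {}"
  proof (rule prime_ideal_avoiding[OF Ji _ _ _ JT])
    show "?T \<subseteq> carrier R" using uc by auto
    show "\<one> \<in> ?T" using Tmem[OF one_closed oneI, of 0] by simp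
    fix s t assume "s \<in> ?T" "t \<in> ?T"
    then obtain k l :: nat and p q where p: "s = u [^] k \<otimes> p" "p \<in> carrier R" "p \<notin> irrelevant_ideal R G"
      and q: "t = u [^] l \<otimes> q" "q \<in> carrier R" "q \<notin> irrelevant_ideal R G" by blast
    have "s \<otimes> t = (u [^] k \<otimes> u [^] l) \<otimes> (p \<otimes> q)"
      unfolding p(1) q(1) using uc p(2) q(2) by (simp add: m_ac)
    also have "\<dots> = u [^] (k + l) \<otimes> (p \<otimes> q)" using uc by (simp add: nat_pow_mult)
    finally show "s \<otimes> t \<in> ?T"
      using Tmem[of "p \<otimes> q" "k + l"] I.I_prime[OF p(2) q(2)] p(2,3) q(2,3) by auto
  qed
  then obtain P where P: "primeideal P R" "J \<subseteq> P" "P \<inter> ?T = {}" by blast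
  interpret P: primeideal P R by (rule P(1))
  have "P \<subseteq> irrelevant_ideal R G"
  proof
    fix t assume t: "t \<in> P"
    show "t \<in> irrelevant_ideal R G"
    proof (rule ccontr)
      assume "t \<notin> irrelevant_ideal R G"
      then have "t \<in> ?T" using Tmem[of t 0] P.Icarr[OF t] by simp
      then show False using P(3) t by blast
    qed
  qed
  moreover have "set zs \<subseteq> P"
  proof
    fix z assume z: "z \<in> set zs"
    have "z \<otimes> \<one> \<in> ?J"
      using M.smult_mem_add_mults[OF zsR sC M.submodule_zero_set one_closed z] by simp
    moreover have "z \<otimes> \<one> = z" by (rule r_one) (use z zsR in blast)
    ultimately have "z \<in> ?J" by simp
    then show "z \<in> P" using JJ P(2) by blast
  qed
  ultimately have "P = irrelevant_ideal R G"
    using prime_over_weakly_regular[OF zsR zs(2) dim P(1)] by blast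
  then have "u \<in> P" using degree_irrelevant[OF u(1)] by simp
  moreover have "u \<in> ?T" using Tmem[OF one_closed oneI, of 1] uc by simp
  ultimately show False using P(3) by blast
qed

end

lemma (in ring) Span_dimension_le:
  assumes "subfield K R" "set Us \<subseteq> carrier R"
  shows "\<exists>n\<le>length Us. dimension n K (Span K Us)"
  using assms(2)
proof (induction Us)
  case Nil
  have "dimension 0 K (Span K [])" by simp
  then show ?case by blast
next
  case (Cons u Us)
  then obtain n where n: "n \<le> length Us" "dimension n K (Span K Us)" by auto
  show ?case
  proof (cases "u \<in> Span K Us")
    case True
    have "Span K (u # Us) = Span K Us"
      using Span_base_incl[OF assms(1)] mono_Span_subset[OF assms(1)] Cons.prems True
      by (metis insert_subset list.simps(15) subset_antisym)
    then show ?thesis using n by (intro exI[of _ n]) simp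
  next
    case False
    have "dimension (Suc n) K (line_extension K u (Span K Us))"
      by (rule Suc_dim[OF _ False n(2)]) (use Cons.prems in simp)
    then show ?thesis using n(1) by (intro exI[of _ "Suc n"]) simp
  qed
qed

section \<open>Powers of the irrelevant ideal and linear regular sequences of maximal length\<close>

context standard_graded_ring
begin

text \<open>The k-th power of the irrelevant ideal, described by vanishing components so that
  membership becomes a matter of degrees.\<close>

definition degree_filtration :: "nat \<Rightarrow> 'a set" where
  "degree_filtration k = {a \<in> carrier R. \<forall>t<int k. component R G t a = \<zero>}"

lemma degree_filtration_1: "degree_filtration 1 = irrelevant_ideal R G"
proof -
  have "component R G t a = \<zero>" if "component R G 0 a = \<zero>" "t < 1" for a t
    using that by (cases "t = 0") auto
  then show ?thesis unfolding degree_filtration_def by (auto simp: irrelevant_ideal_iff)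
qed

lemma degree_filtration_add:
  "a \<in> degree_filtration k \<Longrightarrow> b \<in> degree_filtration k \<Longrightarrow> a \<oplus> b \<in> degree_filtration k"
  unfolding degree_filtration_def by (simp add: component_add)

lemma degree_filtration_mult:
  assumes a: "a \<in> degree_filtration p" and b: "b \<in> degree_filtration q"
  shows "a \<otimes> b \<in> degree_filtration (p + q)"
proof -
  have c: "a \<in> carrier R" "b \<in> carrier R" using a b unfolding degree_filtration_def by auto
  let ?N = "{u \<in> carrier R. u \<otimes> b \<in> degree_filtration (p + q)}"
  have "a \<in> ?N"
  proof (rule mem_of_components[OF c(1)])
    fix i :: nat
    let ?u = "component R G (int i) a"
    have ui: "?u \<in> G i" using component_int_grading[OF c(1), of "int i"] by simp
    have uc: "?u \<in> carrier R" using degree_carrier[OF ui] .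
    have "component R G t (?u \<otimes> b) = \<zero>" if t: "t < int (p + q)" for t
    proof (cases "i < p")
      case True
      then show ?thesis using a c unfolding degree_filtration_def by simp
    next
      case False
      then have "component R G (t - int i) b = \<zero>" using b t unfolding degree_filtration_def by simp
      then show ?thesis using component_mult[OF ui c(2), of t] uc by simp
    qed
    then show "?u \<in> ?N" using uc c unfolding degree_filtration_def by simp
  next
    show "\<zero> \<in> ?N" using c unfolding degree_filtration_def by simp
    show "u \<oplus> v \<in> ?N" if "u \<in> ?N" "v \<in> ?N" for u v
      using that c degree_filtration_add[of "u \<otimes> b" "p + q" "v \<otimes> b"] by (simp add: l_distr)
  qed simp
  then show ?thesis by simp
qed

lemma degree_filtration_pow: "y \<in> irrelevant_ideal R G \<Longrightarrow> y [^] (k::nat) \<in> degree_filtration k"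
proof (induction k)
  case 0
  then show ?case unfolding degree_filtration_def by simp
next
  case (Suc k)
  then have "y [^] k \<otimes> y \<in> degree_filtration (k + 1)"
    using degree_filtration_1 by (intro degree_filtration_mult) auto
  then show ?case by simp
qed

lemma degree_filtration_subset:
  assumes A: "A \<subseteq> carrier R" "\<zero> \<in> A" "\<And>a b. a \<in> A \<Longrightarrow> b \<in> A \<Longrightarrow> a \<oplus> b \<in> A"
    and G: "\<And>t. k \<le> t \<Longrightarrow> G t \<subseteq> A"
  shows "degree_filtration k \<subseteq> A"
proof
  fix x assume x: "x \<in> degree_filtration k"
  then have xc: "x \<in> carrier R" unfolding degree_filtration_def by blast
  show "x \<in> A"
  proof (rule mem_of_components[OF xc A(2,3,1)])
    fix i :: nat
    have "component R G (int i) x \<in> G i" using component_int_grading[OF xc, of "int i"] by simp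
    then show "component R G (int i) x \<in> A"
      using x G[of i] A(2) unfolding degree_filtration_def by (cases "i < k") auto
  qed
qed

lemma nilpotent_mod_ideal:
  assumes J: "ideal J R" "G N \<subseteq> J" and y: "y \<in> irrelevant_ideal R G"
  shows "y [^] N \<in> J"
proof -
  interpret J: ideal J R by fact
  have "degree_filtration N \<subseteq> J"
    by (rule degree_filtration_subset[OF J.a_subset J.zero_closed J.a_closed degree_mono_ideal[OF J]])
  then show ?thesis using degree_filtration_pow[OF y] by blast
qed

lemma genideal_eq_add_mults:
  assumes "set xs \<subseteq> carrier R"
  shows "Idl (set xs) = add_mults (self_module R) xs (carrier R) {\<zero>}"
proof
  interpret M: module R "self_module R" by (rule module_self_module)
  have sC: "submodule (carrier R) R (self_module R)" using M.carrier_is_submodule by simp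
  have J: "ideal (add_mults (self_module R) xs (carrier R) {\<zero>}) R"
    by (rule ideal_add_mults[OF assms zeroideal oneideal])
  have "set xs \<subseteq> add_mults (self_module R) xs (carrier R) {\<zero>}"
  proof
    fix z assume z: "z \<in> set xs"
    have "z \<otimes> \<one> \<in> add_mults (self_module R) xs (carrier R) {\<zero>}"
      using M.smult_mem_add_mults[OF assms sC M.submodule_zero_set one_closed z] by simp
    moreover have "z \<otimes> \<one> = z" by (rule r_one) (use z assms in blast)
    ultimately show "z \<in> add_mults (self_module R) xs (carrier R) {\<zero>}" by simp
  qed
  then show "Idl (set xs) \<subseteq> add_mults (self_module R) xs (carrier R) {\<zero>}"
    by (rule genideal_minimal[OF J])
  interpret I: ideal "Idl (set xs)" R by (rule genideal_ideal[OF assms])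
  show "add_mults (self_module R) xs (carrier R) {\<zero>} \<subseteq> Idl (set xs)"
    by (rule M.add_mults_least)
      (use I.is_ideal I.zero_closed I.I_r_closed subsetD[OF genideal_self[OF assms]]
        in \<open>simp_all add: submodule_self_iff\<close>)
qed

lemma noetherian_self: "noetherian_module R (self_module R)"
  by (rule noetherian_self_module[OF is_cring])

lemma one_not_irrelevant: "\<one> \<notin> irrelevant_ideal R G"
  using component_degree[OF one_degree_0, of 0] one_not_zero by (simp add: irrelevant_ideal_iff)

text \<open>Depth is a supremum in \<open>enat\<close>, and only boundedness ensures that it is
  attained. Otherwise take an ideal A in the irrelevant ideal that is maximal among those with
  arbitrarily long weakly regular sequences on R/A. By \<open>exchange\<close>, A + zR has the same
  property for a linear z regular modulo A; maximality puts z into A, and regularity then puts 1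
  into A.\<close>

lemma weakly_regular_length_bounded:
  assumes inf: "infinite (G 0)"
  shows "\<exists>B. \<forall>ys. set ys \<subseteq> irrelevant_ideal R G \<and>
    weakly_regular (self_module R) ys (carrier R) {\<zero>} \<longrightarrow> length ys \<le> B"
proof (rule ccontr)
  assume no: "\<not> ?thesis"
  let ?S = "self_module R" and ?m = "irrelevant_ideal R G"
  interpret M: module R ?S by (rule module_self_module)
  interpret E: depth_exchange R ?S "G 0" "G 1" ?m
    by (rule depth_exchange_irrelevant[OF M.module_axioms noetherian_self inf])
  have sC: "submodule (carrier R) R ?S" using M.carrier_is_submodule by simp
  interpret I: ideal ?m R by (rule ideal_irrelevant)
  let ?P = "\<lambda>A. \<forall>n. \<exists>ys. set ys \<subseteq> ?m \<and> length ys = n \<and> weakly_regular ?S ys (carrier R) A"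
  let ?Fam = "{A. ideal A R \<and> A \<subseteq> ?m \<and> ?P A}"
  have "?P {\<zero>}"
  proof
    fix n
    obtain ys where ys: "set ys \<subseteq> ?m" "weakly_regular ?S ys (carrier R) {\<zero>}" "n < length ys"
      using no by (meson not_le)
    show "\<exists>ys. set ys \<subseteq> ?m \<and> length ys = n \<and> weakly_regular ?S ys (carrier R) {\<zero>}"
      by (rule exI[of _ "take n ys"])
        (use ys weakly_regular_take[OF ys(2)] set_take_subset[of n ys] in auto)
  qed
  then have ne: "?Fam \<noteq> {}" using zeroideal I.zero_closed by blast
  have "\<exists>A\<in>?Fam. \<forall>A'\<in>?Fam. A \<subseteq> A' \<longrightarrow> A' = A"
    by (rule noetherian_module_maximal[OF noetherian_self ne]) (simp add: submodule_self_iff)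
  then obtain A where A: "A \<in> ?Fam" "\<forall>A'\<in>?Fam. A \<subseteq> A' \<longrightarrow> A' = A" by (rule bexE)
  have Ai: "ideal A R" and Am: "A \<subseteq> ?m" and PA: "?P A" using A(1) by auto
  have sA: "submodule A R ?S" using Ai by (simp add: submodule_self_iff)
  obtain y where y: "set y \<subseteq> ?m" "length y = 1" "weakly_regular ?S y (carrier R) A" using PA by blast
  obtain zs where zs: "length zs = 1" "set zs \<subseteq> G 1" "weakly_regular ?S zs (carrier R) A"
    using E.weakly_regular_in_subspace[OF sA y(1)] y(2,3) by auto
  obtain z where z: "zs = [z]" using zs(1) by (auto simp: length_Suc_conv)
  have zG: "z \<in> G 1" and zr: "regular_on ?S z (carrier R) A" using zs z by auto
  have zm: "z \<in> ?m" and zc: "z \<in> carrier R" using degree_irrelevant[OF zG] degree_carrier[OF zG] by auto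
  let ?A = "add_mult ?S z (carrier R) A"
  have iA: "ideal ?A R" by (rule ideal_add_mult[OF zc Ai oneideal])
  have Am': "?A \<subseteq> ?m"
    by (rule M.add_mult_least) (use ideal_irrelevant Am I.I_r_closed[OF zm] in \<open>simp_all add: submodule_self_iff\<close>)
  have "?P ?A"
  proof
    fix n
    obtain ys where ys: "set ys \<subseteq> ?m" "length ys = Suc n" "weakly_regular ?S ys (carrier R) A"
      using PA by blast
    obtain vs where vs: "length vs = length ys - 1" "set vs \<subseteq> G 1" "weakly_regular ?S vs (carrier R) ?A"
      using E.exchange[OF sA zm _ ys(1)] zr ys(3) by auto
    show "\<exists>ys. set ys \<subseteq> ?m \<and> length ys = n \<and> weakly_regular ?S ys (carrier R) ?A"
      using vs ys(2) E.WI by (intro exI[of _ vs]) auto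
  qed
  then have "?A \<in> ?Fam" using iA Am' by blast
  moreover have "A \<subseteq> ?A"
    by (rule M.add_mult_superset[OF zc sC]) (use ideal.Icarr[OF Ai] in auto)
  ultimately have "?A = A" using A(2) by blast
  moreover have "z \<otimes> \<one> \<in> ?A" using M.smult_mem_add_mult[OF zc sC sA one_closed] by simp
  ultimately have "\<one> \<in> A" using M.regular_onD[OF zr, of \<one>] by simp
  then show False using Am one_not_irrelevant by blast
qed

lemma cohen_macaulay_regular_sequence:
  assumes inf: "infinite (G 0)" and cm: "graded_cohen_macaulay R G"
  shows "\<exists>ys. set ys \<subseteq> irrelevant_ideal R G \<and>
    weakly_regular (self_module R) ys (carrier R) {\<zero>} \<and> krull_dim R = enat (length ys)"
proof -
  let ?S = "self_module R" and ?m = "irrelevant_ideal R G"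
  interpret M: module R ?S by (rule module_self_module)
  obtain B where B: "\<And>ys. set ys \<subseteq> ?m \<Longrightarrow> weakly_regular ?S ys (carrier R) {\<zero>} \<Longrightarrow> length ys \<le> B"
    using weakly_regular_length_bounded[OF inf] by blast
  have mR: "?m \<subseteq> carrier R" by (auto simp: irrelevant_ideal_iff)
  have rs: "weakly_regular ?S ys (carrier R) {\<zero>}" if "set ys \<subseteq> ?m" "regular_sequence ?S ys" for ys
    using regular_sequence_iff[OF M.module_axioms, of ys] that mR by auto
  let ?X = "{enat (length xs) | xs. set xs \<subseteq> ?m \<and> regular_sequence ?S xs}"
  have "?X \<subseteq> enat ` {..B}" using B rs by auto
  then have fin: "finite ?X" using finite_subset by blast
  have dim: "krull_dim R = Sup ?X"
    using cm unfolding graded_cohen_macaulay_def depth_def by simp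
  show ?thesis
  proof (cases "?X = {}")
    case True
    \<comment> \<open>The supremum of the empty set is 0, the length of the empty sequence.\<close>
    then have "krull_dim R = enat (length [])" using dim by (simp add: Sup_enat_def zero_enat_def)
    then show ?thesis by (intro exI[of _ "[]"]) simp
  next
    case False
    then have "krull_dim R = Max ?X" unfolding dim Sup_enat_def by (simp only: fin if_False if_True)
    then have "krull_dim R \<in> ?X" using Max_in[OF fin False] by simp
    then show ?thesis using rs by blast
  qed
qed

text \<open>The Cohen-Macaulay property provides a regular sequence of length
  \<open>krull_dim R\<close> somewhere in the irrelevant ideal, and the exchange argument moves it
  into \<open>W\<close>.\<close>

lemma linear_regular_sequence_in_subspace:
  assumes inf: "infinite (G 0)" and cm: "graded_cohen_macaulay R G"
    and W: "\<zero> \<in> W" "\<And>v w. v \<in> W \<Longrightarrow> w \<in> W \<Longrightarrow> v \<oplus> w \<in> W" "\<And>k w. k \<in> G 0 \<Longrightarrow> w \<in> W \<Longrightarrow> k \<otimes> w \<in> W"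
      "W \<subseteq> G 1" "\<And>P. primeideal P R \<Longrightarrow> W \<subseteq> P \<Longrightarrow> irrelevant_ideal R G \<subseteq> P"
  shows "\<exists>zs. set zs \<subseteq> W \<and> weakly_regular (self_module R) zs (carrier R) {\<zero>} \<and>
    krull_dim R = enat (length zs)"
proof -
  let ?S = "self_module R" and ?m = "irrelevant_ideal R G"
  interpret M: module R ?S by (rule module_self_module)
  have E: "depth_exchange R ?S (G 0) W ?m"
  proof (intro depth_exchange.intro depth_exchange_axioms.intro)
    show "?m \<subseteq> carrier R" by (auto simp: irrelevant_ideal_iff)
    show "W \<subseteq> ?m" using W(4) degree_irrelevant[of _ 1] by auto
  qed (fact M.module_axioms noetherian_ring_axioms noetherian_self degree_0_field inf W)+
  obtain ys where ys: "set ys \<subseteq> ?m" "weakly_regular ?S ys (carrier R) {\<zero>}"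
    "krull_dim R = enat (length ys)" using cohen_macaulay_regular_sequence[OF inf cm] by blast
  obtain zs where "length zs = length ys" "set zs \<subseteq> W" "weakly_regular ?S zs (carrier R) {\<zero>}"
    using depth_exchange.weakly_regular_in_subspace[OF E M.submodule_zero_set ys(1)] ys(2) by auto
  then show ?thesis using ys(3) by auto
qed

definition irrelevant_power :: "nat \<Rightarrow> 'a set" where
  "irrelevant_power n = irrelevant_ideal R G [^]\<^bsub>ideals_set R\<^esub> n"

lemma irrelevant_power_0: "irrelevant_power 0 = carrier R"
  unfolding irrelevant_power_def by (simp add: ideals_set_def)

lemma irrelevant_power_Suc:
  "irrelevant_power (Suc n) = irrelevant_power n \<cdot>\<^bsub>R\<^esub> irrelevant_ideal R G"
  unfolding irrelevant_power_def by (simp add: ideals_set_def)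

lemma ideal_irrelevant_power: "ideal (irrelevant_power n) R"
  by (induction n)
    (simp_all add: irrelevant_power_0 irrelevant_power_Suc oneideal ideal_prod_is_ideal ideal_irrelevant)

lemma degree_subset_irrelevant_power: "n \<le> t \<Longrightarrow> G t \<subseteq> irrelevant_power n"
proof -
  have "G n \<subseteq> irrelevant_power n"
  proof (induction n)
    case 0
    then show ?case using degree_carrier by (auto simp: irrelevant_power_0)
  next
    case (Suc n)
    interpret I: ideal "irrelevant_power (Suc n)" R by (rule ideal_irrelevant_power)
    show ?case
    proof (rule degree_Suc_subset[OF I.a_subset I.zero_closed I.a_closed])
      fix a b assume a: "a \<in> G 1" and b: "b \<in> G n"
      have "b \<otimes> a \<in> irrelevant_power n \<cdot>\<^bsub>R\<^esub> irrelevant_ideal R G"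
        by (rule ideal_prod.prod) (use Suc b degree_irrelevant[OF a] in auto)
      then show "a \<otimes> b \<in> irrelevant_power (Suc n)"
        using degree_carrier[OF a] degree_carrier[OF b] by (simp add: irrelevant_power_Suc m_comm)
    qed
  qed
  then show "n \<le> t \<Longrightarrow> G t \<subseteq> irrelevant_power n"
    by (rule degree_mono_ideal[OF ideal_irrelevant_power])
qed

lemma irrelevant_power_filtration: "irrelevant_power n \<subseteq> degree_filtration n"
proof (induction n)
  case 0
  then show ?case unfolding degree_filtration_def by (auto simp: irrelevant_power_0)
next
  case (Suc n)
  show ?case
  proof
    fix x assume "x \<in> irrelevant_power (Suc n)"
    then have "x \<in> irrelevant_power n \<cdot>\<^bsub>R\<^esub> irrelevant_ideal R G" by (simp add: irrelevant_power_Suc)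
    then show "x \<in> degree_filtration (Suc n)"
    proof (induction x rule: ideal_prod.induct)
      case (prod i j)
      then have "i \<otimes> j \<in> degree_filtration (n + 1)"
        using Suc degree_filtration_1 by (intro degree_filtration_mult) auto
      then show ?case by simp
    next
      case (sum s1 s2)
      then show ?case by (intro degree_filtration_add)
    qed
  qed
qed

lemma ideal_prod_mono:
  assumes "A \<subseteq> B" "C \<subseteq> D"
  shows "A \<cdot>\<^bsub>R\<^esub> C \<subseteq> B \<cdot>\<^bsub>R\<^esub> D"
proof
  fix x assume "x \<in> A \<cdot>\<^bsub>R\<^esub> C"
  then show "x \<in> B \<cdot>\<^bsub>R\<^esub> D"
    by (induction x rule: ideal_prod.induct) (use assms in \<open>auto intro: ideal_prod.intros\<close>)
qed

text \<open>In a sum of terms z h with z linear, only the components of degree t - 1 of the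
  coefficients contribute to degree t. So the coefficients of a homogeneous element may be taken
  homogeneous.\<close>

lemma component_add_mults_mem:
  assumes A: "\<zero> \<in> A" "\<And>a b. a \<in> A \<Longrightarrow> b \<in> A \<Longrightarrow> a \<oplus> b \<in> A"
    and zs: "set zs \<subseteq> G 1" and zA: "\<And>z h. z \<in> set zs \<Longrightarrow> h \<in> G (t - 1) \<Longrightarrow> z \<otimes> h \<in> A" and t: "t \<ge> 1"
    and B: "\<And>b. b \<in> B \<Longrightarrow> b \<in> carrier R \<and> component R G (int t) b \<in> A"
    and g: "g \<in> add_mults (self_module R) zs (carrier R) B"
  shows "component R G (int t) g \<in> A"
  using zs zA B g
proof (induction zs arbitrary: B)
  case (Cons z zs)
  have z: "z \<in> G 1" and zc: "z \<in> carrier R" using Cons.prems(1) degree_carrier by auto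
  have step: "b \<in> carrier R \<and> component R G (int t) b \<in> A"
    if b: "b \<in> add_mult (self_module R) z (carrier R) B" for b
  proof -
    obtain c h where c: "c \<in> B" "h \<in> carrier R" "b = c \<oplus> z \<otimes> h"
      using b unfolding add_mult_def by auto
    have cc: "c \<in> carrier R" "component R G (int t) c \<in> A" using Cons.prems(3)[OF c(1)] by auto
    have "component R G (int (t - 1)) h \<in> G (t - 1)"
      using component_int_grading[OF c(2), of "int (t - 1)"] by simp
    then have "z \<otimes> component R G (int (t - 1)) h \<in> A" by (intro Cons.prems(2)) auto
    then have "component R G (int t) (z \<otimes> h) \<in> A"
      using component_mult[OF z c(2), of "int t"] t by (simp add: of_nat_diff)
    then show ?thesis using A(2)[OF cc(2)] cc(1) c(2,3) zc by (simp add: component_add)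
  qed
  show ?case
    by (rule Cons.IH[OF _ _ step]) (use Cons.prems(1,2,4) in auto)
qed simp

text \<open>\<open>h_vector\<close> uses \<open>SOME\<close>, so this existence gives the choice its
  meaning. A linear regular sequence of length \<open>krull_dim R\<close> whose ideal J contains R_N
  is a reduction: the power N + 1 of the irrelevant ideal is J times its power N.\<close>

lemma minimal_reduction_exists:
  assumes inf: "infinite (G 0)" and cm: "graded_cohen_macaulay R G"
  shows "\<exists>xs. minimal_reduction R G xs"
proof -
  let ?m = "irrelevant_ideal R G"
  have "\<exists>zs. set zs \<subseteq> G 1 \<and> weakly_regular (self_module R) zs (carrier R) {\<zero>} \<and>
      krull_dim R = enat (length zs)"
  proof (rule linear_regular_sequence_in_subspace[OF inf cm degree_zero degree_add _ order_refl])
    show "k \<otimes> w \<in> G 1" if "k \<in> G 0" "w \<in> G 1" for k w using grading_mult[OF that] by simp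
    show "?m \<subseteq> P" if "primeideal P R" "G 1 \<subseteq> P" for P
      using irrelevant_subset_ideal[OF primeideal.axioms(1)[OF that(1)] that(2)] .
  qed
  then obtain zs where zs: "set zs \<subseteq> G 1" "weakly_regular (self_module R) zs (carrier R) {\<zero>}"
    "krull_dim R = enat (length zs)" by blast
  have zsR: "set zs \<subseteq> carrier R" using zs(1) degree_carrier by blast
  let ?J = "Idl (set zs)"
  note Jeq = genideal_eq_add_mults[OF zsR]
  have Ji: "ideal ?J R" by (rule genideal_ideal[OF zsR])
  obtain N where N: "G N \<subseteq> ?J" using degree_subset_of_weakly_regular[OF zs] Jeq by auto
  let ?P = "?J \<cdot>\<^bsub>R\<^esub> irrelevant_power N"
  interpret P: ideal ?P R by (rule ideal_prod_is_ideal[OF Ji ideal_irrelevant_power])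
  have "irrelevant_power (N + 1) = ?P"
  proof
    \<comment> \<open>In degree t > N everything lies in J, with coefficients that can be taken in
      degree t - 1, hence in the power N of the irrelevant ideal.\<close>
    have GP: "G t \<subseteq> ?P" if t: "N + 1 \<le> t" for t
    proof
      fix g assume g: "g \<in> G t"
      have "component R G (int t) g \<in> ?P"
      proof (rule component_add_mults_mem[OF P.zero_closed P.a_closed zs(1)])
        show "g \<in> add_mults (self_module R) zs (carrier R) {\<zero>}"
          using degree_mono_ideal[OF Ji N, of t] t g Jeq by auto
        show "z \<otimes> h \<in> ?P" if "z \<in> set zs" "h \<in> G (t - 1)" for z h
        proof (rule ideal_prod.prod)
          have "N \<le> t - 1" using t by simp
          then show "h \<in> irrelevant_power N" using degree_subset_irrelevant_power that(2) by blast
          show "z \<in> ?J" using genideal_self[OF zsR] that(1) by blast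
        qed
      qed (use t P.zero_closed in auto)
      then show "g \<in> ?P" using component_degree[OF g] by simp
    qed
    have "degree_filtration (N + 1) \<subseteq> ?P"
      by (rule degree_filtration_subset[OF P.a_subset P.zero_closed P.a_closed GP])
    then show "irrelevant_power (N + 1) \<subseteq> ?P" using irrelevant_power_filtration by blast
    have "?J \<subseteq> ?m"
      by (rule genideal_minimal[OF ideal_irrelevant]) (use zs(1) degree_irrelevant[of _ 1] in auto)
    then have "?P \<subseteq> ?m \<cdot>\<^bsub>R\<^esub> irrelevant_power N" by (rule ideal_prod_mono) simp
    also have "\<dots> = irrelevant_power (N + 1)"
      using ideal_prod_commute[OF ideal_irrelevant ideal_irrelevant_power]
      by (simp add: irrelevant_power_Suc)
    finally show "?P \<subseteq> irrelevant_power (N + 1)" .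
  qed
  then have "minimal_reduction R G zs"
    unfolding minimal_reduction_def irrelevant_power_def using zs by auto
  then show ?thesis by blast
qed

text \<open>A generic basis of the span of a minimal reduction is a regular sequence.\<close>

lemma minimal_reduction_regular_sequence:
  assumes inf: "infinite (G 0)" and cm: "graded_cohen_macaulay R G" and xs: "minimal_reduction R G xs"
  shows "\<exists>zs. set zs \<subseteq> G 1 \<and> weakly_regular (self_module R) zs (carrier R) {\<zero>} \<and>
    krull_dim R = enat (length zs) \<and> Idl (set zs) = Idl (set xs)"
proof -
  let ?m = "irrelevant_ideal R G" and ?J = "Idl (set xs)" and ?W = "Span (G 0) xs"
  note K = degree_0_field
  have xG: "set xs \<subseteq> G 1" and dim: "krull_dim R = enat (length xs)"
    using xs unfolding minimal_reduction_def by auto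
  have xR: "set xs \<subseteq> carrier R" using xG degree_carrier by blast
  have Ji: "ideal ?J R" by (rule genideal_ideal[OF xR])
  obtain n where "irrelevant_power (n + 1) = ?J \<cdot>\<^bsub>R\<^esub> irrelevant_power n"
    using xs unfolding minimal_reduction_def irrelevant_power_def by blast
  then have "irrelevant_power (n + 1) \<subseteq> ?J"
    using ideal_prod_inter[OF Ji ideal_irrelevant_power] by blast
  then have GJ: "G (n + 1) \<subseteq> ?J" using degree_subset_irrelevant_power[of "n + 1" "n + 1"] by blast
  note sp = Span_subgroup_props[OF K xR]
  have Wmem: "set xs \<subseteq> ?W" by (rule Span_base_incl[OF K xR])
  have W1: "?W \<subseteq> G 1"
  proof (rule Span_min[OF K xR])
    have "additive_subgroup (G 1) R" using grading unfolding internal_direct_sum_def by blast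
    then show "subgroup (G 1) (add_monoid R)" unfolding additive_subgroup_def .
    show "G 0 <#> set xs \<subseteq> G 1"
    proof
      fix v assume "v \<in> G 0 <#> set xs"
      then obtain k x where "k \<in> G 0" "x \<in> set xs" "v = k \<otimes> x" unfolding set_mult_def by blast
      then show "v \<in> G 1" using grading_mult[of k 0 x 1] xG by auto
    qed
  qed
  have "\<exists>zs. set zs \<subseteq> ?W \<and> weakly_regular (self_module R) zs (carrier R) {\<zero>} \<and>
      krull_dim R = enat (length zs)"
  proof (rule linear_regular_sequence_in_subspace[OF inf cm _ _ _ W1])
    show "?m \<subseteq> P" if P: "primeideal P R" "?W \<subseteq> P" for P
    proof (rule irrelevant_subset_ideal[OF primeideal.axioms(1)[OF P(1)]])
      interpret P: primeideal P R by (rule P(1))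
      \<comment> \<open>A prime over the span contains J, hence the power n + 1 of every linear
        form, hence the form. The reduction equation enters only through this equality of
        radicals.\<close>
      have JP: "?J \<subseteq> P" by (rule genideal_minimal[OF P.is_ideal]) (use Wmem P(2) in blast)
      show "G 1 \<subseteq> P"
      proof
        fix u assume u: "u \<in> G 1"
        have uc: "u \<in> carrier R" by (rule degree_carrier[OF u])
        have "u [^] (n + 1) \<in> ?J" by (rule nilpotent_mod_ideal[OF Ji GJ]) (use degree_irrelevant[OF u] in simp)
        then have up: "u [^] (n + 1) \<in> P" using JP by blast
        show "u \<in> P"
        proof (rule ccontr)
          assume nu: "u \<notin> P"
          have "u [^] k \<notin> P" for k :: nat
          proof (induction k)
            case 0
            then show ?case using P.one_imp_carrier P.I_notcarr by auto
          next
            case (Suc k)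
            then show ?case using P.I_prime[of "u [^] k" u] uc nu by auto
          qed
          then show False using up by blast
        qed
      qed
    qed
  qed (use sp Span_smult_closed[OF K xR] in \<open>simp_all del: Span.simps\<close>)
  then obtain zs where zs: "set zs \<subseteq> ?W" "weakly_regular (self_module R) zs (carrier R) {\<zero>}"
    "krull_dim R = enat (length zs)" by blast
  have zG: "set zs \<subseteq> G 1" using zs(1) W1 by blast
  have zR: "set zs \<subseteq> carrier R" using zG degree_carrier by blast
  have SpanIdl: "Span (G 0) us \<subseteq> Idl (set us)" if us: "set us \<subseteq> carrier R" for us
  proof (rule Span_min[OF K us])
    interpret I: ideal "Idl (set us)" R by (rule genideal_ideal[OF us])
    show "subgroup (Idl (set us)) (add_monoid R)" by (rule I.a_subgroup)
    show "G 0 <#> set us \<subseteq> Idl (set us)"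
    proof
      fix v assume "v \<in> G 0 <#> set us"
      then obtain k x where "k \<in> G 0" "x \<in> set us" "v = k \<otimes> x" unfolding set_mult_def by blast
      then show "v \<in> Idl (set us)"
        using I.I_l_closed[of x k] genideal_self[OF us] degree_carrier[of k 0] by auto
    qed
  qed
  \<comment> \<open>Spans are built at the head of a list, regular sequences at the end, hence
    \<open>rev\<close>. An element in the span of its predecessors would vanish modulo them, and
    regularity would put 1 into the irrelevant ideal.\<close>
  have "independent (G 0) (rev zs)"
    using zs(2) zG zR
  proof (induction zs rule: rev_induct)
    case (snoc z zs)
    interpret M: module R "self_module R" by (rule module_self_module)
    have z: "z \<in> carrier R" and zsR: "set zs \<subseteq> carrier R" "set zs \<subseteq> G 1" using snoc.prems by auto
    have reg: "weakly_regular (self_module R) zs (carrier R) {\<zero>}"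
      "regular_on (self_module R) z (carrier R) (add_mults (self_module R) zs (carrier R) {\<zero>})"
      using snoc.prems(1) by (auto simp: weakly_regular_append)
    have "z \<notin> Span (G 0) (rev zs)"
    proof
      assume "z \<in> Span (G 0) (rev zs)"
      then have "z \<in> Idl (set zs)" using SpanIdl[of "rev zs"] zsR by auto
      then have "z \<otimes> \<one> \<in> add_mults (self_module R) zs (carrier R) {\<zero>}"
        using genideal_eq_add_mults[OF zsR(1)] z by simp
      then have "\<one> \<in> add_mults (self_module R) zs (carrier R) {\<zero>}"
        using M.regular_onD[OF reg(2), of \<one>] by simp
      then have "\<one> \<in> irrelevant_ideal R G"
        by (rule component_0_add_mults[rotated]) (use zsR(2) degree_irrelevant[of _ 1] in auto)
      then show False using one_not_irrelevant by blast
    qed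
    then show ?case using li_Cons[OF z _ snoc.IH[OF reg(1) zsR(2,1)]] by simp
  qed simp
  \<comment> \<open>The span of \<open>xs\<close> has dimension at most \<open>length xs\<close>,
    which equals \<open>length zs\<close>. So the independent list \<open>zs\<close> is a basis of
    it and generates the same ideal.\<close>
  moreover obtain k where k: "k \<le> length xs" "dimension k (G 0) ?W"
    using Span_dimension_le[OF K xR] by blast
  moreover have zlen: "length zs = length xs" using zs(3) dim by simp
  ultimately have "length (rev zs) = k"
    using independent_length_le_dimension[OF K k(2), of "rev zs"] zs(1) by simp
  then have "Span (G 0) (rev zs) = ?W"
    using independent_length_eq_dimension[OF K k(2) \<open>independent (G 0) (rev zs)\<close>] zs(1) by simp
  then have "set xs \<subseteq> Idl (set zs)" using Wmem SpanIdl[of "rev zs"] zR by auto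
  then have "?J \<subseteq> Idl (set zs)" by (rule genideal_minimal[OF genideal_ideal[OF zR]])
  moreover have "set zs \<subseteq> ?J" using zs(1) SpanIdl[OF xR] by blast
  then have "Idl (set zs) \<subseteq> ?J" by (rule genideal_minimal[OF Ji])
  ultimately show ?thesis using zG zs(2,3) by (intro exI[of _ zs]) auto
qed

section \<open>The h-vector\<close>

lemma scalar_mult_mem_ideal:
  assumes "ideal J R" "s \<in> G 0" "s \<noteq> \<zero>" "a \<in> carrier R" "s \<otimes> a \<in> J"
  shows "a \<in> J"
proof -
  interpret J: ideal J R by fact
  have "s \<in> G 0 - {\<zero>}" using assms by blast
  from subfield_m_inv[OF degree_0_field this]
  have i: "inv s \<in> carrier R" "inv s \<otimes> s = \<one>" using degree_carrier by auto
  have "inv s \<otimes> (s \<otimes> a) \<in> J" by (rule J.I_l_closed[OF assms(5) i(1)])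
  then show ?thesis using i degree_carrier[OF assms(2)] assms(4) by (simp add: m_assoc[symmetric])
qed

text \<open>Quadrics have degree larger than the last linear parameter, so a pair independent modulo
  (zs) would satisfy all conditions of \<open>uncountably_many_indecomposables\<close>.\<close>

lemma degree_2_dependent:
  assumes zs: "set zs \<subseteq> G 1" "weakly_regular (self_module R) zs (carrier R) {\<zero>}"
    and dim: "krull_dim R = enat (length zs)" "zs \<noteq> []"
    and unc: "uncountable (G 0)" and ct: "graded_countable_cm_type R G"
    and ab: "a \<in> G 2" "b \<in> G 2"
  shows "\<exists>s\<in>G 0. \<exists>t\<in>G 0. (s \<noteq> \<zero> \<or> t \<noteq> \<zero>) \<and> s \<otimes> a \<oplus> t \<otimes> b \<in> Idl (set zs)"
proof (rule ccontr)
  assume no: "\<not> ?thesis"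
  have zsR: "set zs \<subseteq> carrier R" using zs(1) degree_carrier by blast
  have Ji: "ideal (Idl (set zs)) R" by (rule genideal_ideal[OF zsR])
  note Jeq = genideal_eq_add_mults[OF zsR]
  obtain N where N: "G N \<subseteq> Idl (set zs)" using degree_subset_of_weakly_regular[OF zs dim(1)] Jeq by auto
  have z: "butlast zs @ [last zs] = zs" using dim(2) by simp
  have l: "set (butlast zs) \<subseteq> G 1" using zs(1) in_set_butlastD by fast
  have y: "last zs \<in> G 1" using zs(1) last_in_set[OF dim(2)] by blast
  have "\<not> graded_countable_cm_type R G"
  proof (rule uncountably_many_indecomposables[OF l y _ _ _ _ unc ab])
    show "\<exists>k::nat. x [^] k \<in> add_mults (self_module R) (butlast zs @ [last zs]) (carrier R) {\<zero>}"
      if "x \<in> irrelevant_ideal R G" for x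
      using nilpotent_mod_ideal[OF Ji N that] Jeq unfolding z by auto
    show "s = \<zero> \<and> t = \<zero>" if "s \<in> G 0" "t \<in> G 0"
      "s \<otimes> a \<oplus> t \<otimes> b \<in> add_mults (self_module R) (butlast zs @ [last zs]) (carrier R) {\<zero>}" for s t
      using no that Jeq unfolding z by blast
  qed (simp_all add: z zs(2) dim(1))
  then show False using ct by blast
qed

text \<open>Modulo (ls, y^2) the two elements of degree 3 are a outside J and y b with b a quadric
  outside J. In a relation between them, reduction modulo y isolates a, and cancelling y afterwards
  isolates b.\<close>

lemma degree_3_subset:
  assumes zs: "set zs \<subseteq> G 1" "weakly_regular (self_module R) zs (carrier R) {\<zero>}"
    and dim: "krull_dim R = enat (length zs)" "zs \<noteq> []"
    and unc: "uncountable (G 0)" and ct: "graded_countable_cm_type R G"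
  shows "G 3 \<subseteq> Idl (set zs)"
proof (rule ccontr)
  assume no: "\<not> G 3 \<subseteq> Idl (set zs)"
  let ?S = "self_module R" and ?J = "Idl (set zs)"
  interpret M: module R ?S by (rule module_self_module)
  have zsR: "set zs \<subseteq> carrier R" using zs(1) degree_carrier by blast
  have Ji: "ideal ?J R" by (rule genideal_ideal[OF zsR])
  interpret J: ideal ?J R by (rule Ji)
  note Jeq = genideal_eq_add_mults[OF zsR]
  obtain N where N: "G N \<subseteq> ?J" using degree_subset_of_weakly_regular[OF zs dim(1)] Jeq by auto
  obtain a where a: "a \<in> G 3" "a \<notin> ?J" using no by blast
  \<comment> \<open>An ideal containing R_2 contains R_3, so a cubic outside J forces a quadric
    outside J.\<close>
  have "\<not> G 2 \<subseteq> ?J" using no degree_mono_ideal[OF Ji, of 2 3] by auto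
  then obtain b where b: "b \<in> G 2" "b \<notin> ?J" by blast
  have abc: "a \<in> carrier R" "b \<in> carrier R" using a b degree_carrier by auto
  define ls where "ls = butlast zs"
  define y where "y = last zs"
  have z: "zs = ls @ [y]" unfolding ls_def y_def using dim(2) by simp
  have l: "set ls \<subseteq> G 1" and y: "y \<in> G 1" using zs(1) z by auto
  have lc: "set ls \<subseteq> carrier R" and yc: "y \<in> carrier R" using l y degree_carrier by auto
  have y2: "y \<otimes> y \<in> G 2" using grading_mult[OF y y] by (simp add: numeral_2_eq_2)
  let ?L = "add_mults ?S ls (carrier R) {\<zero>}"
  let ?J2 = "add_mults ?S (ls @ [y \<otimes> y]) (carrier R) {\<zero>}"
  have Li: "ideal ?L R" by (rule ideal_add_mults[OF lc zeroideal oneideal])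
  interpret L: ideal ?L R by (rule Li)
  have wr: "weakly_regular ?S ls (carrier R) {\<zero>}" and ry: "regular_on ?S y (carrier R) ?L"
    using zs(2) unfolding z by (auto simp: weakly_regular_append)
  have reg_y: "r \<in> ?L" if "r \<in> carrier R" "y \<otimes> r \<in> ?L" for r
    using M.regular_onD[OF ry, of r] that by simp
  have J2i: "ideal ?J2 R" by (rule ideal_add_mults[OF _ zeroideal oneideal]) (use lc yc in simp)
  interpret J2: ideal ?J2 R by (rule J2i)
  have "?J = add_mults ?S (ls @ [y]) (carrier R) {\<zero>}" by (subst z[symmetric]) (rule Jeq)
  then have J': "?J = add_mult ?S y (carrier R) ?L" by (simp only: add_mults_append add_mults.simps)
  have Jrep: "r \<in> ?J \<longleftrightarrow> (\<exists>l\<in>?L. \<exists>u\<in>carrier R. r = l \<oplus> y \<otimes> u)" for r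
    unfolding J' by (auto simp: add_mult_def)
  have J2rep: "r \<in> ?J2 \<longleftrightarrow> (\<exists>l\<in>?L. \<exists>u\<in>carrier R. r = l \<oplus> (y \<otimes> y) \<otimes> u)" for r
    unfolding add_mults_append by (auto simp: add_mult_def)
  have J2J: "r \<in> ?J" if r: "r \<in> ?J2" for r
  proof -
    obtain l u where l: "l \<in> ?L" "u \<in> carrier R" "r = l \<oplus> (y \<otimes> y) \<otimes> u" using r J2rep by blast
    then have "r = l \<oplus> y \<otimes> (y \<otimes> u)" using yc by (simp add: m_assoc)
    then show ?thesis using l(1,2) yc Jrep by blast
  qed
  have "\<not> graded_countable_cm_type R G"
  proof (rule uncountably_many_indecomposables[OF l y2 _ _ _ _ unc a(1)])
    show "y \<otimes> b \<in> G 3" using grading_mult[OF y b(1)] by (simp add: numeral_3_eq_3 numeral_2_eq_2)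
    have "regular_on ?S (y \<otimes> y) (carrier R) ?L"
      unfolding regular_on_def
    proof (intro ballI impI)
      fix m assume m: "m \<in> carrier R" "(y \<otimes> y) \<odot>\<^bsub>?S\<^esub> m \<in> ?L"
      have "y \<otimes> m \<in> ?L" by (rule reg_y) (use m yc in \<open>simp_all add: m_assoc\<close>)
      then show "m \<in> ?L" by (rule reg_y[OF m(1)])
    qed
    then show "weakly_regular ?S (ls @ [y \<otimes> y]) (carrier R) {\<zero>}"
      using wr by (simp add: weakly_regular_append)
    show "krull_dim R = enat (length (ls @ [y \<otimes> y]))" using dim(1) z by simp
    show "\<exists>k::nat. x [^] k \<in> ?J2" if x: "x \<in> irrelevant_ideal R G" for x
    proof -
      have xc: "x \<in> carrier R" using x by (simp add: irrelevant_ideal_iff)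
      let ?p = "x [^] N"
      \<comment> \<open>With x^N = l + y u, the square of x^N is a multiple of l plus y^2 u^2.
        Replacing y by y^2 does not change the radical.\<close>
      obtain l u where l: "l \<in> ?L" "u \<in> carrier R" "?p = l \<oplus> y \<otimes> u"
        using nilpotent_mod_ideal[OF Ji N x] Jrep by blast
      have lc: "l \<in> carrier R" using L.Icarr[OF l(1)] .
      have "?p \<otimes> ?p = l \<otimes> (l \<oplus> (y \<otimes> u \<oplus> y \<otimes> u)) \<oplus> (y \<otimes> y) \<otimes> (u \<otimes> u)"
        unfolding l(3) using lc l(2) yc by algebra
      moreover have "l \<otimes> (l \<oplus> (y \<otimes> u \<oplus> y \<otimes> u)) \<in> ?L"
        by (rule L.I_r_closed[OF l(1)]) (use lc l(2) yc in simp)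
      ultimately have "?p \<otimes> ?p \<in> ?J2" using l(2) J2rep by blast
      then have "x [^] (N + N) \<in> ?J2" using nat_pow_mult[OF xc, of N N] by simp
      then show ?thesis by blast
    qed
    fix s t assume s: "s \<in> G 0" and t: "t \<in> G 0" and st: "s \<otimes> a \<oplus> t \<otimes> (y \<otimes> b) \<in> ?J2"
    have stc: "s \<in> carrier R" "t \<in> carrier R" using s t degree_carrier by auto
    have "\<zero> \<oplus> y \<otimes> (t \<otimes> b) \<in> ?J" using Jrep L.zero_closed stc abc by blast
    then have ty: "t \<otimes> (y \<otimes> b) \<in> ?J" using yc stc abc by (simp add: m_lcomm)
    have "(s \<otimes> a \<oplus> t \<otimes> (y \<otimes> b)) \<oplus> \<ominus> (t \<otimes> (y \<otimes> b)) \<in> ?J"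
      by (rule J.a_closed[OF J2J[OF st] J.a_inv_closed[OF ty]])
    moreover have "(s \<otimes> a \<oplus> t \<otimes> (y \<otimes> b)) \<oplus> \<ominus> (t \<otimes> (y \<otimes> b)) = s \<otimes> a"
      using stc abc yc by algebra
    ultimately have "s \<otimes> a \<in> ?J" by simp
    then have s0: "s = \<zero>" using scalar_mult_mem_ideal[OF Ji s _ abc(1)] a(2) by blast
    then have "t \<otimes> (y \<otimes> b) \<in> ?J2" using st stc abc yc by simp
    then obtain l u where l: "l \<in> ?L" "u \<in> carrier R" "t \<otimes> (y \<otimes> b) = l \<oplus> (y \<otimes> y) \<otimes> u"
      using J2rep by blast
    have lc: "l \<in> carrier R" using L.Icarr[OF l(1)] .
    \<comment> \<open>Cancelling the regular element y in t y b = l + y^2 u gives t b = y u modulo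
      (ls), which puts t b into J.\<close>
    have "y \<otimes> (t \<otimes> b \<ominus> y \<otimes> u) = t \<otimes> (y \<otimes> b) \<ominus> (y \<otimes> y) \<otimes> u" using stc abc yc l(2) by algebra
    also have "\<dots> = l" unfolding l(3) using lc yc l(2) by algebra
    finally have "t \<otimes> b \<ominus> y \<otimes> u \<in> ?L" using reg_y[of "t \<otimes> b \<ominus> y \<otimes> u"] l(1,2) stc abc yc by simp
    moreover have "t \<otimes> b = (t \<otimes> b \<ominus> y \<otimes> u) \<oplus> y \<otimes> u" using stc abc yc l(2) by algebra
    ultimately have "t \<otimes> b \<in> ?J" using Jrep l(2) by blast
    then have "t = \<zero>" using scalar_mult_mem_ideal[OF Ji t _ abc(2)] b(2) by blast
    then show "s = \<zero> \<and> t = \<zero>" using s0 by blast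
  qed simp_all
  then show False using ct by blast
qed

text \<open>The inclusion of R_3 in J bounds the top degree by 2, and the dependence of quadrics
  makes a nonzero component of degree 2 a line. The entry in degree 1 remains arbitrary.\<close>

lemma h_vector_wrt_cases:
  assumes J: "Idl (set xs) = J" "set xs \<subseteq> carrier R" "J \<subseteq> irrelevant_ideal R G" "G 3 \<subseteq> J"
    and dep: "\<And>a b. a \<in> G 2 \<Longrightarrow> b \<in> G 2 \<Longrightarrow>
      \<exists>s\<in>G 0. \<exists>t\<in>G 0. (s \<noteq> \<zero> \<or> t \<noteq> \<zero>) \<and> s \<otimes> a \<oplus> t \<otimes> b \<in> J"
  shows "h_vector_wrt R G xs = [1] \<or> (\<exists>n. h_vector_wrt R G xs = [1, n]) \<or>
    (\<exists>n. h_vector_wrt R G xs = [1, n, 1])"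
proof -
  have Ji: "ideal J R" using genideal_ideal[OF J(2)] J(1) by simp
  interpret J: ideal J R by (rule Ji)
  let ?Q = "R Quot J"
  interpret h: ring_hom_ring R ?Q "(+>) J" by (rule J.rcos_ring_hom_ring)
  let ?q = "quotient_component R G xs"
  have q: "?q i = ((+>) J) ` G i" for i unfolding quotient_component_def J(1) by simp
  have zQ: "\<zero>\<^bsub>?Q\<^esub> = J" by (simp only: FactRing_def ring.select_convs)
  have hz: "J +> a = \<zero>\<^bsub>?Q\<^esub> \<longleftrightarrow> a \<in> J" if "a \<in> carrier R" for a
    unfolding zQ using J.a_rcos_const J.a_rcos_self that by auto
  have qz: "?q i = {\<zero>\<^bsub>?Q\<^esub>} \<longleftrightarrow> G i \<subseteq> J" for i
  proof
    assume "?q i = {\<zero>\<^bsub>?Q\<^esub>}"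
    then have "J +> a = \<zero>\<^bsub>?Q\<^esub>" if "a \<in> G i" for a using that unfolding q by blast
    then show "G i \<subseteq> J" using hz degree_carrier by blast
  next
    assume "G i \<subseteq> J"
    then show "?q i = {\<zero>\<^bsub>?Q\<^esub>}" using hz degree_carrier degree_zero[of i] unfolding q by auto
  qed
  have one: "\<one> \<notin> J" using J(3) one_not_irrelevant by blast
  let ?X = "{i. ?q i \<noteq> {\<zero>\<^bsub>?Q\<^esub>}}"
  have Xlt: "i < 3" if "i \<in> ?X" for i
    using that qz degree_mono_ideal[OF Ji J(4), of i] by (simp add: not_le[symmetric]) blast
  \<comment> \<open>The \<open>Max\<close> in the definition is meaningful because the set of
    degrees is bounded by 3 and contains 0, as 1 is not in J.\<close>
  have X0: "0 \<in> ?X" using qz one one_degree_0 by auto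
  have fin: "finite ?X" by (rule finite_subset[of _ "{..<3}"]) (use Xlt in auto)
  define s where "s = Max ?X"
  have sX: "s \<in> ?X" unfolding s_def using Max_in[OF fin] X0 by blast
  have KQ: "subfield (?q 0) ?Q"
    unfolding q
    by (rule h.img_is_subfield(2)[OF degree_0_field]) (use hz[OF one_closed] one in simp)
  have dim0: "ring.dim ?Q (?q 0) (?q 0) = 1"
    using h.S.dimI[OF KQ h.S.dimension_one[OF KQ]] unfolding over_def .
  have hv: "h_vector_wrt R G xs = map (\<lambda>i. ring.dim ?Q (?q 0) (?q i)) [0..<s + 1]"
    unfolding h_vector_wrt_def J(1) Let_def s_def ..
  consider "s = 0" | "s = 1" | "s = 2" using Xlt[OF sX] by linarith
  then show ?thesis
  proof cases
    case 1
    then show ?thesis using hv dim0 by simp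
  next
    case 2
    then show ?thesis using hv dim0 by simp
  next
    case 3
    then obtain a where a: "a \<in> G 2" "a \<notin> J" using sX qz by auto
    have ac: "a \<in> carrier R" using degree_carrier a(1) .
    \<comment> \<open>A relation s a + t b in J has t nonzero because a is outside J, so every b is
      a scalar multiple of a modulo J.\<close>
    have "?q 2 = h.S.line_extension (?q 0) (J +> a) {\<zero>\<^bsub>?Q\<^esub>}"
    proof (intro equalityI subsetI)
      fix v assume "v \<in> ?q 2"
      then obtain b where b: "b \<in> G 2" "v = J +> b" unfolding q by blast
      have bc: "b \<in> carrier R" using degree_carrier b(1) .
      obtain s t where st: "s \<in> G 0" "t \<in> G 0" "s \<noteq> \<zero> \<or> t \<noteq> \<zero>" "s \<otimes> a \<oplus> t \<otimes> b \<in> J"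
        using dep[OF a(1) b(1)] by blast
      have stc: "s \<in> carrier R" "t \<in> carrier R" using st degree_carrier by auto
      have t0: "t \<noteq> \<zero>"
      proof
        assume "t = \<zero>"
        then have "s \<otimes> a \<in> J" "s \<noteq> \<zero>" using st stc ac bc by auto
        then show False using scalar_mult_mem_ideal[OF Ji st(1) _ ac] a(2) by blast
      qed
      then have "t \<in> G 0 - {\<zero>}" using st(2) by blast
      from subfield_m_inv[OF degree_0_field this]
      have i: "inv t \<in> G 0" "inv t \<otimes> t = \<one>" by auto
      have ic: "inv t \<in> carrier R" by (rule degree_carrier[OF i(1)])
      let ?k = "\<ominus> (inv t \<otimes> s)"
      have k: "?k \<in> G 0" using degree_minus grading_mult[OF i(1) st(1)] by simp
      have kc: "?k \<in> carrier R" using degree_carrier[OF k] .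
      have "inv t \<otimes> (s \<otimes> a \<oplus> t \<otimes> b) \<in> J" by (rule J.I_l_closed[OF st(4) ic])
      moreover have "inv t \<otimes> (s \<otimes> a \<oplus> t \<otimes> b) = inv t \<otimes> (s \<otimes> a) \<oplus> (inv t \<otimes> t) \<otimes> b"
        using ic stc ac bc by (simp add: r_distr m_assoc)
      moreover have "\<dots> = b \<ominus> ?k \<otimes> a" unfolding i(2) using ic stc ac bc by algebra
      ultimately have "b \<ominus> ?k \<otimes> a \<in> J" by simp
      then have "J +> (b \<ominus> ?k \<otimes> a) = \<zero>\<^bsub>?Q\<^esub>" using hz kc ac bc by simp
      moreover have "b = (?k \<otimes> a) \<oplus> (b \<ominus> ?k \<otimes> a)" using kc ac bc by algebra
      ultimately have "J +> b = (J +> ?k) \<otimes>\<^bsub>?Q\<^esub> (J +> a) \<oplus>\<^bsub>?Q\<^esub> \<zero>\<^bsub>?Q\<^esub>"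
        using h.hom_add[of "?k \<otimes> a" "b \<ominus> ?k \<otimes> a"] h.hom_mult[OF kc ac] kc ac bc by simp
      then show "v \<in> h.S.line_extension (?q 0) (J +> a) {\<zero>\<^bsub>?Q\<^esub>}"
        unfolding h.S.line_extension_mem_iff b(2) using k unfolding q by blast
    next
      fix v assume "v \<in> h.S.line_extension (?q 0) (J +> a) {\<zero>\<^bsub>?Q\<^esub>}"
      then obtain k where k: "k \<in> G 0" "v = (J +> k) \<otimes>\<^bsub>?Q\<^esub> (J +> a) \<oplus>\<^bsub>?Q\<^esub> \<zero>\<^bsub>?Q\<^esub>"
        unfolding h.S.line_extension_mem_iff unfolding q by blast
      have kc: "k \<in> carrier R" by (rule degree_carrier[OF k(1)])
      have "v = J +> (k \<otimes> a)" using k(2) kc ac by simp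
      moreover have "k \<otimes> a \<in> G 2" using grading_mult[OF k(1) a(1)] by (simp only: add_0_left)
      ultimately show "v \<in> ?q 2" unfolding q by blast
    qed
    moreover have "h.S.dimension (Suc 0) (?q 0) (h.S.line_extension (?q 0) (J +> a) {\<zero>\<^bsub>?Q\<^esub>})"
      by (rule h.S.dimension.intros(2)[OF _ _ h.S.dimension.intros(1)]) (use hz[OF ac] a(2) ac in simp_all)
    ultimately have "ring.dim ?Q (?q 0) (?q 2) = 1"
      using h.S.dimI[OF KQ, of "Suc 0" "?q 2"] unfolding over_def by simp
    then show ?thesis using hv dim0 3 by (simp add: numeral_2_eq_2)
  qed
qed

end

theorem corollary4p5:
  fixes R :: "('a, 'm) ring_scheme" and G :: "nat \<Rightarrow> 'a set"
  assumes "standard_graded_ring R G"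
    and "graded_cohen_macaulay R G"
    and "krull_dim R > 0"
    and "uncountable (G 0)"
    and "graded_countable_cm_type R G"
  shows "h_vector R G = [1] \<or> (\<exists>n. h_vector R G = [1, n]) \<or> (\<exists>n. h_vector R G = [1, n, 1])"
proof -
  interpret standard_graded_ring R G by fact
  have inf: "infinite (G 0)" using assms(4) countable_finite by blast
  define xs where "xs = (SOME xs. minimal_reduction R G xs)"
  have xs: "minimal_reduction R G xs"
    unfolding xs_def by (rule someI_ex[OF minimal_reduction_exists[OF inf assms(2)]])
  have xsG: "set xs \<subseteq> G 1" using xs unfolding minimal_reduction_def by blast
  have xsR: "set xs \<subseteq> carrier R" using xsG degree_carrier by blast
  \<comment> \<open>The chosen \<open>xs\<close> is known to be a reduction, not to be regular. The
    h-vector depends only on its ideal, which \<open>zs\<close> shares.\<close>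
  obtain zs where zs: "set zs \<subseteq> G 1" "weakly_regular (self_module R) zs (carrier R) {\<zero>\<^bsub>R\<^esub>}"
    "krull_dim R = enat (length zs)" "Idl\<^bsub>R\<^esub> (set zs) = Idl\<^bsub>R\<^esub> (set xs)"
    using minimal_reduction_regular_sequence[OF inf assms(2) xs] by blast
  \<comment> \<open>Positive dimension provides the last linear parameter, which plays the role of
    y.\<close>
  have ne: "zs \<noteq> []" using assms(3) zs(3) by (auto simp: zero_enat_def)
  have "Idl\<^bsub>R\<^esub> (set xs) \<subseteq> irrelevant_ideal R G"
    by (rule genideal_minimal[OF ideal_irrelevant]) (use xsG degree_irrelevant[of _ 1] in auto)
  then show ?thesis
    unfolding h_vector_def xs_def[symmetric]
    by (rule h_vector_wrt_cases[OF refl xsR])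
      (use degree_3_subset[OF zs(1-3) ne assms(4,5)]
        degree_2_dependent[OF zs(1-3) ne assms(4,5)] zs(4) in auto)
qed

end
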